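(* Let $M$ be a hypersurface in $\mathbb E^{n+1}$ with the shape operator given by $$S=\mathrm{diag}(k_1,\underbrace{k_2,k_2,\dots,k_2}_{p\text{ times}},\underbrace{k_{p+2},k_{p+2},\dots,k_{p+2}}_{q\text{ times}}),\qquad q=n-p-1,$$ with $k_2\neq k_{p+2}$ and $p>1$, $q>1$. Then $M$ is an $\mathrm H$-hypersurface if and only if it is congruent to one of the following hypersurfaces. (i) A generalized rotational hypersurface given by $$\begin{aligned}x(s,t_2,\dots,t_n)=\big(&\psi(s)\cos t_2,\ \psi(s)\sin t_2\cos t_3,\ \dots,\ \psi(s)\sin t_2\cdots\sin t_p\cos t_{p+1},\\ &\psi(s)\sin t_2\cdots\sin t_p\sin t_{p+1},\ \phi(s)\cos t_{p+2},\ \phi(s)\sin t_{p+2}\cos t_{p+3},\ \dots,\\ &\phi(s)\sin t_{p+2}\cdots\sin t_{n-1}\cos t_n,\ \phi(s)\sin t_{p+2}\cdots\sin t_{n-1}\sin t_n\big)\end{aligned}$$ with the profile curve $(\psi,\phi)$ satisfying $\psi'^2+\phi'^2=1$ and $$\phi'\psi''-\phi''\psi'=\frac13\left(p\,\frac{\phi'}{\psi}-q\,\frac{\psi'}{\phi}\right).$$ (ii) A generalized cylinder over a rotational hypersurface given by $$\begin{aligned}x(s,t_2,\dots,t_n)=\big(&\psi(s)\cos t_2,\ \psi(s)\sin t_2\cos t_3,\ \dots,\ \psi(s)\sin t_2\cdots\sin t_p\cos t_{p+1},\\ &\psi(s)\sin t_2\cdots\sin t_p\sin t_{p+1},\ \phi(s),\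 t_{p+2},\ t_{p+3},\ \dots,\ t_n\big)\end{aligned}$$ with the profile curve $(\psi,\phi)$ satisfying $\psi'^2+\phi'^2=1$ and $$\phi'\psi''-\phi''\psi'=\frac p3\,\frac{\phi'}{\psi}.$$
   Context: $\mathbb E^{m}$ is Euclidean $m$-space. For an oriented hypersurface $M\subset\mathbb E^{n+1}$ with unit normal field $N$, $S$ is its shape operator along $N$, with principal curvatures $k_1,\dots,k_n$, and $s_1=k_1+\dots+k_n$ is its (first) mean curvature; $\nabla s_1$ is the gradient of $s_1$ on $M$. The displayed form of $S$ is with respect to a local orthonormal frame field $\{e_1,\dots,e_n\}$ of principal directions of $M$. $M$ is an $\mathrm H$-hypersurface (biconservative hypersurface) if $S(\nabla s_1)=-\frac{s_1}{2}\nabla s_1$ with $s_1$ non-constant. Standing assumptions: $\nabla s_1$ does not vanish at any point of $M$, and the functions $k_1-k_2$, $k_1-k_{p+2}$ and $k_2-k_{p+2}$ do not vanish on $M$. For an $\mathrm H$-hypersurface the frame is chosen with $e_1=\nabla s_1/|\nabla s_1|$, so that $k_1=-s_1/2$. Here $\psi,\phi$ are smooth functions of $s$, and primes denote derivatives with respect to $s$.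
   Formalization: As written the "only if" fails when k_2 = 0 and p ≠ q (cylinder with ψ-sphere of dimension q and flat factor R^p); the list is therefore extended by family (ii) with p and q interchanged. M is taken connected, and congruence is to an open part of the listed hypersurface. *)

theory Defs
  imports "HOL-Analysis.Analysis"
begin

section \<open>Smooth maps and smooth hypersurfaces of a Euclidean space\<close>

text \<open>
  Intended for open sets \<open>A\<close>: all iterated directional derivatives up to order \<open>m\<close> exist
  (as Frechet derivatives) and are continuous.
\<close>

primrec C_on :: "nat \<Rightarrow> 'a::real_normed_vector set \<Rightarrow> ('a \<Rightarrow> 'b::real_normed_vector) \<Rightarrow> bool" where
  "C_on 0 A f \<longleftrightarrow> continuous_on A f"
| "C_on (Suc m) A f \<longleftrightarrow>
     (\<forall>x\<in>A. f differentiable at x) \<and> (\<forall>v. C_on m A (\<lambda>x. frechet_derivative f (at x) v))"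

definition smooth_on :: "'a::real_normed_vector set \<Rightarrow> ('a \<Rightarrow> 'b::real_normed_vector) \<Rightarrow> bool" where
  "smooth_on A f \<longleftrightarrow> (\<forall>m. C_on m A f)"

text \<open>
  Smoothness of a map defined on a submanifold \<open>M\<close> (or a relatively open part of it): local
  smooth extendability to the ambient space.
\<close>

definition smooth_along :: "'a::real_normed_vector set \<Rightarrow> ('a \<Rightarrow> 'b::real_normed_vector) \<Rightarrow> bool" where
  "smooth_along M f \<longleftrightarrow>
     (\<forall>x\<in>M. \<exists>U g. open U \<and> x \<in> U \<and> smooth_on U g \<and> (\<forall>y\<in>M \<inter> U. g y = f y))"

definition smooth_hypersurface :: "'a::euclidean_space set \<Rightarrow> bool" where
  "smooth_hypersurface M \<longleftrightarrow>
     (\<forall>x\<in>M. \<exists>U (g :: 'a \<Rightarrow> real). open U \<and> x \<in> U \<and> smooth_on U g \<and>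
        (\<forall>y\<in>U. frechet_derivative g (at y) \<noteq> (\<lambda>v. 0)) \<and> M \<inter> U = {y \<in> U. g y = 0})"

definition tangent_space :: "'a::euclidean_space set \<Rightarrow> 'a \<Rightarrow> 'a set" where
  "tangent_space M x =
     {v. \<exists>\<gamma> \<epsilon>. \<epsilon> > 0 \<and> smooth_on {-\<epsilon><..<\<epsilon>} \<gamma> \<and> \<gamma> ` {-\<epsilon><..<\<epsilon>} \<subseteq> M \<and>
        \<gamma> 0 = x \<and> (\<gamma> has_vector_derivative v) (at (0::real))}"

definition oriented_hypersurface :: "'a::euclidean_space set \<Rightarrow> ('a \<Rightarrow> 'a) \<Rightarrow> bool" where
  "oriented_hypersurface M N \<longleftrightarrow>
     smooth_hypersurface M \<and> smooth_along M N \<and>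
     (\<forall>x\<in>M. norm (N x) = 1 \<and> (\<forall>v\<in>tangent_space M x. N x \<bullet> v = 0))"

text \<open>
  The derivative of a map on \<open>M\<close> is the Frechet derivative \<open>at x within M\<close>. It is not unique
  as a linear map of the ambient space, but its values on tangent vectors are; both notions
  below use it on tangent vectors only.
\<close>

definition grad :: "'a::euclidean_space set \<Rightarrow> ('a \<Rightarrow> real) \<Rightarrow> 'a \<Rightarrow> 'a" where
  "grad M f x = (THE w. w \<in> tangent_space M x \<and>
     (\<forall>v\<in>tangent_space M x. w \<bullet> v = frechet_derivative f (at x within M) v))"

definition shape_operator :: "'a::euclidean_space set \<Rightarrow> ('a \<Rightarrow> 'a) \<Rightarrow> 'a \<Rightarrow> 'a \<Rightarrow> 'a" where
  "shape_operator M N x v = - frechet_derivative N (at x within M) v"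

section \<open>Principal curvatures and H-hypersurfaces\<close>

definition principal_space :: "'a::euclidean_space set \<Rightarrow> ('a \<Rightarrow> 'a) \<Rightarrow> 'a \<Rightarrow> real \<Rightarrow> 'a set" where
  "principal_space M N x c = {v \<in> tangent_space M x. shape_operator M N x v = c *\<^sub>R v}"

definition principal_curvatures :: "'a::euclidean_space set \<Rightarrow> ('a \<Rightarrow> 'a) \<Rightarrow> 'a \<Rightarrow> real set" where
  "principal_curvatures M N x = {c. \<exists>v \<in> principal_space M N x c. v \<noteq> 0}"

text \<open>
  The unnormalised mean curvature \<open>s\<^sub>1 = k\<^sub>1 + \<dots> + k\<^sub>n\<close>: the sum of the principal
  curvatures, each counted with its multiplicity.
\<close>

definition mean_curvature :: "'a::euclidean_space set \<Rightarrow> ('a \<Rightarrow> 'a) \<Rightarrow> 'a \<Rightarrow> real" where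
  "mean_curvature M N x =
     (\<Sum>c\<in>principal_curvatures M N x. real (dim (principal_space M N x c)) * c)"

definition H_hypersurface :: "'a::euclidean_space set \<Rightarrow> ('a \<Rightarrow> 'a) \<Rightarrow> bool" where
  "H_hypersurface M N \<longleftrightarrow>
     (let s\<^sub>1 = mean_curvature M N in
        (\<forall>x\<in>M. shape_operator M N x (grad M s\<^sub>1 x) = - (s\<^sub>1 x / 2) *\<^sub>R grad M s\<^sub>1 x) \<and>
        \<not> s\<^sub>1 constant_on M)"

text \<open>
  \<open>S = diag (k\<^sub>1, \<dots>, k\<^sub>n)\<close> with respect to local smooth orthonormal frame fields of principal
  directions around each point; the principal curvatures \<open>k\<^sub>i\<close> are globally defined on \<open>M\<close>.
\<close>

definition shape_diag ::
  "'a::euclidean_space set \<Rightarrow> ('a \<Rightarrow> 'a) \<Rightarrow> nat \<Rightarrow> (nat \<Rightarrow> 'a \<Rightarrow> real) \<Rightarrow> bool" where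
  "shape_diag M N n k \<longleftrightarrow>
     (\<forall>x\<in>M. \<exists>U (e :: nat \<Rightarrow> 'a \<Rightarrow> 'a). open U \<and> x \<in> U \<and>
        (\<forall>i\<in>{1..n}. smooth_along (M \<inter> U) (e i)) \<and>
        (\<forall>y\<in>M \<inter> U.
           (\<forall>i\<in>{1..n}. e i y \<in> tangent_space M y \<and>
                        shape_operator M N y (e i y) = k i y *\<^sub>R e i y) \<and>
           (\<forall>i\<in>{1..n}. \<forall>j\<in>{1..n}. e i y \<bullet> e j y = (if i = j then 1 else 0))))"

section \<open>The two families of hypersurfaces\<close>

definition congruent_sets :: "'a::euclidean_space set \<Rightarrow> 'a set \<Rightarrow> bool" where
  "congruent_sets A B \<longleftrightarrow> (\<exists>f :: 'a \<Rightarrow> 'a. (\<forall>x y. dist (f x) (f y) = dist x y) \<and> f ` A = B)"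

text \<open>
  \<open>sphere_coord d \<theta> i\<close>, for \<open>1 \<le> i \<le> d + 1\<close>, is the \<open>i\<close>-th coordinate of the point
  \<open>(cos \<theta>\<^sub>1, sin \<theta>\<^sub>1 cos \<theta>\<^sub>2, \<dots>, sin \<theta>\<^sub>1 \<cdots> sin \<theta>\<^bsub>d-1\<^esub> cos \<theta>\<^sub>d, sin \<theta>\<^sub>1 \<cdots> sin \<theta>\<^sub>d)\<close>
  of the unit \<open>d\<close>-sphere.
\<close>

definition sphere_coord :: "nat \<Rightarrow> (nat \<Rightarrow> real) \<Rightarrow> nat \<Rightarrow> real" where
  "sphere_coord d \<theta> i = (\<Prod>l\<in>{1..<i}. sin (\<theta> l)) * (if i \<le> d then cos (\<theta> i) else 1)"

text \<open>
  In what follows \<open>b 1, \<dots>, b (n + 1)\<close> is the standard basis of the ambient space, and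
  \<open>t i\<close> is the parameter \<open>t\<^sub>i\<close> for \<open>2 \<le> i \<le> n\<close>.
\<close>

definition rotational_param ::
  "(nat \<Rightarrow> 'a::euclidean_space) \<Rightarrow> nat \<Rightarrow> nat \<Rightarrow> (real \<Rightarrow> real) \<Rightarrow> (real \<Rightarrow> real) \<Rightarrow>
   real \<times> (nat \<Rightarrow> real) \<Rightarrow> 'a" where
  "rotational_param b n p \<psi> \<phi> = (\<lambda>(s, t). \<Sum>j\<in>{1..n+1}.
     (if j \<le> p + 1 then \<psi> s * sphere_coord p (\<lambda>l. t (l + 1)) j
      else \<phi> s * sphere_coord (n - p - 1) (\<lambda>l. t (l + p + 1)) (j - (p + 1))) *\<^sub>R b j)"

definition cylinder_param ::
  "(nat \<Rightarrow> 'a::euclidean_space) \<Rightarrow> nat \<Rightarrow> nat \<Rightarrow> (real \<Rightarrow> real) \<Rightarrow> (real \<Rightarrow> real) \<Rightarrow>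
   real \<times> (nat \<Rightarrow> real) \<Rightarrow> 'a" where
  "cylinder_param b n p \<psi> \<phi> = (\<lambda>(s, t). \<Sum>j\<in>{1..n+1}.
     (if j \<le> p + 1 then \<psi> s * sphere_coord p (\<lambda>l. t (l + 1)) j
      else if j = p + 2 then \<phi> s
      else t (j - 1)) *\<^sub>R b j)"

definition profile_curve :: "real set \<Rightarrow> (real \<Rightarrow> real) \<Rightarrow> (real \<Rightarrow> real) \<Rightarrow> bool" where
  "profile_curve I \<psi> \<phi> \<longleftrightarrow>
     open I \<and> is_interval I \<and> smooth_on I \<psi> \<and> smooth_on I \<phi> \<and>
     (\<forall>s\<in>I. (deriv \<psi> s)\<^sup>2 + (deriv \<phi> s)\<^sup>2 = 1)"

text \<open>
  An open subset \<open>D\<close> of \<open>I \<times> \<real>\<^bsup>n-1\<^esup>\<close> in which \<open>(s, t\<^sub>2, \<dots>, t\<^sub>n)\<close> varies. A hypersurface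
  given by a parametrization is its image over such a domain, so that open parts of the
  complete rotational hypersurfaces and cylinders are included.
\<close>

definition param_domain :: "nat \<Rightarrow> real set \<Rightarrow> (real \<times> (nat \<Rightarrow> real)) set \<Rightarrow> bool" where
  "param_domain n I D \<longleftrightarrow>
     openin (prod_topology euclideanreal (product_topology (\<lambda>i. euclideanreal) {2..n})) D \<and>
     fst ` D \<subseteq> I"

text \<open>
  The conditions \<open>\<psi> s \<noteq> 0\<close> and \<open>\<phi> s \<noteq> 0\<close> are implicit in the quotients of the profile equations.
\<close>

definition rotational_type ::
  "(nat \<Rightarrow> 'a::euclidean_space) \<Rightarrow> nat \<Rightarrow> nat \<Rightarrow> 'a set \<Rightarrow> bool" where
  "rotational_type b n p M \<longleftrightarrow>
     (\<exists>I \<psi> \<phi> D. profile_curve I \<psi> \<phi> \<and>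
        (\<forall>s\<in>I. \<psi> s \<noteq> 0 \<and> \<phi> s \<noteq> 0 \<and>
           deriv \<phi> s * deriv (deriv \<psi>) s - deriv (deriv \<phi>) s * deriv \<psi> s =
             1 / 3 * (real p * (deriv \<phi> s / \<psi> s) - real (n - p - 1) * (deriv \<psi> s / \<phi> s))) \<and>
        param_domain n I D \<and> congruent_sets M (rotational_param b n p \<psi> \<phi> ` D))"

text \<open>
  Here the flat factor carries the principal curvature \<open>0\<close> of multiplicity \<open>n - p - 1\<close>. For
  principal curvatures of multiplicities \<open>1\<close>, \<open>p\<close>, \<open>q = n - p - 1\<close> the vanishing one may have
  multiplicity \<open>q\<close> or \<open>p\<close>; the latter case is \<open>cylinder_type b n q\<close>. No such distinction is
  needed for \<open>rotational_type\<close>, which is symmetric under exchanging \<open>(\<psi>, p)\<close> and \<open>(\<phi>, q)\<close>.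
\<close>

definition cylinder_type ::
  "(nat \<Rightarrow> 'a::euclidean_space) \<Rightarrow> nat \<Rightarrow> nat \<Rightarrow> 'a set \<Rightarrow> bool" where
  "cylinder_type b n p M \<longleftrightarrow>
     (\<exists>I \<psi> \<phi> D. profile_curve I \<psi> \<phi> \<and>
        (\<forall>s\<in>I. \<psi> s \<noteq> 0 \<and>
           deriv \<phi> s * deriv (deriv \<psi>) s - deriv (deriv \<phi>) s * deriv \<psi> s =
             real p / 3 * (deriv \<phi> s / \<psi> s)) \<and>
        param_domain n I D \<and> congruent_sets M (cylinder_param b n p \<psi> \<phi> ` D))"

end

theory Submission
  imports Defs
begin

text \<open>
  The gradient of the mean curvature \<open>s1\<close> of an H-hypersurface is a principal direction for
  \<open>- s1 / 2\<close>. By the Codazzi equation a principal curvature of multiplicity at least two is constant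
  along its own leaves, so that eigenvalue is the simple one (\<open>k1_eq\<close>): \<open>k 1 = - s1 / 2\<close> varies along
  \<open>e 1\<close> only, and \<open>3 k 1 + p k 2 + q k (p+2) = 0\<close>.

  The Codazzi equations now give the derivative of \<open>e 1\<close> and show that the two multiple
  eigenspaces do not rotate into each other (\<open>D_e1\<close>, \<open>\<Gamma>_mixed\<close>); the remaining information is in
  \<open>\<alpha> i = D 1 (k i) / (k i - k 1)\<close> and in one Gauss equation, \<open>\<alpha> 2 \<alpha> (p+2) + k 2 k (p+2) = 0\<close>
  (\<open>gauss_mixed\<close>). The leaves of \<open>k 2\<close> are therefore spheres of radius \<open>\<psi>\<close> with
  \<open>1 / \<psi>\<^sup>2 = (\<alpha> 2)\<^sup>2 + (k 2)\<^sup>2\<close>, or flat. The plane of \<open>e 1\<close> and \<open>N\<close> has an orthonormal basis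
  \<open>u\<close>, \<open>w\<close> such that \<open>u\<close> moves only along the leaves of \<open>k 2\<close> and \<open>w\<close> only along those of \<open>k (p+2)\<close>,
  and the span of \<open>u\<close> and the first eigenspace is constant (\<open>leaf_equations\<close>, \<open>pr_constant\<close>).
  Flatness of a family of leaves is a zero of a solution of a linear differential equation along
  paths, so on connected \<open>M\<close> it holds everywhere or nowhere (\<open>stationary_value\<close>). If neither family is
  flat, \<open>x - \<psi> u - \<phi> w\<close> is constant for a function \<open>\<phi>\<close>, and \<open>M\<close> is rotational; if one is flat, its
  directions split off and \<open>M\<close> is a cylinder (\<open>classification\<close>).

  The curves along \<open>e 1\<close> need not fit together to a global arc length on \<open>M\<close>, so the profile is found
  differently: \<open>(\<psi>, \<phi>)\<close> and its velocity satisfy an autonomous equation along \<open>e 1\<close>, and by uniqueness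
  all of \<open>M\<close> is mapped to one maximal integral curve (\<open>single_integral_curve\<close>). Near a point of \<open>M\<close>
  every point whose coordinates lie over the profile belongs to \<open>M\<close> (\<open>transversal_points\<close>); this
  makes the parameter domain open.

  Conversely, the coordinate fields of a rotational hypersurface or cylinder are principal directions.
  The profile equation says that the curvature \<open>\<kappa>\<close> of the profile is a third of minus the sum of
  the other principal curvatures, so that \<open>s1 = - 2 \<kappa>\<close> depends on \<open>s\<close> only and its gradient is tangent
  to the profile (\<open>H_equation_param\<close>). The coordinates degenerate at the poles of the spheres, but
  the regular points are dense (\<open>H_hypersurface_dense\<close>).
\<close>

section \<open>Calculus of smooth maps\<close>

lemma frechet_derivative_eqI:
  "(f has_derivative f') (at x) ==> frechet_derivative f (at x) = f'"
  using frechet_derivative_at by metis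

lemma frechet_derivative_cong_open:
  assumes "open A" "x \<in> A" "!!y. y \<in> A ==> f y = g y"
  shows "frechet_derivative f (at x) = frechet_derivative g (at x)"
proof -
  have "(f has_derivative F) (at x) = (g has_derivative F) (at x)" for F
    using has_derivative_transform_within_open[OF _ assms(1,2), of f F UNIV g]
      has_derivative_transform_within_open[OF _ assms(1,2), of g F UNIV f] assms(3) by metis
  then show ?thesis unfolding frechet_derivative_def by simp
qed

lemma C_on_cong:
  assumes "open A" "!!x. x \<in> A ==> f x = g x" "C_on m A f"
  shows "C_on m A g"
  using assms(2,3)
proof (induction m arbitrary: f g)
  case 0
  then show ?case using continuous_on_cong[of A A f g] by auto
next
  case (Suc m)
  have "g differentiable at x" if x: "x \<in> A" for x
  proof -
    obtain F where "(f has_derivative F) (at x)"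
      using Suc.prems(2) x by (auto simp: differentiable_def)
    then have "(g has_derivative F) (at x)"
      by (rule has_derivative_transform_within_open[OF _ assms(1) x Suc.prems(1)])
    then show ?thesis by (auto simp: differentiable_def)
  qed
  moreover have "C_on m A (\<lambda>x. frechet_derivative g (at x) v)" for v
    by (rule Suc.IH[of "\<lambda>x. frechet_derivative f (at x) v"])
      (use Suc.prems frechet_derivative_cong_open[OF assms(1) _ Suc.prems(1)] in auto)
  ultimately show ?case by simp
qed

lemma C_on_SucI:
  assumes "open A" "!!x. x \<in> A ==> (f has_derivative F x) (at x)" "!!v. C_on m A (\<lambda>x. F x v)"
  shows "C_on (Suc m) A f"
proof -
  have "C_on m A (\<lambda>x. frechet_derivative f (at x) v)" for v
    by (rule C_on_cong[OF assms(1) _ assms(3)[of v]]) (simp add: frechet_derivative_eqI[OF assms(2)])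
  then show ?thesis using assms(2) by (auto simp: differentiable_def)
qed

lemma C_on_SucD: "C_on (Suc m) A f ==> C_on m A f"
proof (induction m arbitrary: f)
  case 0
  then show ?case
    by (auto intro!: differentiable_imp_continuous_on simp: differentiable_on_def differentiable_at_withinI)
next
  case (Suc m)
  then show ?case by auto
qed

lemma C_on_has_derivative:
  "C_on (Suc m) A f ==> x \<in> A ==> (f has_derivative frechet_derivative f (at x)) (at x)"
  using frechet_derivative_works by auto

lemma C_on_subset: "C_on m A f ==> B \<subseteq> A ==> C_on m B f"
  by (induction m arbitrary: f) (auto intro: continuous_on_subset)

lemma C_on_const: "C_on m A (\<lambda>x. c)"
  by (induction m arbitrary: c) (auto simp: frechet_derivative_const)

lemma C_on_bounded_linear: "bounded_linear f ==> C_on m A f"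
proof (induction m)
  case 0
  then show ?case by (simp add: linear_continuous_on)
next
  case (Suc m)
  then have "frechet_derivative f (at x) = f" for x
    by (intro frechet_derivative_eqI bounded_linear_imp_has_derivative)
  then show ?case using Suc bounded_linear_imp_differentiable by (auto simp: C_on_const)
qed

lemma C_on_add:
  assumes "open A" "C_on m A f" "C_on m A g"
  shows "C_on m A (\<lambda>x. f x + g x)"
  using assms(2,3)
proof (induction m arbitrary: f g)
  case 0
  then show ?case by (auto intro: continuous_on_add)
next
  case (Suc m)
  show ?case
    by (rule C_on_SucI[OF assms(1) has_derivative_add[OF C_on_has_derivative[OF Suc.prems(1)]
          C_on_has_derivative[OF Suc.prems(2)]]]) (use Suc assms(1) in auto)
qed

lemma C_on_sum:
  assumes "open A" "!!i. i \<in> I ==> C_on m A (f i)"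
  shows "C_on m A (\<lambda>x. \<Sum>i\<in>I. f i x)"
  using assms(2)
  by (induction I rule: infinite_finite_induct) (auto intro: C_on_const C_on_add[OF assms(1)])

lemma (in bounded_bilinear) C_on_bilinear:
  assumes "open A" "C_on m A f" "C_on m A g"
  shows "C_on m A (\<lambda>x. prod (f x) (g x))"
  using assms(2,3)
proof (induction m arbitrary: f g)
  case 0
  then show ?case by (auto intro: continuous_on)
next
  case (Suc m)
  show ?case
    by (rule C_on_SucI[OF assms(1) FDERIV[OF C_on_has_derivative[OF Suc.prems(1)]
          C_on_has_derivative[OF Suc.prems(2)]]])
      (use Suc C_on_SucD[OF Suc.prems(1)] C_on_SucD[OF Suc.prems(2)] in \<open>auto intro!: C_on_add[OF assms(1)]\<close>)
qed

lemmas C_on_scaleR = bounded_bilinear.C_on_bilinear[OF bounded_bilinear_scaleR]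
lemmas C_on_mult = bounded_bilinear.C_on_bilinear[OF bounded_bilinear_mult]
lemmas C_on_inner = bounded_bilinear.C_on_bilinear[OF bounded_bilinear_inner]

lemma C_on_compose:
  fixes f :: "'b::euclidean_space => 'c::real_normed_vector" and g :: "'a::real_normed_vector => 'b"
  assumes "open A" "open B" "g ` A \<subseteq> B" "C_on m B f" "C_on m A g"
  shows "C_on m A (\<lambda>x. f (g x))"
  using assms(4,5)
proof (induction m arbitrary: f)
  case 0
  then show ?case using assms(3) by (auto intro: continuous_on_compose2)
next
  case (Suc m)
  let ?F = "\<lambda>x v. \<Sum>i\<in>Basis. (frechet_derivative g (at x) v \<bullet> i) *\<^sub>R frechet_derivative f (at (g x)) i"
  have "((\<lambda>x. f (g x)) has_derivative ?F x) (at x)" if x: "x \<in> A" for x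
  proof -
    have g: "(g has_derivative frechet_derivative g (at x)) (at x)"
      by (rule C_on_has_derivative[OF Suc.prems(2) x])
    have f: "(f has_derivative frechet_derivative f (at (g x))) (at (g x))"
      by (rule C_on_has_derivative[OF Suc.prems(1)]) (use x assms(3) in auto)
    have expand: "frechet_derivative f (at (g x)) w = (\<Sum>i\<in>Basis. (w \<bullet> i) *\<^sub>R frechet_derivative f (at (g x)) i)" for w
      by (subst euclidean_representation[of w, symmetric])
        (simp only: linear_sum[OF has_derivative_linear[OF f]] linear_scale[OF has_derivative_linear[OF f]])
    have "?F x = (\<lambda>v. frechet_derivative f (at (g x)) (frechet_derivative g (at x) v))"
      by (rule ext, rule expand[symmetric])
    then show ?thesis using has_derivative_compose[OF g f] by simp
  qed
  moreover have "C_on m A (\<lambda>x. ?F x v)" for v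
    by (intro C_on_sum[OF assms(1)] C_on_scaleR[OF assms(1)] C_on_inner[OF assms(1)] C_on_const
        Suc.IH[OF _ C_on_SucD[OF Suc.prems(2)]]) (use Suc.prems in auto)
  ultimately show ?case by (rule C_on_SucI[OF assms(1)])
qed

lemma C_on_inverse:
  fixes f :: "'a::real_normed_vector => real"
  assumes "open A" "!!x. x \<in> A ==> f x ~= 0" "C_on m A f"
  shows "C_on m A (\<lambda>x. inverse (f x))"
  using assms(3)
proof (induction m)
  case 0
  then show ?case using assms(2) by (auto intro: continuous_on_inverse)
next
  case (Suc m)
  have 1: "C_on m A (\<lambda>x. inverse (f x))" by (rule Suc.IH[OF C_on_SucD[OF Suc.prems]])
  have "((\<lambda>x. inverse (f x)) has_derivative
      (\<lambda>v. (-1) * (inverse (f x) * (frechet_derivative f (at x) v * inverse (f x))))) (at x)" if x: "x \<in> A" for x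
    using Deriv.has_derivative_inverse[OF assms(2)[OF x] C_on_has_derivative[OF Suc.prems x]]
    by (simp add: mult.assoc)
  moreover have "C_on m A (\<lambda>x. (-1) * (inverse (f x) * (frechet_derivative f (at x) v * inverse (f x))))" for v
    by (intro C_on_mult[OF assms(1)] C_on_const 1) (use Suc.prems in auto)
  ultimately show ?case by (rule C_on_SucI[OF assms(1)])
qed

lemma C_on_sqrt:
  fixes f :: "'a::real_normed_vector => real"
  assumes "open A" "!!x. x \<in> A ==> f x > 0" "C_on m A f"
  shows "C_on m A (\<lambda>x. sqrt (f x))"
  using assms(3)
proof (induction m)
  case 0
  then show ?case using assms(2) by (auto intro: continuous_on_real_sqrt)
next
  case (Suc m)
  have 1: "C_on m A (\<lambda>x. sqrt (f x))" by (rule Suc.IH[OF C_on_SucD[OF Suc.prems]])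
  have "C_on m A (\<lambda>x. inverse (sqrt (f x)))"
    by (rule C_on_inverse[OF assms(1) _ 1]) (use assms(2) in \<open>force\<close>)
  note 2 = this
  have "((\<lambda>x. sqrt (f x)) has_derivative (\<lambda>v. frechet_derivative f (at x) v * (inverse (sqrt (f x)) * (1/2)))) (at x)"
    if x: "x \<in> A" for x
    using has_derivative_real_sqrt[OF assms(2)[OF x] C_on_has_derivative[OF Suc.prems x]]
    by (simp add: field_simps)
  moreover have "C_on m A (\<lambda>x. frechet_derivative f (at x) v * (inverse (sqrt (f x)) * (1/2)))" for v
    by (intro C_on_mult[OF assms(1)] C_on_const 2) (use Suc.prems in auto)
  ultimately show ?case by (rule C_on_SucI[OF assms(1)])
qed

text \<open>
  The mean value theorem, once in each direction. The left side is symmetric in \<open>u\<close> and \<open>v\<close>, whence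
  the symmetry of second derivatives.
\<close>

lemma second_difference_mean_value:
  fixes f :: "'a::real_normed_vector => real"
  assumes "h > 0" "C_on 2 A f" "!!s t. 0 <= s ==> s <= h ==> 0 <= t ==> t <= h ==> x + s *\<^sub>R u + t *\<^sub>R v \<in> A"
  shows "\<exists>s t. 0 <= s \<and> s <= h \<and> 0 <= t \<and> t <= h \<and>
    f (x + h *\<^sub>R u + h *\<^sub>R v) - f (x + h *\<^sub>R u) - f (x + h *\<^sub>R v) + f x =
    h * h * frechet_derivative (\<lambda>y. frechet_derivative f (at y) u) (at (x + s *\<^sub>R u + t *\<^sub>R v)) v"
proof -
  define fu where "fu = (\<lambda>y. frechet_derivative f (at y) u)"
  have C: "C_on (Suc (Suc 0)) A f" using assms(2) by (simp only: numeral_2_eq_2)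
  have df: "(f has_derivative frechet_derivative f (at y)) (at y)" if "y \<in> A" for y
    by (rule C_on_has_derivative[OF C that])
  have dfu: "(fu has_derivative frechet_derivative fu (at y)) (at y)" if "y \<in> A" for y
    unfolding fu_def by (rule C_on_has_derivative[of 0, OF _ that]) (use C in auto)
  have along_u: "((\<lambda>s. f (x + s *\<^sub>R u + t *\<^sub>R v)) has_real_derivative fu (x + s *\<^sub>R u + t *\<^sub>R v)) (at s)"
    if "0 <= s" "s <= h" "0 <= t" "t <= h" for s t
  proof -
    have 1: "((\<lambda>s. x + s *\<^sub>R u + t *\<^sub>R v) has_derivative (\<lambda>d. d *\<^sub>R u)) (at s)"
      by (auto intro!: derivative_eq_intros)
    have "((\<lambda>s. f (x + s *\<^sub>R u + t *\<^sub>R v)) has_derivative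
        (\<lambda>d. frechet_derivative f (at (x + s *\<^sub>R u + t *\<^sub>R v)) (d *\<^sub>R u))) (at s)"
      by (rule has_derivative_compose[OF 1 df]) (use assms(3) that in auto)
    then show ?thesis
      by (simp add: has_field_derivative_def fu_def mult_commute_abs
          linear_scale[OF has_derivative_linear[OF df[OF assms(3)[OF that]]]])
  qed
  have along_v: "((\<lambda>t. fu (x + s *\<^sub>R u + t *\<^sub>R v)) has_real_derivative
      frechet_derivative fu (at (x + s *\<^sub>R u + t *\<^sub>R v)) v) (at t)"
    if "0 <= s" "s <= h" "0 <= t" "t <= h" for s t
  proof -
    have 1: "((\<lambda>t. x + s *\<^sub>R u + t *\<^sub>R v) has_derivative (\<lambda>d. d *\<^sub>R v)) (at t)"
      by (auto intro!: derivative_eq_intros)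
    have "((\<lambda>t. fu (x + s *\<^sub>R u + t *\<^sub>R v)) has_derivative
        (\<lambda>d. frechet_derivative fu (at (x + s *\<^sub>R u + t *\<^sub>R v)) (d *\<^sub>R v))) (at t)"
      by (rule has_derivative_compose[OF 1 dfu]) (use assms(3) that in auto)
    then show ?thesis
      by (simp add: has_field_derivative_def mult_commute_abs
          linear_scale[OF has_derivative_linear[OF dfu[OF assms(3)[OF that]]]])
  qed
  let ?g = "\<lambda>s. f (x + s *\<^sub>R u + h *\<^sub>R v) - f (x + s *\<^sub>R u + 0 *\<^sub>R v)"
  have "\<exists>s. 0 < s \<and> s < h \<and> ?g h - ?g 0 = (h - 0) * (fu (x + s *\<^sub>R u + h *\<^sub>R v) - fu (x + s *\<^sub>R u + 0 *\<^sub>R v))"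
    by (rule MVT2) (use assms(1) in \<open>auto intro!: DERIV_diff along_u along_u[where t=0, simplified]\<close>)
  then obtain s where s: "0 < s" "s < h"
    and 1: "?g h - ?g 0 = h * (fu (x + s *\<^sub>R u + h *\<^sub>R v) - fu (x + s *\<^sub>R u + 0 *\<^sub>R v))" by auto
  have "\<exists>t. 0 < t \<and> t < h \<and> fu (x + s *\<^sub>R u + h *\<^sub>R v) - fu (x + s *\<^sub>R u + 0 *\<^sub>R v) =
      (h - 0) * frechet_derivative fu (at (x + s *\<^sub>R u + t *\<^sub>R v)) v"
    by (rule MVT2) (use assms(1) s in \<open>auto intro!: along_v\<close>)
  then obtain t where t: "0 < t" "t < h"
    and 2: "fu (x + s *\<^sub>R u + h *\<^sub>R v) - fu (x + s *\<^sub>R u + 0 *\<^sub>R v) =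
      h * frechet_derivative fu (at (x + s *\<^sub>R u + t *\<^sub>R v)) v" by auto
  show ?thesis
    by (rule exI[of _ s], rule exI[of _ t]) (use s t 1 2 in \<open>simp add: fu_def algebra_simps\<close>)
qed

lemma second_derivative_symmetric_real:
  fixes f :: "'a::real_normed_vector => real"
  assumes "open A" "C_on 2 A f" "x \<in> A"
  shows "frechet_derivative (\<lambda>y. frechet_derivative f (at y) u) (at x) v =
    frechet_derivative (\<lambda>y. frechet_derivative f (at y) v) (at x) u" (is "?L x = ?R x")
proof (rule ccontr)
  assume neq: "?L x ~= ?R x"
  define e where "e = \<bar>?L x - ?R x\<bar> / 2"
  have e: "e > 0" using neq by (simp add: e_def)
  have C: "C_on (Suc (Suc 0)) A f" using assms(2) by (simp only: numeral_2_eq_2)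
  have "continuous_on A (\<lambda>x. frechet_derivative (\<lambda>y. frechet_derivative f (at y) u) (at x) v)" for u v
    using C by simp
  note cL = this[of u v] and cR = this[of v u]
  obtain d1 where d1: "d1 > 0" "!!y. y \<in> A ==> dist y x < d1 ==> dist (?L y) (?L x) < e"
    using cL[unfolded continuous_on_iff, rule_format, OF assms(3) e] by (elim exE conjE) simp
  obtain d2 where d2: "d2 > 0" "!!y. y \<in> A ==> dist y x < d2 ==> dist (?R y) (?R x) < e"
    using cR[unfolded continuous_on_iff, rule_format, OF assms(3) e] by (elim exE conjE) simp
  obtain d3 where d3: "d3 > 0" "ball x d3 \<subseteq> A" using assms(1,3) open_contains_ball by blast
  define d where "d = min d1 (min d2 d3)"
  define h where "h = d / (2 * (norm u + norm v + 1))"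
  have n: "norm u + norm v + 1 > 0" by (meson add_nonneg_pos add_nonneg_nonneg norm_ge_zero zero_less_one)
  have d: "d > 0" using d1 d2 d3 by (simp add: d_def)
  have h: "h > 0" using d n by (simp add: h_def)
  have near: "dist (x + s *\<^sub>R u + t *\<^sub>R v) x < d" if "0 <= s" "s <= h" "0 <= t" "t <= h" for s t
  proof -
    have "dist (x + s *\<^sub>R u + t *\<^sub>R v) x <= s * norm u + t * norm v"
      using norm_triangle_ineq[of "s *\<^sub>R u" "t *\<^sub>R v"] that by (simp add: dist_norm add.assoc)
    also have "\<dots> <= h * norm u + h * norm v" using that by (intro add_mono mult_right_mono) auto
    also have "\<dots> = h * (norm u + norm v)" by (simp only: distrib_left)
    also have "\<dots> < h * (2 * (norm u + norm v + 1))"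
    proof (rule mult_strict_left_mono[OF _ h])
      show "norm u + norm v < 2 * (norm u + norm v + 1)" using n by argo
    qed
    also have "\<dots> = d" using n by (simp add: h_def)
    finally show ?thesis .
  qed
  have inA: "x + s *\<^sub>R u + t *\<^sub>R v \<in> A" if "0 <= s" "s <= h" "0 <= t" "t <= h" for s t
    using near[OF that] d3 by (auto simp: d_def dist_commute)
  have inA': "x + s *\<^sub>R v + t *\<^sub>R u \<in> A" if "0 <= s" "s <= h" "0 <= t" "t <= h" for s t
    using inA[of t s] that by (simp add: ac_simps)
  obtain s t where st: "0 <= s" "s <= h" "0 <= t" "t <= h" and
    1: "f (x + h *\<^sub>R u + h *\<^sub>R v) - f (x + h *\<^sub>R u) - f (x + h *\<^sub>R v) + f x = h * h * ?L (x + s *\<^sub>R u + t *\<^sub>R v)"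
    using second_difference_mean_value[OF h assms(2) inA] by auto
  obtain s' t' where st': "0 <= s'" "s' <= h" "0 <= t'" "t' <= h" and
    2: "f (x + h *\<^sub>R v + h *\<^sub>R u) - f (x + h *\<^sub>R v) - f (x + h *\<^sub>R u) + f x = h * h * ?R (x + s' *\<^sub>R v + t' *\<^sub>R u)"
    using second_difference_mean_value[OF h assms(2) inA'] by auto
  have comm: "x + h *\<^sub>R v + h *\<^sub>R u = x + h *\<^sub>R u + h *\<^sub>R v" by (simp add: ac_simps)
  have "h * h * ?L (x + s *\<^sub>R u + t *\<^sub>R v) = h * h * ?R (x + s' *\<^sub>R v + t' *\<^sub>R u)"
    using 1 2 unfolding comm by linarith
  then have eq: "?L (x + s *\<^sub>R u + t *\<^sub>R v) = ?R (x + s' *\<^sub>R v + t' *\<^sub>R u)" using h by simp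
  have "dist (?L (x + s *\<^sub>R u + t *\<^sub>R v)) (?L x) < e"
    by (rule d1(2)[OF inA[OF st]]) (use near[OF st] in \<open>simp add: d_def\<close>)
  moreover have "dist (?R (x + s' *\<^sub>R v + t' *\<^sub>R u)) (?R x) < e"
    by (rule d2(2)[OF inA'[OF st']]) (use near[of t' s'] st' in \<open>simp add: d_def ac_simps\<close>)
  ultimately show False using eq by (simp add: dist_real_def e_def abs_if split: if_splits)
qed

lemma second_derivative_symmetric:
  fixes f :: "'a::real_normed_vector => 'b::euclidean_space"
  assumes "open A" "C_on 2 A f" "x \<in> A"
  shows "frechet_derivative (\<lambda>y. frechet_derivative f (at y) u) (at x) v =
    frechet_derivative (\<lambda>y. frechet_derivative f (at y) v) (at x) u"
proof (rule euclidean_eqI)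
  fix i :: 'b assume "i \<in> Basis"
  have C: "C_on (Suc (Suc 0)) A f" using assms(2) by (simp only: numeral_2_eq_2)
  have C2: "C_on 2 A (\<lambda>y. f y \<bullet> i)" by (rule C_on_inner[OF assms(1,2) C_on_const])
  have d1: "frechet_derivative (\<lambda>y. f y \<bullet> i) (at y) w = frechet_derivative f (at y) w \<bullet> i" if "y \<in> A" for y w
    by (subst frechet_derivative_eqI[OF has_derivative_inner_left[OF C_on_has_derivative[OF C that]]]) simp
  have d2: "frechet_derivative (\<lambda>y. frechet_derivative (\<lambda>y. f y \<bullet> i) (at y) w) (at x) w' =
      frechet_derivative (\<lambda>y. frechet_derivative f (at y) w) (at x) w' \<bullet> i" for w w'
  proof -
    have "C_on (Suc 0) A (\<lambda>y. frechet_derivative f (at y) w)" using C by auto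
    from has_derivative_inner_left[OF C_on_has_derivative[OF this assms(3)], of i]
    have "frechet_derivative (\<lambda>y. frechet_derivative f (at y) w \<bullet> i) (at x) w' =
      frechet_derivative (\<lambda>y. frechet_derivative f (at y) w) (at x) w' \<bullet> i"
      using frechet_derivative_eqI by metis
    then show ?thesis using frechet_derivative_cong_open[OF assms(1,3) d1] by simp
  qed
  show "frechet_derivative (\<lambda>y. frechet_derivative f (at y) u) (at x) v \<bullet> i =
    frechet_derivative (\<lambda>y. frechet_derivative f (at y) v) (at x) u \<bullet> i"
    using second_derivative_symmetric_real[OF assms(1) C2 assms(3), of u v] d2 by simp
qed

lemma smooth_onD: "smooth_on A f ==> C_on m A f"
  by (simp add: smooth_on_def)

lemma smooth_on_has_derivative:
  "smooth_on A f ==> x \<in> A ==> (f has_derivative frechet_derivative f (at x)) (at x)"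
  using C_on_has_derivative[OF smooth_onD[of A f "Suc 0"]] by simp

lemma smooth_on_continuous: "smooth_on A f ==> continuous_on A f"
  using smooth_onD[of A f 0] by simp

lemma smooth_on_subset: "smooth_on A f ==> B \<subseteq> A ==> smooth_on B f"
  by (meson C_on_subset smooth_on_def)

lemma smooth_on_derivative: "smooth_on A f ==> smooth_on A (\<lambda>x. frechet_derivative f (at x) v)"
  unfolding smooth_on_def
proof
  fix m assume "\<forall>m. C_on m A f"
  then have "C_on (Suc m) A f" by simp
  then show "C_on m A (\<lambda>x. frechet_derivative f (at x) v)" by simp
qed

section \<open>Smooth retractions onto level sets\<close>

text \<open>The map \<open>\<Theta>\<close> below replaces the coordinate along \<open>\<nu>\<close> by \<open>g\<close>, so it straightens the level set.\<close>

lemma level_set_retraction: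
  fixes g :: "'a::euclidean_space => real"
  assumes U: "open U" "x0 \<in> U" and g: "smooth_on U g" "g x0 = 0" and nu: "frechet_derivative g (at x0) \<nu> ~= 0"
  obtains d \<eta> where "d > 0" "ball x0 d \<subseteq> U" "smooth_on (ball x0 d) \<eta>"
    "!!y. y \<in> ball x0 d ==> y + \<eta> y *\<^sub>R \<nu> \<in> U \<and> g (y + \<eta> y *\<^sub>R \<nu>) = 0"
    "!!y. y \<in> ball x0 d ==> g y = 0 ==> \<eta> y = 0"
proof -
  define Dg where "Dg y = frechet_derivative g (at y)" for y
  have dg: "(g has_derivative Dg y) (at y)" if "y \<in> U" for y
    unfolding Dg_def by (rule smooth_on_has_derivative[OF g(1) that])
  have lin: "bounded_linear (Dg y)" if "y \<in> U" for y
    using dg[OF that] by (rule has_derivative_bounded_linear)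
  have nu0: "\<nu> ~= 0"
  proof
    assume "\<nu> = 0"
    then show False using nu linear_0[OF bounded_linear.linear[OF lin[OF U(2)]]] by (simp add: Dg_def)
  qed
  define l where "l v = (v \<bullet> \<nu>) / (\<nu> \<bullet> \<nu>)" for v
  have l_nu: "l \<nu> = 1" using nu0 by (simp add: l_def)
  have l_lin: "bounded_linear l" unfolding l_def
    by (rule bounded_linear_compose[OF bounded_linear_divide bounded_linear_inner_left])
  note l_simps = linear_add[OF bounded_linear.linear[OF l_lin]] linear_diff[OF bounded_linear.linear[OF l_lin]]
    linear_scale[OF bounded_linear.linear[OF l_lin]] l_nu
  define \<Theta> where "\<Theta> y = y + (g y - l (y - x0)) *\<^sub>R \<nu>" for y
  define D where "D y v = v + (Dg y v - l v) *\<^sub>R \<nu>" for y v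
  have derT: "(\<Theta> has_derivative D y) (at y)" if "y \<in> U" for y
  proof -
    have "((\<lambda>y. l (y - x0)) has_derivative (\<lambda>v. l (v - 0))) (at y)"
      by (rule bounded_linear.has_derivative[OF l_lin]) (intro derivative_intros)
    then have "(\<Theta> has_derivative (\<lambda>v. v + (Dg y v - l (v - 0)) *\<^sub>R \<nu>)) (at y)"
      unfolding \<Theta>_def by (intro derivative_intros dg that)
    then show ?thesis unfolding D_def by simp
  qed
  have D_lin: "bounded_linear (D y)" if "y \<in> U" for y
    using derT[OF that] by (rule has_derivative_bounded_linear)
  define D' where "D' y = Blinfun (D y)" for y
  have D': "blinfun_apply (D' y) = D y" if "y \<in> U" for y
    using D_lin[OF that] by (simp add: D'_def bounded_linear_Blinfun_apply)
  define J where "J y w = w + ((l w - Dg y w) / Dg y \<nu>) *\<^sub>R \<nu>" for y w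
  have DJ: "D y (J y w) = w" if "y \<in> U" "Dg y \<nu> ~= 0" for y w
  proof -
    note Dg_simps = linear_add[OF bounded_linear.linear[OF lin[OF that(1)]]]
      linear_diff[OF bounded_linear.linear[OF lin[OF that(1)]]]
      linear_scale[OF bounded_linear.linear[OF lin[OF that(1)]]]
    show ?thesis using that(2)
      by (simp add: D_def J_def l_simps Dg_simps scaleR_add_left[symmetric] add.assoc)
  qed
  have JD: "J y (D y w) = w" if "y \<in> U" "Dg y \<nu> ~= 0" for y w
  proof -
    note Dg_simps = linear_add[OF bounded_linear.linear[OF lin[OF that(1)]]]
      linear_diff[OF bounded_linear.linear[OF lin[OF that(1)]]]
      linear_scale[OF bounded_linear.linear[OF lin[OF that(1)]]]
    have "(l (D y w) - Dg y (D y w)) / Dg y \<nu> = - (Dg y w - l w)"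
      using that(2) by (simp add: D_def l_simps Dg_simps field_simps)
    then have "J y (D y w) = D y w + (- (Dg y w - l w)) *\<^sub>R \<nu>" by (simp only: J_def)
    then show ?thesis unfolding scaleR_minus_left by (simp add: D_def)
  qed
  have nu1: "Dg x0 \<nu> ~= 0" using nu by (simp add: Dg_def)
  have J_lin: "bounded_linear (J x0)"
    unfolding J_def divide_inverse by (intro bounded_linear_intros l_lin lin[OF U(2)])
  have cont: "continuous_on U D'"
  proof (rule continuous_on_blinfun_componentwise)
    fix i :: 'a assume "i \<in> Basis"
    have "continuous_on U (\<lambda>y. D y i)"
      unfolding D_def Dg_def
      by (intro continuous_intros smooth_on_continuous[OF smooth_on_derivative[OF g(1)]])
    then show "continuous_on U (\<lambda>y. blinfun_apply (D' y) i)"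
      by (rule continuous_on_eq) (simp add: D')
  qed
  have inv: "Blinfun (J x0) o\<^sub>L D' x0 = id_blinfun"
    by (rule blinfun_eqI) (simp add: bounded_linear_Blinfun_apply[OF J_lin] D'[OF U(2)] JD[OF U(2) nu1])
  obtain U' V G G' where UV: "open U'" "U' \<subseteq> U" "x0 \<in> U'" "open V" "\<Theta> x0 \<in> V" "homeomorphism U' V \<Theta> G"
    and G: "!!y. y \<in> V ==> (G has_derivative G' y) (at y)"
      "!!y. y \<in> V ==> G' y = inv (blinfun_apply (D' (G y)))"
      "!!y. y \<in> V ==> bij (blinfun_apply (D' (G y)))"
    by (rule inverse_function_theorem[OF U(1) _ cont U(2) inv, of \<Theta>]) (use derT D' in auto)
  have GU: "G y \<in> U" if "y \<in> V" for y
    using UV(2) homeomorphism_image2[OF UV(6)] that by (metis image_eqI subsetD)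
  have nz: "Dg (G y) \<nu> ~= 0" if y: "y \<in> V" for y
  proof
    assume "Dg (G y) \<nu> = 0"
    then have "D (G y) \<nu> = D (G y) 0"
      using linear_0[OF bounded_linear.linear[OF D_lin[OF GU[OF y]]]] by (simp add: D_def l_nu)
    then have "\<nu> = 0" by (rule injD[OF bij_is_inj[OF G(3)[OF y], unfolded D'[OF GU[OF y]]]])
    then show False using nu0 by simp
  qed
  have G_der: "(G has_derivative J (G y)) (at y)" if y: "y \<in> V" for y
  proof -
    have "inv (D (G y)) w = J (G y) w" for w
      by (rule inv_f_eq[OF bij_is_inj[OF G(3)[OF y], unfolded D'[OF GU[OF y]]] DJ[OF GU[OF y] nz[OF y]]])
    then have "G' y = J (G y)" unfolding G(2)[OF y] D'[OF GU[OF y]] by (rule ext)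
    then show ?thesis using G(1)[OF y] by simp
  qed
  have "C_on m V G" for m
  proof (induction m)
    case 0
    show ?case using homeomorphism_cont2[OF UV(6)] by simp
  next
    case (Suc m)
    have 1: "C_on m V (\<lambda>y. Dg (G y) w)" for w
      by (rule C_on_compose[OF UV(4) U(1) _ smooth_onD[OF smooth_on_derivative[OF g(1)], folded Dg_def] Suc])
        (use GU in auto)
    have 2: "C_on m V (\<lambda>y. l w + (-1) * Dg (G y) w)" for w
      by (intro C_on_add[OF UV(4)] C_on_mult[OF UV(4)] C_on_const 1)
    have 3: "C_on m V (\<lambda>y. inverse (Dg (G y) \<nu>))"
      by (rule C_on_inverse[OF UV(4) nz 1])
    have "C_on m V (\<lambda>y. w + ((l w + (-1) * Dg (G y) w) * inverse (Dg (G y) \<nu>)) *\<^sub>R \<nu>)" for w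
      by (rule C_on_add[OF UV(4) C_on_const C_on_scaleR[OF UV(4) C_on_mult[OF UV(4) 2 3] C_on_const]])
    then have "C_on m V (\<lambda>y. J (G y) w)" for w
      unfolding J_def divide_inverse by simp
    from C_on_SucI[OF UV(4) G_der this] show ?case .
  qed
  then have G_smooth: "smooth_on V G" by (simp add: smooth_on_def)
  define A where "A y = y - l (y - x0) *\<^sub>R \<nu>" for y
  have A_C: "C_on m B A" if "open B" for m B
  proof -
    have "bounded_linear (\<lambda>y. y - l y *\<^sub>R \<nu>)" by (intro bounded_linear_intros l_lin)
    then have "C_on m B (\<lambda>y. (y - l y *\<^sub>R \<nu>) + l x0 *\<^sub>R \<nu>)"
      by (intro C_on_add that C_on_bounded_linear C_on_const)
    then show ?thesis
      by (rule C_on_cong[OF that, rotated]) (simp add: A_def l_simps algebra_simps)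
  qed
  define B where "B = U' \<inter> A -` V"
  have "continuous_on U' A" using A_C[OF UV(1), of 0] by simp
  then have "open B" unfolding B_def using UV(1,4) continuous_open_preimage by blast
  moreover have "x0 \<in> B"
  proof -
    have "l 0 = 0" by (rule linear_0[OF bounded_linear.linear[OF l_lin]])
    then have "A x0 = \<Theta> x0" using g(2) by (simp add: \<Theta>_def A_def)
    then show ?thesis using UV(3,5) by (simp add: B_def)
  qed
  ultimately obtain d where d: "d > 0" "ball x0 d \<subseteq> B" using open_contains_ball by blast
  define \<eta> where "\<eta> y = l (G (A y) - y)" for y
  show thesis
  proof (rule that[of d \<eta>])
    show "d > 0" "ball x0 d \<subseteq> U" using d UV(2) by (auto simp: B_def)
    have AV: "A y \<in> V" if "y \<in> ball x0 d" for y using d that by (auto simp: B_def)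
    have "C_on m (ball x0 d) \<eta>" for m
    proof -
      have 1: "C_on m (ball x0 d) (\<lambda>y. G (A y))"
        by (rule C_on_compose[OF open_ball UV(4) _ smooth_onD[OF G_smooth] A_C[OF open_ball]]) (use AV in auto)
      have 2: "C_on m (ball x0 d) (\<lambda>y. G (A y) + (- y))"
        by (rule C_on_add[OF open_ball 1 C_on_bounded_linear[OF bounded_linear_minus[OF bounded_linear_ident]]])
      have "C_on m (ball x0 d) (\<lambda>y. l (G (A y) + (- y)))"
        by (rule C_on_compose[OF open_ball open_UNIV subset_UNIV C_on_bounded_linear[OF l_lin] 2])
      then show ?thesis by (simp add: \<eta>_def[abs_def])
    qed
    then show "smooth_on (ball x0 d) \<eta>" by (simp add: smooth_on_def)
    show "y + \<eta> y *\<^sub>R \<nu> \<in> U \<and> g (y + \<eta> y *\<^sub>R \<nu>) = 0" if y: "y \<in> ball x0 d" for y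
    proof -
      let ?r = "G (A y)"
      have "\<Theta> ?r = A y" by (rule homeomorphism_apply2[OF UV(6) AV[OF y]])
      then have eq: "?r + (g ?r - l (?r - x0)) *\<^sub>R \<nu> = y - l (y - x0) *\<^sub>R \<nu>" by (simp add: \<Theta>_def A_def)
      from arg_cong[OF this, of l] have "g ?r = 0" by (simp add: l_simps)
      moreover from this eq have "?r = y + \<eta> y *\<^sub>R \<nu>" by (simp add: \<eta>_def l_simps algebra_simps)
      ultimately show ?thesis using GU[OF AV[OF y]] by metis
    qed
    show "\<eta> y = 0" if "y \<in> ball x0 d" "g y = 0" for y
    proof -
      have "\<Theta> y = A y" using that(2) by (simp add: \<Theta>_def A_def)
      moreover have "y \<in> U'" using that(1) d(2) by (auto simp: B_def)
      then have "G (\<Theta> y) = y" by (rule homeomorphism_apply1[OF UV(6)])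
      ultimately show ?thesis using linear_0[OF bounded_linear.linear[OF l_lin]] by (simp add: \<eta>_def)
    qed
  qed
qed

section \<open>Functions on a hypersurface and their tangential derivatives\<close>

lemma smooth_alongE:
  assumes "smooth_along M f" "x \<in> M"
  obtains U g where "open U" "x \<in> U" "smooth_on U g" "!!y. y \<in> M ==> y \<in> U ==> g y = f y"
  using assms(1)[unfolded smooth_along_def, rule_format, OF assms(2)] by (elim exE conjE) simp

lemma smooth_alongI:
  assumes "!!x. x \<in> M ==> \<exists>U g. open U \<and> x \<in> U \<and> smooth_on U g \<and> (\<forall>y\<in>M \<inter> U. g y = f y)"
  shows "smooth_along M f"
  using assms unfolding smooth_along_def by simp

lemma smooth_along_cong_subset:
  assumes f: "smooth_along M f" and A: "A \<subseteq> M" and eq: "!!x. x \<in> A ==> f x = g x"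
  shows "smooth_along A g"
proof (rule smooth_alongI)
  fix x assume x: "x \<in> A"
  obtain U h where U: "open U" "x \<in> U" "smooth_on U h" "!!y. y \<in> M ==> y \<in> U ==> h y = f y"
    using smooth_alongE[OF f subsetD[OF A x]] by metis
  show "\<exists>U h. open U \<and> x \<in> U \<and> smooth_on U h \<and> (\<forall>y\<in>A \<inter> U. h y = g y)"
    by (rule exI[of _ U], rule exI[of _ h]) (use U A eq in auto)
qed

lemmas smooth_along_subset = smooth_along_cong_subset[OF _ _ refl]
lemmas smooth_along_cong = smooth_along_cong_subset[OF _ subset_refl]

lemma smooth_along_local:
  assumes "!!x. x \<in> M ==> \<exists>U. open U \<and> x \<in> U \<and> smooth_along (M \<inter> U) f"
  shows "smooth_along M f"
proof (rule smooth_alongI)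
  fix x assume x: "x \<in> M"
  obtain U where U: "open U" "x \<in> U" "smooth_along (M \<inter> U) f" using assms[OF x] by blast
  obtain V g where V: "open V" "x \<in> V" "smooth_on V g" "!!y. y \<in> M \<inter> U ==> y \<in> V ==> g y = f y"
    using smooth_alongE[OF U(3), of x] U(2) x by (metis IntI)
  show "\<exists>U g. open U \<and> x \<in> U \<and> smooth_on U g \<and> (\<forall>y\<in>M \<inter> U. g y = f y)"
    by (intro exI[of _ "U \<inter> V"] exI[of _ g] conjI ballI open_Int U V(1) smooth_on_subset[OF V(3)])
      (use U V in auto)
qed

lemma smooth_along_smooth_on: "open U ==> M \<subseteq> U ==> smooth_on U f ==> smooth_along M f"
  by (rule smooth_alongI, rule exI[of _ U], rule exI[of _ f]) auto

lemma smooth_along_const: "smooth_along M (\<lambda>x. c)"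
  by (rule smooth_along_smooth_on[of UNIV]) (auto simp: smooth_on_def C_on_const)

lemma smooth_along_ident: "smooth_along M (\<lambda>x. x)"
  by (rule smooth_along_smooth_on[of UNIV]) (auto simp: smooth_on_def C_on_bounded_linear bounded_linear_ident)

lemma smooth_along_lift1:
  fixes M :: "'a::euclidean_space set"
  assumes P: "!!(A :: 'a set) h. open A ==> h ` A \<subseteq> B ==> smooth_on A h ==> smooth_on A (\<lambda>x. P (h x))"
    and B: "open B" "f ` M \<subseteq> B" and f: "smooth_along M f"
  shows "smooth_along M (\<lambda>x. P (f x))"
proof (rule smooth_alongI)
  fix x assume x: "x \<in> M"
  obtain U g where U: "open U" "x \<in> U" "smooth_on U g" "!!y. y \<in> M ==> y \<in> U ==> g y = f y"
    using smooth_alongE[OF f x] by metis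
  define A where "A = U \<inter> g -` B"
  have A: "open A" unfolding A_def
    using continuous_open_preimage[OF smooth_on_continuous[OF U(3)] U(1) B(1)] .
  have xA: "x \<in> A" using U x B(2) by (auto simp: A_def)
  have "smooth_on A g" by (rule smooth_on_subset[OF U(3)]) (auto simp: A_def)
  then have "smooth_on A (\<lambda>x. P (g x))"
    by (rule P[OF A, rotated]) (auto simp: A_def)
  then show "\<exists>U h. open U \<and> x \<in> U \<and> smooth_on U h \<and> (\<forall>y\<in>M \<inter> U. h y = P (f y))"
    by (intro exI[of _ A] exI[of _ "\<lambda>x. P (g x)"] conjI ballI A xA) (use U(4) in \<open>auto simp: A_def\<close>)
qed

lemma smooth_along_lift2:
  fixes M :: "'a::euclidean_space set"
  assumes P: "!!(A :: 'a set) f g. open A ==> smooth_on A f ==> smooth_on A g ==> smooth_on A (\<lambda>x. P (f x) (g x))"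
    and f: "smooth_along M f" and g: "smooth_along M g"
  shows "smooth_along M (\<lambda>x. P (f x) (g x))"
proof (rule smooth_alongI)
  fix x assume x: "x \<in> M"
  obtain U f' where U: "open U" "x \<in> U" "smooth_on U f'" "!!y. y \<in> M ==> y \<in> U ==> f' y = f y"
    using smooth_alongE[OF f x] by metis
  obtain V g' where V: "open V" "x \<in> V" "smooth_on V g'" "!!y. y \<in> M ==> y \<in> V ==> g' y = g y"
    using smooth_alongE[OF g x] by metis
  have "smooth_on (U \<inter> V) (\<lambda>x. P (f' x) (g' x))"
  proof (rule P)
    show "open (U \<inter> V)" using U V by blast
    show "smooth_on (U \<inter> V) f'" by (rule smooth_on_subset[OF U(3)]) auto
    show "smooth_on (U \<inter> V) g'" by (rule smooth_on_subset[OF V(3)]) auto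
  qed
  then show "\<exists>U h. open U \<and> x \<in> U \<and> smooth_on U h \<and> (\<forall>y\<in>M \<inter> U. h y = P (f y) (g y))"
    by (intro exI[of _ "U \<inter> V"] exI[of _ "\<lambda>x. P (f' x) (g' x)"] conjI ballI open_Int U V)
      (use U V in auto)
qed

lemma smooth_on_bilinear:
  "bounded_bilinear P ==> open A ==> smooth_on A f ==> smooth_on A g ==> smooth_on A (\<lambda>x. P (f x) (g x))"
  using bounded_bilinear.C_on_bilinear[of P A _ f g] by (simp add: smooth_on_def)

lemma smooth_on_add:
  "open A ==> smooth_on A f ==> smooth_on A g ==> smooth_on A (\<lambda>x. f x + g x)"
  using C_on_add[of A _ f g] by (simp add: smooth_on_def)

lemma smooth_along_add: "smooth_along (M :: 'a::euclidean_space set) f ==> smooth_along M g ==> smooth_along M (\<lambda>x. f x + g x)"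
  by (rule smooth_along_lift2[of "(+)"]) (auto intro: smooth_on_add)

lemma smooth_along_scaleR: "smooth_along (M :: 'a::euclidean_space set) f ==> smooth_along M g ==> smooth_along M (\<lambda>x. f x *\<^sub>R g x)"
  by (rule smooth_along_lift2[of "(*\<^sub>R)"]) (auto intro: smooth_on_bilinear[OF bounded_bilinear_scaleR])

lemma smooth_along_mult:
  fixes f g :: "'a::euclidean_space => real"
  shows "smooth_along M f ==> smooth_along M g ==> smooth_along M (\<lambda>x. f x * g x)"
  by (rule smooth_along_lift2[of "(*)"]) (auto intro: smooth_on_bilinear[OF bounded_bilinear_mult])

lemma smooth_along_inner: "smooth_along (M :: 'a::euclidean_space set) f ==> smooth_along M g ==> smooth_along M (\<lambda>x. f x \<bullet> g x)"
  by (rule smooth_along_lift2[of "(\<bullet>)"]) (auto intro: smooth_on_bilinear[OF bounded_bilinear_inner])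

lemma smooth_along_uminus: "smooth_along (M :: 'a::euclidean_space set) f ==> smooth_along M (\<lambda>x. - f x)"
  using smooth_along_scaleR[OF smooth_along_const[of M "-1"], of f] by simp

lemma smooth_along_diff: "smooth_along (M :: 'a::euclidean_space set) f ==> smooth_along M g ==> smooth_along M (\<lambda>x. f x - g x)"
  using smooth_along_add[OF _ smooth_along_uminus, of M f g] by simp

lemma smooth_along_sum: "(!!i. i \<in> I ==> smooth_along (M :: 'a::euclidean_space set) (f i)) ==> smooth_along M (\<lambda>x. \<Sum>i\<in>I. f i x)"
  by (induction I rule: infinite_finite_induct) (auto intro: smooth_along_add smooth_along_const)

lemma smooth_along_inverse:
  fixes f :: "'a::euclidean_space => real"
  shows "smooth_along M f ==> (!!x. x \<in> M ==> f x ~= 0) ==> smooth_along M (\<lambda>x. inverse (f x))"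
  by (rule smooth_along_lift1[of "-{0}" inverse]) (auto simp: smooth_on_def intro!: C_on_inverse)

lemma smooth_along_divide:
  fixes f g :: "'a::euclidean_space => real"
  shows "smooth_along M f ==> smooth_along M g ==> (!!x. x \<in> M ==> g x ~= 0) ==> smooth_along M (\<lambda>x. f x / g x)"
  unfolding divide_inverse by (intro smooth_along_mult smooth_along_inverse)

lemma smooth_along_sqrt:
  fixes f :: "'a::euclidean_space => real"
  shows "smooth_along M f ==> (!!x. x \<in> M ==> f x > 0) ==> smooth_along M (\<lambda>x. sqrt (f x))"
  by (rule smooth_along_lift1[of "{0<..}" sqrt]) (auto simp: smooth_on_def intro!: C_on_sqrt)

definition tder :: "'a::euclidean_space set => ('a => 'b::real_normed_vector) => 'a => 'a => 'b" where
  "tder M f x v = frechet_derivative f (at x within M) v"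

lemma smooth_along_has_tder:
  assumes "smooth_along M f" "x \<in> M"
  shows "(f has_derivative tder M f x) (at x within M)"
proof -
  obtain U g where U: "open U" "x \<in> U" "smooth_on U g" "!!y. y \<in> M ==> y \<in> U ==> g y = f y"
    using smooth_alongE[OF assms] by metis
  have g: "(g has_derivative frechet_derivative g (at x)) (at x within M)"
    by (rule has_derivative_at_withinI[OF smooth_on_has_derivative[OF U(3,2)]])
  obtain d where d: "d > 0" "ball x d \<subseteq> U" using U(1,2) open_contains_ball by metis
  have "(f has_derivative frechet_derivative g (at x)) (at x within M)"
    by (rule has_derivative_transform_within[OF g d(1) assms(2)]) (use U(4) d(2) in \<open>auto simp: dist_commute subset_iff\<close>)
  then have "f differentiable (at x within M)" by (auto simp: differentiable_def)
  then show ?thesis unfolding tder_def[abs_def] by (simp add: frechet_derivative_works)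
qed

lemma smooth_along_continuous_on: "smooth_along (M :: 'a::euclidean_space set) f ==> continuous_on M f"
  by (rule has_derivative_continuous_on[OF smooth_along_has_tder])

lemma tder_linear: "smooth_along M f ==> x \<in> M ==> linear (tder M f x)"
  using smooth_along_has_tder has_derivative_linear by blast

lemma tder_cong:
  assumes "x \<in> M" "!!y. y \<in> M ==> f y = g y"
  shows "tder M f x = tder M g x"
proof -
  have "(f has_derivative F) (at x within M) = (g has_derivative F) (at x within M)" for F
    using has_derivative_transform[OF assms(1), of f g F] has_derivative_transform[OF assms(1), of g f F]
      assms(2) by metis
  then show ?thesis unfolding tder_def[abs_def] frechet_derivative_def by simp
qed

lemma tder_Int_open:
  assumes "open U" "x \<in> U"
  shows "tder (M \<inter> U) f x = tder M f x"
proof -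
  have "at x within (M \<inter> U) = at x within M" by (rule at_within_nhd[OF assms(2,1)]) auto
  then show ?thesis unfolding tder_def[abs_def] by simp
qed

text \<open>A tangent vector is the velocity of a curve in \<open>M\<close>, so it determines the derivative along it.\<close>

lemma derivative_unique_on_tangent:
  assumes v: "v \<in> tangent_space M x" and f: "(f has_derivative F) (at x within M)" "(f has_derivative G) (at x within M)"
  shows "F v = G v"
proof -
  obtain \<gamma> \<epsilon> where g: "\<epsilon> > 0" "\<gamma> ` {-\<epsilon><..<\<epsilon>} \<subseteq> M" "\<gamma> 0 = x" "(\<gamma> has_vector_derivative v) (at (0::real))"
    using v unfolding tangent_space_def by blast
  have d: "(\<gamma> has_derivative (\<lambda>h. h *\<^sub>R v)) (at 0 within {-\<epsilon><..<\<epsilon>})"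
    using g(4) unfolding has_vector_derivative_def by (rule has_derivative_at_withinI)
  have *: "((\<lambda>t. f (\<gamma> t)) has_derivative (\<lambda>h. H (h *\<^sub>R v))) (at 0)" if "(f has_derivative H) (at x within M)" for H
  proof -
    have "((\<lambda>t. f (\<gamma> t)) has_derivative (\<lambda>h. H (h *\<^sub>R v))) (at 0 within {-\<epsilon><..<\<epsilon>})"
      by (rule has_derivative_in_compose[OF d]) (use has_derivative_subset[OF that g(2)] g(3) in simp)
    then show ?thesis using g(1) at_within_open[of 0 "{-\<epsilon><..<\<epsilon>}"] by simp
  qed
  have "(\<lambda>h. F (h *\<^sub>R v)) = (\<lambda>h. G (h *\<^sub>R v))"
    by (rule has_derivative_unique[OF *[OF f(1)] *[OF f(2)]])
  from fun_cong[OF this, of 1] show ?thesis by simp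
qed

lemma tder_eqI:
  assumes "v \<in> tangent_space M x" "(f has_derivative F) (at x within M)"
  shows "tder M f x v = F v"
proof -
  have "f differentiable (at x within M)" using assms(2) by (auto simp: differentiable_def)
  then have "(f has_derivative tder M f x) (at x within M)"
    unfolding tder_def[abs_def] by (simp add: frechet_derivative_works)
  then show ?thesis using derivative_unique_on_tangent[OF assms(1) _ assms(2)] by blast
qed

lemma tder_extension:
  assumes "x \<in> M" "v \<in> tangent_space M x" "open U" "x \<in> U" "smooth_on U g" "!!y. y \<in> M ==> y \<in> U ==> g y = f y"
  shows "tder M f x v = frechet_derivative g (at x) v"
proof -
  have 1: "tder (M \<inter> U) f x = tder (M \<inter> U) g x"
    by (rule tder_cong) (use assms in auto)
  have "tder M f x v = tder M g x v"
    using 1 tder_Int_open[OF assms(3,4), of M f] tder_Int_open[OF assms(3,4), of M g] by simp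
  also have "\<dots> = frechet_derivative g (at x) v"
    by (rule tder_eqI[OF assms(2) has_derivative_at_withinI[OF smooth_on_has_derivative[OF assms(5,4)]]])
  finally show ?thesis .
qed

context
  fixes M :: "'a::euclidean_space set" and x v
  assumes x: "x \<in> M" and v: "v \<in> tangent_space M x"
begin

lemma tder_const: "tder M (\<lambda>y. c) x v = 0"
  by (rule tder_eqI[OF v, of _ "\<lambda>h. 0"]) auto

lemma tder_ident: "tder M (\<lambda>y. y) x v = v"
  by (rule tder_eqI[OF v, of _ "\<lambda>h. h"]) auto

lemma tder_add:
  "smooth_along M f ==> smooth_along M g ==> tder M (\<lambda>y. f y + g y) x v = tder M f x v + tder M g x v"
  by (rule tder_eqI[OF v has_derivative_add[OF smooth_along_has_tder[OF _ x] smooth_along_has_tder[OF _ x]]])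

lemma tder_diff:
  "smooth_along M f ==> smooth_along M g ==> tder M (\<lambda>y. f y - g y) x v = tder M f x v - tder M g x v"
  by (rule tder_eqI[OF v has_derivative_diff[OF smooth_along_has_tder[OF _ x] smooth_along_has_tder[OF _ x]]])

lemma tder_uminus: "smooth_along M f ==> tder M (\<lambda>y. - f y) x v = - tder M f x v"
  by (rule tder_eqI[OF v has_derivative_minus[OF smooth_along_has_tder[OF _ x]]])

lemma tder_scaleR:
  "smooth_along M f ==> smooth_along M g ==>
   tder M (\<lambda>y. f y *\<^sub>R g y) x v = f x *\<^sub>R tder M g x v + tder M f x v *\<^sub>R g x"
  by (rule tder_eqI[OF v has_derivative_scaleR[OF smooth_along_has_tder[OF _ x] smooth_along_has_tder[OF _ x]]])

lemma tder_mult: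
  fixes f g :: "'a => real"
  shows "smooth_along M f ==> smooth_along M g ==>
   tder M (\<lambda>y. f y * g y) x v = f x * tder M g x v + tder M f x v * g x"
  by (rule tder_eqI[OF v has_derivative_mult[OF smooth_along_has_tder[OF _ x] smooth_along_has_tder[OF _ x]]])

lemma tder_inner:
  "smooth_along M f ==> smooth_along M g ==>
   tder M (\<lambda>y. f y \<bullet> g y) x v = f x \<bullet> tder M g x v + tder M f x v \<bullet> g x"
  by (rule tder_eqI[OF v has_derivative_inner[OF smooth_along_has_tder[OF _ x] smooth_along_has_tder[OF _ x]]])

lemma tder_inverse:
  fixes f :: "'a => real"
  shows "smooth_along M f ==> f x ~= 0 ==> tder M (\<lambda>y. inverse (f y)) x v = - (tder M f x v / (f x)\<^sup>2)"
  by (subst tder_eqI[OF v Deriv.has_derivative_inverse[OF _ smooth_along_has_tder[OF _ x]]])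
    (simp_all add: field_simps power2_eq_square)

lemma tder_sqrt:
  fixes f :: "'a => real"
  shows "smooth_along M f ==> f x > 0 ==> tder M (\<lambda>y. sqrt (f y)) x v = tder M f x v / (2 * sqrt (f x))"
  by (subst tder_eqI[OF v has_derivative_real_sqrt[OF _ smooth_along_has_tder[OF _ x]]])
    (simp_all add: field_simps)

end

lemma derivative_bound_on_compact:
  fixes f :: "'a::euclidean_space => 'b::real_normed_vector"
  assumes f: "smooth_on U f" and K: "compact K" "K \<subseteq> U"
  obtains B where "B >= 0" "!!z v. z \<in> K ==> norm (frechet_derivative f (at z) v) <= B * norm v"
proof -
  have "\<exists>C. \<forall>z\<in>K. norm (frechet_derivative f (at z) b) <= C" for b
  proof -
    have "continuous_on K (\<lambda>z. frechet_derivative f (at z) b)"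
      by (rule continuous_on_subset[OF smooth_on_continuous[OF smooth_on_derivative[OF f]] K(2)])
    from compact_imp_bounded[OF compact_continuous_image[OF this K(1)]]
    show ?thesis by (simp add: bounded_iff)
  qed
  then obtain C where C: "!!b z. z \<in> K ==> norm (frechet_derivative f (at z) b) <= C b" by metis
  define B where "B = (\<Sum>b\<in>Basis. \<bar>C (b::'a)\<bar>)"
  have "norm (frechet_derivative f (at z) v) <= B * norm v" if z: "z \<in> K" for z v
  proof -
    have lin: "linear (frechet_derivative f (at z))"
      using has_derivative_linear[OF smooth_on_has_derivative[OF f, of z]] z K(2) by auto
    have "frechet_derivative f (at z) v = frechet_derivative f (at z) (\<Sum>b\<in>Basis. (v \<bullet> b) *\<^sub>R b)"
      by (simp add: euclidean_representation)
    also have "\<dots> = (\<Sum>b\<in>Basis. (v \<bullet> b) *\<^sub>R frechet_derivative f (at z) b)"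
      by (simp only: linear_sum[OF lin] linear_scale[OF lin])
    finally have "norm (frechet_derivative f (at z) v) <= (\<Sum>b\<in>Basis. norm ((v \<bullet> b) *\<^sub>R frechet_derivative f (at z) b))"
      by (simp only: norm_sum)
    also have "\<dots> <= (\<Sum>b\<in>Basis. \<bar>C b\<bar> * norm v)"
    proof (rule sum_mono)
      fix b :: 'a assume b: "b \<in> Basis"
      have "\<bar>v \<bullet> b\<bar> * norm (frechet_derivative f (at z) b) <= norm v * \<bar>C b\<bar>"
        using Basis_le_norm[OF b, of v] C[OF z, of b] by (intro mult_mono) auto
      then show "norm ((v \<bullet> b) *\<^sub>R frechet_derivative f (at z) b) <= \<bar>C b\<bar> * norm v"
        by (simp add: mult.commute)
    qed
    also have "\<dots> = B * norm v" by (simp add: B_def sum_distrib_right)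
    finally show ?thesis .
  qed
  moreover have "B >= 0" by (simp add: B_def sum_nonneg)
  ultimately show thesis by (rule that[rotated])
qed

lemma frechet_derivative_expand:
  fixes f :: "'a::euclidean_space => 'b::real_normed_vector"
  assumes "smooth_on U f" "z \<in> U"
  shows "frechet_derivative f (at z) v = (\<Sum>b\<in>Basis. (v \<bullet> b) *\<^sub>R frechet_derivative f (at z) b)"
proof -
  have lin: "linear (frechet_derivative f (at z))"
    using has_derivative_linear[OF smooth_on_has_derivative[OF assms]] .
  have "frechet_derivative f (at z) v = frechet_derivative f (at z) (\<Sum>b\<in>Basis. (v \<bullet> b) *\<^sub>R b)"
    by (simp add: euclidean_representation)
  also have "\<dots> = (\<Sum>b\<in>Basis. (v \<bullet> b) *\<^sub>R frechet_derivative f (at z) b)"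
    by (simp only: linear_sum[OF lin] linear_scale[OF lin])
  finally show ?thesis .
qed

lemma smooth_on_sum: "open A ==> (!!i. i \<in> I ==> smooth_on A (f i)) ==> smooth_on A (\<lambda>x. \<Sum>i\<in>I. f i x)"
  unfolding smooth_on_def using C_on_sum[of A I _ f] by simp

lemma smooth_on_const: "smooth_on A (\<lambda>x. c)"
  by (simp add: smooth_on_def C_on_const)

lemma smooth_on_cong: "open A ==> smooth_on A f ==> (!!x. x \<in> A ==> f x = g x) ==> smooth_on A g"
  unfolding smooth_on_def using C_on_cong[of A f g] by simp

lemma smooth_on_compose:
  fixes f :: "'b::euclidean_space => 'c::real_normed_vector" and g :: "'a::real_normed_vector => 'b"
  shows "open A ==> open B ==> g ` A \<subseteq> B ==> smooth_on B f ==> smooth_on A g ==> smooth_on A (\<lambda>x. f (g x))"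
  unfolding smooth_on_def using C_on_compose[of A B g _ f] by simp

lemma smooth_on_derivative_along:
  fixes g :: "'a::euclidean_space => 'b::real_normed_vector"
  assumes A: "open A" and g: "smooth_on A g" and Z: "smooth_on A Z"
  shows "smooth_on A (\<lambda>y. frechet_derivative g (at y) (Z y))"
proof (rule smooth_on_cong[OF A])
  show "smooth_on A (\<lambda>y. \<Sum>b\<in>Basis. (Z y \<bullet> b) *\<^sub>R frechet_derivative g (at y) b)"
    by (rule smooth_on_sum[OF A], rule smooth_on_bilinear[OF bounded_bilinear_scaleR A],
        rule smooth_on_bilinear[OF bounded_bilinear_inner A Z smooth_on_const],
        rule smooth_on_derivative[OF g])
qed (rule frechet_derivative_expand[OF g, symmetric])

lemma derivative_of_derivative_along:
  fixes g :: "'a::euclidean_space => 'b::real_normed_vector"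
  assumes A: "open A" "x \<in> A" and g: "smooth_on A g" and Z: "smooth_on A Z"
  shows "frechet_derivative (\<lambda>y. frechet_derivative g (at y) (Z y)) (at x) v =
    frechet_derivative (\<lambda>y. frechet_derivative g (at y) (Z x)) (at x) v
    + frechet_derivative g (at x) (frechet_derivative Z (at x) v)"
proof -
  let ?dg = "\<lambda>b y. frechet_derivative g (at y) b"
  let ?Z' = "frechet_derivative Z (at x)"
  have dZ: "(Z has_derivative ?Z') (at x)" by (rule smooth_on_has_derivative[OF Z A(2)])
  have ddg: "(?dg b has_derivative frechet_derivative (?dg b) (at x)) (at x)" for b
    by (rule smooth_on_has_derivative[OF smooth_on_derivative[OF g] A(2)])
  have "((\<lambda>y. \<Sum>b\<in>Basis. (Z y \<bullet> b) *\<^sub>R ?dg b y) has_derivative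
      (\<lambda>v. \<Sum>b\<in>Basis. (Z x \<bullet> b) *\<^sub>R frechet_derivative (?dg b) (at x) v + (?Z' v \<bullet> b) *\<^sub>R ?dg b x)) (at x)"
    by (intro has_derivative_sum has_derivative_scaleR has_derivative_inner_left dZ ddg)
  then have 1: "((\<lambda>y. ?dg (Z y) y) has_derivative
      (\<lambda>v. \<Sum>b\<in>Basis. (Z x \<bullet> b) *\<^sub>R frechet_derivative (?dg b) (at x) v + (?Z' v \<bullet> b) *\<^sub>R ?dg b x)) (at x)"
    by (rule has_derivative_transform_within_open[OF _ A]) (rule frechet_derivative_expand[OF g, symmetric])
  have "((\<lambda>y. \<Sum>b\<in>Basis. (Z x \<bullet> b) *\<^sub>R ?dg b y) has_derivative
      (\<lambda>v. \<Sum>b\<in>Basis. (Z x \<bullet> b) *\<^sub>R frechet_derivative (?dg b) (at x) v)) (at x)"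
    by (intro has_derivative_sum has_derivative_scaleR_right ddg)
  then have 2: "(?dg (Z x) has_derivative
      (\<lambda>v. \<Sum>b\<in>Basis. (Z x \<bullet> b) *\<^sub>R frechet_derivative (?dg b) (at x) v)) (at x)"
    by (rule has_derivative_transform_within_open[OF _ A]) (rule frechet_derivative_expand[OF g, symmetric])
  show ?thesis
    unfolding frechet_derivative_eqI[OF 1] frechet_derivative_eqI[OF 2]
    by (simp only: sum.distrib frechet_derivative_expand[OF g A(2), symmetric])
qed

locale hypersurface =
  fixes M :: "'a::euclidean_space set" and N :: "'a => 'a"
  assumes oriented: "oriented_hypersurface M N"
begin

lemma N_smooth: "smooth_along M N"
  using oriented by (simp add: oriented_hypersurface_def)

lemma N_norm: "x \<in> M ==> norm (N x) = 1"
  using oriented by (simp add: oriented_hypersurface_def)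

lemma N_unit: "x \<in> M ==> N x \<bullet> N x = 1"
  using N_norm by (simp add: norm_eq_1)

lemma N_perp: "x \<in> M ==> v \<in> tangent_space M x ==> N x \<bullet> v = 0"
  using oriented by (simp add: oriented_hypersurface_def)

lemma local_equation:
  assumes x: "x \<in> M"
  obtains U and g :: "'a => real" and a where "open U" "x \<in> U" "smooth_on U g" "M \<inter> U = {y \<in> U. g y = 0}"
    "a ~= 0" "!!v. frechet_derivative g (at x) v = a * (N x \<bullet> v)"
    "tangent_space M x = {v. N x \<bullet> v = 0}"
proof -
  obtain U and g :: "'a => real" where U: "open U" "x \<in> U" and g: "smooth_on U g"
    and reg: "frechet_derivative g (at x) ~= (\<lambda>v. 0)" and MU: "M \<inter> U = {y \<in> U. g y = 0}"
    using oriented[unfolded oriented_hypersurface_def smooth_hypersurface_def, THEN conjunct1, rule_format, OF x]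
    by (elim exE conjE) simp
  define G where "G = frechet_derivative g (at x)"
  have dG: "(g has_derivative G) (at x)" unfolding G_def by (rule smooth_on_has_derivative[OF g U(2)])
  have linG: "linear G" using dG by (rule has_derivative_linear)
  define w where "w = adjoint G 1"
  have Gw: "G v = w \<bullet> v" for v
    using adjoint_works[OF linG, of v 1] by (simp add: w_def inner_commute)
  have w0: "w ~= 0"
  proof
    assume "w = 0"
    then have "G = (\<lambda>v. 0)" using Gw by auto
    then show False using reg by (simp add: G_def)
  qed
  have gx: "g x = 0" using MU x U(2) by auto
  have sub: "v \<in> tangent_space M x" if v: "w \<bullet> v = 0" for v
  proof -
    have ne: "frechet_derivative g (at x) w ~= 0" using Gw[of w] w0 by (simp add: G_def)
    obtain d \<eta> where d: "d > 0" "ball x d \<subseteq> U" and eta: "smooth_on (ball x d) \<eta>"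
      "!!y. y \<in> ball x d ==> y + \<eta> y *\<^sub>R w \<in> U \<and> g (y + \<eta> y *\<^sub>R w) = 0"
      "!!y. y \<in> ball x d ==> g y = 0 ==> \<eta> y = 0"
      by (rule level_set_retraction[OF U g gx ne]) simp
    define \<epsilon> where "\<epsilon> = d / (norm v + 1)"
    have n: "norm v + 1 > 0" by (simp add: add_nonneg_pos)
    have eps: "\<epsilon> > 0" using d(1) n by (simp add: \<epsilon>_def)
    define l where "l t = x + t *\<^sub>R v" for t :: real
    have lb: "l t \<in> ball x d" if "t \<in> {-\<epsilon><..<\<epsilon>}" for t
    proof -
      have "\<bar>t\<bar> * norm v <= \<bar>t\<bar> * (norm v + 1)" by (simp add: mult_left_mono)
      also have "\<dots> < \<epsilon> * (norm v + 1)" using that n by (intro mult_strict_right_mono) auto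
      also have "\<dots> = d" using n by (simp add: \<epsilon>_def)
      finally show ?thesis by (simp add: l_def dist_norm)
    qed
    define \<gamma> where "\<gamma> t = l t + \<eta> (l t) *\<^sub>R w" for t
    have l_smooth: "smooth_on S l" if "open S" for S
    proof -
      have "smooth_on S (\<lambda>t. t *\<^sub>R v)"
        by (simp add: smooth_on_def C_on_bounded_linear bounded_linear_scaleR_left)
      from smooth_on_add[OF that smooth_on_const[of S x] this] show ?thesis by (simp add: l_def[abs_def])
    qed
    have g_smooth: "smooth_on {-\<epsilon><..<\<epsilon>} \<gamma>"
    proof -
      have "smooth_on {-\<epsilon><..<\<epsilon>} (\<lambda>t. \<eta> (l t))"
        by (rule smooth_on_compose[OF _ open_ball _ eta(1) l_smooth]) (use lb in auto)
      from smooth_on_add[OF _ l_smooth smooth_on_bilinear[OF bounded_bilinear_scaleR _ this smooth_on_const[of _ w]]]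
      show ?thesis by (simp add: \<gamma>_def[abs_def])
    qed
    have gM: "\<gamma> t \<in> M" if "t \<in> {-\<epsilon><..<\<epsilon>}" for t
      using eta(2)[OF lb[OF that]] MU unfolding \<gamma>_def by blast
    have eta0: "\<eta> x = 0" using eta(3)[of x] d(1) gx by simp
    have dl: "(l has_derivative (\<lambda>h. h *\<^sub>R v)) (at 0)" unfolding l_def by (auto intro!: derivative_eq_intros)
    have de: "(\<eta> has_derivative frechet_derivative \<eta> (at x)) (at x)"
      by (rule smooth_on_has_derivative[OF eta(1)]) (use d(1) in simp)
    have l0: "l 0 = x" by (simp add: l_def)
    have "((\<lambda>t. \<eta> (l t)) has_derivative (\<lambda>h. frechet_derivative \<eta> (at x) (h *\<^sub>R v))) (at 0)"
      by (rule has_derivative_compose[OF dl]) (use de l0 in simp)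
    from has_derivative_add[OF dl has_derivative_scaleR_left[OF this, of w]]
    have dg: "(\<gamma> has_derivative (\<lambda>h. h *\<^sub>R v + frechet_derivative \<eta> (at x) (h *\<^sub>R v) *\<^sub>R w)) (at 0)"
      by (simp add: \<gamma>_def[abs_def])
    have g0: "\<gamma> 0 = x" by (simp add: \<gamma>_def l0 eta0)
    have "((\<lambda>t. g (\<gamma> t)) has_derivative (\<lambda>h. G (h *\<^sub>R v + frechet_derivative \<eta> (at x) (h *\<^sub>R v) *\<^sub>R w))) (at 0)"
      by (rule has_derivative_compose[OF dg]) (use dG g0 in simp)
    moreover have "((\<lambda>t. g (\<gamma> t)) has_derivative (\<lambda>h. 0)) (at 0)"
    proof (rule has_derivative_transform_within_open[of "\<lambda>t. 0" _ _ _ "{-\<epsilon><..<\<epsilon>}"])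
      show "0 = g (\<gamma> t)" if "t \<in> {-\<epsilon><..<\<epsilon>}" for t
        using eta(2)[OF lb[OF that]] unfolding \<gamma>_def by simp
    qed (use eps in auto)
    ultimately have "(\<lambda>h. G (h *\<^sub>R v + frechet_derivative \<eta> (at x) (h *\<^sub>R v) *\<^sub>R w)) = (\<lambda>h. 0)"
      by (rule has_derivative_unique)
    from fun_cong[OF this, of 1] have "frechet_derivative \<eta> (at x) v * (w \<bullet> w) = 0"
      using v by (simp add: Gw inner_right_distrib)
    then have 0: "frechet_derivative \<eta> (at x) v = 0" using w0 by simp
    have "frechet_derivative \<eta> (at x) (h *\<^sub>R v) = 0" for h
      using linear_scale[OF has_derivative_linear[OF de], of h v] 0 by simp
    then have "(\<gamma> has_vector_derivative v) (at 0)" using dg by (simp add: has_vector_derivative_def)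
    moreover have "\<gamma> ` {-\<epsilon><..<\<epsilon>} \<subseteq> M" using gM by (rule image_subsetI)
    ultimately show ?thesis unfolding tangent_space_def mem_Collect_eq using eps g_smooth g0
      by (intro exI[of _ \<gamma>] exI[of _ \<epsilon>] conjI)
  qed
  define c where "c = (N x \<bullet> w) / (w \<bullet> w)"
  define u where "u = N x - c *\<^sub>R w"
  have "w \<bullet> u = 0" using w0 by (simp add: u_def c_def inner_diff_right inner_commute)
  then have "N x \<bullet> u = 0" by (rule N_perp[OF x sub])
  have "u \<bullet> u = N x \<bullet> u - c * (w \<bullet> u)" by (subst (1) u_def) (simp add: inner_diff_left)
  also have "\<dots> = 0" by (simp only: \<open>N x \<bullet> u = 0\<close> \<open>w \<bullet> u = 0\<close>)
  finally have "u = 0" by simp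
  then have Nw: "N x = c *\<^sub>R w" by (simp add: u_def)
  have c0: "c ~= 0" using Nw N_unit[OF x] by auto
  show thesis
  proof (rule that[OF U g MU, of "1/c"])
    show "1 / c ~= 0" using c0 by simp
    show "frechet_derivative g (at x) v = 1 / c * (N x \<bullet> v)" for v
      using Gw[of v] c0 by (simp add: G_def Nw)
    show "tangent_space M x = {v. N x \<bullet> v = 0}"
    proof (intro subset_antisym subsetI CollectI)
      show "N x \<bullet> v = 0" if "v \<in> tangent_space M x" for v by (rule N_perp[OF x that])
      show "v \<in> tangent_space M x" if "v \<in> {v. N x \<bullet> v = 0}" for v
        by (rule sub) (use that c0 in \<open>simp add: Nw\<close>)
    qed
  qed
qed

lemma tangent_iff: "x \<in> M ==> v \<in> tangent_space M x \<longleftrightarrow> N x \<bullet> v = 0"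
  by (rule local_equation[of x]) simp_all

text \<open>
  Moving along the fixed direction \<open>N x\<close> until \<open>M\<close> is met gives a smooth local retraction onto \<open>M\<close>,
  from the implicit function theorem for a local equation of \<open>M\<close>.
\<close>

lemma retraction:
  assumes x: "x \<in> M"
  obtains d \<eta> where "d > 0" "smooth_on (ball x d) \<eta>"
    "!!y. y \<in> ball x d ==> y + \<eta> y *\<^sub>R N x \<in> M" "!!y. y \<in> ball x d ==> y \<in> M ==> \<eta> y = 0"
proof -
  obtain U and g :: "'a => real" and a where U: "open U" "x \<in> U" and g: "smooth_on U g" and MU: "M \<inter> U = {y \<in> U. g y = 0}"
    and a: "a ~= 0" "!!v. frechet_derivative g (at x) v = a * (N x \<bullet> v)"
    and "tangent_space M x = {v. N x \<bullet> v = 0}"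
    by (rule local_equation[OF x], rule that)
  have gx: "g x = 0" using MU x U(2) by auto
  have ne: "frechet_derivative g (at x) (N x) ~= 0" using a(1,2) N_unit[OF x] by simp
  obtain d \<eta> where d: "d > 0" "ball x d \<subseteq> U" and eta: "smooth_on (ball x d) \<eta>"
    "!!y. y \<in> ball x d ==> y + \<eta> y *\<^sub>R N x \<in> U \<and> g (y + \<eta> y *\<^sub>R N x) = 0"
    "!!y. y \<in> ball x d ==> g y = 0 ==> \<eta> y = 0"
    by (rule level_set_retraction[OF U g gx ne]) simp
  show thesis
  proof (rule that[OF d(1) eta(1)])
    show "y + \<eta> y *\<^sub>R N x \<in> M" if "y \<in> ball x d" for y using eta(2)[OF that] MU by blast
    show "\<eta> y = 0" if "y \<in> ball x d" "y \<in> M" for y using eta(3)[OF that(1)] MU that d(2) by blast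
  qed
qed

lemma velocity_tangent:
  assumes c: "(c has_vector_derivative w) (at t)" and S: "open S" "t \<in> S" "!!s. s \<in> S ==> c s \<in> M"
  shows "w \<in> tangent_space M (c t)"
proof -
  have x: "c t \<in> M" using S by simp
  obtain U and g :: "'a => real" and a where U: "open U" "c t \<in> U" and g: "smooth_on U g" and MU: "M \<inter> U = {y \<in> U. g y = 0}"
    and a: "a ~= 0" "!!v. frechet_derivative g (at (c t)) v = a * (N (c t) \<bullet> v)"
    and "tangent_space M (c t) = {v. N (c t) \<bullet> v = 0}"
    by (rule local_equation[OF x], rule that)
  have "isCont c t" using c by (rule has_vector_derivative_continuous)
  then obtain S' where S': "open S'" "t \<in> S'" "!!s. s \<in> S' ==> c s \<in> U"
    using U by (metis continuous_at_open)
  have "((\<lambda>s. g (c s)) has_derivative (\<lambda>h. frechet_derivative g (at (c t)) (h *\<^sub>R w))) (at t)"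
    by (rule has_derivative_compose[OF c[unfolded has_vector_derivative_def] smooth_on_has_derivative[OF g U(2)]])
  moreover have "((\<lambda>s. g (c s)) has_derivative (\<lambda>h. 0)) (at t)"
  proof (rule has_derivative_transform_within_open[of "\<lambda>t. 0" _ _ _ "S \<inter> S'"])
    show "0 = g (c s)" if "s \<in> S \<inter> S'" for s using that S(3) S'(3) MU by auto
  qed (use S S' in auto)
  ultimately have "(\<lambda>h. frechet_derivative g (at (c t)) (h *\<^sub>R w)) = (\<lambda>h. 0)" by (rule has_derivative_unique)
  from fun_cong[OF this, of 1] have "N (c t) \<bullet> w = 0" using a by simp
  then show ?thesis using tangent_iff[OF x] by simp
qed

lemma has_derivative_along_curve:
  assumes c: "(c has_vector_derivative w) (at t)" and S: "open S" "t \<in> S" "!!s. s \<in> S ==> c s \<in> M"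
    and f: "smooth_along M f"
  shows "((\<lambda>s. f (c s)) has_vector_derivative tder M f (c t) w) (at t)"
proof -
  have x: "c t \<in> M" using S by simp
  have "(c has_derivative (\<lambda>h. h *\<^sub>R w)) (at t within S)"
    using c unfolding has_vector_derivative_def by (rule has_derivative_at_withinI)
  then have "((\<lambda>s. f (c s)) has_derivative (\<lambda>h. tder M f (c t) (h *\<^sub>R w))) (at t within S)"
    by (rule has_derivative_in_compose)
      (rule has_derivative_subset[OF smooth_along_has_tder[OF f x]], use S in auto)
  then show ?thesis using at_within_open[OF S(2,1)]
    by (simp add: has_vector_derivative_def linear_scale[OF tder_linear[OF f x]])
qed

text \<open>Nearby points of \<open>M\<close> are joined by curves in \<open>M\<close> of comparable length.\<close>

lemma local_paths:
  assumes x: "x \<in> M"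
  obtains d B where "d > 0" "B >= 0"
    "!!y. y \<in> M ==> dist y x < d ==> \<exists>c c'. c 0 = x \<and> c 1 = y \<and> continuous_on {-2<..<2::real} c' \<and>
      (\<forall>t\<in>{-2<..<2}. c t \<in> M \<and> (c has_vector_derivative c' t) (at t) \<and> norm (c' t) <= B * dist y x)"
proof -
  obtain d \<eta> where d: "d > 0" and eta: "smooth_on (ball x d) \<eta>"
    "!!y. y \<in> ball x d ==> y + \<eta> y *\<^sub>R N x \<in> M" "!!y. y \<in> ball x d ==> y \<in> M ==> \<eta> y = 0"
    by (rule retraction[OF x]) simp
  define e where "e = d / 3"
  have e: "e > 0" using d by (simp add: e_def)
  have cb: "cball x (2*e) \<subseteq> ball x d" using d by (auto simp: e_def)
  obtain B where B: "B >= 0" "!!z v. z \<in> cball x (2*e) ==> norm (frechet_derivative \<eta> (at z) v) <= B * norm v"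
    by (rule derivative_bound_on_compact[OF eta(1) compact_cball cb]) simp
  show thesis
  proof (rule that[OF e, of "1 + B"])
    show "1 + B >= 0" using B(1) by simp
    fix y assume y: "y \<in> M" "dist y x < e"
    define l where "l t = x + t *\<^sub>R (y - x)" for t :: real
    have lb: "l t \<in> cball x (2*e)" if "t \<in> {-2<..<2}" for t
    proof -
      have "\<bar>t\<bar> * norm (y - x) <= 2 * e" using that y(2) by (intro mult_mono) (auto simp: dist_norm)
      then show ?thesis by (simp add: l_def dist_norm)
    qed
    define c where "c t = l t + \<eta> (l t) *\<^sub>R N x" for t
    define c' where "c' t = (y - x) + frechet_derivative \<eta> (at (l t)) (y - x) *\<^sub>R N x" for t
    have dl: "(l has_vector_derivative (y - x)) (at t)" for t
      unfolding l_def by (auto intro!: derivative_eq_intros)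
    have "(c has_vector_derivative c' t) (at t)" if t: "t \<in> {-2<..<2}" for t
    proof -
      have de: "(\<eta> has_derivative frechet_derivative \<eta> (at (l t))) (at (l t))"
        by (rule smooth_on_has_derivative[OF eta(1)]) (use lb[OF t] cb in blast)
      have "((\<lambda>t. \<eta> (l t)) has_derivative (\<lambda>h. frechet_derivative \<eta> (at (l t)) (h *\<^sub>R (y - x)))) (at t)"
        by (rule has_derivative_compose[OF dl[unfolded has_vector_derivative_def] de])
      from has_derivative_add[OF dl[of t, unfolded has_vector_derivative_def] has_derivative_scaleR_left[OF this, of "N x"]]
      show ?thesis unfolding has_vector_derivative_def c_def c'_def
        by (simp add: linear_scale[OF has_derivative_linear[OF de]] scaleR_add_right)
    qed
    moreover have "c t \<in> M" if t: "t \<in> {-2<..<2}" for t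
      unfolding c_def by (rule eta(2)) (use lb[OF t] cb in blast)
    moreover have "norm (c' t) <= (1 + B) * dist y x" if t: "t \<in> {-2<..<2}" for t
    proof -
      have "norm (c' t) <= norm (y - x) + norm (frechet_derivative \<eta> (at (l t)) (y - x) *\<^sub>R N x)"
        unfolding c'_def by (rule norm_triangle_ineq)
      also have "\<dots> <= norm (y - x) + B * norm (y - x)"
        using B(2)[OF lb[OF t], of "y - x"] N_norm[OF x] by simp
      finally show ?thesis by (simp add: dist_norm algebra_simps)
    qed
    moreover have "continuous_on {-2<..<2} c'"
    proof -
      have 1: "continuous_on (ball x d) (\<lambda>z. frechet_derivative \<eta> (at z) (y - x))"
        by (rule smooth_on_continuous[OF smooth_on_derivative[OF eta(1)]])
      have "continuous_on {-2<..<2} (\<lambda>t. frechet_derivative \<eta> (at (l t)) (y - x))"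
        by (rule continuous_on_compose2[OF 1, of _ l])
          (use lb cb in \<open>auto simp: l_def intro!: continuous_intros\<close>)
      then show ?thesis unfolding c'_def by (intro continuous_intros)
    qed
    moreover have "c 0 = x" using eta(3)[of x] d x by (simp add: c_def l_def)
    moreover have "c 1 = y" using eta(3)[of y] y d by (simp add: c_def l_def e_def dist_commute)
    ultimately show "\<exists>c c'. c 0 = x \<and> c 1 = y \<and> continuous_on {-2<..<2::real} c' \<and>
      (\<forall>t\<in>{-2<..<2}. c t \<in> M \<and> (c has_vector_derivative c' t) (at t) \<and> norm (c' t) <= (1 + B) * dist y x)"
      by (intro exI[of _ c] exI[of _ c']) simp
  qed
qed


lemma smooth_along_tder:
  fixes f :: "'a => 'b::real_normed_vector"
  assumes f: "smooth_along M f" and Y: "smooth_along M Y" "!!x. x \<in> M ==> N x \<bullet> Y x = 0"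
  shows "smooth_along M (\<lambda>x. tder M f x (Y x))"
proof (rule smooth_alongI)
  fix x assume x: "x \<in> M"
  obtain U g where U: "open U" "x \<in> U" "smooth_on U g" "!!y. y \<in> M ==> y \<in> U ==> g y = f y"
    using smooth_alongE[OF f x] by metis
  obtain V Z where V: "open V" "x \<in> V" "smooth_on V Z" "!!y. y \<in> M ==> y \<in> V ==> Z y = Y y"
    using smooth_alongE[OF Y(1) x] by metis
  define A where "A = U \<inter> V"
  have A: "open A" "x \<in> A" "smooth_on A g" "smooth_on A Z"
    using U V smooth_on_subset[of U g A] smooth_on_subset[of V Z A] by (auto simp: A_def)
  show "\<exists>U h. open U \<and> x \<in> U \<and> smooth_on U h \<and> (\<forall>y\<in>M \<inter> U. h y = tder M f y (Y y))"
  proof (rule exI[of _ A], rule exI[of _ "\<lambda>y. frechet_derivative g (at y) (Z y)"], intro conjI ballI A(1,2))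
    show "smooth_on A (\<lambda>y. frechet_derivative g (at y) (Z y))"
      by (rule smooth_on_derivative_along[OF A(1,3,4)])
    fix y assume y: "y \<in> M \<inter> A"
    have "tder M f y (Y y) = frechet_derivative g (at y) (Y y)"
      by (rule tder_extension[OF _ _ U(1) _ U(3,4)]) (use y Y(2) tangent_iff in \<open>auto simp: A_def\<close>)
    then show "frechet_derivative g (at y) (Z y) = tder M f y (Y y)" using V(4) y by (simp add: A_def)
  qed
qed

text \<open>
  Two derivatives along tangent fields commute up to the bracket of the fields. The bracket is
  tangent because the same identity holds for a local equation of \<open>M\<close>.
\<close>

lemma extension_commutator:
  fixes g :: "'a => 'b::euclidean_space"
  assumes A: "open A" "x \<in> A" "x \<in> M" and g: "smooth_on A g"
    and X: "smooth_on A X" "N x \<bullet> X x = 0" and Y: "smooth_on A Y" "N x \<bullet> Y x = 0"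
  shows "tder M (\<lambda>y. frechet_derivative g (at y) (Y y)) x (X x) - tder M (\<lambda>y. frechet_derivative g (at y) (X y)) x (Y x)
    = frechet_derivative g (at x) (tder M Y x (X x) - tder M X x (Y x))"
proof -
  have T: "X x \<in> tangent_space M x" "Y x \<in> tangent_space M x" using X Y A(3) tangent_iff by auto
  have 1: "tder M h x (X x) = frechet_derivative h (at x) (X x)" "tder M h x (Y x) = frechet_derivative h (at x) (Y x)"
    if "smooth_on A h" for h :: "'a => 'c::euclidean_space"
    by (rule tder_extension[OF A(3) T(1) A(1,2) that refl] tder_extension[OF A(3) T(2) A(1,2) that refl])+
  have 2: "tder M h x (X x) = frechet_derivative h (at x) (X x)" "tder M h x (Y x) = frechet_derivative h (at x) (Y x)"
    if "smooth_on A h" for h :: "'a => 'a"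
    by (rule tder_extension[OF A(3) T(1) A(1,2) that refl] tder_extension[OF A(3) T(2) A(1,2) that refl])+
  have sym: "frechet_derivative (\<lambda>y. frechet_derivative g (at y) (Y x)) (at x) (X x) =
      frechet_derivative (\<lambda>y. frechet_derivative g (at y) (X x)) (at x) (Y x)"
    by (rule second_derivative_symmetric[OF A(1) smooth_onD[OF g] A(2)])
  show ?thesis
    unfolding tder_extension[OF A(3) T(1) A(1,2) smooth_on_derivative_along[OF A(1) g Y(1)] refl]
      tder_extension[OF A(3) T(2) A(1,2) smooth_on_derivative_along[OF A(1) g X(1)] refl]
      tder_extension[OF A(3) T(1) A(1,2) Y(1) refl] tder_extension[OF A(3) T(2) A(1,2) X(1) refl]
      derivative_of_derivative_along[OF A(1,2) g X(1)] derivative_of_derivative_along[OF A(1,2) g Y(1)] sym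
      linear_diff[OF has_derivative_linear[OF smooth_on_has_derivative[OF g A(2)]]]
    by simp
qed

lemma bracket_tangent:
  assumes X: "smooth_along M X" "!!x. x \<in> M ==> N x \<bullet> X x = 0"
    and Y: "smooth_along M Y" "!!x. x \<in> M ==> N x \<bullet> Y x = 0" and x: "x \<in> M"
  shows "N x \<bullet> (tder M Y x (X x) - tder M X x (Y x)) = 0"
proof -
  obtain U and g :: "'a => real" and a where U: "open U" "x \<in> U" and g: "smooth_on U g" and MU: "M \<inter> U = {y \<in> U. g y = 0}"
    and a: "a ~= 0" "!!v. frechet_derivative g (at x) v = a * (N x \<bullet> v)"
    and "tangent_space M x = {v. N x \<bullet> v = 0}"
    by (rule local_equation[OF x], rule that)
  obtain V Z where V: "open V" "x \<in> V" "smooth_on V Z" "!!y. y \<in> M ==> y \<in> V ==> Z y = Y y"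
    using smooth_alongE[OF Y(1) x] by metis
  obtain W X' where W: "open W" "x \<in> W" "smooth_on W X'" "!!y. y \<in> M ==> y \<in> W ==> X' y = X y"
    using smooth_alongE[OF X(1) x] by metis
  define A where "A = U \<inter> V \<inter> W"
  have A: "open A" "x \<in> A" "smooth_on A g" "smooth_on A Z" "smooth_on A X'"
    using U V W smooth_on_subset[OF g, of A] smooth_on_subset[OF V(3), of A] smooth_on_subset[OF W(3), of A]
    by (auto simp: A_def)
  have T: "X x \<in> tangent_space M x" "Y x \<in> tangent_space M x" using X Y x tangent_iff by auto
  have eq: "X' x = X x" "Z x = Y x" using V W x by auto
  have tX: "tder M X' x = tder M X x"
    using tder_cong[of x "M \<inter> A" X' X] tder_Int_open[OF A(1,2), of M X'] tder_Int_open[OF A(1,2), of M X] W(4) x A(2)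
    by (simp add: A_def)
  have tZ: "tder M Z x = tder M Y x"
    using tder_cong[of x "M \<inter> A" Z Y] tder_Int_open[OF A(1,2), of M Z] tder_Int_open[OF A(1,2), of M Y] V(4) x A(2)
    by (simp add: A_def)
  have zero: "tder M (\<lambda>y. frechet_derivative g (at y) (F y)) x v = 0"
    if F: "!!y. y \<in> M \<inter> A ==> N y \<bullet> F y = 0" and v: "v \<in> tangent_space M x" for F v
  proof -
    have "frechet_derivative g (at y) (F y) = 0" if y: "y \<in> M \<inter> A" for y
    proof -
      have "tder M g y (F y) = frechet_derivative g (at y) (F y)"
        by (rule tder_extension[OF _ _ A(1) _ A(3) refl]) (use y F[OF y] tangent_iff in auto)
      moreover have "tder M g y = tder M (\<lambda>y. 0) y"
        using tder_cong[of y "M \<inter> A" g "\<lambda>y. 0"] tder_Int_open[OF A(1), of y M g]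
          tder_Int_open[OF A(1), of y M "\<lambda>y. 0 :: real"] MU y by (auto simp: A_def)
      ultimately show ?thesis using tder_const[of y M "F y" "0::real"] y F[OF y] tangent_iff by auto
    qed
    then have "tder (M \<inter> A) (\<lambda>y. frechet_derivative g (at y) (F y)) x = tder (M \<inter> A) (\<lambda>y. 0) x"
      by (intro tder_cong) (use x A(2) in auto)
    then show ?thesis
      using tder_Int_open[OF A(1,2), of M "\<lambda>y. frechet_derivative g (at y) (F y)"]
        tder_Int_open[OF A(1,2), of M "\<lambda>y. 0 :: real"] tder_const[OF x v, of "0::real"] by simp
  qed
  have "frechet_derivative g (at x) (tder M Z x (X' x) - tder M X' x (Z x)) = 0"
    using extension_commutator[OF A(1,2) x A(3) A(5) _ A(4)] zero[of Z "X x"] zero[of X' "Y x"] T eq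
      X(2) Y(2) x V(4) W(4) by (simp add: A_def)
  then show ?thesis using a by (simp add: tX tZ eq)
qed

lemma commutator:
  fixes f :: "'a => 'b::euclidean_space"
  assumes f: "smooth_along M f" and X: "smooth_along M X" "!!x. x \<in> M ==> N x \<bullet> X x = 0"
    and Y: "smooth_along M Y" "!!x. x \<in> M ==> N x \<bullet> Y x = 0" and x: "x \<in> M"
  shows "tder M (\<lambda>y. tder M f y (Y y)) x (X x) - tder M (\<lambda>y. tder M f y (X y)) x (Y x)
    = tder M f x (tder M Y x (X x) - tder M X x (Y x))"
proof -
  obtain U g where U: "open U" "x \<in> U" "smooth_on U g" "!!y. y \<in> M ==> y \<in> U ==> g y = f y"
    using smooth_alongE[OF f x] by metis
  obtain V Z where V: "open V" "x \<in> V" "smooth_on V Z" "!!y. y \<in> M ==> y \<in> V ==> Z y = Y y"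
    using smooth_alongE[OF Y(1) x] by metis
  obtain W X' where W: "open W" "x \<in> W" "smooth_on W X'" "!!y. y \<in> M ==> y \<in> W ==> X' y = X y"
    using smooth_alongE[OF X(1) x] by metis
  define A where "A = U \<inter> V \<inter> W"
  have A: "open A" "x \<in> A" "smooth_on A g" "smooth_on A Z" "smooth_on A X'"
    using U V W smooth_on_subset[OF U(3), of A] smooth_on_subset[OF V(3), of A] smooth_on_subset[OF W(3), of A]
    by (auto simp: A_def)
  have eq: "X' x = X x" "Z x = Y x" using V W x by auto
  have loc: "tder M h x = tder M k x" if "!!y. y \<in> M \<inter> A ==> h y = k y" for h k :: "'a => 'c::euclidean_space"
    using tder_cong[of x "M \<inter> A" h k] tder_Int_open[OF A(1,2), of M h] tder_Int_open[OF A(1,2), of M k] that x A(2)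
    by simp
  have loc': "tder M h x = tder M k x" if "!!y. y \<in> M \<inter> A ==> h y = k y" for h k :: "'a => 'a"
    using tder_cong[of x "M \<inter> A" h k] tder_Int_open[OF A(1,2), of M h] tder_Int_open[OF A(1,2), of M k] that x A(2)
    by simp
  have loc'': "tder M h x = tder M k x" if "!!y. y \<in> M \<inter> A ==> h y = k y" for h k :: "'a => 'b"
    using tder_cong[of x "M \<inter> A" h k] tder_Int_open[OF A(1,2), of M h] tder_Int_open[OF A(1,2), of M k] that x A(2)
    by simp
  have tX: "tder M X' x = tder M X x" by (rule loc') (use W in \<open>auto simp: A_def\<close>)
  have tZ: "tder M Z x = tder M Y x" by (rule loc') (use V in \<open>auto simp: A_def\<close>)
  have ext: "tder M f y v = frechet_derivative g (at y) v" if "y \<in> M \<inter> A" "N y \<bullet> v = 0" for y v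
    by (rule tder_extension[OF _ _ U(1) _ U(3,4)]) (use that tangent_iff in \<open>auto simp: A_def\<close>)
  have fY: "tder M (\<lambda>y. tder M f y (Y y)) x = tder M (\<lambda>y. frechet_derivative g (at y) (Z y)) x"
    by (rule loc'') (use ext Y(2) V(4) in \<open>auto simp: A_def\<close>)
  have fX: "tder M (\<lambda>y. tder M f y (X y)) x = tder M (\<lambda>y. frechet_derivative g (at y) (X' y)) x"
    by (rule loc'') (use ext X(2) W(4) in \<open>auto simp: A_def\<close>)
  have "N x \<bullet> X' x = 0" "N x \<bullet> Z x = 0" using eq X(2) Y(2) x by auto
  from extension_commutator[OF A(1,2) x A(3) A(5) this(1) A(4) this(2)]
  have "tder M (\<lambda>y. tder M f y (Y y)) x (X x) - tder M (\<lambda>y. tder M f y (X y)) x (Y x)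
    = frechet_derivative g (at x) (tder M Y x (X x) - tder M X x (Y x))"
    unfolding fX fY eq tX tZ .
  also have "\<dots> = tder M f x (tder M Y x (X x) - tder M X x (Y x))"
    by (rule ext[symmetric]) (use x A(2) bracket_tangent[OF X Y x] in auto)
  finally show ?thesis .
qed

lemma grad_exists:
  assumes f: "smooth_along M f" and x: "x \<in> M"
  shows "grad M f x \<in> tangent_space M x" "!!v. v \<in> tangent_space M x ==> grad M f x \<bullet> v = tder M f x v"
proof -
  have lin: "linear (tder M f x)" by (rule tder_linear[OF f x])
  define w where "w = adjoint (tder M f x) 1"
  have w: "tder M f x v = w \<bullet> v" for v
    using adjoint_works[OF lin, of v 1] by (simp add: w_def inner_commute)
  define u where "u = w - (N x \<bullet> w) *\<^sub>R N x"
  have u: "u \<in> tangent_space M x" using N_unit[OF x] by (simp add: tangent_iff[OF x] u_def inner_diff_right)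
  have uv: "u \<bullet> v = tder M f x v" if "v \<in> tangent_space M x" for v
    using that by (simp add: tangent_iff[OF x] u_def inner_diff_left w)
  have "grad M f x = u"
    unfolding grad_def tder_def[symmetric]
  proof (rule the_equality)
    show "u \<in> tangent_space M x \<and> (\<forall>v\<in>tangent_space M x. u \<bullet> v = tder M f x v)" using u uv by simp
    fix z assume z: "z \<in> tangent_space M x \<and> (\<forall>v\<in>tangent_space M x. z \<bullet> v = tder M f x v)"
    have "z - u \<in> tangent_space M x" using z u by (simp add: tangent_iff[OF x] inner_diff_right)
    then have "(z - u) \<bullet> (z - u) = 0" using z uv by (simp add: inner_diff_left)
    then show "z = u" by simp
  qed
  then show "grad M f x \<in> tangent_space M x" "!!v. v \<in> tangent_space M x ==> grad M f x \<bullet> v = tder M f x v"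
    using u uv by simp_all
qed

lemma hypersurface_Int_open:
  assumes "open U" shows "hypersurface (M \<inter> U) N"
proof
  show "oriented_hypersurface (M \<inter> U) N"
    unfolding oriented_hypersurface_def
  proof (intro conjI ballI)
    show "smooth_along (M \<inter> U) N" by (rule smooth_along_subset[OF N_smooth]) simp
    show "smooth_hypersurface (M \<inter> U)"
      unfolding smooth_hypersurface_def
    proof
      fix x assume xU: "x \<in> M \<inter> U"
      then have x: "x \<in> M" by simp
      obtain V and g :: "'a => real" where V: "open V" "x \<in> V" "smooth_on V g"
        "\<forall>y\<in>V. frechet_derivative g (at y) ~= (\<lambda>v. 0)" "M \<inter> V = {y \<in> V. g y = 0}"
        using oriented[unfolded oriented_hypersurface_def smooth_hypersurface_def, THEN conjunct1, rule_format, OF x]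
        by (elim exE conjE) simp
      show "\<exists>V (g :: 'a => real). open V \<and> x \<in> V \<and> smooth_on V g \<and>
          (\<forall>y\<in>V. frechet_derivative g (at y) ~= (\<lambda>v. 0)) \<and> M \<inter> U \<inter> V = {y \<in> V. g y = 0}"
        by (rule exI[of _ "U \<inter> V"], rule exI[of _ g], intro conjI)
          (use V assms xU smooth_on_subset[OF V(3), of "U \<inter> V"] in auto)
    qed
    fix x assume x: "x \<in> M \<inter> U"
    show "norm (N x) = 1" using x N_norm by simp
    fix v assume "v \<in> tangent_space (M \<inter> U) x"
    then have "v \<in> tangent_space M x" unfolding tangent_space_def by (simp, elim exE conjE) (intro exI conjI; assumption)
    then show "N x \<bullet> v = 0" using N_perp x by simp
  qed
qed

end

section \<open>Frames of principal directions\<close>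

lemma tder_cmult:
  fixes f :: "'a::euclidean_space => real"
  assumes "x \<in> M" "v \<in> tangent_space M x" "smooth_along M f"
  shows "tder M (\<lambda>y. c * f y) x v = c * tder M f x v"
  using tder_mult[OF assms(1,2) smooth_along_const[of M c] assms(3)] tder_const[OF assms(1,2), of c] by simp

lemma orthonormal_expansion:
  fixes a :: "'i => 'a::euclidean_space"
  assumes fin: "finite I" "card I = DIM('a)"
    and on: "!!i j. i \<in> I ==> j \<in> I ==> a i \<bullet> a j = (if i = j then 1 else 0)"
  shows "(\<Sum>i\<in>I. (v \<bullet> a i) *\<^sub>R a i) = v" "v \<bullet> w = (\<Sum>i\<in>I. (v \<bullet> a i) * (w \<bullet> a i))"
proof -
  have inj: "inj_on a I"
    using on by (intro inj_onI) (metis zero_neq_one)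
  have n1: "norm (a i) = 1" if "i \<in> I" for i using on[OF that that] by (simp add: norm_eq_1)
  have orth: "pairwise orthogonal (a ` I)"
    unfolding pairwise_def orthogonal_def using on by (auto split: if_splits)
  have "0 \<notin> a ` I" using n1 by force
  then have ind: "independent (a ` I)" using orth pairwise_orthogonal_independent by blast
  have "UNIV \<subseteq> span (a ` I)"
    by (rule card_ge_dim_independent[OF _ ind]) (simp_all add: card_image[OF inj] fin(2))
  then have v: "v \<in> span (a ` I)" by auto
  have "(\<Sum>b\<in>a ` I. (v \<bullet> b) *\<^sub>R b) = v"
    using orthonormal_basis_expand[OF orth _ v] n1 fin(1) by auto
  then show e: "(\<Sum>i\<in>I. (v \<bullet> a i) *\<^sub>R a i) = v"
    by (simp add: sum.reindex[OF inj])
  have "v \<bullet> w = (\<Sum>i\<in>I. (v \<bullet> a i) *\<^sub>R a i) \<bullet> w" by (simp only: e)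
  also have "\<dots> = (\<Sum>i\<in>I. (v \<bullet> a i) * (w \<bullet> a i))"
    unfolding inner_sum_left by (rule sum.cong) (simp_all add: inner_commute[of w])
  finally show "v \<bullet> w = (\<Sum>i\<in>I. (v \<bullet> a i) * (w \<bullet> a i))" .
qed

context hypersurface
begin

context
  fixes n :: nat and x and e :: "nat => 'a"
  assumes dim: "DIM('a) = n + 1" and x: "x \<in> M"
    and tan: "!!i. i \<in> {1..n} ==> N x \<bullet> e i = 0"
    and on: "!!i j. i \<in> {1..n} ==> j \<in> {1..n} ==> e i \<bullet> e j = (if i = j then 1 else 0)"
begin

lemma frame_expand:
  shows "(v \<bullet> N x) *\<^sub>R N x + (\<Sum>i\<in>{1..n}. (v \<bullet> e i) *\<^sub>R e i) = v"
    and "v \<bullet> w = (v \<bullet> N x) * (w \<bullet> N x) + (\<Sum>i\<in>{1..n}. (v \<bullet> e i) * (w \<bullet> e i))"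
proof -
  define a where "a i = (if i = 0 then N x else e i)" for i
  have on': "a i \<bullet> a j = (if i = j then 1 else 0)" if "i \<in> insert 0 {1..n}" "j \<in> insert 0 {1..n}" for i j
    using that tan[of i] tan[of j] on[of i j] N_unit[OF x] by (auto simp: a_def inner_commute)
  have fin: "finite (insert 0 {1..n})" "card (insert 0 {1..n}) = DIM('a)" by (simp_all add: dim)
  note ex = orthonormal_expansion[OF fin on']
  show "(v \<bullet> N x) *\<^sub>R N x + (\<Sum>i\<in>{1..n}. (v \<bullet> e i) *\<^sub>R e i) = v"
    using ex(1)[of v] by (simp add: a_def cong: sum.cong_simp)
  show "v \<bullet> w = (v \<bullet> N x) * (w \<bullet> N x) + (\<Sum>i\<in>{1..n}. (v \<bullet> e i) * (w \<bullet> e i))"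
    using ex(2)[of v w] by (simp add: a_def cong: sum.cong_simp)
qed

lemma frame_eqI:
  assumes "v \<bullet> N x = w \<bullet> N x" "!!i. i \<in> {1..n} ==> v \<bullet> e i = w \<bullet> e i"
  shows "v = w"
  using frame_expand(1)[of v] frame_expand(1)[of w] assms by simp

lemma mean_curvature_eq:
  assumes ev: "!!i. i \<in> {1..n} ==> shape_operator M N x (e i) = k i *\<^sub>R e i"
  shows "mean_curvature M N x = (\<Sum>i\<in>{1..n}. k i)"
proof -
  have S: "shape_operator M N x v = - tder M N x v" for v by (simp add: shape_operator_def tder_def)
  have lin: "linear (tder M N x)" by (rule tder_linear[OF N_smooth x])
  have S_expand: "shape_operator M N x v = (\<Sum>i\<in>{1..n}. (v \<bullet> e i) *\<^sub>R k i *\<^sub>R e i)" if v: "N x \<bullet> v = 0" for v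
  proof -
    have "v = (\<Sum>i\<in>{1..n}. (v \<bullet> e i) *\<^sub>R e i)"
      using frame_expand(1)[of v] v by (simp add: inner_commute)
    then have "tder M N x v = tder M N x (\<Sum>i\<in>{1..n}. (v \<bullet> e i) *\<^sub>R e i)" by simp
    also have "\<dots> = (\<Sum>i\<in>{1..n}. (v \<bullet> e i) *\<^sub>R tder M N x (e i))"
      by (simp only: linear_sum[OF lin] linear_scale[OF lin])
    finally have "shape_operator M N x v = (\<Sum>i\<in>{1..n}. (v \<bullet> e i) *\<^sub>R shape_operator M N x (e i))"
      by (simp add: S sum_negf)
    then show ?thesis by (simp add: ev)
  qed
  have inj: "inj_on e {1..n}" using on by (intro inj_onI) (metis zero_neq_one)
  have n1: "norm (e i) = 1" if "i \<in> {1..n}" for i using on[OF that that] by (simp add: norm_eq_1)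
  have eigen: "principal_space M N x c = span (e ` {i \<in> {1..n}. k i = c})" for c
  proof (intro subset_antisym subsetI)
    fix v assume "v \<in> principal_space M N x c"
    then have v: "N x \<bullet> v = 0" "shape_operator M N x v = c *\<^sub>R v"
      by (auto simp: principal_space_def tangent_iff[OF x])
    have "(v \<bullet> e j) *\<^sub>R e j \<in> span (e ` {i \<in> {1..n}. k i = c})" if j: "j \<in> {1..n}" for j
    proof (cases "k j = c")
      case True
      then show ?thesis using j by (intro span_scale span_base) auto
    next
      case False
      have a: "(\<Sum>i\<in>{1..n}. (v \<bullet> e i) *\<^sub>R k i *\<^sub>R e i) \<bullet> e j = c * (v \<bullet> e j)"
        by (simp only: S_expand[OF v(1), symmetric] v(2) inner_scaleR_left)
      have s: "(\<Sum>i\<in>{1..n}. (v \<bullet> e i) *\<^sub>R k i *\<^sub>R e i) \<bullet> e j = (\<Sum>i\<in>{1..n}. if i = j then (v \<bullet> e j) * k j else 0)"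
        unfolding inner_sum_left by (rule sum.cong) (use on j in auto)
      have b: "(\<Sum>i\<in>{1..n}. if i = j then (v \<bullet> e j) * k j else 0) = (v \<bullet> e j) * k j" using j by simp
      have "(v \<bullet> e j) * k j = c * (v \<bullet> e j)" using a unfolding s b .
      then have "(v \<bullet> e j) * k j = (v \<bullet> e j) * c" by (simp only: mult.commute)
      then have "v \<bullet> e j = 0" using False by (metis mult_cancel_left)
      then show ?thesis by (simp add: span_zero)
    qed
    then have "(\<Sum>j\<in>{1..n}. (v \<bullet> e j) *\<^sub>R e j) \<in> span (e ` {i \<in> {1..n}. k i = c})" by (rule span_sum)
    then show "v \<in> span (e ` {i \<in> {1..n}. k i = c})"
      using frame_expand(1)[of v] v(1) by (simp add: inner_commute)
  next
    fix v assume "v \<in> span (e ` {i \<in> {1..n}. k i = c})"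
    then show "v \<in> principal_space M N x c"
    proof (induction rule: span_induct_alt)
      case base
      then show ?case by (simp add: principal_space_def tangent_iff[OF x] S linear_0[OF lin])
    next
      case (step r b y)
      obtain i where i: "i \<in> {1..n}" "k i = c" "b = e i" using step.hyps(1) by auto
      have "- tder M N x (e i) = c *\<^sub>R e i" using ev[OF i(1)] i(2) by (simp add: S)
      then have "tder M N x (e i) = - (c *\<^sub>R e i)" by (metis minus_minus)
      moreover have "- tder M N x y = c *\<^sub>R y" "N x \<bullet> y = 0"
        using step.IH by (simp_all add: principal_space_def tangent_iff[OF x] S)
      then have "tder M N x y = - (c *\<^sub>R y)" "N x \<bullet> y = 0" by (metis minus_minus)+
      ultimately show ?case using tan[OF i(1)]
        by (simp add: principal_space_def tangent_iff[OF x] S linear_add[OF lin] linear_scale[OF lin]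
          inner_right_distrib i(3) algebra_simps)
    qed
  qed
  have dim_eq: "dim (principal_space M N x c) = card {i \<in> {1..n}. k i = c}" for c
  proof -
    let ?B = "e ` {i \<in> {1..n}. k i = c}"
    have "pairwise orthogonal ?B"
      unfolding pairwise_def orthogonal_def using on by (auto split: if_splits)
    moreover have "0 \<notin> ?B" using n1 by force
    ultimately have "independent ?B" using pairwise_orthogonal_independent by blast
    then have "dim (span ?B) = card ?B" by (simp add: dim_eq_card_independent)
    also have "card ?B = card {i \<in> {1..n}. k i = c}"
      by (rule card_image, rule inj_on_subset[OF inj]) auto
    finally show ?thesis by (simp add: eigen)
  qed
  have pc: "principal_curvatures M N x = k ` {1..n}"
  proof (intro subset_antisym subsetI)
    fix c assume "c \<in> principal_curvatures M N x"
    then obtain v where v: "v \<in> principal_space M N x c" "v ~= 0" by (auto simp: principal_curvatures_def)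
    have "{i \<in> {1..n}. k i = c} ~= {}"
    proof
      assume em: "{i \<in> {1..n}. k i = c} = {}"
      show False using v by (simp only: eigen em) simp
    qed
    then show "c \<in> k ` {1..n}" by auto
  next
    fix c assume "c \<in> k ` {1..n}"
    then obtain i where i: "i \<in> {1..n}" "k i = c" by auto
    have "e i \<in> principal_space M N x c" unfolding eigen by (rule span_base) (use i in auto)
    moreover have "e i ~= 0" using n1[OF i(1)] by auto
    ultimately show "c \<in> principal_curvatures M N x" unfolding principal_curvatures_def by blast
  qed
  have "(\<Sum>i\<in>{1..n}. k i) = (\<Sum>c\<in>k ` {1..n}. \<Sum>i\<in>{i \<in> {1..n}. k i = c}. k i)"
    by (rule sum.image_gen) simp
  also have "\<dots> = (\<Sum>c\<in>k ` {1..n}. real (card {i \<in> {1..n}. k i = c}) * c)"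
    by (rule sum.cong) auto
  finally show ?thesis unfolding mean_curvature_def pc dim_eq by simp
qed

end

end

locale principal_frame = hypersurface M N for M :: "'a::euclidean_space set" and N +
  fixes n :: nat and e :: "nat => 'a => 'a" and k :: "nat => 'a => real"
  assumes dim: "DIM('a) = n + 1"
    and e_smooth: "!!i. i \<in> {1..n} ==> smooth_along M (e i)"
    and e_tangent: "!!x i. x \<in> M ==> i \<in> {1..n} ==> N x \<bullet> e i x = 0"
    and e_orthonormal: "!!x i j. x \<in> M ==> i \<in> {1..n} ==> j \<in> {1..n} ==> e i x \<bullet> e j x = (if i = j then 1 else 0)"
    and e_principal: "!!x i. x \<in> M ==> i \<in> {1..n} ==> shape_operator M N x (e i x) = k i x *\<^sub>R e i x"
begin

abbreviation D :: "nat => ('a => 'b::real_normed_vector) => 'a => 'b" where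
  "D i f x \<equiv> tder M f x (e i x)"

abbreviation \<Gamma> :: "nat => nat => nat => 'a => real" where
  "\<Gamma> i j l x \<equiv> D i (e j) x \<bullet> e l x"

lemma e_T: "x \<in> M ==> i \<in> {1..n} ==> e i x \<in> tangent_space M x"
  using e_tangent[of x i] tangent_iff[of x "e i x"] by simp

lemma expand:
  assumes x: "x \<in> M"
  shows "(v \<bullet> N x) *\<^sub>R N x + (\<Sum>i\<in>{1..n}. (v \<bullet> e i x) *\<^sub>R e i x) = v"
    and "v \<bullet> w = (v \<bullet> N x) * (w \<bullet> N x) + (\<Sum>i\<in>{1..n}. (v \<bullet> e i x) * (w \<bullet> e i x))"
  by (rule frame_expand[OF dim x e_tangent[OF x] e_orthonormal[OF x]]; assumption)+

lemma eqI:
  "x \<in> M ==> v \<bullet> N x = w \<bullet> N x ==> (!!i. i \<in> {1..n} ==> v \<bullet> e i x = w \<bullet> e i x) ==> v = w"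
  by (rule frame_eqI[OF dim _ e_tangent e_orthonormal])

lemma D_N: "x \<in> M ==> i \<in> {1..n} ==> D i N x = - (k i x *\<^sub>R e i x)"
  using e_principal[of x i] by (simp add: shape_operator_def tder_def minus_equation_iff)

lemma D_smooth: "smooth_along M f ==> i \<in> {1..n} ==> smooth_along M (D i f)"
  by (rule smooth_along_tder[OF _ e_smooth e_tangent])

lemma k_smooth: assumes i: "i \<in> {1..n}" shows "smooth_along M (k i)"
proof (rule smooth_along_cong)
  show "smooth_along M (\<lambda>x. - (D i N x \<bullet> e i x))"
    by (intro smooth_along_uminus smooth_along_inner D_smooth N_smooth e_smooth i)
  show "- (D i N x \<bullet> e i x) = k i x" if "x \<in> M" for x
    using D_N[OF that i] e_orthonormal[OF that i i] by simp
qed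

lemma D_cong: "x \<in> M ==> (!!y. y \<in> M ==> f y = g y) ==> D i f x = D i g x"
  using tder_cong[of x M f g] by simp

lemma D_zero: "x \<in> M ==> i \<in> {1..n} ==> (!!y. y \<in> M ==> f y = c) ==> D i f x = 0"
  using D_cong[of x f "\<lambda>y. c" i] tder_const[OF _ e_T, of x i c] by simp

lemma D_e_N: assumes x: "x \<in> M" and i: "i \<in> {1..n}" and j: "j \<in> {1..n}"
  shows "D i (e j) x \<bullet> N x = (if i = j then k i x else 0)"
proof -
  have "D i (\<lambda>y. e j y \<bullet> N y) x = 0" by (rule D_zero[OF x i]) (use e_tangent j in \<open>simp add: inner_commute\<close>)
  then show ?thesis
    using tder_inner[OF x e_T[OF x i] e_smooth[OF j] N_smooth] D_N[OF x i] e_orthonormal[OF x j i] by auto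
qed

lemma \<Gamma>_antisym: assumes x: "x \<in> M" and i: "i \<in> {1..n}" and j: "j \<in> {1..n}" and l: "l \<in> {1..n}"
  shows "\<Gamma> i j l x = - \<Gamma> i l j x"
proof -
  have "D i (\<lambda>y. e j y \<bullet> e l y) x = 0" by (rule D_zero[OF x i]) (use e_orthonormal j l in simp)
  then show ?thesis
    using tder_inner[OF x e_T[OF x i] e_smooth[OF j] e_smooth[OF l]] by (simp add: inner_commute)
qed

lemma D_expand:
  assumes f: "smooth_along M f" and x: "x \<in> M" and w: "N x \<bullet> w = 0"
  shows "tder M f x w = (\<Sum>l\<in>{1..n}. (w \<bullet> e l x) *\<^sub>R D l f x)"
proof -
  have lin: "linear (tder M f x)" by (rule tder_linear[OF f x])
  have "tder M f x w = tder M f x (\<Sum>l\<in>{1..n}. (w \<bullet> e l x) *\<^sub>R e l x)"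
    using expand(1)[OF x, of w] w by (simp add: inner_commute)
  also have "\<dots> = (\<Sum>l\<in>{1..n}. (w \<bullet> e l x) *\<^sub>R D l f x)"
    by (simp only: linear_sum[OF lin] linear_scale[OF lin])
  finally show ?thesis .
qed

lemma D_commutator:
  fixes f :: "'a => 'b::euclidean_space"
  assumes f: "smooth_along M f" and x: "x \<in> M" and i: "i \<in> {1..n}" and j: "j \<in> {1..n}"
  shows "D i (D j f) x - D j (D i f) x = (\<Sum>l\<in>{1..n}. (\<Gamma> i j l x - \<Gamma> j i l x) *\<^sub>R D l f x)"
proof -
  have "D i (D j f) x - D j (D i f) x = tder M f x (D i (e j) x - D j (e i) x)"
    by (rule commutator[OF f e_smooth[OF i] e_tangent[OF _ i] e_smooth[OF j] e_tangent[OF _ j] x])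
  also have "\<dots> = (\<Sum>l\<in>{1..n}. ((D i (e j) x - D j (e i) x) \<bullet> e l x) *\<^sub>R D l f x)"
    by (rule D_expand[OF f x bracket_tangent[OF e_smooth[OF i] e_tangent[OF _ i] e_smooth[OF j] e_tangent[OF _ j] x]])
  finally show ?thesis by (simp add: inner_diff_left)
qed

lemma codazzi:
  assumes x: "x \<in> M" and i: "i \<in> {1..n}" and j: "j \<in> {1..n}" and l: "l \<in> {1..n}"
  shows "(if j = l then D i (k j) x else 0) - (if i = l then D j (k i) x else 0) =
    (k l x - k j x) * \<Gamma> i j l x - (k l x - k i x) * \<Gamma> j i l x"
proof -
  have DD: "D i (D j N) x = - (k j x *\<^sub>R D i (e j) x + D i (k j) x *\<^sub>R e j x)"
    if i: "i \<in> {1..n}" and j: "j \<in> {1..n}" for i j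
  proof -
    have "D i (D j N) x = D i (\<lambda>y. - (k j y *\<^sub>R e j y)) x"
      by (rule D_cong[OF x D_N[OF _ j]])
    then show ?thesis
      using tder_uminus[OF x e_T[OF x i] smooth_along_scaleR[OF k_smooth[OF j] e_smooth[OF j]]]
        tder_scaleR[OF x e_T[OF x i] k_smooth[OF j] e_smooth[OF j]] by simp
  qed
  have "(\<Sum>m\<in>{1..n}. (\<Gamma> i j m x - \<Gamma> j i m x) *\<^sub>R D m N x) \<bullet> e l x
      = (\<Sum>m\<in>{1..n}. if m = l then - ((\<Gamma> i j l x - \<Gamma> j i l x) * k l x) else 0)"
    unfolding inner_sum_left by (rule sum.cong) (use D_N[OF x] e_orthonormal[OF x _ l] in auto)
  also have "\<dots> = - ((\<Gamma> i j l x - \<Gamma> j i l x) * k l x)" using l by simp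
  finally have "(D i (D j N) x - D j (D i N) x) \<bullet> e l x = - ((\<Gamma> i j l x - \<Gamma> j i l x) * k l x)"
    using D_commutator[OF N_smooth x i j] by simp
  then show ?thesis
    unfolding DD[OF i j] DD[OF j i] using e_orthonormal[OF x i l] e_orthonormal[OF x j l]
    by (auto simp: inner_diff_left inner_add_left algebra_simps)
qed

end


section \<open>The structure equations when the mean curvature varies along one direction only\<close>

locale H_frame = principal_frame M N n e k for M :: "'a::euclidean_space set" and N and n :: nat
    and e :: "nat => 'a => 'a" and k :: "nat => 'a => real" +
  fixes p q :: nat
  assumes pq: "p > 1" "q > 1" "n = p + q + 1"
    and mult2: "!!x i. x \<in> M ==> i \<in> {2..p+1} ==> k i x = k 2 x"
    and mult3: "!!x i. x \<in> M ==> i \<in> {p+2..n} ==> k i x = k (p+2) x"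
    and distinct: "!!x. x \<in> M ==> k 1 x ~= k 2 x \<and> k 1 x ~= k (p+2) x \<and> k 2 x ~= k (p+2) x"
    and D_k1: "!!x i. x \<in> M ==> i \<in> {2..n} ==> D i (k 1) x = 0"
    and D1_k1: "!!x. x \<in> M ==> D 1 (k 1) x ~= 0"
    and k_sum: "!!x. x \<in> M ==> 3 * k 1 x + p * k 2 x + q * k (p+2) x = 0"
begin

abbreviation same :: "nat => nat => bool" where
  "same i j \<equiv> (i <= p + 1 \<longleftrightarrow> j <= p + 1)"

lemma I_simps: "1 \<in> {1..n}" "2 \<in> {1..n}" "p + 2 \<in> {1..n}" "i \<in> {2..n} ==> i \<in> {1..n}"
  using pq by auto

lemma k_class: "x \<in> M ==> i \<in> {2..n} ==> k i x = (if i <= p + 1 then k 2 x else k (p+2) x)"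
  using mult2[of x i] mult3[of x i] by auto

lemma k_same: "x \<in> M ==> i \<in> {2..n} ==> j \<in> {2..n} ==> k i x = k j x \<longleftrightarrow> same i j"
  using k_class[of x i] k_class[of x j] distinct[of x] by auto

lemma k_1: "x \<in> M ==> i \<in> {2..n} ==> k i x ~= k 1 x"
  using k_class[of x i] distinct[of x] by auto

lemma D_k_same_distinct:
  assumes x: "x \<in> M" and i: "i \<in> {2..n}" and j: "j \<in> {2..n}" and ij: "i ~= j" "same i j"
  shows "D i (k j) x = 0"
  using codazzi[OF x I_simps(4)[OF i] I_simps(4)[OF j] I_simps(4)[OF j]] ij k_same[OF x i j] by simp

text \<open>
  The Codazzi equation compares \<open>i\<close> with another index of the same class, which exists since both
  multiplicities exceed one.
\<close>

lemma D_k_same: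
  assumes x: "x \<in> M" and i: "i \<in> {2..n}" and j: "j \<in> {2..n}" and ij: "same i j"
  shows "D i (k j) x = 0"
proof -
  obtain l where l: "l \<in> {2..n}" "l ~= i" "same i l"
  proof -
    have "\<exists>l. l \<in> {2..n} \<and> l ~= i \<and> same i l"
    proof (cases "i <= p + 1")
      case True
      then show ?thesis using pq i by (intro exI[of _ "if i = 2 then 3 else 2"]) auto
    next
      case False
      then show ?thesis using pq i by (intro exI[of _ "if i = p + 2 then p + 3 else p + 2"]) auto
    qed
    then show thesis using that by blast
  qed
  have "D i (k j) x = D i (k l) x"
  proof (rule D_cong[OF x])
    show "k j y = k l y" if "y \<in> M" for y using k_same[OF that j l(1)] ij l(3) by simp
  qed
  then show ?thesis using D_k_same_distinct[OF x i l(1)] l by simp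
qed

lemma D_k:
  assumes x: "x \<in> M" and i: "i \<in> {2..n}" and j: "j \<in> {1..n}"
  shows "D i (k j) x = 0"
proof (cases "j = 1")
  case True
  then show ?thesis using D_k1[OF x i] by simp
next
  case False
  then have j2: "j \<in> {2..n}" using j by auto
  note iI = I_simps(4)[OF i]
  have T: "e i x \<in> tangent_space M x" by (rule e_T[OF x iI])
  have "D i (\<lambda>y. 3 * k 1 y + p * k 2 y + q * k (p+2) y) x = 0"
    by (rule D_zero[OF x iI k_sum])
  moreover have s: "smooth_along M (k 1)" "smooth_along M (k 2)" "smooth_along M (k (p+2))"
    by (intro k_smooth I_simps)+
  note cm = smooth_along_mult[OF smooth_along_const]
  have "D i (\<lambda>y. 3 * k 1 y + p * k 2 y + q * k (p+2) y) x = 3 * D i (k 1) x + p * D i (k 2) x + q * D i (k (p+2)) x"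
    by (simp only: tder_add[OF x T smooth_along_add[OF cm[OF s(1)] cm[OF s(2)]] cm[OF s(3)]]
        tder_add[OF x T cm[OF s(1)] cm[OF s(2)]]
        tder_cmult[OF x T s(1)] tder_cmult[OF x T s(2)] tder_cmult[OF x T s(3)])
  ultimately have sum: "3 * D i (k 1) x + p * D i (k 2) x + q * D i (k (p+2)) x = 0" by simp
  have both: "D i (k 2) x = 0 \<and> D i (k (p+2)) x = 0"
  proof (cases "i <= p + 1")
    case True
    then have "D i (k 2) x = 0" using D_k_same[OF x i, of 2] pq by simp
    then show ?thesis using sum D_k1[OF x i] pq by simp
  next
    case False
    then have "D i (k (p+2)) x = 0" using D_k_same[OF x i, of "p+2"] pq by simp
    then show ?thesis using sum D_k1[OF x i] pq by simp
  qed
  have "D i (k j) x = D i (k (if j <= p + 1 then 2 else p + 2)) x"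
    by (rule D_cong[OF x]) (use k_class[OF _ j2] in simp)
  then show ?thesis using both by simp
qed

text \<open>
  Minus \<open>\<alpha> i\<close> is the component of \<open>D i (e 1)\<close> along \<open>e i\<close>: together with \<open>k i\<close> it measures how the leaf
  through \<open>e i\<close> bends in the ambient space.
\<close>

definition \<alpha> :: "nat => 'a => real" where
  "\<alpha> i x = D 1 (k i) x / (k i x - k 1 x)"

lemma \<alpha>_smooth: assumes i: "i \<in> {2..n}" shows "smooth_along M (\<alpha> i)"
  unfolding \<alpha>_def[abs_def]
proof (rule smooth_along_divide)
  show "smooth_along M (D 1 (k i))" "smooth_along M (\<lambda>y. k i y - k 1 y)"
    by (intro D_smooth k_smooth smooth_along_diff I_simps(1) I_simps(4)[OF i])+
  show "k i y - k 1 y ~= 0" if "y \<in> M" for y using k_1[OF that i] by simp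
qed

lemma \<Gamma>_to_1:
  assumes x: "x \<in> M" and i: "i \<in> {2..n}" and j: "j \<in> {2..n}"
  shows "\<Gamma> i j 1 x = (if i = j then \<alpha> j x else 0)"
proof -
  note I = I_simps(1) I_simps(4)[OF i] I_simps(4)[OF j]
  have ne: "k j x - k 1 x ~= 0" "k i x - k 1 x ~= 0" using k_1[OF x] i j by auto
  have anti: "\<Gamma> i 1 j x = - \<Gamma> i j 1 x" by (rule \<Gamma>_antisym[OF x I(2,1,3)])
  show ?thesis
  proof (cases "i = j")
    case True
    have "D 1 (k j) x = - ((k j x - k 1 x) * \<Gamma> j 1 j x)"
      using codazzi[OF x I(1) I(3) I(3)] j by simp
    then show ?thesis using True anti ne by (simp add: \<alpha>_def field_simps)
  next
    case False
    show ?thesis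
    proof (cases "same i j")
      case True
      then have "(k j x - k 1 x) * \<Gamma> i 1 j x = 0"
        using codazzi[OF x I(1) I(2) I(3)] k_same[OF x i j] False j by auto
      then show ?thesis using False anti ne by simp
    next
      case diff: False
      have z: "D i (D j (k 1)) x = 0" "D j (D i (k 1)) x = 0"
        by (rule D_zero[OF x I(2)], use D_k1[OF _ j] in simp) (rule D_zero[OF x I(3)], use D_k1[OF _ i] in simp)
      have "(\<Sum>l\<in>{1..n}. (\<Gamma> i j l x - \<Gamma> j i l x) *\<^sub>R D l (k 1) x) =
          (\<Sum>l\<in>{1..n}. if l = 1 then (\<Gamma> i j 1 x - \<Gamma> j i 1 x) * D 1 (k 1) x else 0)"
      proof (rule sum.cong)
        fix l assume "l \<in> {1..n}"
        then show "(\<Gamma> i j l x - \<Gamma> j i l x) *\<^sub>R D l (k 1) x = (if l = 1 then (\<Gamma> i j 1 x - \<Gamma> j i 1 x) * D 1 (k 1) x else 0)"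
          using D_k1[OF x, of l] by auto
      qed simp
      also have "\<dots> = (\<Gamma> i j 1 x - \<Gamma> j i 1 x) * D 1 (k 1) x" using I(1) by simp
      finally have "(\<Gamma> i j 1 x - \<Gamma> j i 1 x) * D 1 (k 1) x = 0"
        using D_commutator[OF k_smooth[OF I(1)] x I(2,3)] z by simp
      then have sym: "\<Gamma> i j 1 x = \<Gamma> j i 1 x" using D1_k1[OF x] by simp
      have "(k 1 x - k j x) * \<Gamma> i j 1 x - (k 1 x - k i x) * \<Gamma> j i 1 x = 0"
        using codazzi[OF x I(2,3,1)] i j by simp
      then have "(k i x - k j x) * \<Gamma> i j 1 x = 0" unfolding sym left_diff_distrib by linarith
      then show ?thesis using k_same[OF x i j] diff False by simp
    qed
  qed
qed

lemma \<Gamma>_1_1: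
  assumes x: "x \<in> M" and j: "j \<in> {2..n}"
  shows "\<Gamma> 1 1 j x = 0"
proof -
  note I = I_simps(1) I_simps(4)[OF j]
  have "(k 1 x - k j x) * \<Gamma> 1 j 1 x = 0"
    using codazzi[OF x I(2) I(1) I(1)] D_k1[OF x j] j by auto
  then have "\<Gamma> 1 j 1 x = 0" using k_1[OF x j] by auto
  then show ?thesis using \<Gamma>_antisym[OF x I(1) I(1) I(2)] by simp
qed

lemma \<Gamma>_mixed:
  assumes x: "x \<in> M" and i: "i \<in> {1..n}" and j: "j \<in> {2..n}" and l: "l \<in> {2..n}" and diff: "\<not> same j l"
  shows "\<Gamma> i j l x = 0"
proof -
  have *: "\<Gamma> i j l x = 0" if i: "i \<in> {2..n}" and j: "j \<in> {2..n}" and l: "l \<in> {2..n}" and diff: "same i j" "\<not> same j l" for i j l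
  proof -
    note I = I_simps(4)[OF i] I_simps(4)[OF j] I_simps(4)[OF l]
    have lj: "l ~= j" using diff by (metis)
    have kij: "k i x = k j x" using k_same[OF x i j] diff by simp
    have "(if i = j then D l (k i) x else 0) = 0" "(if l = j then D i (k l) x else 0) = 0"
      "(k j x - k i x) * \<Gamma> l i j x = 0"
      using D_k[OF x l I(1)] D_k[OF x l I(2)] lj kij by simp_all
    then have "(k j x - k l x) * \<Gamma> i l j x = 0"
      using codazzi[OF x I(3) I(1) I(2)] by linarith
    then have "\<Gamma> i l j x = 0" using k_same[OF x j l] diff by simp
    then show ?thesis using \<Gamma>_antisym[OF x I(1) I(2) I(3)] by simp
  qed
  note I = I_simps(1) i I_simps(4)[OF j] I_simps(4)[OF l]
  show ?thesis
  proof (cases "i = 1")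
    case True
    have "\<Gamma> j 1 l x = 0"
      using \<Gamma>_to_1[OF x j l] \<Gamma>_antisym[OF x I(3) I(1) I(4)] diff by auto
    then have "(k l x - k j x) * \<Gamma> 1 j l x = 0"
      using codazzi[OF x I(1) I(3) I(4)] diff l by auto
    then show ?thesis using True k_same[OF x j l] diff by auto
  next
    case False
    then have i2: "i \<in> {2..n}" using i by auto
    show ?thesis
    proof (cases "same i j")
      case True
      then show ?thesis using *[OF i2 j l] diff by simp
    next
      case False
      then have "\<Gamma> i l j x = 0" using *[OF i2 l j] diff by auto
      then show ?thesis using \<Gamma>_antisym[OF x I(2) I(3) I(4)] by simp
    qed
  qed
qed

lemma D_e1:
  assumes x: "x \<in> M"
  shows "D 1 (e 1) x = k 1 x *\<^sub>R N x" "!!i. i \<in> {2..n} ==> D i (e 1) x = - (\<alpha> i x *\<^sub>R e i x)"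
proof -
  note I1 = I_simps(1)
  have 11: "\<Gamma> i 1 1 x = 0" if "i \<in> {1..n}" for i using \<Gamma>_antisym[OF x that I1 I1] by simp
  show "D 1 (e 1) x = k 1 x *\<^sub>R N x"
  proof (rule eqI[OF x])
    show "D 1 (e 1) x \<bullet> N x = (k 1 x *\<^sub>R N x) \<bullet> N x" using D_e_N[OF x I1 I1] N_unit[OF x] by simp
    fix l assume l: "l \<in> {1..n}"
    then show "\<Gamma> 1 1 l x = (k 1 x *\<^sub>R N x) \<bullet> e l x"
      using e_tangent[OF x l] \<Gamma>_1_1[OF x, of l] 11[OF I1] by (cases "l = 1") auto
  qed
  show "D i (e 1) x = - (\<alpha> i x *\<^sub>R e i x)" if i: "i \<in> {2..n}" for i
  proof (rule eqI[OF x])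
    note iI = I_simps(4)[OF i]
    show "D i (e 1) x \<bullet> N x = - (\<alpha> i x *\<^sub>R e i x) \<bullet> N x"
      using D_e_N[OF x iI I1] e_tangent[OF x iI] i by (simp add: inner_commute)
    fix l assume l: "l \<in> {1..n}"
    show "\<Gamma> i 1 l x = - (\<alpha> i x *\<^sub>R e i x) \<bullet> e l x"
    proof (cases "l = 1")
      case True
      then show ?thesis using 11[OF iI] e_orthonormal[OF x iI I1] i by simp
    next
      case False
      then have "l \<in> {2..n}" using l by auto
      then show ?thesis
        using \<Gamma>_to_1[OF x i, of l] \<Gamma>_antisym[OF x iI I1 l] e_orthonormal[OF x iI l] by simp
    qed
  qed
qed

lemma D_\<alpha>:
  assumes x: "x \<in> M" and i: "i \<in> {2..n}" and j: "j \<in> {2..n}"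
  shows "D j (\<alpha> i) x = 0"
proof -
  note I = I_simps(1) I_simps(4)[OF i] I_simps(4)[OF j]
  have T: "e j x \<in> tangent_space M x" by (rule e_T[OF x I(3)])
  have "(\<Sum>l\<in>{1..n}. (\<Gamma> j 1 l x - \<Gamma> 1 j l x) *\<^sub>R D l (k i) x) = 0"
  proof (rule sum.neutral, rule ballI)
    fix l assume l: "l \<in> {1..n}"
    show "(\<Gamma> j 1 l x - \<Gamma> 1 j l x) *\<^sub>R D l (k i) x = 0"
    proof (cases "l = 1")
      case True
      have "\<Gamma> j 1 1 x = 0" using \<Gamma>_antisym[OF x I(3) I(1) I(1)] by simp
      moreover have "\<Gamma> 1 j 1 x = 0" using \<Gamma>_antisym[OF x I(1) I(3) I(1)] \<Gamma>_1_1[OF x j] by simp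
      ultimately show ?thesis using True by simp
    next
      case False
      then show ?thesis using D_k[OF x _ I(2), of l] l by simp
    qed
  qed
  then have "D j (D 1 (k i)) x = D 1 (D j (k i)) x"
    using D_commutator[OF k_smooth[OF I(2)] x I(3) I(1)] by simp
  also have "\<dots> = 0" by (rule D_zero[OF x I(1) D_k[OF _ j I(2)]])
  finally have 1: "D j (D 1 (k i)) x = 0" .
  have s: "smooth_along M (\<lambda>y. k i y - k 1 y)" "smooth_along M (\<lambda>y. inverse (k i y - k 1 y))"
    using smooth_along_inverse[OF smooth_along_diff[OF k_smooth[OF I(2)] k_smooth[OF I(1)]]]
      smooth_along_diff[OF k_smooth[OF I(2)] k_smooth[OF I(1)]] k_1[OF _ i] by auto
  have "D j (\<lambda>y. k i y - k 1 y) x = 0"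
    using tder_diff[OF x T k_smooth[OF I(2)] k_smooth[OF I(1)]] D_k[OF x j] I by simp
  then have 2: "D j (\<lambda>y. inverse (k i y - k 1 y)) x = 0"
    using tder_inverse[OF x T s(1)] k_1[OF x i] by simp
  show ?thesis
    unfolding \<alpha>_def[abs_def] divide_inverse
    using tder_mult[OF x T D_smooth[OF k_smooth[OF I(2)] I(1)] s(2)] 1 2 by simp
qed

lemma D1_k: "x \<in> M ==> i \<in> {2..n} ==> D 1 (k i) x = \<alpha> i x * (k i x - k 1 x)"
  using k_1[of x i] by (simp add: \<alpha>_def)

lemma D1_\<alpha>:
  assumes x: "x \<in> M" and i: "i \<in> {2..n}"
  shows "D 1 (\<alpha> i) x = (\<alpha> i x)\<^sup>2 + k 1 x * k i x"
proof -
  note I = I_simps(1) I_simps(4)[OF i]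
  have T: "e i x \<in> tangent_space M x" "e 1 x \<in> tangent_space M x" using e_T[OF x] I by auto
  have "D i (D 1 (e 1)) x = D i (\<lambda>y. k 1 y *\<^sub>R N y) x"
    by (rule D_cong[OF x D_e1(1)])
  also have "\<dots> = - (k 1 x * k i x) *\<^sub>R e i x"
    using tder_scaleR[OF x T(1) k_smooth[OF I(1)] N_smooth] D_N[OF x I(2)] D_k1[OF x i] by simp
  finally have 1: "D i (D 1 (e 1)) x \<bullet> e i x = - (k 1 x * k i x)"
    using e_orthonormal[OF x I(2) I(2)] by simp
  have "D 1 (D i (e 1)) x = D 1 (\<lambda>y. - (\<alpha> i y *\<^sub>R e i y)) x"
    by (rule D_cong[OF x D_e1(2)[OF _ i]])
  also have "\<dots> = - (\<alpha> i x *\<^sub>R D 1 (e i) x + D 1 (\<alpha> i) x *\<^sub>R e i x)"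
    using tder_uminus[OF x T(2) smooth_along_scaleR[OF \<alpha>_smooth[OF i] e_smooth[OF I(2)]]]
      tder_scaleR[OF x T(2) \<alpha>_smooth[OF i] e_smooth[OF I(2)]] by simp
  finally have 2: "D 1 (D i (e 1)) x \<bullet> e i x = - D 1 (\<alpha> i) x"
    using e_orthonormal[OF x I(2) I(2)] \<Gamma>_antisym[OF x I(1) I(2) I(2)]
    by (simp add: inner_add_left inner_diff_left)
  have "(\<Sum>l\<in>{1..n}. (\<Gamma> i 1 l x - \<Gamma> 1 i l x) *\<^sub>R D l (e 1) x) \<bullet> e i x =
      (\<Sum>l\<in>{1..n}. if l = i then (\<Gamma> i 1 i x - \<Gamma> 1 i i x) * - \<alpha> i x else 0)"
    unfolding inner_sum_left
  proof (rule sum.cong)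
    fix l assume l: "l \<in> {1..n}"
    show "((\<Gamma> i 1 l x - \<Gamma> 1 i l x) *\<^sub>R D l (e 1) x) \<bullet> e i x =
        (if l = i then (\<Gamma> i 1 i x - \<Gamma> 1 i i x) * - \<alpha> i x else 0)"
    proof (cases "l = 1")
      case True
      then show ?thesis using \<Gamma>_1_1[OF x i] i by simp
    next
      case False
      then have "l \<in> {2..n}" using l by auto
      then show ?thesis using D_e1(2)[OF x, of l] e_orthonormal[OF x l I(2)] by simp
    qed
  qed simp
  also have "\<dots> = (\<alpha> i x)\<^sup>2"
    using I(2) \<Gamma>_antisym[OF x I(1) I(2) I(2)] D_e1(2)[OF x i] e_orthonormal[OF x I(2) I(2)]
    by (simp add: power2_eq_square)
  finally have "(D i (D 1 (e 1)) x - D 1 (D i (e 1)) x) \<bullet> e i x = (\<alpha> i x)\<^sup>2"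
    by (simp only: D_commutator[OF e_smooth[OF I(1)] x I(2) I(1)])
  then show ?thesis unfolding inner_diff_left 1 2 by linarith
qed

text \<open>The Gauss equation for a plane spanned by principal directions of both multiple curvatures.\<close>

lemma gauss_mixed:
  assumes x: "x \<in> M" and i: "i \<in> {2..n}" and j: "j \<in> {2..n}" and diff: "\<not> same i j"
  shows "\<alpha> i x * \<alpha> j x + k i x * k j x = 0"
proof -
  note I = I_simps(1) I_simps(4)[OF i] I_simps(4)[OF j]
  have ij: "i ~= j" using diff by auto
  have T: "e i x \<in> tangent_space M x" "e j x \<in> tangent_space M x" using e_T[OF x] I by auto
  note s = D_smooth[OF e_smooth[OF I(2)]]
  have "D i (\<lambda>y. D j (e i) y \<bullet> e j y) x = 0"
    by (rule D_zero[OF x I(2) \<Gamma>_mixed[OF _ I(3) i j diff]])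
  then have 1: "D i (D j (e i)) x \<bullet> e j x = - (D j (e i) x \<bullet> D i (e j) x)"
    using tder_inner[OF x T(1) s[OF I(3)] e_smooth[OF I(3)]] by simp
  have "D j (e i) x \<bullet> D i (e j) x = (\<Sum>l\<in>{1..n}. \<Gamma> j i l x * \<Gamma> i j l x)"
    using expand(2)[OF x, of "D j (e i) x" "D i (e j) x"] D_e_N[OF x I(3) I(2)] ij by simp
  also have "\<dots> = 0"
  proof (rule sum.neutral, rule ballI)
    fix l assume l: "l \<in> {1..n}"
    show "\<Gamma> j i l x * \<Gamma> i j l x = 0"
    proof (cases "l = 1")
      case True
      then show ?thesis using \<Gamma>_to_1[OF x i j] ij by simp
    next
      case False
      then have l2: "l \<in> {2..n}" using l by auto
      show ?thesis
        using \<Gamma>_mixed[OF x I(3) i l2] \<Gamma>_mixed[OF x I(2) j l2] diff by (cases "same i l") auto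
    qed
  qed
  finally have 1: "D i (D j (e i)) x \<bullet> e j x = 0" using 1 by simp
  have "D j (\<lambda>y. D i (e i) y \<bullet> e j y) x = 0"
    by (rule D_zero[OF x I(3) \<Gamma>_mixed[OF _ I(2) i j diff]])
  then have 2: "D j (D i (e i)) x \<bullet> e j x = - (D i (e i) x \<bullet> D j (e j) x)"
    using tder_inner[OF x T(2) s[OF I(2)] e_smooth[OF I(3)]] by simp
  have "D i (e i) x \<bullet> D j (e j) x = k i x * k j x + (\<Sum>l\<in>{1..n}. \<Gamma> i i l x * \<Gamma> j j l x)"
    using expand(2)[OF x, of "D i (e i) x" "D j (e j) x"] D_e_N[OF x I(2) I(2)] D_e_N[OF x I(3) I(3)] by simp
  also have "(\<Sum>l\<in>{1..n}. \<Gamma> i i l x * \<Gamma> j j l x) = (\<Sum>l\<in>{1..n}. if l = 1 then \<alpha> i x * \<alpha> j x else 0)"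
  proof (rule sum.cong)
    fix l assume l: "l \<in> {1..n}"
    show "\<Gamma> i i l x * \<Gamma> j j l x = (if l = 1 then \<alpha> i x * \<alpha> j x else 0)"
    proof (cases "l = 1")
      case True
      then show ?thesis using \<Gamma>_to_1[OF x i i] \<Gamma>_to_1[OF x j j] by simp
    next
      case False
      then have l2: "l \<in> {2..n}" using l by auto
      show ?thesis
        using False \<Gamma>_mixed[OF x I(2) i l2] \<Gamma>_mixed[OF x I(3) j l2] diff by (cases "same i l") auto
    qed
  qed simp
  also have "\<dots> = \<alpha> i x * \<alpha> j x" using I(1) by simp
  finally have 2: "D j (D i (e i)) x \<bullet> e j x = - (\<alpha> i x * \<alpha> j x + k i x * k j x)" using 2 by simp
  have "(\<Sum>l\<in>{1..n}. (\<Gamma> i j l x - \<Gamma> j i l x) *\<^sub>R D l (e i) x) \<bullet> e j x = 0"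
    unfolding inner_sum_left
    by (rule sum.neutral) (use \<Gamma>_mixed[OF x _ i j diff] in simp)
  then have "(D i (D j (e i)) x - D j (D i (e i)) x) \<bullet> e j x = 0"
    using D_commutator[OF e_smooth[OF I(2)] x I(2) I(3)] by simp
  then show ?thesis using 1 2 by (simp add: inner_diff_left)
qed

end

section \<open>The two normal directions of the leaves\<close>

text \<open>
  The data of the two families of leaves, written with the shape operator and the field \<open>E = e 1\<close> only,
  so that they are globally defined although the frames are local. In the plane of \<open>E\<close> and \<open>N\<close>,
  \<open>dir2\<close> is the outer unit normal of the spherical leaf of \<open>k 2\<close>, whose radius is \<open>radius\<close>, and \<open>dir3\<close> is
  orthogonal to it; \<open>slope\<close> and \<open>coslope\<close> are the components of \<open>E\<close> with respect to them. \<open>curv3\<close> is the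
  curvature of the other leaf in direction \<open>dir3\<close>.
\<close>

definition leaf_curv :: "'a::euclidean_space set => (nat => 'a => real) => ('a => 'a) => nat => 'a => real" where
  "leaf_curv M k E i x = tder M (k i) x (E x) / (k i x - k 1 x)"

definition radius where
  "radius M k E x = inverse (sqrt ((leaf_curv M k E 2 x)\<^sup>2 + (k 2 x)\<^sup>2))"

definition slope where "slope M k E x = - (leaf_curv M k E 2 x * radius M k E x)"

definition coslope where "coslope M k E x = k 2 x * radius M k E x"

definition dir2 where "dir2 M N k E x = slope M k E x *\<^sub>R E x - coslope M k E x *\<^sub>R N x"

definition dir3 where "dir3 M N k E x = coslope M k E x *\<^sub>R E x + slope M k E x *\<^sub>R N x"

definition curv3 where
  "curv3 M k E p x = leaf_curv M k E (p+2) x * coslope M k E x + k (p+2) x * slope M k E x"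

text \<open>
  The orthogonal projection onto the principal space of \<open>k 2\<close>, as a linear expression in the shape
  operator: on the tangent space the latter has only three eigenvalues.
\<close>

definition proj2 where
  "proj2 M N k E p x w = inverse (k 2 x - k (p+2) x) *\<^sub>R
     (shape_operator M N x (w - (w \<bullet> N x) *\<^sub>R N x) - k (p+2) x *\<^sub>R (w - (w \<bullet> N x) *\<^sub>R N x)
      - ((k 1 x - k (p+2) x) * (w \<bullet> E x)) *\<^sub>R E x)"

lemma leaf_curv_Int_open:
  assumes "open U" "x \<in> U" "E x = E' x"
  shows "leaf_curv (M \<inter> U) k E' i x = leaf_curv M k E i x"
  using tder_Int_open[OF assms(1,2), of M "k i"] assms(3) by (simp add: leaf_curv_def)

declare One_nat_def [simp del]

lemma leaf_data_Int_open:
  assumes "open U" "x \<in> U" "E x = E' x"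
  shows "radius (M \<inter> U) k E' x = radius M k E x" "slope (M \<inter> U) k E' x = slope M k E x"
    "coslope (M \<inter> U) k E' x = coslope M k E x" "dir2 (M \<inter> U) N k E' x = dir2 M N k E x"
    "dir3 (M \<inter> U) N k E' x = dir3 M N k E x" "curv3 (M \<inter> U) k E' p x = curv3 M k E p x"
    "proj2 (M \<inter> U) N k E' p x w = proj2 M N k E p x w"
proof -
  have l: "leaf_curv (M \<inter> U) k E' i x = leaf_curv M k E i x" for i
    by (rule leaf_curv_Int_open[of U x E E', OF assms])
  show r: "radius (M \<inter> U) k E' x = radius M k E x" by (simp add: radius_def l)
  show s: "slope (M \<inter> U) k E' x = slope M k E x" by (simp add: slope_def l r)
  show c: "coslope (M \<inter> U) k E' x = coslope M k E x" by (simp add: coslope_def r)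
  show "dir2 (M \<inter> U) N k E' x = dir2 M N k E x" by (simp add: dir2_def s c assms(3))
  show "dir3 (M \<inter> U) N k E' x = dir3 M N k E x" by (simp add: dir3_def s c assms(3))
  show "curv3 (M \<inter> U) k E' p x = curv3 M k E p x" by (simp add: curv3_def s c l)
  have "shape_operator (M \<inter> U) N x = shape_operator M N x"
    using tder_Int_open[OF assms(1,2), of M N] by (simp add: shape_operator_def[abs_def] tder_def[abs_def])
  then show "proj2 (M \<inter> U) N k E' p x w = proj2 M N k E p x w" by (simp add: proj2_def assms(3))
qed

context H_frame
begin

lemma I2: "2 \<in> {2..n}" "p + 2 \<in> {2..n}" using pq by auto

lemma leaf_curv_eq: "leaf_curv M k (e 1) = \<alpha>"
  by (intro ext) (simp add: leaf_curv_def \<alpha>_def)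

lemma h_smooth: "smooth_along M (\<lambda>x. \<alpha> 2 x * \<alpha> 2 x + k 2 x * k 2 x)"
  by (rule smooth_along_add; rule smooth_along_mult; rule \<alpha>_smooth[OF I2(1)] k_smooth[OF I_simps(2)])

lemma D_h:
  assumes x: "x \<in> M" and l: "l \<in> {1..n}"
  shows "D l (\<lambda>x. \<alpha> 2 x * \<alpha> 2 x + k 2 x * k 2 x) x =
    (if l = 1 then 2 * \<alpha> 2 x * (\<alpha> 2 x * \<alpha> 2 x + k 2 x * k 2 x) else 0)"
proof -
  have T: "e l x \<in> tangent_space M x" by (rule e_T[OF x l])
  note s = \<alpha>_smooth[OF I2(1)] k_smooth[OF I_simps(2)]
  let ?h = "\<alpha> 2 x * \<alpha> 2 x + k 2 x * k 2 x"
  show ?thesis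
  proof (cases "l = 1")
    case True
    have "D 1 (\<lambda>x. \<alpha> 2 x * \<alpha> 2 x + k 2 x * k 2 x) x = 2 * (\<alpha> 2 x * D 1 (\<alpha> 2) x) + 2 * (k 2 x * D 1 (k 2) x)"
      using True tder_add[OF x T smooth_along_mult[OF s(1) s(1)] smooth_along_mult[OF s(2) s(2)]]
        tder_mult[OF x T s(1) s(1)] tder_mult[OF x T s(2) s(2)] by simp
    then show ?thesis using True D1_\<alpha>[OF x I2(1)] D1_k[OF x I2(1)]
      by (simp add: power2_eq_square algebra_simps)
  next
    case False
    then have l2: "l \<in> {2..n}" using l by auto
    show ?thesis
      using False tder_add[OF x T smooth_along_mult[OF s(1) s(1)] smooth_along_mult[OF s(2) s(2)]]
        tder_mult[OF x T s(1) s(1)] tder_mult[OF x T s(2) s(2)] D_\<alpha>[OF x I2(1) l2] D_k[OF x l2 I_simps(2)] by simp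
  qed
qed

lemma tder_eq_sum:
  assumes f: "smooth_along M f" and x: "x \<in> M" and v: "N x \<bullet> v = 0"
    and d: "!!l. l \<in> {1..n} ==> D l f x = (if l = 1 then d else 0)"
  shows "tder M f x v = (v \<bullet> e 1 x) *\<^sub>R d"
proof -
  have "tder M f x v = (\<Sum>l\<in>{1..n}. if l = 1 then (v \<bullet> e 1 x) *\<^sub>R d else 0)"
    unfolding D_expand[OF f x v] by (rule sum.cong) (use d in auto)
  then show ?thesis using I_simps(1) by simp
qed

end

locale H_frame_pos = H_frame +
  assumes pos: "!!x. x \<in> M ==> (\<alpha> 2 x)\<^sup>2 + (k 2 x)\<^sup>2 > 0"
begin

abbreviation "\<psi> \<equiv> radius M k (e 1)"
abbreviation "a \<equiv> slope M k (e 1)"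
abbreviation "b \<equiv> coslope M k (e 1)"
abbreviation "u \<equiv> dir2 M N k (e 1)"
abbreviation "w \<equiv> dir3 M N k (e 1)"
abbreviation "c \<equiv> curv3 M k (e 1) p"
abbreviation "P \<equiv> proj2 M N k (e 1) p"

lemma \<alpha>_class: assumes x: "x \<in> M" and i: "i \<in> {2..n}"
  shows "\<alpha> i x = (if i <= p + 1 then \<alpha> 2 x else \<alpha> (p+2) x)"
proof -
  have "D 1 (k i) x = D 1 (k (if i <= p + 1 then 2 else p + 2)) x"
    by (rule D_cong[OF x]) (use k_class[OF _ i] in simp)
  then show ?thesis using k_class[OF x i] by (simp add: \<alpha>_def)
qed

lemma rad_eq: "\<psi> = (\<lambda>x. inverse (sqrt ((\<alpha> 2 x)\<^sup>2 + (k 2 x)\<^sup>2)))"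
  by (rule ext) (simp add: radius_def leaf_curv_eq)

lemma rad_pos: "x \<in> M ==> \<psi> x > 0"
  using pos[of x] by (simp add: rad_eq)

lemma rad_square: assumes x: "x \<in> M" shows "((\<alpha> 2 x)\<^sup>2 + (k 2 x)\<^sup>2) * (\<psi> x)\<^sup>2 = 1"
proof -
  define h where "h = (\<alpha> 2 x)\<^sup>2 + (k 2 x)\<^sup>2"
  have h: "h > 0" using pos[OF x] by (simp add: h_def)
  then have "(inverse (sqrt h))\<^sup>2 = inverse h" by (simp add: power_inverse)
  then show ?thesis unfolding rad_eq h_def[symmetric] using h by simp
qed

lemma ab_unit: "x \<in> M ==> a x * a x + b x * b x = 1"
  using rad_square[of x] by (simp add: slope_def coslope_def leaf_curv_eq power2_eq_square algebra_simps)

lemma ak_rad: assumes "x \<in> M" shows "b x * k 2 x - a x * \<alpha> 2 x = inverse (\<psi> x)"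
proof -
  have "(b x * k 2 x - a x * \<alpha> 2 x) * \<psi> x = ((\<alpha> 2 x)\<^sup>2 + (k 2 x)\<^sup>2) * (\<psi> x)\<^sup>2"
    by (simp add: slope_def coslope_def leaf_curv_eq power2_eq_square algebra_simps)
  then show ?thesis using rad_square[OF assms] rad_pos[OF assms] by (simp add: inverse_eq_divide eq_divide_eq)
qed

lemma sqrt_h_smooth: "smooth_along M (\<lambda>x. sqrt (\<alpha> 2 x * \<alpha> 2 x + k 2 x * k 2 x))"
  by (rule smooth_along_sqrt[OF h_smooth]) (use pos in \<open>simp add: power2_eq_square\<close>)

lemma rad_eq': "\<psi> = (\<lambda>x. inverse (sqrt (\<alpha> 2 x * \<alpha> 2 x + k 2 x * k 2 x)))"
  by (simp add: rad_eq power2_eq_square)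

lemma rad_smooth: "smooth_along M \<psi>"
  unfolding rad_eq' by (rule smooth_along_inverse[OF sqrt_h_smooth]) (use pos in \<open>force simp: power2_eq_square\<close>)

lemma a_smooth: "smooth_along M a"
  unfolding slope_def[abs_def] leaf_curv_eq
  by (rule smooth_along_uminus, rule smooth_along_mult, rule \<alpha>_smooth[OF I2(1)], rule rad_smooth)

lemma b_smooth: "smooth_along M b"
  unfolding coslope_def[abs_def] by (rule smooth_along_mult, rule k_smooth[OF I_simps(2)], rule rad_smooth)

lemma u_smooth: "smooth_along M u"
  unfolding dir2_def[abs_def]
  by (rule smooth_along_diff; rule smooth_along_scaleR; rule a_smooth b_smooth N_smooth e_smooth[OF I_simps(1)])

lemma w_smooth: "smooth_along M w"
  unfolding dir3_def[abs_def]
  by (rule smooth_along_add; rule smooth_along_scaleR; rule a_smooth b_smooth N_smooth e_smooth[OF I_simps(1)])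

lemma c_smooth: "smooth_along M c"
  unfolding curv3_def[abs_def] leaf_curv_eq
  by (rule smooth_along_add; rule smooth_along_mult;
      rule a_smooth b_smooth \<alpha>_smooth[OF I2(2)] k_smooth[OF I_simps(3)])

lemma D_rad:
  assumes x: "x \<in> M" and l: "l \<in> {1..n}"
  shows "D l \<psi> x = (if l = 1 then a x else 0)"
proof -
  have T: "e l x \<in> tangent_space M x" by (rule e_T[OF x l])
  note s = \<alpha>_smooth[OF I2(1)] k_smooth[OF I_simps(2)]
  let ?h = "\<alpha> 2 x * \<alpha> 2 x + k 2 x * k 2 x"
  have h: "?h > 0" using pos[OF x] by (simp add: power2_eq_square)
  have sq: "sqrt ?h ~= 0" using h by (metis less_irrefl real_sqrt_eq_zero_cancel_iff)
  note dh = D_h[OF x l]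
  have "D l \<psi> x = - (D l (\<lambda>x. \<alpha> 2 x * \<alpha> 2 x + k 2 x * k 2 x) x / (2 * sqrt ?h) / (sqrt ?h)\<^sup>2)"
    unfolding rad_eq' tder_inverse[OF x T sqrt_h_smooth sq] tder_sqrt[OF x T h_smooth h] by (rule refl)
  also have "\<dots> = (if l = 1 then - (\<alpha> 2 x * inverse (sqrt ?h)) else 0)"
  proof -
    have "- (2 * A * r / (2 * sqrt r) / (sqrt r)\<^sup>2) = - (A * inverse (sqrt r))" if "r > 0" for A r :: real
      using that by (simp add: field_simps)
    from this[OF h, of "\<alpha> 2 x"] show ?thesis unfolding dh by simp
  qed
  finally show ?thesis by (simp add: slope_def leaf_curv_eq rad_eq')
qed

lemma D_a:
  assumes x: "x \<in> M" and l: "l \<in> {1..n}"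
  shows "D l a x = (if l = 1 then - (k 1 x * b x) else 0)"
proof -
  have T: "e l x \<in> tangent_space M x" by (rule e_T[OF x l])
  note s = \<alpha>_smooth[OF I2(1)]
  have 1: "D l a x = - (\<alpha> 2 x * D l \<psi> x + D l (\<alpha> 2) x * \<psi> x)"
    unfolding slope_def[abs_def] leaf_curv_eq
    using tder_uminus[OF x T smooth_along_mult[OF s rad_smooth]] tder_mult[OF x T s rad_smooth] by simp
  show ?thesis
  proof (cases "l = 1")
    case True
    then show ?thesis using 1 D_rad[OF x l] D1_\<alpha>[OF x I2(1)]
      by (simp add: slope_def coslope_def leaf_curv_eq power2_eq_square algebra_simps)
  next
    case False
    then show ?thesis using 1 D_rad[OF x l] D_\<alpha>[OF x I2(1), of l] l by simp
  qed
qed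

lemma D_b:
  assumes x: "x \<in> M" and l: "l \<in> {1..n}"
  shows "D l b x = (if l = 1 then k 1 x * a x else 0)"
proof -
  have T: "e l x \<in> tangent_space M x" by (rule e_T[OF x l])
  note s = k_smooth[OF I_simps(2)]
  have 1: "D l b x = k 2 x * D l \<psi> x + D l (k 2) x * \<psi> x"
    unfolding coslope_def[abs_def] using tder_mult[OF x T s rad_smooth] by simp
  show ?thesis
  proof (cases "l = 1")
    case True
    then show ?thesis using 1 D_rad[OF x l] D1_k[OF x I2(1)]
      by (simp add: slope_def coslope_def leaf_curv_eq algebra_simps)
  next
    case False
    then show ?thesis using 1 D_rad[OF x l] D_k[OF x _ I_simps(2), of l] l by simp
  qed
qed

text \<open>The Gauss equation says that the mean curvature vector of the second leaf is a multiple of \<open>w\<close>.\<close>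

lemma curv3_components:
  assumes x: "x \<in> M"
  shows "\<alpha> (p+2) x = c x * b x" "k (p+2) x = c x * a x"
proof -
  have g: "\<alpha> 2 x * \<alpha> (p+2) x + k 2 x * k (p+2) x = 0"
    by (rule gauss_mixed[OF x I2]) (use pq in simp)
  have "\<psi> x * (\<alpha> 2 x * \<alpha> (p+2) x + k 2 x * k (p+2) x) = 0" by (simp only: g mult_zero_right)
  then have g': "b x * k (p+2) x = a x * \<alpha> (p+2) x"
    by (simp add: slope_def coslope_def leaf_curv_eq algebra_simps)
  have ab: "a x * a x + b x * b x = 1" by (rule ab_unit[OF x])
  have c: "c x = \<alpha> (p+2) x * b x + k (p+2) x * a x" by (simp add: curv3_def leaf_curv_eq)
  have "c x * b x = \<alpha> (p+2) x * (b x * b x) + a x * (b x * k (p+2) x)" by (simp add: c algebra_simps)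
  also have "\<dots> = \<alpha> (p+2) x * (a x * a x + b x * b x)" by (simp only: g') (simp add: algebra_simps)
  finally show "\<alpha> (p+2) x = c x * b x" using ab by simp
  have "c x * a x = b x * (a x * \<alpha> (p+2) x) + k (p+2) x * (a x * a x)" by (simp add: c algebra_simps)
  also have "\<dots> = k (p+2) x * (a x * a x + b x * b x)" by (simp only: g'[symmetric]) (simp add: algebra_simps)
  finally show "k (p+2) x = c x * a x" using ab by simp
qed

lemma D_c:
  assumes x: "x \<in> M" and l: "l \<in> {1..n}"
  shows "D l c x = (if l = 1 then \<alpha> (p+2) x * c x else 0)"
proof -
  have T: "e l x \<in> tangent_space M x" by (rule e_T[OF x l])
  note s = k_smooth[OF I_simps(3)] \<alpha>_smooth[OF I2(2)]
  have 1: "D l c x = (\<alpha> (p+2) x * D l b x + D l (\<alpha> (p+2)) x * b x) + (k (p+2) x * D l a x + D l (k (p+2)) x * a x)"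
    unfolding curv3_def[abs_def] leaf_curv_eq
    using tder_add[OF x T smooth_along_mult[OF s(2) b_smooth] smooth_along_mult[OF s(1) a_smooth]]
      tder_mult[OF x T s(2) b_smooth] tder_mult[OF x T s(1) a_smooth] by simp
  show ?thesis
  proof (cases "l = 1")
    case True
    have "D 1 c x = \<alpha> (p+2) x * (k 1 x * a x) + ((\<alpha> (p+2) x)\<^sup>2 + k 1 x * k (p+2) x) * b x
        + (k (p+2) x * - (k 1 x * b x) + \<alpha> (p+2) x * (k (p+2) x - k 1 x) * a x)"
      using 1 True D_a[OF x l] D_b[OF x l] D1_k[OF x I2(2)] D1_\<alpha>[OF x I2(2)] by simp
    also have "\<dots> = \<alpha> (p+2) x * (\<alpha> (p+2) x * b x + k (p+2) x * a x)"
      by (simp add: power2_eq_square algebra_simps)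
    finally show ?thesis using True by (simp add: curv3_def leaf_curv_eq)
  next
    case False
    then show ?thesis
      using 1 D_a[OF x l] D_b[OF x l] D_k[OF x _ I_simps(3), of l] D_\<alpha>[OF x I2(2), of l] l by simp
  qed
qed

lemma D_u:
  assumes x: "x \<in> M" and l: "l \<in> {1..n}"
  shows "D l u x = (if l \<in> {2..p+1} then inverse (\<psi> x) *\<^sub>R e l x else 0)"
proof -
  have T: "e l x \<in> tangent_space M x" by (rule e_T[OF x l])
  note e1 = e_smooth[OF I_simps(1)]
  have 1: "D l u x = (a x *\<^sub>R D l (e 1) x + D l a x *\<^sub>R e 1 x) - (b x *\<^sub>R D l N x + D l b x *\<^sub>R N x)"
    unfolding dir2_def[abs_def]
    by (simp only: tder_diff[OF x T smooth_along_scaleR[OF a_smooth e1] smooth_along_scaleR[OF b_smooth N_smooth]]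
        tder_scaleR[OF x T a_smooth e1] tder_scaleR[OF x T b_smooth N_smooth])
  show ?thesis
  proof (cases "l = 1")
    case True
    then show ?thesis using 1 D_a[OF x l] D_b[OF x l] D_e1(1)[OF x] D_N[OF x l] by (simp add: mult.commute)
  next
    case False
    then have l2: "l \<in> {2..n}" using l by auto
    have 2: "D l u x = (b x * k l x - a x * \<alpha> l x) *\<^sub>R e l x"
      using 1 False D_a[OF x l] D_b[OF x l] D_e1(2)[OF x l2] D_N[OF x l] by (simp add: algebra_simps)
    show ?thesis
    proof (cases "l <= p + 1")
      case True
      then have "b x * k l x - a x * \<alpha> l x = inverse (\<psi> x)"
        using ak_rad[OF x] \<alpha>_class[OF x l2] k_class[OF x l2] by simp
      then show ?thesis using 2 True l2 by simp
    next
      case False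
      then have "b x * k l x - a x * \<alpha> l x = 0"
        using curv3_components[OF x] \<alpha>_class[OF x l2] k_class[OF x l2] by simp
      then show ?thesis using 2 False by simp
    qed
  qed
qed

lemma D_w:
  assumes x: "x \<in> M" and l: "l \<in> {1..n}"
  shows "D l w x = (if l \<in> {p+2..n} then - c x *\<^sub>R e l x else 0)"
proof -
  have T: "e l x \<in> tangent_space M x" by (rule e_T[OF x l])
  note e1 = e_smooth[OF I_simps(1)]
  have 1: "D l w x = (b x *\<^sub>R D l (e 1) x + D l b x *\<^sub>R e 1 x) + (a x *\<^sub>R D l N x + D l a x *\<^sub>R N x)"
    unfolding dir3_def[abs_def]
    by (simp only: tder_add[OF x T smooth_along_scaleR[OF b_smooth e1] smooth_along_scaleR[OF a_smooth N_smooth]]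
        tder_scaleR[OF x T b_smooth e1] tder_scaleR[OF x T a_smooth N_smooth])
  show ?thesis
  proof (cases "l = 1")
    case True
    then show ?thesis using 1 D_a[OF x l] D_b[OF x l] D_e1(1)[OF x] D_N[OF x l] by (simp add: mult.commute)
  next
    case False
    then have l2: "l \<in> {2..n}" using l by auto
    have 2: "D l w x = - (b x * \<alpha> l x + a x * k l x) *\<^sub>R e l x"
      using 1 False D_a[OF x l] D_b[OF x l] D_e1(2)[OF x l2] D_N[OF x l] by (simp add: algebra_simps)
    show ?thesis
    proof (cases "l <= p + 1")
      case True
      then have "b x * \<alpha> l x + a x * k l x = 0"
        using \<alpha>_class[OF x l2] k_class[OF x l2] by (simp add: slope_def coslope_def leaf_curv_eq)
      then show ?thesis using 2 True by simp
    next
      case False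
      then have "b x * \<alpha> l x + a x * k l x = c x"
        using \<alpha>_class[OF x l2] k_class[OF x l2] by (simp add: curv3_def leaf_curv_eq mult.commute)
      then show ?thesis using 2 False l2 by simp
    qed
  qed
qed

lemma uw_orthonormal:
  assumes x: "x \<in> M"
  shows "u x \<bullet> u x = 1" "w x \<bullet> w x = 1" "u x \<bullet> w x = 0" "w x \<bullet> u x = 0"
    "!!i. i \<in> {2..n} ==> u x \<bullet> e i x = 0" "!!i. i \<in> {2..n} ==> w x \<bullet> e i x = 0"
    "e 1 x = a x *\<^sub>R u x + b x *\<^sub>R w x" "N x = a x *\<^sub>R w x - b x *\<^sub>R u x"
proof -
  note o = N_unit[OF x] e_orthonormal[OF x I_simps(1) I_simps(1)] e_tangent[OF x I_simps(1)]
    e_tangent[OF x I_simps(1), unfolded inner_commute[of "N x"]]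
  note ab = ab_unit[OF x]
  show "u x \<bullet> u x = 1" "w x \<bullet> w x = 1" "u x \<bullet> w x = 0" "w x \<bullet> u x = 0"
    using o ab by (simp_all add: dir2_def dir3_def inner_diff_left inner_diff_right inner_add_left inner_add_right)
  show "u x \<bullet> e i x = 0" "w x \<bullet> e i x = 0" if i: "i \<in> {2..n}" for i
    using e_tangent[OF x, of i] e_orthonormal[OF x I_simps(1), of i] i
    by (simp_all add: dir2_def dir3_def inner_diff_left inner_add_left)
  have "a x *\<^sub>R u x + b x *\<^sub>R w x = (a x * a x + b x * b x) *\<^sub>R e 1 x"
    by (simp add: dir2_def dir3_def algebra_simps)
  then show "e 1 x = a x *\<^sub>R u x + b x *\<^sub>R w x" using ab by simp
  have "a x *\<^sub>R w x - b x *\<^sub>R u x = (a x * a x + b x * b x) *\<^sub>R N x"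
    by (simp add: dir2_def dir3_def algebra_simps)
  then show "N x = a x *\<^sub>R w x - b x *\<^sub>R u x" using ab by simp
qed

lemma proj2_components:
  assumes x: "x \<in> M"
  shows "P x z \<bullet> N x = 0" "!!j. j \<in> {1..n} ==> P x z \<bullet> e j x = (if j \<in> {2..p+1} then z \<bullet> e j x else 0)"
proof -
  let ?t = "z - (z \<bullet> N x) *\<^sub>R N x"
  have t: "N x \<bullet> ?t = 0" using N_unit[OF x] by (simp add: inner_diff_right inner_commute)
  have S: "shape_operator M N x ?t = - tder M N x ?t" by (simp add: shape_operator_def tder_def)
  have SN: "shape_operator M N x ?t \<bullet> N x = 0"
    unfolding S D_expand[OF N_smooth x t] inner_minus_left inner_sum_left
    by (simp, rule sum.neutral, use D_N[OF x] e_tangent[OF x] in \<open>auto simp: inner_commute\<close>)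
  show "P x z \<bullet> N x = 0"
    using SN N_unit[OF x] e_tangent[OF x I_simps(1), unfolded inner_commute[of "N x"]]
    by (simp add: proj2_def inner_diff_left)
  fix j assume j: "j \<in> {1..n}"
  have te: "?t \<bullet> e j x = z \<bullet> e j x" if "j \<in> {1..n}" for j using e_tangent[OF x that] by (simp add: inner_diff_left)
  have "(\<Sum>l\<in>{1..n}. (?t \<bullet> e l x) *\<^sub>R D l N x) \<bullet> e j x = (\<Sum>l\<in>{1..n}. if l = j then - ((z \<bullet> e j x) * k j x) else 0)"
    unfolding inner_sum_left by (rule sum.cong) (use D_N[OF x] te e_orthonormal[OF x _ j] in auto)
  also have "\<dots> = - ((z \<bullet> e j x) * k j x)" using j by simp
  finally have Se: "shape_operator M N x ?t \<bullet> e j x = (z \<bullet> e j x) * k j x"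
    unfolding S D_expand[OF N_smooth x t] by simp
  have d: "k 2 x - k (p+2) x ~= 0" using distinct[OF x] by simp
  have 1: "P x z \<bullet> e j x = inverse (k 2 x - k (p+2) x) * ((z \<bullet> e j x) * k j x - k (p+2) x * (z \<bullet> e j x)
      - (k 1 x - k (p+2) x) * (z \<bullet> e 1 x) * (e 1 x \<bullet> e j x))"
    unfolding proj2_def inner_scaleR_left inner_diff_left[of _ _ "e j x"] Se
    using te[OF j] by (simp add: inner_diff_left)
  show "P x z \<bullet> e j x = (if j \<in> {2..p+1} then z \<bullet> e j x else 0)"
  proof (cases "j = 1")
    case True
    then show ?thesis using 1 e_orthonormal[OF x I_simps(1) j] by (simp add: algebra_simps)
  next
    case False
    then have j2: "j \<in> {2..n}" using j by auto
    show ?thesis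
    proof (cases "j <= p + 1")
      case True
      have "P x z \<bullet> e j x = inverse (k 2 x - k (p+2) x) * ((k 2 x - k (p+2) x) * (z \<bullet> e j x))"
        using 1 False True e_orthonormal[OF x I_simps(1) j] k_class[OF x j2] by (simp add: algebra_simps)
      then show ?thesis using d True j2 by simp
    next
      case gt: False
      then show ?thesis using 1 False e_orthonormal[OF x I_simps(1) j] k_class[OF x j2] by simp
    qed
  qed
qed

lemma proj2_uw:
  assumes x: "x \<in> M"
  shows "P x z \<bullet> u x = 0" "P x z \<bullet> w x = 0"
  using proj2_components(1)[OF x, of z] proj2_components(2)[OF x I_simps(1), of z]
  by (simp_all add: dir2_def dir3_def inner_diff_right inner_add_right)

lemma tder_leaf_data:
  assumes x: "x \<in> M" and v: "N x \<bullet> v = 0"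
  shows "tder M \<psi> x v = a x * (v \<bullet> e 1 x)"
    "tder M a x v = - (k 1 x * b x) * (v \<bullet> e 1 x)"
    "tder M b x v = k 1 x * a x * (v \<bullet> e 1 x)"
    "tder M c x v = c x * b x * c x * (v \<bullet> e 1 x)"
    "tder M u x v = inverse (\<psi> x) *\<^sub>R P x v"
    "tder M w x v = - c x *\<^sub>R (v - (v \<bullet> e 1 x) *\<^sub>R e 1 x - P x v)"
proof -
  show "tder M \<psi> x v = a x * (v \<bullet> e 1 x)"
    using tder_eq_sum[OF rad_smooth x v D_rad[OF x]] by simp
  show "tder M a x v = - (k 1 x * b x) * (v \<bullet> e 1 x)"
    using tder_eq_sum[OF a_smooth x v D_a[OF x]] by simp
  show "tder M b x v = k 1 x * a x * (v \<bullet> e 1 x)"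
    using tder_eq_sum[OF b_smooth x v D_b[OF x]] by simp
  show "tder M c x v = c x * b x * c x * (v \<bullet> e 1 x)"
    using tder_eq_sum[OF c_smooth x v D_c[OF x]] curv3_components(1)[OF x] by simp
  show "tder M u x v = inverse (\<psi> x) *\<^sub>R P x v"
  proof (rule eqI[OF x])
    show "tder M u x v \<bullet> N x = (inverse (\<psi> x) *\<^sub>R P x v) \<bullet> N x"
      unfolding D_expand[OF u_smooth x v] inner_sum_left using proj2_components(1)[OF x]
      by (simp, intro sum.neutral) (use D_u[OF x] e_tangent[OF x] in \<open>auto simp: inner_commute\<close>)
    fix j assume j: "j \<in> {1..n}"
    have "tder M u x v \<bullet> e j x = (\<Sum>l\<in>{1..n}. if l = j then (if j \<in> {2..p+1} then inverse (\<psi> x) * (v \<bullet> e j x) else 0) else 0)"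
      unfolding D_expand[OF u_smooth x v] inner_sum_left
      by (rule sum.cong) (use D_u[OF x] e_orthonormal[OF x _ j] in auto)
    then show "tder M u x v \<bullet> e j x = (inverse (\<psi> x) *\<^sub>R P x v) \<bullet> e j x"
      using j proj2_components(2)[OF x j] by simp
  qed
  show "tder M w x v = - c x *\<^sub>R (v - (v \<bullet> e 1 x) *\<^sub>R e 1 x - P x v)"
  proof (rule eqI[OF x])
    show "tder M w x v \<bullet> N x = (- c x *\<^sub>R (v - (v \<bullet> e 1 x) *\<^sub>R e 1 x - P x v)) \<bullet> N x"
    proof -
      have "tder M w x v \<bullet> N x = 0"
        unfolding D_expand[OF w_smooth x v] inner_sum_left
        by (rule sum.neutral) (use D_w[OF x] e_tangent[OF x] in \<open>auto simp: inner_commute\<close>)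
      then show ?thesis
        using proj2_components(1)[OF x, of v] v e_tangent[OF x I_simps(1)]
        by (simp add: inner_diff_left inner_diff_right inner_commute)
    qed
    fix j assume j: "j \<in> {1..n}"
    have "tder M w x v \<bullet> e j x = (\<Sum>l\<in>{1..n}. if l = j then (if j \<in> {p+2..n} then - c x * (v \<bullet> e j x) else 0) else 0)"
      unfolding D_expand[OF w_smooth x v] inner_sum_left
      by (rule sum.cong) (use D_w[OF x] e_orthonormal[OF x _ j] in auto)
    also have "\<dots> = (if j \<in> {p+2..n} then - c x * (v \<bullet> e j x) else 0)" using j by simp
    also have "\<dots> = (- c x *\<^sub>R (v - (v \<bullet> e 1 x) *\<^sub>R e 1 x - P x v)) \<bullet> e j x"
      using proj2_components(2)[OF x j, of v] e_orthonormal[OF x I_simps(1) j] j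
      by (cases "j = 1") (auto simp: inner_diff_left)
    finally show "tder M w x v \<bullet> e j x = (- c x *\<^sub>R (v - (v \<bullet> e 1 x) *\<^sub>R e 1 x - P x v)) \<bullet> e j x" .
  qed
qed


text \<open>
  The span of the principal directions for \<open>k 2\<close> and of \<open>u\<close> is parallel, and so is its
  orthogonal complement; hence the orthogonal projection onto it does not vary.
\<close>

abbreviation "pr z x \<equiv> P x z + (z \<bullet> u x) *\<^sub>R u x"

lemma pr_components:
  assumes x: "x \<in> M"
  shows "pr z x \<bullet> u x = z \<bullet> u x" "pr z x \<bullet> w x = 0"
    "!!j. j \<in> {2..n} ==> pr z x \<bullet> e j x = (if j <= p + 1 then z \<bullet> e j x else 0)"
  using proj2_uw[OF x, of z] uw_orthonormal[OF x] proj2_components(2)[OF x, of _ z]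
  by (auto simp: inner_add_left)

lemma proj2_orthogonal:
  assumes x: "x \<in> M"
  shows "(y - P x y) \<bullet> P x z = 0"
proof -
  have "(y - P x y) \<bullet> P x z = (\<Sum>i\<in>{1..n}. ((y - P x y) \<bullet> e i x) * (P x z \<bullet> e i x))"
    using expand(2)[OF x, of "y - P x y" "P x z"] proj2_components(1)[OF x, of z] by simp
  also have "\<dots> = 0"
  proof (rule sum.neutral, rule ballI)
    fix i assume i: "i \<in> {1..n}"
    show "((y - P x y) \<bullet> e i x) * (P x z \<bullet> e i x) = 0"
      unfolding inner_diff_left proj2_components(2)[OF x i] by simp
  qed
  finally show ?thesis .
qed

lemma pr_inner:
  assumes x: "x \<in> M"
  shows "pr z x \<bullet> y = (\<Sum>i\<in>{2..p+1}. (z \<bullet> e i x) * (e i x \<bullet> y)) + (z \<bullet> u x) * (u x \<bullet> y)"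
proof -
  have "P x z \<bullet> y = (\<Sum>i\<in>{1..n}. (P x z \<bullet> e i x) * (y \<bullet> e i x))"
    using expand(2)[OF x, of "P x z" y] proj2_components(1)[OF x, of z] by simp
  also have "\<dots> = (\<Sum>i\<in>{1..n}. if i \<in> {2..p+1} then (z \<bullet> e i x) * (e i x \<bullet> y) else 0)"
    by (rule sum.cong) (use proj2_components(2)[OF x, of _ z] in \<open>auto simp: inner_commute\<close>)
  also have "\<dots> = (\<Sum>i\<in>{1..n} \<inter> {2..p+1}. (z \<bullet> e i x) * (e i x \<bullet> y))"
    by (rule sum.inter_restrict[symmetric]) simp
  also have "{1..n} \<inter> {2..p+1} = {2..p+1}" using pq by auto
  finally show ?thesis by (simp add: inner_add_left)
qed

lemma pr_smooth: "smooth_along M (pr z)"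
proof (rule smooth_along_cong)
  show "smooth_along M (\<lambda>x. (\<Sum>i\<in>{2..p+1}. (z \<bullet> e i x) *\<^sub>R e i x) + (z \<bullet> u x) *\<^sub>R u x)"
    by (intro smooth_along_add smooth_along_sum smooth_along_scaleR smooth_along_inner smooth_along_const u_smooth e_smooth)
      (use pq in auto)
  show "(\<Sum>i\<in>{2..p+1}. (z \<bullet> e i x) *\<^sub>R e i x) + (z \<bullet> u x) *\<^sub>R u x = pr z x" if "x \<in> M" for x
    by (rule vector_eq_rdot[THEN iffD1], rule allI)
      (simp only: pr_inner[OF that], simp add: inner_add_left inner_sum_left)
qed

lemma D_pr:
  assumes x: "x \<in> M" and l: "l \<in> {1..n}"
  shows "D l (pr z) x = 0"
proof -
  have T: "e l x \<in> tangent_space M x" by (rule e_T[OF x l])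
  have complementary: "D l (pr z) x \<bullet> y x = 0"
    if y: "smooth_along M y" and 0: "!!x. x \<in> M ==> pr z x \<bullet> y x = 0"
      and Dy: "D l y x \<bullet> u x = 0" "!!i. i \<in> {2..p+1} ==> e i x \<bullet> D l y x = 0" for y
  proof -
    have "D l (\<lambda>x. pr z x \<bullet> y x) x = 0" by (rule D_zero[OF x l 0])
    moreover have "pr z x \<bullet> D l y x = 0" unfolding pr_inner[OF x] using Dy by (simp add: inner_commute)
    ultimately show ?thesis using tder_inner[OF x T pr_smooth y] by simp
  qed
  have parallel: "D l (pr z) x \<bullet> y x = (z - pr z x) \<bullet> D l y x"
    if y: "smooth_along M y" and 0: "!!x. x \<in> M ==> pr z x \<bullet> y x = z \<bullet> y x" for y
  proof -
    have "D l (\<lambda>x. pr z x \<bullet> y x) x = D l (\<lambda>x. z \<bullet> y x) x" by (rule D_cong[OF x 0])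
    then show ?thesis
      using tder_inner[OF x T pr_smooth y] tder_inner[OF x T smooth_along_const y] tder_const[OF x T, of z]
      by (simp add: inner_diff_left)
  qed
  have "D l (pr z) x \<bullet> u x = (z - pr z x) \<bullet> D l u x"
    by (rule parallel[OF u_smooth pr_components(1)])
  then have Du: "D l (pr z) x \<bullet> u x = 0"
    using D_u[OF x l] pr_components(3)[OF x, of l z] l by (simp add: inner_diff_left)
  have Dw: "D l (pr z) x \<bullet> w x = 0"
  proof (rule complementary[OF w_smooth pr_components(2)])
    show "D l w x \<bullet> u x = 0"
      using D_w[OF x l] uw_orthonormal(5)[OF x, of l] l pq by (auto simp: inner_commute)
    show "e i x \<bullet> D l w x = 0" if "i \<in> {2..p+1}" for i
      using D_w[OF x l] e_orthonormal[OF x _ l, of i] l that pq by auto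
  qed
  have De: "D l (pr z) x \<bullet> e j x = 0" if j: "j \<in> {2..n}" for j
  proof (cases "j <= p + 1")
    case True
    have jI: "j \<in> {1..n}" using j by auto
    let ?y = "z - pr z x"
    have y0: "?y \<bullet> e i x = 0" if "i \<in> {2..p+1}" for i
      using pr_components(3)[OF x, of i z] that pq by (simp add: inner_diff_left)
    have yu: "?y \<bullet> u x = 0" using pr_components(1)[OF x] by (simp add: inner_diff_left)
    have "D l (pr z) x \<bullet> e j x = ?y \<bullet> D l (e j) x"
      by (rule parallel[OF e_smooth[OF jI]]) (use pr_components(3)[OF _ j] True in simp)
    also have "\<dots> = (?y \<bullet> N x) * (D l (e j) x \<bullet> N x) + (\<Sum>i\<in>{1..n}. (?y \<bullet> e i x) * \<Gamma> l j i x)"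
      by (rule expand(2)[OF x])
    also have "(\<Sum>i\<in>{1..n}. (?y \<bullet> e i x) * \<Gamma> l j i x) = (\<Sum>i\<in>{1..n}. if i = 1 then (?y \<bullet> e 1 x) * \<Gamma> l j 1 x else 0)"
    proof (rule sum.cong)
      fix i assume i: "i \<in> {1..n}"
      show "(?y \<bullet> e i x) * \<Gamma> l j i x = (if i = 1 then (?y \<bullet> e 1 x) * \<Gamma> l j 1 x else 0)"
      proof (cases "i = 1 \<or> i <= p + 1")
        case True
        then show ?thesis using y0[of i] i by auto
      next
        case False
        then show ?thesis using \<Gamma>_mixed[OF x l j, of i] True i by auto
      qed
    qed simp
    also have "\<dots> = (?y \<bullet> e 1 x) * \<Gamma> l j 1 x" using I_simps(1) by simp
    also have "(?y \<bullet> N x) * (D l (e j) x \<bullet> N x) + (?y \<bullet> e 1 x) * \<Gamma> l j 1 x = 0"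
    proof (cases "l = j")
      case True2: True
      have "\<Gamma> l j 1 x = \<alpha> 2 x" "D l (e j) x \<bullet> N x = k 2 x"
        using True2 \<Gamma>_to_1[OF x j j] D_e_N[OF x jI jI] \<alpha>_class[OF x j] k_class[OF x j] True by simp_all
      moreover have "\<psi> x * ((?y \<bullet> N x) * k 2 x + (?y \<bullet> e 1 x) * \<alpha> 2 x) = - (?y \<bullet> u x)"
        unfolding dir2_def inner_diff_right inner_scaleR_right slope_def coslope_def leaf_curv_eq
        by (simp add: algebra_simps)
      then have "(?y \<bullet> N x) * k 2 x + (?y \<bullet> e 1 x) * \<alpha> 2 x = 0" using yu rad_pos[OF x] by simp
      ultimately show ?thesis by simp
    next
      case False
      have "\<Gamma> l j 1 x = 0"
      proof (cases "l = 1")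
        case True
        then show ?thesis using \<Gamma>_antisym[OF x l jI I_simps(1)] \<Gamma>_1_1[OF x j] by simp
      next
        case False2: False
        then have "l \<in> {2..n}" using l by auto
        then show ?thesis using \<Gamma>_to_1[OF x _ j] False by simp
      qed
      then show ?thesis using D_e_N[OF x l jI] False by simp
    qed
    finally show ?thesis .
  next
    case False
    have jI: "j \<in> {1..n}" using j by auto
    show ?thesis
    proof (rule complementary[OF e_smooth[OF jI]])
      show "pr z x \<bullet> e j x = 0" if "x \<in> M" for x using pr_components(3)[OF that j] False by simp
      show "e i x \<bullet> D l (e j) x = 0" if i: "i \<in> {2..p+1}" for i
        using \<Gamma>_mixed[OF x l j, of i] i False pq by (simp add: inner_commute)
      have "D l (\<lambda>x. e j x \<bullet> u x) x = 0"
        by (rule D_zero[OF x l]) (use uw_orthonormal(5)[OF _ j] in \<open>simp add: inner_commute\<close>)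
      moreover have "e j x \<bullet> D l u x = 0"
        using D_u[OF x l] e_orthonormal[OF x jI l] False by simp
      ultimately show "D l (e j) x \<bullet> u x = 0" using tder_inner[OF x T e_smooth[OF jI] u_smooth] by simp
    qed
  qed
  show ?thesis
  proof (rule eqI[OF x])
    show "D l (pr z) x \<bullet> N x = 0 \<bullet> N x"
      unfolding uw_orthonormal(8)[OF x] using Du Dw by (simp add: inner_diff_right)
    fix j assume j: "j \<in> {1..n}"
    show "D l (pr z) x \<bullet> e j x = 0 \<bullet> e j x"
    proof (cases "j = 1")
      case True
      show ?thesis unfolding True uw_orthonormal(7)[OF x] using Du Dw by (simp add: inner_add_right)
    next
      case False
      then show ?thesis using De[of j] j by simp
    qed
  qed
qed

lemma tder_pr: "x \<in> M ==> N x \<bullet> v = 0 ==> tder M (pr z) x v = 0"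
  using D_expand[OF pr_smooth, of x v z] D_pr[of x _ z] by simp

end

section \<open>Autonomous differential equations\<close>

lemma smooth_lipschitz_compact:
  fixes G :: "'s::euclidean_space => 's"
  assumes \<Omega>: "open \<Omega>" and G: "smooth_on \<Omega> G" and K: "compact K" "K \<subseteq> \<Omega>"
  obtains L where "L-lipschitz_on K G"
proof -
  define G' where "G' tx = Blinfun (frechet_derivative G (at (snd tx)))" for tx :: "real \<times> 's"
  have d: "(G has_derivative frechet_derivative G (at x)) (at x)" if "x \<in> \<Omega>" for x
    by (rule smooth_on_has_derivative[OF G that])
  have app: "blinfun_apply (G' (t, x)) = frechet_derivative G (at x)" if "x \<in> \<Omega>" for t x
    using has_derivative_bounded_linear[OF d[OF that]] by (simp add: G'_def bounded_linear_Blinfun_apply)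
  have "local_lipschitz UNIV \<Omega> (\<lambda>t::real. G)"
  proof (rule c1_implies_local_lipschitz[OF _ _ open_UNIV \<Omega>])
    show "(G has_derivative blinfun_apply (G' (t, x))) (at x)" if "x \<in> \<Omega>" for t x
      using d[OF that] by (simp add: app[OF that])
    show "continuous_on (UNIV \<times> \<Omega>) G'"
    proof (rule continuous_on_blinfun_componentwise)
      fix i :: 's assume "i \<in> Basis"
      have "continuous_on (UNIV \<times> \<Omega>) (\<lambda>tx :: real \<times> 's. frechet_derivative G (at (snd tx)) i)"
        by (rule continuous_on_compose2[OF smooth_on_continuous[OF smooth_on_derivative[OF G]]])
          (auto intro: continuous_intros)
      then show "continuous_on (UNIV \<times> \<Omega>) (\<lambda>tx. blinfun_apply (G' tx) i)"
        by (rule continuous_on_eq) (auto simp: app)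
    qed
  qed
  then have "local_lipschitz {0} K (\<lambda>t::real. G)"
    by (rule local_lipschitz_subset) (use K in auto)
  then obtain L where "!!t. t \<in> {0::real} ==> L-lipschitz_on K G"
    by (rule local_lipschitz_compact_implies_lipschitz[OF _ K(1), of "{0}"]) (auto simp: that)
  then show thesis using that by simp
qed

text \<open>Uniqueness for \<open>z' = w(t) G(z)\<close>, by the usual estimate of the squared distance.\<close>

lemma ode_path_unique:
  fixes G :: "'s::euclidean_space => 's"
  assumes \<Omega>: "open \<Omega>" and G: "smooth_on \<Omega> G" and w: "!!t. t \<in> {0..1} ==> \<bar>w t\<bar> <= W"
    and z1: "!!t. t \<in> {0..1} ==> z1 t \<in> \<Omega> \<and> (z1 has_vector_derivative w t *\<^sub>R G (z1 t)) (at t)"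
    and z2: "!!t. t \<in> {0..1} ==> z2 t \<in> \<Omega> \<and> (z2 has_vector_derivative w t *\<^sub>R G (z2 t)) (at t)"
    and eq: "z1 0 = z2 0"
  shows "z1 1 = z2 (1::real)"
proof -
  have c1: "continuous_on {0..1} z1" "continuous_on {0..1} z2"
    by (rule continuous_on_vector_derivative[OF has_vector_derivative_at_within],
        use z1 z2 in \<open>auto simp: has_vector_derivative_at_within\<close>)
      (rule continuous_on_vector_derivative[OF has_vector_derivative_at_within],
        use z1 z2 in \<open>auto simp: has_vector_derivative_at_within\<close>)
  define K where "K = z1 ` {0..1} \<union> z2 ` {0..1}"
  have "compact K" unfolding K_def by (intro compact_Un compact_continuous_image c1 compact_Icc)
  moreover have "K \<subseteq> \<Omega>" using z1 z2 by (auto simp: K_def)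
  ultimately obtain L where L: "L-lipschitz_on K G" by (rule smooth_lipschitz_compact[OF \<Omega> G])
  define C where "C = 2 * W * L"
  define d where "d t = (z1 t - z2 t) \<bullet> (z1 t - z2 t)" for t
  define d' where "d' t = 2 * (w t * ((z1 t - z2 t) \<bullet> (G (z1 t) - G (z2 t))))" for t
  have dd: "DERIV d t :> d' t" if t: "t \<in> {0..1}" for t
  proof -
    have "((\<lambda>t. z1 t - z2 t) has_derivative (\<lambda>h. h *\<^sub>R (w t *\<^sub>R G (z1 t) - w t *\<^sub>R G (z2 t)))) (at t)"
      using has_vector_derivative_diff[of z1 _ _ z2] z1[OF t] z2[OF t] by (simp add: has_vector_derivative_def)
    from has_derivative_inner[OF this this]
    show ?thesis unfolding d_def has_field_derivative_def
    proof (rule has_derivative_eq_rhs, intro ext)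
      fix h :: real
      have "u \<bullet> (h *\<^sub>R v) + (h *\<^sub>R v) \<bullet> u = h * (2 * (u \<bullet> v))" for u v :: 's
        by (simp add: inner_commute)
      moreover have "w t *\<^sub>R G (z1 t) - w t *\<^sub>R G (z2 t) = w t *\<^sub>R (G (z1 t) - G (z2 t))"
        by (simp add: scaleR_diff_right)
      ultimately show "(z1 t - z2 t) \<bullet> (h *\<^sub>R (w t *\<^sub>R G (z1 t) - w t *\<^sub>R G (z2 t))) +
          (h *\<^sub>R (w t *\<^sub>R G (z1 t) - w t *\<^sub>R G (z2 t))) \<bullet> (z1 t - z2 t) = d' t * h"
        by (simp add: d'_def inner_commute)
    qed
  qed
  have dle: "d' t <= C * d t" if t: "t \<in> {0..1}" for t
  proof -
    have "dist (G (z1 t)) (G (z2 t)) <= L * dist (z1 t) (z2 t)"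
      by (rule lipschitz_onD[OF L]) (use t in \<open>auto simp: K_def\<close>)
    then have 1: "norm (G (z1 t) - G (z2 t)) <= L * norm (z1 t - z2 t)" by (simp add: dist_norm)
    have "d' t <= 2 * (\<bar>w t\<bar> * (norm (z1 t - z2 t) * norm (G (z1 t) - G (z2 t))))"
    proof -
      have "w t * ((z1 t - z2 t) \<bullet> (G (z1 t) - G (z2 t))) <= \<bar>w t\<bar> * \<bar>(z1 t - z2 t) \<bullet> (G (z1 t) - G (z2 t))\<bar>"
        by (simp add: abs_mult[symmetric])
      also have "\<dots> <= \<bar>w t\<bar> * (norm (z1 t - z2 t) * norm (G (z1 t) - G (z2 t)))"
        by (intro mult_left_mono Cauchy_Schwarz_ineq2) simp
      finally show ?thesis by (simp add: d'_def)
    qed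
    also have "\<dots> <= 2 * (W * (norm (z1 t - z2 t) * (L * norm (z1 t - z2 t))))"
      using w[OF t] 1 by (intro mult_left_mono mult_mono) auto
    also have "\<dots> = C * d t" by (simp add: C_def d_def power2_norm_eq_inner[symmetric] power2_eq_square)
    finally show ?thesis .
  qed
  have "d 1 * exp (- C * 1) <= d 0 * exp (- C * 0)"
  proof (rule DERIV_nonpos_imp_nonincreasing[of 0 1 "\<lambda>t. d t * exp (- C * t)"])
    fix t :: real assume t: "0 <= t" "t <= 1"
    have "((\<lambda>t. d t * exp (- C * t)) has_real_derivative (d' t * exp (- C * t) + d t * (exp (- C * t) * (- C)))) (at t)"
      using dd[of t] t by (auto intro!: derivative_eq_intros)
    moreover have "d' t * exp (- C * t) + d t * (exp (- C * t) * (- C)) = (d' t - C * d t) * exp (- C * t)"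
      by (simp add: algebra_simps)
    moreover have "\<dots> <= 0" using dle[of t] t by (simp add: mult_nonpos_nonneg)
    ultimately show "\<exists>y. DERIV (\<lambda>t. d t * exp (- C * t)) t :> y \<and> y <= 0" by (metis (no_types))
  qed simp
  then have "d 1 * exp (- C) <= 0" by (simp add: d_def eq)
  then have "d 1 <= 0" by (simp add: mult_le_0_iff)
  then have "(z1 1 - z2 1) \<bullet> (z1 1 - z2 1) = 0"
    using inner_ge_zero[of "z1 1 - z2 1"] by (simp add: d_def del: inner_ge_zero)
  then show ?thesis by simp
qed

definition solves :: "('s::euclidean_space => 's) => 's set => (real => 's) => real set => bool" where
  "solves G \<Omega> z I \<longleftrightarrow> open I \<and> is_interval I \<and> (\<forall>s\<in>I. z s \<in> \<Omega> \<and> (z has_vector_derivative G (z s)) (at s))"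

lemma solvesD:
  "solves G \<Omega> z I ==> s \<in> I ==> z s \<in> \<Omega>"
  "solves G \<Omega> z I ==> s \<in> I ==> (z has_vector_derivative G (z s)) (at s)"
  "solves G \<Omega> z I ==> open I" "solves G \<Omega> z I ==> is_interval I"
  by (simp_all add: solves_def)

lemma interval_affine:
  assumes "is_interval (I :: real set)" "s0 \<in> I" "s \<in> I" "t \<in> {0..1}"
  shows "s0 + t * (s - s0) \<in> I"
proof -
  have "convex I" using assms(1) by (simp add: is_interval_convex_1)
  from convexD[OF this assms(2,3), of "1 - t" t] assms(4) show ?thesis by (simp add: algebra_simps)
qed

lemma solves_unique:
  assumes \<Omega>: "open \<Omega>" and G: "smooth_on \<Omega> G" and z: "solves G \<Omega> z1 I" "solves G \<Omega> z2 J"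
    and s: "s0 \<in> I \<inter> J" "z1 s0 = z2 s0" "s \<in> I \<inter> J"
  shows "z1 s = z2 s"
proof -
  have *: "z (s0 + t * (s - s0)) \<in> \<Omega> \<and> ((\<lambda>t. z (s0 + t * (s - s0))) has_vector_derivative (s - s0) *\<^sub>R G (z (s0 + t * (s - s0)))) (at t)"
    if z: "solves G \<Omega> z I" and I: "s0 \<in> I" "s \<in> I" and t: "t \<in> {0..1}" for z I t
  proof -
    have i: "s0 + t * (s - s0) \<in> I" by (rule interval_affine[OF solvesD(4)[OF z] I t])
    have "((\<lambda>t. s0 + t * (s - s0)) has_vector_derivative (s - s0)) (at t)"
      by (auto intro!: derivative_eq_intros)
    from vector_diff_chain_at[OF this solvesD(2)[OF z i]] show ?thesis using solvesD(1)[OF z i] by (simp add: o_def)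
  qed
  have "(\<lambda>t. z1 (s0 + t * (s - s0))) 1 = (\<lambda>t. z2 (s0 + t * (s - s0))) 1"
  proof (rule ode_path_unique[OF \<Omega> G, of "\<lambda>t. s - s0" "\<bar>s - s0\<bar>"])
    show "z1 (s0 + t * (s - s0)) \<in> \<Omega> \<and> ((\<lambda>t. z1 (s0 + t * (s - s0))) has_vector_derivative (s - s0) *\<^sub>R G (z1 (s0 + t * (s - s0)))) (at t)"
      if "t \<in> {0..1}" for t using *[OF z(1) _ _ that] s by blast
    show "z2 (s0 + t * (s - s0)) \<in> \<Omega> \<and> ((\<lambda>t. z2 (s0 + t * (s - s0))) has_vector_derivative (s - s0) *\<^sub>R G (z2 (s0 + t * (s - s0)))) (at t)"
      if "t \<in> {0..1}" for t using *[OF z(2) _ _ that] s by blast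
  qed (use s in auto)
  then show ?thesis by simp
qed

lemma interval_Un:
  assumes "is_interval (I :: real set)" "is_interval J" "s \<in> I \<inter> J" shows "is_interval (I \<union> J)"
proof -
  have "connected (I \<union> J)"
    by (rule connected_Un) (use assms is_interval_connected in auto)
  then show ?thesis by (simp add: is_interval_connected_1)
qed

lemma solves_glue:
  assumes \<Omega>: "open \<Omega>" and G: "smooth_on \<Omega> G" and z: "solves G \<Omega> z1 I" "solves G \<Omega> z2 J"
    and s: "s0 \<in> I \<inter> J" "z1 s0 = z2 s0"
  shows "solves G \<Omega> (\<lambda>s. if s \<in> I then z1 s else z2 s) (I \<union> J)"
proof -
  let ?z = "\<lambda>s. if s \<in> I then z1 s else z2 s"
  have zJ: "?z s = z2 s" if "s \<in> J" for s
    using solves_unique[OF \<Omega> G z s, of s] that by auto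
  have "?z s \<in> \<Omega> \<and> (?z has_vector_derivative G (?z s)) (at s)" if "s \<in> I \<union> J" for s
  proof (cases "s \<in> I")
    case True
    have "(?z has_vector_derivative G (z1 s)) (at s)"
      by (rule has_vector_derivative_transform_within_open[OF solvesD(2)[OF z(1) True] solvesD(3)[OF z(1)] True]) simp
    then show ?thesis using solvesD(1)[OF z(1) True] True by simp
  next
    case False
    then have J: "s \<in> J" using that by simp
    have "(?z has_vector_derivative G (z2 s)) (at s)"
      by (rule has_vector_derivative_transform_within_open[OF solvesD(2)[OF z(2) J] solvesD(3)[OF z(2)] J])
        (rule zJ[symmetric])
    then show ?thesis using solvesD(1)[OF z(2) J] False by simp
  qed
  then show ?thesis
    using solvesD(3)[OF z(1)] solvesD(3)[OF z(2)] interval_Un[OF solvesD(4)[OF z(1)] solvesD(4)[OF z(2)] s(1)]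
    by (auto simp: solves_def)
qed

lemma solves_shift:
  assumes z: "solves G \<Omega> z I"
  shows "solves G \<Omega> (\<lambda>s. z (s + r)) {s. s + r \<in> I}"
  unfolding solves_def
proof (intro conjI ballI)
  have e: "{s. s + r \<in> I} = (\<lambda>s. s + r) -` I" by auto
  show "open {s. s + r \<in> I}" unfolding e
    by (rule continuous_open_vimage[OF solvesD(3)[OF z]]) simp
  show "is_interval {s. s + r \<in> I}"
    unfolding is_interval_1
  proof (intro ballI allI impI)
    fix a b x assume "a \<in> {s. s + r \<in> I}" "b \<in> {s. s + r \<in> I}" "a <= x \<and> x <= b"
    then show "x \<in> {s. s + r \<in> I}"
      using solvesD(4)[OF z, unfolded is_interval_1, rule_format, of "a + r" "b + r" "x + r"] by simp
  qed
  fix s assume s: "s \<in> {s. s + r \<in> I}"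
  show "z (s + r) \<in> \<Omega>" using solvesD(1)[OF z] s by simp
  have "((\<lambda>s. s + r) has_vector_derivative 1) (at s)" by (auto intro!: derivative_eq_intros)
  from vector_diff_chain_at[OF this, of z "G (z (s + r))"] solvesD(2)[OF z, of "s + r"] s
  show "((\<lambda>s. z (s + r)) has_vector_derivative G (z (s + r))) (at s)" by (simp add: o_def)
qed

text \<open>All solutions with a given initial value are restrictions of a single one.\<close>

lemma maximal_solution:
  assumes \<Omega>: "open \<Omega>" and G: "smooth_on \<Omega> G" and z0: "solves G \<Omega> z0 I0" "0 \<in> I0"
  obtains Z I where "solves G \<Omega> Z I" "0 \<in> I" "Z 0 = z0 0"
    "!!z J s. solves G \<Omega> z J ==> s \<in> I \<inter> J ==> z s = Z s ==> J \<subseteq> I \<and> (\<forall>t\<in>J. z t = Z t)"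
proof -
  define F where "F = {(z, J). solves G \<Omega> z J \<and> 0 \<in> J \<and> z 0 = z0 0}"
  define I where "I = (\<Union>(z, J)\<in>F. J)"
  define Z where "Z s = (SOME y. \<exists>z J. (z, J) \<in> F \<and> s \<in> J \<and> y = z s)" for s
  have Z_eq: "Z s = z s" if zJ: "(z, J) \<in> F" and s: "s \<in> J" for z J s
  proof -
    have "\<exists>y z J. (z, J) \<in> F \<and> s \<in> J \<and> y = z s" using zJ s by blast
    then have "\<exists>z J. (z, J) \<in> F \<and> s \<in> J \<and> Z s = z s" unfolding Z_def by (rule someI_ex)
    then obtain z' J' where z': "(z', J') \<in> F" "s \<in> J'" "Z s = z' s" by blast
    have "z' s = z s"
      by (rule solves_unique[OF \<Omega> G, of z' J' z J 0]) (use z' zJ s in \<open>auto simp: F_def\<close>)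
    then show ?thesis using z'(3) by simp
  qed
  have FI: "J \<subseteq> I" if "(z, J) \<in> F" for z J using that by (auto simp: I_def)
  have 0: "(z0, I0) \<in> F" using z0 by (simp add: F_def)
  have ZI: "solves G \<Omega> Z I"
    unfolding solves_def
  proof (intro conjI ballI)
    show "open I" unfolding I_def by (rule open_UN) (auto simp: F_def solves_def)
    have "connected I" unfolding I_def
    proof (rule connected_Union)
      show "connected S" if "S \<in> (\<lambda>(z, J). J) ` F" for S
        using that by (auto simp: F_def solves_def is_interval_connected)
      have "0 \<in> \<Inter> ((\<lambda>(z, J). J) ` F)" by (auto simp: F_def)
      then show "\<Inter> ((\<lambda>(z, J). J) ` F) ~= {}" by blast
    qed
    then show "is_interval I" by (simp add: is_interval_connected_1)
    fix s assume "s \<in> I"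
    then obtain z J where zJ: "(z, J) \<in> F" "s \<in> J" by (auto simp: I_def)
    have z: "solves G \<Omega> z J" using zJ(1) by (simp add: F_def)
    show "Z s \<in> \<Omega>" using solvesD(1)[OF z zJ(2)] Z_eq[OF zJ] by simp
    have "(Z has_vector_derivative G (z s)) (at s)"
      by (rule has_vector_derivative_transform_within_open[OF solvesD(2)[OF z zJ(2)] solvesD(3)[OF z] zJ(2)])
        (rule Z_eq[OF zJ(1), symmetric])
    then show "(Z has_vector_derivative G (Z s)) (at s)" using Z_eq[OF zJ] by simp
  qed
  have I0: "0 \<in> I" using FI[OF 0] z0(2) by blast
  have Z0: "Z 0 = z0 0" by (rule Z_eq[OF 0 z0(2)])
  show thesis
  proof (rule that[OF ZI I0 Z0])
    fix z J s assume z: "solves G \<Omega> z J" and s: "s \<in> I \<inter> J" "z s = Z s"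
    have "solves G \<Omega> (\<lambda>s. if s \<in> I then Z s else z s) (I \<union> J)"
      by (rule solves_glue[OF \<Omega> G ZI z s(1) s(2)[symmetric]])
    then have "((\<lambda>s. if s \<in> I then Z s else z s), I \<union> J) \<in> F" using I0 Z0 by (simp add: F_def)
    then have J: "J \<subseteq> I" using FI by blast
    then show "J \<subseteq> I \<and> (\<forall>t\<in>J. z t = Z t)"
      using solves_unique[OF \<Omega> G z ZI, of s] s by blast
  qed
qed

lemma solves_smooth:
  assumes \<Omega>: "open \<Omega>" and G: "smooth_on \<Omega> G" and z: "solves G \<Omega> z I"
  shows "smooth_on I z"
  unfolding smooth_on_def
proof
  note I = solvesD(3)[OF z]
  fix m show "C_on m I z"
  proof (induction m)
    case 0
    show ?case
      using continuous_on_vector_derivative[of I z "\<lambda>s. G (z s)"] solvesD(2)[OF z]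
      by (simp add: has_vector_derivative_at_within)
  next
    case (Suc m)
    have "C_on m I (\<lambda>s. G (z s))"
      by (rule C_on_compose[OF I \<Omega> _ smooth_onD[OF G] Suc]) (use solvesD(1)[OF z] in auto)
    then have d: "C_on m I (\<lambda>s. h *\<^sub>R G (z s))" for h
      by (rule C_on_scaleR[OF I C_on_const])
    show ?case
      by (rule C_on_SucI[OF I solvesD(2)[OF z, unfolded has_vector_derivative_def] d])
  qed
qed

text \<open>
  A map whose derivative at \<open>x\<close> in direction \<open>v\<close> is \<open>(v \<bullet> E) G\<close> follows a single integral curve
  of \<open>G\<close>, even when \<open>M\<close> carries no global arc length along \<open>E\<close>.
\<close>

context hypersurface
begin

context
  fixes E :: "'a => 'a" and Y :: "'a => 's::euclidean_space" and G :: "'s => 's" and \<Omega>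
  assumes E: "smooth_along M E" "!!x. x \<in> M ==> N x \<bullet> E x = 0" "!!x. x \<in> M ==> E x \<bullet> E x = 1"
    and Om: "open \<Omega>" and G: "smooth_on \<Omega> G"
    and Y: "smooth_along M Y" "!!x. x \<in> M ==> Y x \<in> \<Omega>"
    and DY: "!!x v. x \<in> M ==> N x \<bullet> v = 0 ==> tder M Y x v = (v \<bullet> E x) *\<^sub>R G (Y x)"
begin

lemma along_curve:
  assumes c: "(c has_vector_derivative v) (at t)" and S: "open S" "t \<in> S" "!!s. s \<in> S ==> c s \<in> M"
  shows "((\<lambda>s. Y (c s)) has_vector_derivative (v \<bullet> E (c t)) *\<^sub>R G (Y (c t))) (at t)"
proof -
  have "N (c t) \<bullet> v = 0"
    using velocity_tangent[OF c S] tangent_iff[of "c t"] S by simp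
  then show ?thesis using has_derivative_along_curve[OF c S Y(1)] DY[of "c t" v] S by simp
qed

lemma local_integral_curve:
  assumes x: "x \<in> M"
  obtains \<zeta> r where "r > 0" "solves G \<Omega> \<zeta> {-r<..<r}" "\<zeta> 0 = Y x"
proof -
  have "E x \<in> tangent_space M x" using E(2)[OF x] tangent_iff[OF x] by simp
  then obtain \<gamma> \<epsilon> where g: "\<epsilon> > 0" "smooth_on {-\<epsilon><..<\<epsilon>} \<gamma>" "\<gamma> ` {-\<epsilon><..<\<epsilon>} \<subseteq> M" "\<gamma> 0 = x"
    "(\<gamma> has_vector_derivative E x) (at (0::real))"
    unfolding tangent_space_def by (simp, elim exE conjE)
  let ?S = "{-\<epsilon><..<\<epsilon>}"
  define \<gamma>' where "\<gamma>' t = frechet_derivative \<gamma> (at t) 1" for t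
  have gd: "(\<gamma> has_vector_derivative \<gamma>' t) (at t)" if "t \<in> ?S" for t
  proof -
    have d: "(\<gamma> has_derivative frechet_derivative \<gamma> (at t)) (at t)" by (rule smooth_on_has_derivative[OF g(2) that])
    have eq: "frechet_derivative \<gamma> (at t) = (\<lambda>h. h *\<^sub>R \<gamma>' t)"
    proof
      show "frechet_derivative \<gamma> (at t) h = h *\<^sub>R \<gamma>' t" for h
        unfolding \<gamma>'_def using linear_scale[OF has_derivative_linear[OF d], of h 1] by simp
    qed
    show ?thesis using d unfolding eq has_vector_derivative_def .
  qed
  have gM: "\<gamma> t \<in> M" if "t \<in> ?S" for t using g(3) that by blast
  have "\<gamma>' 0 = E x" using vector_derivative_unique_at[OF gd g(5)] g(1) by simp
  define w where "w t = \<gamma>' t \<bullet> E (\<gamma> t)" for t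
  have w0: "w 0 = 1" by (simp add: w_def \<open>\<gamma>' 0 = E x\<close> g(4) E(3)[OF x])
  have wc: "continuous_on ?S w"
    unfolding w_def \<gamma>'_def
  proof (intro continuous_on_inner)
    show "continuous_on ?S (\<lambda>t. frechet_derivative \<gamma> (at t) 1)"
      by (rule smooth_on_continuous[OF smooth_on_derivative[OF g(2)]])
    show "continuous_on ?S (\<lambda>t. E (\<gamma> t))"
      by (rule continuous_on_compose2[OF smooth_along_continuous_on[OF E(1)] smooth_on_continuous[OF g(2)] g(3)])
  qed
  obtain d where d: "d > 0" "d < \<epsilon>" "!!t. \<bar>t\<bar> <= d ==> w t > 0"
  proof -
    have "0 \<in> ?S" using g(1) by simp
    then obtain d' where d': "d' > 0" "!!t. t \<in> ?S ==> dist t 0 < d' ==> dist (w t) (w 0) < 1"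
      using wc[unfolded continuous_on_iff, rule_format, of 0 1] by auto
    define d where "d = min (d' / 2) (\<epsilon> / 2)"
    have "w t > 0" if "\<bar>t\<bar> <= d" for t
    proof -
      have "dist (w t) (w 0) < 1" by (rule d'(2)) (use that d'(1) g(1) in \<open>auto simp: d_def\<close>)
      then show ?thesis by (simp add: w0 dist_real_def abs_if split: if_splits)
    qed
    moreover have "d > 0" "d < \<epsilon>" using d'(1) g(1) by (auto simp: d_def)
    ultimately show thesis using that by blast
  qed
  have sub: "{-d..d} \<subseteq> ?S" using d by auto
  obtain \<sigma>' where s': "!!t. t \<in> {-d..d} ==> (\<sigma>' has_vector_derivative w t) (at t within {-d..d})"
    by (rule antiderivative_continuous[OF continuous_on_subset[OF wc sub]], rule that)
  define \<sigma> where "\<sigma> t = \<sigma>' t - \<sigma>' 0" for t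
  have sd: "DERIV \<sigma> t :> w t" if "t \<in> {-d<..<d}" for t
  proof -
    have "(\<sigma>' has_vector_derivative w t) (at t)"
      using s'[of t] that at_within_interior[of t "{-d..d}"] by (simp add: interior_atLeastAtMost_real)
    then have "DERIV \<sigma>' t :> w t" by (simp add: has_real_derivative_iff_has_vector_derivative)
    then show ?thesis unfolding \<sigma>_def by (auto intro!: derivative_eq_intros)
  qed
  define e where "e = d / 2"
  have e: "e > 0" "e < d" using d(1) by (auto simp: e_def)
  have mono: "\<sigma> s < \<sigma> t" if "- e <= s" "s < t" "t <= e" for s t
  proof (rule DERIV_pos_imp_increasing[OF that(2)])
    fix y assume "s <= y" "y <= t"
    then have y: "y \<in> {-d<..<d}" "\<bar>y\<bar> <= d" using that e by auto
    show "\<exists>D. DERIV \<sigma> y :> D \<and> D > 0" by (rule exI[of _ "w y"]) (simp add: sd[OF y(1)] d(3)[OF y(2)])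
  qed
  have cont: "isCont \<sigma> t" if "\<bar>t\<bar> <= e" for t
    by (rule DERIV_isCont[OF sd]) (use that e in auto)
  have s0: "\<sigma> 0 = 0" by (simp add: \<sigma>_def)
  define r where "r = min (\<sigma> e) (- \<sigma> (- e))"
  have r: "r > 0" using mono[of 0 e] mono[of "-e" 0] e s0 by (simp add: r_def)
  have surj: "\<exists>t. -e < t \<and> t < e \<and> \<sigma> t = y" if y: "y \<in> {-r<..<r}" for y
  proof -
    have "\<sigma> (-e) <= y" "y <= \<sigma> e" using y by (auto simp: r_def)
    moreover have "\<forall>x. - e <= x \<and> x <= e --> isCont \<sigma> x" using cont by (simp add: abs_le_iff)
    ultimately obtain t where t: "-e <= t" "t <= e" "\<sigma> t = y"
      using IVT[of \<sigma> "-e" y e] e by auto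
    have "t ~= e" "t ~= -e" using t(3) y by (auto simp: r_def)
    then show ?thesis using t by (intro exI[of _ t]) auto
  qed
  define \<tau> where "\<tau> y = (THE t. -e <= t \<and> t <= e \<and> \<sigma> t = y)" for y
  have tau_s: "\<tau> (\<sigma> t) = t" if "-e <= t" "t <= e" for t
    unfolding \<tau>_def
  proof (rule the_equality)
    show "-e <= t \<and> t <= e \<and> \<sigma> t = \<sigma> t" using that by simp
    show "t' = t" if "-e <= t' \<and> t' <= e \<and> \<sigma> t' = \<sigma> t" for t'
    proof (rule ccontr)
      assume "t' ~= t"
      then consider "t < t'" | "t' < t" by linarith
      then show False using mono[of t t'] mono[of t' t] that \<open>-e <= t\<close> \<open>t <= e\<close> by cases simp_all
    qed
  qed
  have s_tau: "\<sigma> (\<tau> y) = y \<and> -e < \<tau> y \<and> \<tau> y < e" if y: "y \<in> {-r<..<r}" for y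
  proof -
    obtain t where t: "-e < t" "t < e" "\<sigma> t = y" using surj[OF y] by blast
    then show ?thesis using tau_s[of t] by simp
  qed
  have tau_d: "DERIV \<tau> y :> inverse (w (\<tau> y))" if y: "y \<in> {-r<..<r}" for y
  proof (rule DERIV_inverse_function[of \<sigma>])
    note st = s_tau[OF y]
    show "DERIV \<sigma> (\<tau> y) :> w (\<tau> y)" by (rule sd) (use st e in auto)
    show "w (\<tau> y) ~= 0" using d(3)[of "\<tau> y"] st e by (auto simp: abs_le_iff)
    show "-r < y" "y < r" using y by auto
    show "\<sigma> (\<tau> y) = y" if "-r < y" "y < r" for y using s_tau[of y] that by simp
    have "isCont \<tau> (\<sigma> (\<tau> y))"
      by (rule isCont_inverse_function2[of "-e" "\<tau> y" e]) (use st tau_s cont in auto)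
    then show "isCont \<tau> y" using st by simp
  qed
  define \<zeta> where "\<zeta> y = Y (\<gamma> (\<tau> y))" for y
  show thesis
  proof (rule that[OF r, of \<zeta>])
    show "\<zeta> 0 = Y x" using tau_s[of 0] e s0 g(4) by (simp add: \<zeta>_def)
    show "solves G \<Omega> \<zeta> {-r<..<r}"
      unfolding solves_def
    proof (intro conjI ballI)
      show "open {-r<..<r}" "is_interval {-r<..<r}" by (auto simp: is_interval_1)
      fix y assume y: "y \<in> {-r<..<r}"
      have tS: "\<tau> y \<in> ?S" using s_tau[OF y] e d by auto
      show "\<zeta> y \<in> \<Omega>" unfolding \<zeta>_def by (rule Y(2)[OF gM[OF tS]])
      have 1: "((\<lambda>t. Y (\<gamma> t)) has_vector_derivative w (\<tau> y) *\<^sub>R G (Y (\<gamma> (\<tau> y)))) (at (\<tau> y))"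
        unfolding w_def by (rule along_curve[OF gd[OF tS] _ tS gM]) auto
      have "(\<tau> has_vector_derivative inverse (w (\<tau> y))) (at y)"
        using tau_d[OF y] by (simp add: has_real_derivative_iff_has_vector_derivative)
      from vector_diff_chain_at[OF this 1]
      have "(\<zeta> has_vector_derivative inverse (w (\<tau> y)) *\<^sub>R w (\<tau> y) *\<^sub>R G (\<zeta> y)) (at y)"
        by (simp add: \<zeta>_def[abs_def] o_def)
      moreover have "w (\<tau> y) > 0" using d(3)[of "\<tau> y"] s_tau[OF y] e by (auto simp: abs_le_iff)
      ultimately show "(\<zeta> has_vector_derivative G (\<zeta> y)) (at y)" by simp
    qed
  qed
qed

lemma near_integral_curve:
  assumes x: "x \<in> M" and \<zeta>: "solves G \<Omega> \<zeta> J" "s \<in> J" "\<zeta> s = Y x" and r: "r > 0"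
  obtains d where "d > 0" "!!y. y \<in> M ==> dist y x < d ==> \<exists>s'\<in>J. \<bar>s' - s\<bar> < r \<and> \<zeta> s' = Y y"
proof -
  obtain r' where r': "r' > 0" "ball s r' \<subseteq> J" using solvesD(3)[OF \<zeta>(1)] \<zeta>(2) open_contains_ball by metis
  define m where "m = min r r'"
  have m: "m > 0" using r r' by (simp add: m_def)
  obtain d B where d: "d > 0" and B: "B >= 0"
    and path: "!!y. y \<in> M ==> dist y x < d ==> \<exists>c c'. c 0 = x \<and> c 1 = y \<and> continuous_on {-2<..<2::real} c' \<and>
      (\<forall>t\<in>{-2<..<2}. c t \<in> M \<and> (c has_vector_derivative c' t) (at t) \<and> norm (c' t) <= B * dist y x)"
    by (rule local_paths[OF x]) simp
  define d1 where "d1 = min d (m / (2 * (B + 1)))"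
  have d1: "d1 > 0" using d m B by (simp add: d1_def)
  show thesis
  proof (rule that[OF d1])
    fix y assume y: "y \<in> M" "dist y x < d1"
    then obtain c c' where c: "c 0 = x" "c 1 = y" "continuous_on {-2<..<2::real} c'"
      "!!t. t \<in> {-2<..<2} ==> c t \<in> M \<and> (c has_vector_derivative c' t) (at t) \<and> norm (c' t) <= B * dist y x"
      using path[of y] by (auto simp: d1_def)
    define w where "w t = c' t \<bullet> E (c t)" for t
    have small: "B * dist y x < m / 2"
    proof -
      have "B * dist y x <= B * d1" using y(2) B by (intro mult_left_mono) auto
      also have "\<dots> <= B * (m / (2 * (B + 1)))" using B by (intro mult_left_mono) (auto simp: d1_def)
      also have "\<dots> < m / 2" using B m by (simp add: field_simps)
      finally show ?thesis .
    qed
    have wb: "\<bar>w t\<bar> <= B * dist y x" if "t \<in> {-2<..<2}" for t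
    proof -
      have "\<bar>w t\<bar> <= norm (c' t) * norm (E (c t))" unfolding w_def by (rule Cauchy_Schwarz_ineq2)
      also have "norm (E (c t)) = 1" using E(3)[of "c t"] c(4)[OF that] by (simp add: norm_eq_1)
      finally show ?thesis using c(4)[OF that] by simp
    qed
    have cc: "continuous_on {-2<..<2} c"
      by (rule continuous_on_vector_derivative[of _ _ c']) (use c(4) in \<open>simp add: has_vector_derivative_at_within\<close>)
    have wc: "continuous_on {-2<..<2} w"
      unfolding w_def
      by (intro continuous_on_inner c(3) continuous_on_compose2[OF smooth_along_continuous_on[OF E(1)] cc])
        (use c(4) in auto)
    have sub: "{-1..3/2} \<subseteq> {-2<..<2::real}" by auto
    obtain \<sigma>' where s': "!!t. t \<in> {-1..3/2} ==> (\<sigma>' has_vector_derivative w t) (at t within {-1..3/2})"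
      by (rule antiderivative_continuous[OF continuous_on_subset[OF wc sub]], rule that)
    define \<sigma> where "\<sigma> t = s + (\<sigma>' t - \<sigma>' 0)" for t
    have sd: "DERIV \<sigma> t :> w t" if "t \<in> {0..1}" for t
    proof -
      have "(\<sigma>' has_vector_derivative w t) (at t)"
        using s'[of t] that at_within_interior[of t "{-1..3/2}"] by (simp add: interior_atLeastAtMost_real)
      then have "DERIV \<sigma>' t :> w t" by (simp add: has_real_derivative_iff_has_vector_derivative)
      then show ?thesis unfolding \<sigma>_def by (auto intro!: derivative_eq_intros)
    qed
    have sb: "\<bar>\<sigma> t - s\<bar> < m" if t: "t \<in> {0..1}" for t
    proof (cases "t = 0")
      case True
      then show ?thesis using m by (simp add: \<sigma>_def)
    next
      case False
      then have "0 < t" using t by simp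
      then obtain z where z: "0 < z" "z < t" "\<sigma> t - \<sigma> 0 = (t - 0) * w z"
        using MVT2[of 0 t \<sigma> w] sd t by auto
      have "\<bar>\<sigma> t - \<sigma> 0\<bar> = t * \<bar>w z\<bar>" using z t by (simp add: abs_mult)
      also have "\<dots> <= 1 * (B * dist y x)" using t z wb[of z] by (intro mult_mono) auto
      finally show ?thesis using small m by (simp add: \<sigma>_def)
    qed
    have inJ: "\<sigma> t \<in> J" if "t \<in> {0..1}" for t
      using sb[OF that] r'(2) by (auto simp: m_def dist_real_def abs_minus_commute subset_iff)
    have "(\<lambda>t. Y (c t)) 1 = (\<lambda>t. \<zeta> (\<sigma> t)) 1"
    proof (rule ode_path_unique[OF Om G, of w "B * dist y x"])
      fix t :: real assume t: "t \<in> {0..1}"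
      have t2: "t \<in> {-2<..<2}" using t by simp
      show "\<bar>w t\<bar> <= B * dist y x" by (rule wb[OF t2])
      show "Y (c t) \<in> \<Omega> \<and> ((\<lambda>t. Y (c t)) has_vector_derivative w t *\<^sub>R G (Y (c t))) (at t)"
        unfolding w_def using along_curve[of c "c' t" t "{-2<..<2}"] c(4) t2 Y(2) by simp
      have "(\<sigma> has_vector_derivative w t) (at t)"
        using sd[OF t] by (simp add: has_real_derivative_iff_has_vector_derivative)
      from vector_diff_chain_at[OF this solvesD(2)[OF \<zeta>(1) inJ[OF t]]]
      show "\<zeta> (\<sigma> t) \<in> \<Omega> \<and> ((\<lambda>t. \<zeta> (\<sigma> t)) has_vector_derivative w t *\<^sub>R G (\<zeta> (\<sigma> t))) (at t)"
        using solvesD(1)[OF \<zeta>(1) inJ[OF t]] by (simp add: o_def)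
    qed (simp add: c(1) \<sigma>_def \<zeta>(3))
    then have "\<zeta> (\<sigma> 1) = Y y" using c(2) by simp
    then show "\<exists>s'\<in>J. \<bar>s' - s\<bar> < r \<and> \<zeta> s' = Y y"
      using sb[of 1] inJ[of 1] by (intro bexI[of _ "\<sigma> 1"]) (auto simp: m_def)
  qed
qed

lemma single_integral_curve:
  assumes conn: "connected M" "M ~= {}"
  obtains Z I where "solves G \<Omega> Z I" "!!x. x \<in> M ==> \<exists>s\<in>I. Z s = Y x"
proof -
  obtain x0 where x0: "x0 \<in> M" using conn(2) by blast
  obtain \<zeta>0 r0 where z0: "r0 > 0" "solves G \<Omega> \<zeta>0 {-r0<..<r0}" "\<zeta>0 0 = Y x0"
    by (rule local_integral_curve[OF x0])
  have 0: "0 \<in> {-r0<..<r0}" using z0(1) by simp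
  obtain Z I where Z: "solves G \<Omega> Z I" "0 \<in> I" "Z 0 = \<zeta>0 0"
    and max: "!!z J s. solves G \<Omega> z J ==> s \<in> I \<inter> J ==> z s = Z s ==> J \<subseteq> I \<and> (\<forall>t\<in>J. z t = Z t)"
    by (rule maximal_solution[OF Om G z0(2) 0], rule that)
  have "\<exists>s\<in>I. Z s = Y x" if x: "x \<in> M" for x
  proof (rule connected_induction_simple[OF conn(1) x0 x, of "\<lambda>x. \<exists>s\<in>I. Z s = Y x"])
    show "\<exists>s\<in>I. Z s = Y x0" using Z z0 by auto
    fix a assume a: "a \<in> M"
    obtain \<zeta> r where z: "r > 0" "solves G \<Omega> \<zeta> {-r<..<r}" "\<zeta> 0 = Y a"
      by (rule local_integral_curve[OF a])
    have 0: "0 \<in> {-r<..<r}" using z(1) by simp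
    obtain d where d: "d > 0" "!!y. y \<in> M ==> dist y a < d ==> \<exists>s'\<in>{-r<..<r}. \<bar>s' - 0\<bar> < r \<and> \<zeta> s' = Y y"
      by (rule near_integral_curve[OF a z(2) 0 z(3) z(1)], rule that)
    show "\<exists>T. openin (top_of_set M) T \<and> a \<in> T \<and> (\<forall>x\<in>T. \<forall>y\<in>T. (\<exists>s\<in>I. Z s = Y x) --> (\<exists>s\<in>I. Z s = Y y))"
    proof (intro exI[of _ "M \<inter> ball a d"] conjI ballI impI)
      show "openin (top_of_set M) (M \<inter> ball a d)" by (simp add: openin_open_Int)
      show "a \<in> M \<inter> ball a d" using a d(1) by simp
      fix x y assume xy: "x \<in> M \<inter> ball a d" "y \<in> M \<inter> ball a d" and "\<exists>s\<in>I. Z s = Y x"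
      then obtain s where s: "s \<in> I" "Z s = Y x" by blast
      obtain sx where sx: "sx \<in> {-r<..<r}" "\<zeta> sx = Y x" using d(2)[of x] xy by (auto simp: dist_commute)
      obtain sy where sy: "sy \<in> {-r<..<r}" "\<zeta> sy = Y y" using d(2)[of y] xy by (auto simp: dist_commute)
      let ?J = "{t. t + (sx - s) \<in> {-r<..<r}}"
      have "solves G \<Omega> (\<lambda>t. \<zeta> (t + (sx - s))) ?J" by (rule solves_shift[OF z(2)])
      moreover have "s \<in> I \<inter> ?J" using s(1) sx(1) by auto
      ultimately have "?J \<subseteq> I \<and> (\<forall>t\<in>?J. \<zeta> (t + (sx - s)) = Z t)"
        by (rule max) (simp add: sx(2) s(2))
      moreover have "sy - (sx - s) \<in> ?J" using sy(1) by simp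
      ultimately show "\<exists>s\<in>I. Z s = Y y" using sy(2) by (metis diff_add_cancel subsetD)
    qed
  qed
  then show thesis using that Z(1) by blast
qed

end

end

section \<open>Propagation along a connected hypersurface\<close>

lemma smooth_on_ident: "smooth_on A (\<lambda>x. x)"
  by (simp add: smooth_on_def C_on_bounded_linear bounded_linear_ident)

lemma smooth_locally_injective:
  fixes f :: "'n::euclidean_space => 'm::euclidean_space"
  assumes S: "open S" "a \<in> S" and f: "smooth_on S f" and inj: "!!v. frechet_derivative f (at a) v = 0 ==> v = 0"
  obtains r where "r > 0" "ball a r \<subseteq> S" "inj_on f (ball a r)"
proof -
  let ?f' = "\<lambda>x. frechet_derivative f (at x)"
  have d: "(f has_derivative ?f' x) (at x)" if "x \<in> S" for x by (rule smooth_on_has_derivative[OF f that])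
  have lin: "linear (?f' a)" using d[OF S(2)] by (rule has_derivative_linear)
  have "inj (?f' a)" using inj linear_injective_0[OF lin] by blast
  then obtain g' where g': "linear g'" "g' \<circ> ?f' a = id" using linear_injective_left_inverse[OF lin] by blast
  define B where "B x = Blinfun (?f' x)" for x
  have B: "blinfun_apply (B x) = ?f' x" if "x \<in> S" for x
    using has_derivative_bounded_linear[OF d[OF that]] by (simp add: B_def bounded_linear_Blinfun_apply)
  have Bc: "continuous_on S B"
  proof (rule continuous_on_blinfun_componentwise)
    fix i :: 'n assume "i \<in> Basis"
    show "continuous_on S (\<lambda>x. blinfun_apply (B x) i)"
      by (rule continuous_on_eq[OF smooth_on_continuous[OF smooth_on_derivative[OF f, of i]]]) (simp add: B)
  qed
  have small: "\<exists>d>0. \<forall>x. dist a x < d --> onorm (\<lambda>v. ?f' x v - ?f' a v) < e" if e: "e > 0" for e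
  proof -
    obtain d1 where d1: "d1 > 0" "!!x. x \<in> S ==> dist x a < d1 ==> dist (B x) (B a) < e"
      using Bc[unfolded continuous_on_iff, rule_format, OF S(2) e] by (elim exE conjE) simp
    obtain d2 where d2: "d2 > 0" "ball a d2 \<subseteq> S" using S open_contains_ball by metis
    have "onorm (\<lambda>v. ?f' x v - ?f' a v) < e" if x: "dist a x < min d1 d2" for x
    proof -
      have xS: "x \<in> S" using d2(2) x by auto
      have "dist (B x) (B a) < e" by (rule d1(2)[OF xS]) (use x in \<open>simp add: dist_commute\<close>)
      then have "norm (B x - B a) < e" by (simp only: dist_norm)
      then show ?thesis by (simp add: norm_blinfun.rep_eq minus_blinfun.rep_eq B[OF xS] B[OF S(2)])
    qed
    then show ?thesis using d1(1) d2(1) by (intro exI[of _ "min d1 d2"]) simp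
  qed
  show thesis
    by (rule has_derivative_locally_injective[OF S(2,1) linear_conv_bounded_linear[THEN iffD1, OF g'(1)] g'(2) d small that])
qed

lemma smooth_on_bounded_linear: "bounded_linear L ==> smooth_on A L"
  by (simp add: smooth_on_def C_on_bounded_linear)

lemma smooth_on_Pair:
  fixes f :: "'z::real_normed_vector => 'x::euclidean_space" and g :: "'z => 'y::euclidean_space"
  assumes A: "open A" and f: "smooth_on A f" and g: "smooth_on A g"
  shows "smooth_on A (\<lambda>x. (f x, g x))"
proof -
  have 1: "smooth_on A (\<lambda>x. (f x, 0::'y))"
    by (rule smooth_on_compose[OF A open_UNIV subset_UNIV _ f, of "\<lambda>y. (y, 0)"])
      (intro smooth_on_bounded_linear bounded_linear_Pair bounded_linear_ident bounded_linear_zero)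
  have 2: "smooth_on A (\<lambda>x. (0::'x, g x))"
    by (rule smooth_on_compose[OF A open_UNIV subset_UNIV _ g, of "\<lambda>y. (0, y)"])
      (intro smooth_on_bounded_linear bounded_linear_Pair bounded_linear_ident bounded_linear_zero)
  from smooth_on_add[OF A 1 2] show ?thesis by simp
qed

context hypersurface
begin

text \<open>
  Along a path in \<open>M\<close> the map \<open>f\<close> solves an ordinary differential equation for which \<open>c0\<close> is an
  equilibrium. Uniqueness makes the set where \<open>f\<close> takes that value open and closed.
\<close>

lemma stationary_value:
  fixes f :: "'a => 's::euclidean_space" and F :: "'a => 'a" and G :: "'s => 's"
  assumes conn: "connected M" and F: "continuous_on M F" and G: "smooth_on UNIV G" "G c0 = 0"
    and f: "smooth_along M f" and Df: "!!x v. x \<in> M ==> N x \<bullet> v = 0 ==> tder M f x v = (v \<bullet> F x) *\<^sub>R G (f x)"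
    and x: "x0 \<in> M" "f x0 = c0" "x \<in> M"
  shows "f x = c0"
proof (rule connected_induction_simple[OF conn x(1,3), of "\<lambda>x. f x = c0"])
  show "f x0 = c0" by (rule x(2))
  fix a assume a: "a \<in> M"
  obtain d B where d: "d > 0" and B: "B >= 0"
    and path: "!!y. y \<in> M ==> dist y a < d ==> \<exists>c c'. c 0 = a \<and> c 1 = y \<and> continuous_on {-2<..<2::real} c' \<and>
      (\<forall>t\<in>{-2<..<2}. c t \<in> M \<and> (c has_vector_derivative c' t) (at t) \<and> norm (c' t) <= B * dist y a)"
    by (rule local_paths[OF a]) simp
  have eq: "f a = c0 \<longleftrightarrow> f y = c0" if y: "y \<in> M" "dist y a < d" for y
  proof -
    obtain c c' where c: "c 0 = a" "c 1 = y" "continuous_on {-2<..<2::real} c'"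
      "!!t. t \<in> {-2<..<2} ==> c t \<in> M \<and> (c has_vector_derivative c' t) (at t) \<and> norm (c' t) <= B * dist y a"
      using path[OF y] by auto
    define w where "w t = c' t \<bullet> F (c t)" for t
    have cc: "continuous_on {-2<..<2} c"
      by (rule continuous_on_vector_derivative[of _ _ c']) (use c(4) in \<open>simp add: has_vector_derivative_at_within\<close>)
    have "continuous_on {-2<..<2} w"
      unfolding w_def by (intro continuous_on_inner c(3) continuous_on_compose2[OF F cc]) (use c(4) in auto)
    then have wc: "continuous_on {0..1} w" by (rule continuous_on_subset) auto
    have "bounded (w ` {0..1})" by (intro compact_imp_bounded compact_continuous_image wc compact_Icc)
    then obtain W where "\<forall>t\<in>{0..1}. \<bar>w t\<bar> <= W" by (auto simp: bounded_iff)
    then have W: "!!t. t \<in> {0..1} ==> \<bar>w t\<bar> <= W" by blast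
    have fc: "((\<lambda>t. f (c t)) has_vector_derivative w t *\<^sub>R G (f (c t))) (at t)" if t: "t \<in> {0..1}" for t
    proof -
      have t2: "t \<in> {-2<..<2}" using t by simp
      have cd: "(c has_vector_derivative c' t) (at t)" and cM: "!!s. s \<in> {-2<..<2} ==> c s \<in> M"
        using c(4) t2 by blast+
      have "N (c t) \<bullet> c' t = 0"
        using velocity_tangent[OF cd _ t2 cM] tangent_iff[OF cM[OF t2]] by simp
      then show ?thesis using has_derivative_along_curve[OF cd _ t2 cM f] Df[OF cM[OF t2], of "c' t"]
        by (simp add: w_def)
    qed
    have const: "c0 \<in> UNIV \<and> ((\<lambda>t. c0) has_vector_derivative r *\<^sub>R G c0) (at t)" for r t by (simp add: G(2))
    show ?thesis
    proof
      assume "f a = c0"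
      have "(\<lambda>t. f (c t)) 1 = (\<lambda>t. c0) (1::real)"
        by (rule ode_path_unique[OF open_UNIV G(1) W conjI[OF UNIV_I fc] const]) (simp_all add: c(1) \<open>f a = c0\<close>)
      then show "f y = c0" using c(2) by simp
    next
      assume fy: "f y = c0"
      have rev: "((\<lambda>t. f (c (1 - t))) has_vector_derivative - w (1 - t) *\<^sub>R G (f (c (1 - t)))) (at t)"
        if t: "t \<in> {0..1}" for t
      proof -
        have "((\<lambda>t. 1 - t) has_vector_derivative -1) (at t)" by (auto intro!: derivative_eq_intros)
        from vector_diff_chain_at[OF this fc] t show ?thesis by (simp add: o_def)
      qed
      have "(\<lambda>t. f (c (1 - t))) 1 = (\<lambda>t. c0) (1::real)"
        by (rule ode_path_unique[OF open_UNIV G(1) _ conjI[OF UNIV_I rev] const, of W])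
          (simp_all add: c(2) fy W)
      then show "f a = c0" using c(1) by simp
    qed
  qed
  show "\<exists>T. openin (top_of_set M) T \<and> a \<in> T \<and> (\<forall>x\<in>T. \<forall>y\<in>T. f x = c0 --> f y = c0)"
  proof (intro exI[of _ "M \<inter> ball a d"] conjI ballI impI)
    show "f y = c0" if "x \<in> M \<inter> ball a d" "y \<in> M \<inter> ball a d" "f x = c0" for x y
      using eq[of x] eq[of y] that by (simp add: dist_commute)
  qed (use a d in \<open>auto simp: openin_open_Int\<close>)
qed

lemma zero_derivative_constant:
  fixes f :: "'a => 's::euclidean_space"
  assumes "connected M" "smooth_along M f" "!!x v. x \<in> M ==> N x \<bullet> v = 0 ==> tder M f x v = 0"
    and "x \<in> M" "y \<in> M"
  shows "f x = f y"
  by (rule stationary_value[of "\<lambda>x. 0" "\<lambda>x. 0" "f y" f y x, OF assms(1)])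
    (use assms smooth_on_const in auto)

text \<open>
  If \<open>R\<close> maps \<open>M\<close> into a plane curve transversally, then near \<open>x0\<close> every solution of
  \<open>R y = r s\<close> lies on \<open>M\<close>: the point of \<open>M\<close> above \<open>y\<close> in normal direction solves the same
  equation, and a solution is determined locally by its component orthogonal to the normal.
\<close>

lemma transversal_points:
  fixes R :: "'a => real \<times> real" and r :: "real => real \<times> real"
  assumes x0: "x0 \<in> M" and R: "smooth_on UNIV R" and I: "open I" "s0 \<in> I" and r: "smooth_on I r"
    and r': "(r has_vector_derivative r') (at s0)" and R': "frechet_derivative R (at x0) (N x0) = R'"
    and trans: "!!c \<sigma>. c *\<^sub>R R' = \<sigma> *\<^sub>R r' ==> c = 0 \<and> \<sigma> = 0"
    and near: "!!e. e > 0 ==> \<exists>d>0. \<forall>y\<in>M. dist y x0 < d --> (\<exists>s\<in>I. \<bar>s - s0\<bar> < e \<and> Q s y)"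
    and Q: "!!s y. s \<in> I ==> y \<in> M ==> Q s y ==> R y = r s"
  obtains d where "d > 0" "!!y s. s \<in> I ==> dist y x0 < d ==> \<bar>s - s0\<bar> < d ==> R y = r s ==> y \<in> M \<and> Q s y"
proof -
  let ?n = "N x0"
  define P where "P y = y - (y \<bullet> ?n) *\<^sub>R ?n" for y
  have P_lin: "bounded_linear P" unfolding P_def
    by (intro bounded_linear_sub bounded_linear_ident bounded_linear_compose[OF bounded_linear_scaleR_left] bounded_linear_inner_left)
  define \<Theta> where "\<Theta> z = (R (fst z) - r (snd z), P (fst z))" for z :: "'a \<times> real"
  let ?S = "UNIV \<times> I :: ('a \<times> real) set"
  have S: "open ?S" "(x0, s0) \<in> ?S" using I by (auto intro: open_Times)
  have fst_smooth: "smooth_on ?S fst" and snd_smooth: "smooth_on ?S snd"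
    by (simp_all add: smooth_on_bounded_linear bounded_linear_fst bounded_linear_snd)
  have T_smooth: "smooth_on ?S \<Theta>"
    unfolding \<Theta>_def diff_conv_add_uminus
  proof (intro smooth_on_Pair[OF S(1)] smooth_on_add[OF S(1)])
    show "smooth_on ?S (\<lambda>z. R (fst z))" by (rule smooth_on_compose[OF S(1) open_UNIV _ R fst_smooth]) simp
    have "smooth_on ?S (\<lambda>z. r (snd z))" by (rule smooth_on_compose[OF S(1) I(1) _ r snd_smooth]) auto
    then show "smooth_on ?S (\<lambda>z. - r (snd z))"
      by (rule smooth_on_compose[OF S(1) open_UNIV subset_UNIV smooth_on_bounded_linear[OF bounded_linear_minus[OF bounded_linear_ident]]])
    show "smooth_on ?S (\<lambda>z. P (fst z))"
      by (rule smooth_on_compose[OF S(1) open_UNIV subset_UNIV smooth_on_bounded_linear[OF P_lin] fst_smooth])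
  qed
  have dR: "(R has_derivative frechet_derivative R (at x0)) (at x0)"
    by (rule smooth_on_has_derivative[OF R]) simp
  have "((\<lambda>z. R (fst z)) has_derivative (\<lambda>z. frechet_derivative R (at x0) (fst z))) (at (x0, s0))"
    by (rule has_derivative_compose[OF has_derivative_fst[OF has_derivative_ident]]) (use dR in simp)
  moreover have "((\<lambda>z. r (snd z)) has_derivative (\<lambda>z. snd z *\<^sub>R r')) (at (x0, s0))"
    by (rule has_derivative_compose[OF has_derivative_snd[OF has_derivative_ident]])
      (use r' in \<open>simp add: has_vector_derivative_def\<close>)
  moreover have "((\<lambda>z. P (fst z)) has_derivative (\<lambda>z. P (fst z))) (at (x0, s0))"
    by (intro bounded_linear.has_derivative[OF P_lin] derivative_intros)
  ultimately have dT: "(\<Theta> has_derivative (\<lambda>z. (frechet_derivative R (at x0) (fst z) - snd z *\<^sub>R r', P (fst z)))) (at (x0, s0))"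
    unfolding \<Theta>_def by (intro has_derivative_Pair has_derivative_diff)
  have "z = 0" if "frechet_derivative \<Theta> (at (x0, s0)) z = 0" for z
  proof -
    obtain v \<sigma> where z: "z = (v, \<sigma>)" by (cases z)
    have 0: "(frechet_derivative R (at x0) v - \<sigma> *\<^sub>R r', P v) = 0"
      using that unfolding frechet_derivative_eqI[OF dT] z by simp
    have 1: "frechet_derivative R (at x0) v = \<sigma> *\<^sub>R r'" "P v = 0"
      using arg_cong[OF 0, of fst] arg_cong[OF 0, of snd] by simp_all
    then have v: "v = (v \<bullet> ?n) *\<^sub>R ?n" by (simp add: P_def)
    have "frechet_derivative R (at x0) v = (v \<bullet> ?n) *\<^sub>R R'"
      by (subst v) (simp add: linear_scale[OF has_derivative_linear[OF dR]] R')
    then have "v \<bullet> ?n = 0 \<and> \<sigma> = 0" using trans 1 by metis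
    then show ?thesis using v z by (simp add: zero_prod_def)
  qed
  then obtain e where e: "e > 0" "ball (x0, s0) e \<subseteq> ?S" "inj_on \<Theta> (ball (x0, s0) e)"
    using smooth_locally_injective[OF S T_smooth] by metis
  define e' where "e' = e / 2"
  have e': "e' > 0" using e by (simp add: e'_def)
  have ball: "(y, s) \<in> ball (x0, s0) e" if "dist y x0 < e'" "\<bar>s - s0\<bar> < e'" for y s
  proof -
    have "dist (x0, s0) (y, s) <= dist x0 y + dist s0 s"
      by (simp add: dist_prod_def sqrt_sum_squares_le_sum_abs[THEN order_trans])
    then show ?thesis using that by (simp add: e'_def dist_commute dist_real_def abs_minus_commute)
  qed
  obtain d1 where d1: "d1 > 0" "!!y. y \<in> M ==> dist y x0 < d1 ==> \<exists>s\<in>I. \<bar>s - s0\<bar> < e' \<and> Q s y"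
    using near[OF e'] by metis
  obtain d2 \<eta> where d2: "d2 > 0" and eta: "smooth_on (ball x0 d2) \<eta>"
    "!!y. y \<in> ball x0 d2 ==> y + \<eta> y *\<^sub>R ?n \<in> M" "!!y. y \<in> ball x0 d2 ==> y \<in> M ==> \<eta> y = 0"
    by (rule retraction[OF x0]) simp
  have "continuous_on (ball x0 d2) (\<lambda>y. y + \<eta> y *\<^sub>R ?n)"
    by (intro continuous_intros smooth_on_continuous[OF eta(1)])
  moreover have "x0 + \<eta> x0 *\<^sub>R ?n = x0" using eta(3)[of x0] x0 d2 by simp
  moreover have "min d1 e' > 0" using d1(1) e' by simp
  ultimately obtain d3 where d3: "d3 > 0"
    "!!y. y \<in> ball x0 d2 ==> dist y x0 < d3 ==> dist (y + \<eta> y *\<^sub>R ?n) x0 < min d1 e'"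
    unfolding continuous_on_iff using d2 by (metis centre_in_ball)
  define d where "d = min (min d2 d3) e'"
  show thesis
  proof (rule that[of d])
    show "d > 0" using d2 d3(1) e' by (simp add: d_def)
    fix y s assume s: "s \<in> I" and y: "dist y x0 < d" "\<bar>s - s0\<bar> < d" and eq: "R y = r s"
    have yb: "y \<in> ball x0 d2" using y(1) by (simp add: d_def dist_commute)
    let ?y = "y + \<eta> y *\<^sub>R ?n"
    have yM: "?y \<in> M" by (rule eta(2)[OF yb])
    have yd: "dist ?y x0 < min d1 e'" by (rule d3(2)[OF yb]) (use y in \<open>simp add: d_def\<close>)
    obtain s' where s': "s' \<in> I" "\<bar>s' - s0\<bar> < e'" "Q s' ?y" using d1(2)[OF yM] yd by auto
    have "P ?y = P y" using N_unit[OF x0] by (simp add: P_def inner_add_left algebra_simps)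
    then have "\<Theta> (?y, s') = \<Theta> (y, s)" using Q[OF s'(1) yM s'(3)] eq by (simp add: \<Theta>_def)
    moreover have "(?y, s') \<in> ball (x0, s0) e" using yd s' by (intro ball) auto
    moreover have "(y, s) \<in> ball (x0, s0) e" using y by (intro ball) (auto simp: d_def)
    ultimately have "(?y, s') = (y, s)" using e(3) by (metis inj_onD)
    then show "y \<in> M \<and> Q s y" using yM s'(3) by auto
  qed
qed

end

section \<open>Spherical coordinates\<close>

lemma sphere_coord_1: "sphere_coord d \<theta> 1 = (if d >= 1 then cos (\<theta> 1) else 1)"
  by (simp add: sphere_coord_def)

lemma sphere_coord_Suc:
  assumes "i >= 1" shows "sphere_coord (Suc d) \<theta> (Suc i) = sin (\<theta> 1) * sphere_coord d (\<lambda>l. \<theta> (Suc l)) i"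
proof -
  have "{1..<Suc i} = insert 1 {Suc 1..<Suc i}" using assms by auto
  then have "(\<Prod>l\<in>{1..<Suc i}. sin (\<theta> l)) = sin (\<theta> 1) * (\<Prod>l\<in>{Suc 1..<Suc i}. sin (\<theta> l))"
    by simp
  also have "(\<Prod>l\<in>{Suc 1..<Suc i}. sin (\<theta> l)) = (\<Prod>l\<in>{1..<i}. sin (\<theta> (Suc l)))"
    by (rule prod.shift_bounds_Suc_ivl)
  finally have "(\<Prod>l\<in>{1..<Suc i}. sin (\<theta> l)) = sin (\<theta> 1) * (\<Prod>l\<in>{1..<i}. sin (\<theta> (Suc l)))" .
  then show ?thesis by (simp add: sphere_coord_def)
qed

lemma sum_shift_1: "(\<Sum>i\<in>{1..Suc m}. f i) = f 1 + (\<Sum>i\<in>{1..m}. f (Suc i))" for f :: "nat => real"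
  using sum.atLeast_Suc_atMost[of 1 "Suc m" f] sum.shift_bounds_cl_Suc_ivl[of f 1 m] by simp

lemma sphere_coord_norm: "(\<Sum>i\<in>{1..d+1}. (sphere_coord d \<theta> i)\<^sup>2) = 1"
proof (induction d arbitrary: \<theta>)
  case 0
  then show ?case by (simp add: sphere_coord_def)
next
  case (Suc d)
  have "(\<Sum>i\<in>{1..Suc d+1}. (sphere_coord (Suc d) \<theta> i)\<^sup>2) =
      (cos (\<theta> 1))\<^sup>2 + (\<Sum>i\<in>{1..d+1}. (sin (\<theta> 1))\<^sup>2 * (sphere_coord d (\<lambda>l. \<theta> (Suc l)) i)\<^sup>2)"
    using sum_shift_1[of "\<lambda>i. (sphere_coord (Suc d) \<theta> i)\<^sup>2" "d + 1"] sphere_coord_Suc[of _ d \<theta>]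
    by (simp add: sphere_coord_1 power_mult_distrib)
  also have "\<dots> = 1" unfolding sum_distrib_left[symmetric] Suc.IH by simp
  finally show ?case .
qed

lemma sphere_coord_surj:
  assumes "d >= 1" "(\<Sum>i\<in>{1..d+1}. (v i)\<^sup>2) = (1::real)"
  shows "\<exists>\<theta>. \<forall>i\<in>{1..d+1}. v i = sphere_coord d \<theta> i"
  using assms
proof (induction d arbitrary: v rule: nat_induct_at_least)
  case base
  have "{1..2::nat} = {1, 2}" by auto
  then have "(v 1)\<^sup>2 + (v 2)\<^sup>2 = 1" using base by (simp add: numeral_2_eq_2 One_nat_def)
  then obtain t where t: "v 1 = cos t" "v 2 = sin t" using sincos_total_2pi by metis
  show ?case
  proof (intro exI[of _ "\<lambda>_. t"] ballI)
    fix i :: nat assume "i \<in> {1..1+1}"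
    then consider "i = 1" | "i = Suc 1" by force
    then show "v i = sphere_coord 1 (\<lambda>_. t) i"
    proof cases
      case 1
      then show ?thesis using t by (simp add: sphere_coord_def)
    next
      case 2
      have "{1..<Suc 1} = {1::nat}" by auto
      then show ?thesis using 2 t by (simp add: sphere_coord_def numeral_2_eq_2 One_nat_def)
    qed
  qed
next
  case (Suc d)
  have s: "(v 1)\<^sup>2 + (\<Sum>i\<in>{1..d+1}. (v (Suc i))\<^sup>2) = 1"
    using Suc.prems sum_shift_1[of "\<lambda>i. (v i)\<^sup>2" "d+1"] by simp
  have "(v 1)\<^sup>2 <= 1" using s sum_nonneg[of "{1..d+1}" "\<lambda>i. (v (Suc i))\<^sup>2"] by simp
  then have v1: "-1 <= v 1" "v 1 <= 1" by (simp_all add: abs_square_le_1 abs_le_iff)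
  define t where "t = arccos (v 1)"
  have ct: "cos t = v 1" using v1 by (simp add: t_def)
  have st: "(sin t)\<^sup>2 = (\<Sum>i\<in>{1..d+1}. (v (Suc i))\<^sup>2)" using s ct sin_squared_eq[of t] by simp
  obtain \<theta> where \<theta>: "!!i. i \<in> {1..d+1} ==> v (Suc i) = sin t * sphere_coord d \<theta> i"
  proof (cases "sin t = 0")
    case True
    then have "(\<Sum>i\<in>{1..d+1}. (v (Suc i))\<^sup>2) = 0" using st by simp
    then have "\<forall>i\<in>{1..d+1}. (v (Suc i))\<^sup>2 = 0" by (subst (asm) sum_nonneg_eq_0_iff) auto
    then show thesis using that[of undefined] True by simp
  next
    case False
    have "(\<Sum>i\<in>{1..d+1}. (v (Suc i) / sin t)\<^sup>2) = 1"
      unfolding power_divide sum_divide_distrib[symmetric] st[symmetric] using False by simp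
    then obtain \<theta> where "\<forall>i\<in>{1..d+1}. v (Suc i) / sin t = sphere_coord d \<theta> i" using Suc.IH by metis
    then have "v (Suc i) = sin t * sphere_coord d \<theta> i" if "i \<in> {1..d+1}" for i
      using False that by (metis nonzero_eq_divide_eq mult.commute)
    then show thesis by (rule that)
  qed
  let ?\<theta> = "\<lambda>l. if l = 1 then t else \<theta> (l - 1)"
  have eq: "(\<lambda>l. ?\<theta> (Suc l)) i = \<theta> i" if "i >= 1" for i using that by simp
  have cong: "sphere_coord d (\<lambda>l. ?\<theta> (Suc l)) i = sphere_coord d \<theta> i" if "i >= 1" for i
    unfolding sphere_coord_def using that by (intro arg_cong2[where f = "(*)"] prod.cong) auto
  show ?case
  proof (intro exI[of _ ?\<theta>] ballI)
    fix i assume i: "i \<in> {1..Suc d + 1}"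
    show "v i = sphere_coord (Suc d) ?\<theta> i"
    proof (cases "i = 1")
      case True
      then show ?thesis using ct by (simp add: sphere_coord_1)
    next
      case False
      then obtain j where j: "i = Suc j" "j \<in> {1..d+1}" using i by (cases i) auto
      then show ?thesis using \<theta>[OF j(2)] cong[of j] sphere_coord_Suc[of j d ?\<theta>] by simp
    qed
  qed
qed

section \<open>Parameter domains\<close>

abbreviation param_topology :: "nat => (real \<times> (nat => real)) topology" where
  "param_topology n \<equiv> prod_topology euclideanreal (product_topology (\<lambda>i. euclideanreal) {2..n})"

lemma openin_param_topology:
  assumes "open W"
  shows "openin (param_topology n) ({z. snd z \<in> extensional {2..n}} \<inter> W)"
proof -
  let ?T = "product_topology (\<lambda>i. euclideanreal) {2..n}"
  have top: "topspace ?T = extensional {2..n}" by (simp add: PiE_def)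
  have "continuous_map ?T (product_topology (\<lambda>i. euclideanreal) UNIV) id"
    unfolding continuous_map_componentwise_UNIV
  proof
    fix i
    show "continuous_map ?T euclideanreal (\<lambda>x. id x i)"
    proof (cases "i \<in> {2..n}")
      case True
      then show ?thesis using continuous_map_product_projection[of i "{2..n}" "\<lambda>i. euclideanreal"] by simp
    next
      case False
      have "continuous_map ?T euclideanreal (\<lambda>x. undefined)" by simp
      then show ?thesis
        by (rule continuous_map_eq) (use False top in \<open>auto simp: extensional_def\<close>)
    qed
  qed
  then have "continuous_map ?T euclidean id" by (simp add: euclidean_product_topology)
  then have "continuous_map (param_topology n) (prod_topology euclidean euclidean) (\<lambda>z. (fst z, id (snd z)))"
    by (intro continuous_map_pairedI continuous_map_fst continuous_map_compose[OF continuous_map_snd, unfolded o_def])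
  then have "continuous_map (param_topology n) euclidean id"
    by (simp add: prod_topology_euclidean id_def)
  from openin_continuous_map_preimage[OF this, of W] assms
  have "openin (param_topology n) {z \<in> topspace (param_topology n). z \<in> W}" by simp
  moreover have "{z \<in> topspace (param_topology n). z \<in> W} = {z. snd z \<in> extensional {2..n}} \<inter> W"
    using top by (auto simp: topspace_prod_topology mem_Times_iff)
  ultimately show ?thesis by simp
qed

section \<open>The global structure of an H-hypersurface\<close>

lemma smooth_along_Pair:
  fixes M :: "'a::euclidean_space set" and f :: "'a => 'x::euclidean_space" and g :: "'a => 'y::euclidean_space"
  shows "smooth_along M f ==> smooth_along M g ==> smooth_along M (\<lambda>x. (f x, g x))"
  by (rule smooth_along_lift2[of Pair, OF smooth_on_Pair])

lemma tder_Pair: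
  assumes "x \<in> M" "v \<in> tangent_space M x" "smooth_along M f" "smooth_along M g"
  shows "tder M (\<lambda>y. (f y, g y)) x v = (tder M f x v, tder M g x v)"
  by (rule tder_eqI[OF assms(2) has_derivative_Pair[OF smooth_along_has_tder[OF assms(3,1)] smooth_along_has_tder[OF assms(4,1)]]])

locale H_global = hypersurface M N for M :: "'a::euclidean_space set" and N +
  fixes n :: nat and k :: "nat => 'a => real" and p q :: nat and E :: "'a => 'a"
  assumes frames: "!!x. x \<in> M ==> \<exists>U e. open U \<and> x \<in> U \<and> H_frame (M \<inter> U) N n e k p q \<and> (\<forall>y\<in>M \<inter> U. e 1 y = E y)"
    and conn: "connected M" "M ~= {}"
begin

lemma frameE:
  assumes "x \<in> M"
  obtains U e where "open U" "x \<in> U" "H_frame (M \<inter> U) N n e k p q" "!!y. y \<in> M ==> y \<in> U ==> e 1 y = E y"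
  using frames[OF assms] by (elim exE conjE) simp

lemma local_tder:
  assumes "open U" "x \<in> M" "x \<in> U" "!!y. y \<in> M ==> y \<in> U ==> f y = g y"
  shows "tder M f x = tder (M \<inter> U) g x"
  using tder_cong[of x "M \<inter> U" f g] tder_Int_open[OF assms(1,3), of M f] assms by simp

lemma leaf_curv_local:
  assumes "open U" "y \<in> M" "y \<in> U" "!!y. y \<in> M ==> y \<in> U ==> e 1 y = E y"
  shows "leaf_curv (M \<inter> U) k (e 1) i y = leaf_curv M k E i y"
  by (rule leaf_curv_Int_open[of U y E "e 1"]) (use assms in auto)

lemma pointwise_facts:
  assumes x: "x \<in> M"
  shows "DIM('a) = n + 1" "p > 1" "q > 1" "n = p + q + 1"
    "N x \<bullet> E x = 0" "E x \<bullet> E x = 1"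
    "k 1 x ~= k 2 x" "k 1 x ~= k (p+2) x" "k 2 x ~= k (p+2) x"
    "3 * k 1 x + p * k 2 x + q * k (p+2) x = 0"
proof -
  obtain U e where U: "open U" "x \<in> U" "H_frame (M \<inter> U) N n e k p q" "!!y. y \<in> M ==> y \<in> U ==> e 1 y = E y"
    by (rule frameE[OF x], rule that)
  interpret F: H_frame "M \<inter> U" N n e k p q by (rule U(3))
  have x': "x \<in> M \<inter> U" using x U by simp
  show "DIM('a) = n + 1" by (rule F.dim)
  show "p > 1" "q > 1" "n = p + q + 1" using F.pq by auto
  show "N x \<bullet> E x = 0" using F.e_tangent[OF x' F.I_simps(1)] U(4) x U(2) by simp
  show "E x \<bullet> E x = 1" using F.e_orthonormal[OF x' F.I_simps(1) F.I_simps(1)] U(4) x U(2) by simp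
  show "k 1 x ~= k 2 x" "k 1 x ~= k (p+2) x" "k 2 x ~= k (p+2) x" using F.distinct[OF x'] by auto
  show "3 * k 1 x + p * k 2 x + q * k (p+2) x = 0" by (rule F.k_sum[OF x'])
qed

lemma index_facts: "1 \<in> {1..n}" "2 \<in> {2..n}" "p + 2 \<in> {2..n}" "2 \<in> {1..n}" "p + 2 \<in> {1..n}"
proof -
  obtain x where "x \<in> M" using conn(2) by blast
  from pointwise_facts(2-4)[OF this] show "1 \<in> {1..n}" "2 \<in> {2..n}" "p + 2 \<in> {2..n}" "2 \<in> {1..n}" "p + 2 \<in> {1..n}"
    by auto
qed

lemma E_smooth: "smooth_along M E"
proof (rule smooth_along_local)
  fix x assume x: "x \<in> M"
  obtain U e where U: "open U" "x \<in> U" "H_frame (M \<inter> U) N n e k p q" "!!y. y \<in> M ==> y \<in> U ==> e 1 y = E y"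
    by (rule frameE[OF x], rule that)
  interpret F: H_frame "M \<inter> U" N n e k p q by (rule U(3))
  have "smooth_along (M \<inter> U) E"
    by (rule smooth_along_cong[OF F.e_smooth[OF F.I_simps(1)]]) (use U(4) in simp)
  then show "\<exists>U. open U \<and> x \<in> U \<and> smooth_along (M \<inter> U) E" using U(1,2) by blast
qed

lemma k_smooth: assumes i: "i \<in> {1..n}" shows "smooth_along M (k i)"
proof (rule smooth_along_local)
  fix x assume x: "x \<in> M"
  obtain U e where U: "open U" "x \<in> U" "H_frame (M \<inter> U) N n e k p q" "!!y. y \<in> M ==> y \<in> U ==> e 1 y = E y"
    by (rule frameE[OF x], rule that)
  interpret F: H_frame "M \<inter> U" N n e k p q by (rule U(3))
  show "\<exists>U. open U \<and> x \<in> U \<and> smooth_along (M \<inter> U) (k i)" using U(1,2) F.k_smooth[OF i] by blast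
qed

lemma leaf_curv_smooth: assumes i: "i = 2 \<or> i = p + 2" shows "smooth_along M (leaf_curv M k E i)"
  unfolding leaf_curv_def[abs_def]
proof (rule smooth_along_divide)
  have iI: "i \<in> {1..n}" using i index_facts by auto
  show "smooth_along M (\<lambda>x. tder M (k i) x (E x))"
    by (rule smooth_along_tder[OF k_smooth[OF iI] E_smooth]) (rule pointwise_facts(5))
  show "smooth_along M (\<lambda>x. k i x - k 1 x)"
    by (intro smooth_along_diff k_smooth iI index_facts)
  show "k i x - k 1 x ~= 0" if "x \<in> M" for x using pointwise_facts(7,8)[OF that] i by auto
qed

lemma E_continuous: "continuous_on M E"
  by (rule smooth_along_continuous_on[OF E_smooth])

text \<open>
  The sum of the squares of the two quantities solves a linear differential equation along \<open>E\<close> and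
  is constant in the other directions. So the leaves of \<open>k 2\<close> are flat everywhere or nowhere.
\<close>

lemma leaf_flat_propagates:
  assumes x0: "x0 \<in> M" "leaf_curv M k E 2 x0 = 0" "k 2 x0 = 0" and x: "x \<in> M"
  shows "leaf_curv M k E 2 x = 0 \<and> k 2 x = 0"
proof -
  define h where "h x = leaf_curv M k E 2 x * leaf_curv M k E 2 x + k 2 x * k 2 x" for x
  have hs: "smooth_along M h" unfolding h_def
    by (intro smooth_along_add smooth_along_mult leaf_curv_smooth k_smooth index_facts) auto
  have "h x = 0"
  proof (rule stationary_value[of "\<lambda>x. (2 * leaf_curv M k E 2 x) *\<^sub>R E x" "\<lambda>x. x" 0 h x0 x])
    show "connected M" by (rule conn(1))
    show "continuous_on M (\<lambda>x. (2 * leaf_curv M k E 2 x) *\<^sub>R E x)"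
      by (intro continuous_intros E_continuous smooth_along_continuous_on leaf_curv_smooth) auto
    show "smooth_on UNIV (\<lambda>x :: real. x)" by (rule smooth_on_ident)
    show "tder M h y v = (v \<bullet> (2 * leaf_curv M k E 2 y) *\<^sub>R E y) *\<^sub>R h y" if y: "y \<in> M" and v: "N y \<bullet> v = 0" for y v
    proof -
      obtain U e where U: "open U" "y \<in> U" "H_frame (M \<inter> U) N n e k p q" "!!y. y \<in> M ==> y \<in> U ==> e 1 y = E y"
        by (rule frameE[OF y], rule that)
      interpret F: H_frame "M \<inter> U" N n e k p q by (rule U(3))
      have eq: "F.\<alpha> 2 z = leaf_curv M k E 2 z" if "z \<in> M" "z \<in> U" for z
        unfolding F.leaf_curv_eq[symmetric] by (rule leaf_curv_local[of U z e, OF U(1) that U(4)])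
      have "tder M h y v = tder (M \<inter> U) (\<lambda>x. F.\<alpha> 2 x * F.\<alpha> 2 x + k 2 x * k 2 x) y v"
        using local_tder[OF U(1) y U(2), of h "\<lambda>x. F.\<alpha> 2 x * F.\<alpha> 2 x + k 2 x * k 2 x"] eq by (simp add: h_def)
      also have "\<dots> = (v \<bullet> e 1 y) *\<^sub>R (2 * F.\<alpha> 2 y * (F.\<alpha> 2 y * F.\<alpha> 2 y + k 2 y * k 2 y))"
        by (rule F.tder_eq_sum[OF F.h_smooth _ v F.D_h]) (use y U in auto)
      finally show ?thesis using eq[OF y U(2)] U(4)[OF y U(2)] by (simp add: h_def)
    qed
  qed (use hs x0 x in \<open>simp_all add: h_def\<close>)
  then show ?thesis unfolding h_def by (simp add: sum_squares_eq_zero_iff)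
qed

end

locale H_global_pos = H_global +
  assumes pos: "!!x. x \<in> M ==> leaf_curv M k E 2 x ~= 0 \<or> k 2 x ~= 0"
begin

abbreviation "\<psi> \<equiv> radius M k E"
abbreviation "a \<equiv> slope M k E"
abbreviation "b \<equiv> coslope M k E"
abbreviation "u \<equiv> dir2 M N k E"
abbreviation "w \<equiv> dir3 M N k E"
abbreviation "c \<equiv> curv3 M k E p"
abbreviation "P \<equiv> proj2 M N k E p"
abbreviation "pr z x \<equiv> P x z + (z \<bullet> u x) *\<^sub>R u x"

lemma frame_pos:
  assumes x: "x \<in> M"
  obtains U e where "open U" "x \<in> U" "H_frame_pos (M \<inter> U) N n e k p q"
    "!!y. y \<in> M \<inter> U ==> e 1 y = E y"
    "!!y. y \<in> M \<inter> U ==> radius (M \<inter> U) k (e 1) y = \<psi> y"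
    "!!y. y \<in> M \<inter> U ==> slope (M \<inter> U) k (e 1) y = a y"
    "!!y. y \<in> M \<inter> U ==> coslope (M \<inter> U) k (e 1) y = b y"
    "!!y. y \<in> M \<inter> U ==> dir2 (M \<inter> U) N k (e 1) y = u y"
    "!!y. y \<in> M \<inter> U ==> dir3 (M \<inter> U) N k (e 1) y = w y"
    "!!y. y \<in> M \<inter> U ==> curv3 (M \<inter> U) k (e 1) p y = c y"
    "!!y z. y \<in> M \<inter> U ==> proj2 (M \<inter> U) N k (e 1) p y z = P y z"
    "\<forall>f g v. (\<forall>y\<in>M \<inter> U. f y = g y) --> tder M (f :: 'a => real) x v = tder (M \<inter> U) g x v"
    "\<forall>f g v. (\<forall>y\<in>M \<inter> U. f y = g y) --> tder M (f :: 'a => 'a) x v = tder (M \<inter> U) g x v"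
proof -
  obtain U e where U: "open U" "x \<in> U" "H_frame (M \<inter> U) N n e k p q" "!!y. y \<in> M ==> y \<in> U ==> e 1 y = E y"
    by (rule frameE[OF x], rule that)
  interpret F: H_frame "M \<inter> U" N n e k p q by (rule U(3))
  have pos': "H_frame_pos (M \<inter> U) N n e k p q"
  proof unfold_locales
    fix y assume y: "y \<in> M \<inter> U"
    have "F.\<alpha> 2 y = leaf_curv M k E 2 y"
      unfolding F.leaf_curv_eq[symmetric] by (rule leaf_curv_local[of U y e, OF U(1) _ _ U(4)]) (use y in auto)
    then show "(F.\<alpha> 2 y)\<^sup>2 + (k 2 y)\<^sup>2 > 0" using pos[of y] y by (auto simp: sum_power2_gt_zero_iff)
  qed
  have eE: "E y = e 1 y" if "y \<in> M \<inter> U" for y using U(4)[of y] that by simp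
  have l: "open U" "y \<in> U" "E y = e 1 y" if "y \<in> M \<inter> U" for y using U(1) that eE by auto
  note L = leaf_data_Int_open[of U _ E "e 1"]
  have t1: "\<forall>f g v. (\<forall>y\<in>M \<inter> U. f y = g y) --> tder M (f :: 'a => real) x v = tder (M \<inter> U) g x v"
    using local_tder[OF U(1) x U(2), where 'b = "real"] by simp
  have t2: "\<forall>f g v. (\<forall>y\<in>M \<inter> U. f y = g y) --> tder M (f :: 'a => 'a) x v = tder (M \<inter> U) g x v"
    using local_tder[OF U(1) x U(2), where 'b = "'a"] by simp
  show thesis
    by (rule that[OF U(1,2) pos' eE[symmetric] L(1)[OF l] L(2)[OF l] L(3)[OF l] L(4)[OF l] L(5)[OF l] L(6)[OF l] L(7)[OF l] t1 t2])
      assumption+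
qed

lemma leaf_data_smooth:
  "smooth_along M \<psi>" "smooth_along M a" "smooth_along M b" "smooth_along M u" "smooth_along M w" "smooth_along M c"
  "smooth_along M (pr z)"
proof -
  have "\<exists>U. open U \<and> x \<in> U \<and> smooth_along (M \<inter> U) \<psi> \<and> smooth_along (M \<inter> U) a \<and> smooth_along (M \<inter> U) b \<and>
      smooth_along (M \<inter> U) u \<and> smooth_along (M \<inter> U) w \<and> smooth_along (M \<inter> U) c \<and> smooth_along (M \<inter> U) (pr z)"
    if x: "x \<in> M" for x
  proof (rule frame_pos[OF x])
    fix U e assume U: "open U" "x \<in> U" "H_frame_pos (M \<inter> U) N n e k p q"
      and eq: "!!y. y \<in> M \<inter> U ==> radius (M \<inter> U) k (e 1) y = \<psi> y"
        "!!y. y \<in> M \<inter> U ==> slope (M \<inter> U) k (e 1) y = a y"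
        "!!y. y \<in> M \<inter> U ==> coslope (M \<inter> U) k (e 1) y = b y"
        "!!y. y \<in> M \<inter> U ==> dir2 (M \<inter> U) N k (e 1) y = u y"
        "!!y. y \<in> M \<inter> U ==> dir3 (M \<inter> U) N k (e 1) y = w y"
        "!!y. y \<in> M \<inter> U ==> curv3 (M \<inter> U) k (e 1) p y = c y"
        "!!y z. y \<in> M \<inter> U ==> proj2 (M \<inter> U) N k (e 1) p y z = P y z"
    interpret F: H_frame_pos "M \<inter> U" N n e k p q by (rule U(3))
    have "smooth_along (M \<inter> U) (pr z)"
      by (rule smooth_along_cong[OF F.pr_smooth[of z]]) (simp add: eq)
    then show ?thesis
      using U(1,2) smooth_along_cong[OF F.rad_smooth eq(1)] smooth_along_cong[OF F.a_smooth eq(2)]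
        smooth_along_cong[OF F.b_smooth eq(3)] smooth_along_cong[OF F.u_smooth eq(4)]
        smooth_along_cong[OF F.w_smooth eq(5)] smooth_along_cong[OF F.c_smooth eq(6)]
      by (intro exI[of _ U] conjI)
  qed
  note * = this
  show "smooth_along M \<psi>" "smooth_along M a" "smooth_along M b" "smooth_along M u" "smooth_along M w" "smooth_along M c"
    "smooth_along M (pr z)"
    by (rule smooth_along_local, frule *, elim exE conjE, intro exI conjI; assumption)+
qed

text \<open>
  The structure equations in terms of the global data: \<open>\<psi>\<close>, \<open>a\<close>, \<open>b\<close>, \<open>c\<close> change along \<open>E\<close> only, \<open>u\<close> only
  along the first and \<open>w\<close> only along the second family of leaves.
\<close>

lemma leaf_equations:
  assumes x: "x \<in> M"
  shows "\<psi> x > 0" "a x * a x + b x * b x = 1" "k 2 x = b x * inverse (\<psi> x)" "k (p+2) x = c x * a x"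
    "u x \<bullet> u x = 1" "w x \<bullet> w x = 1" "u x \<bullet> w x = 0" "E x = a x *\<^sub>R u x + b x *\<^sub>R w x" "N x = a x *\<^sub>R w x - b x *\<^sub>R u x"
    "P x z \<bullet> u x = 0" "P x z \<bullet> w x = 0" "(y - P x y) \<bullet> P x z = 0"
  and "N x \<bullet> v = 0 ==> tder M \<psi> x v = a x * (v \<bullet> E x)"
    "N x \<bullet> v = 0 ==> tder M a x v = - (k 1 x * b x) * (v \<bullet> E x)"
    "N x \<bullet> v = 0 ==> tder M b x v = k 1 x * a x * (v \<bullet> E x)"
    "N x \<bullet> v = 0 ==> tder M c x v = c x * b x * c x * (v \<bullet> E x)"
    "N x \<bullet> v = 0 ==> tder M u x v = inverse (\<psi> x) *\<^sub>R P x v"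
    "N x \<bullet> v = 0 ==> tder M w x v = - c x *\<^sub>R (v - (v \<bullet> E x) *\<^sub>R E x - P x v)"
    "N x \<bullet> v = 0 ==> tder M (pr z) x v = 0"
proof -
  obtain U e where U: "open U" "x \<in> U" "H_frame_pos (M \<inter> U) N n e k p q"
      and eq: "!!y. y \<in> M \<inter> U ==> e 1 y = E y"
        "!!y. y \<in> M \<inter> U ==> radius (M \<inter> U) k (e 1) y = \<psi> y"
        "!!y. y \<in> M \<inter> U ==> slope (M \<inter> U) k (e 1) y = a y"
        "!!y. y \<in> M \<inter> U ==> coslope (M \<inter> U) k (e 1) y = b y"
        "!!y. y \<in> M \<inter> U ==> dir2 (M \<inter> U) N k (e 1) y = u y"
        "!!y. y \<in> M \<inter> U ==> dir3 (M \<inter> U) N k (e 1) y = w y"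
        "!!y. y \<in> M \<inter> U ==> curv3 (M \<inter> U) k (e 1) p y = c y"
        "!!y z. y \<in> M \<inter> U ==> proj2 (M \<inter> U) N k (e 1) p y z = P y z"
      and t1: "\<forall>f g v. (\<forall>y\<in>M \<inter> U. f y = g y) --> tder M (f :: 'a => real) x v = tder (M \<inter> U) g x v"
      and t2: "\<forall>f g v. (\<forall>y\<in>M \<inter> U. f y = g y) --> tder M (f :: 'a => 'a) x v = tder (M \<inter> U) g x v"
    by (rule frame_pos[OF x], rule that)
  interpret F: H_frame_pos "M \<inter> U" N n e k p q by (rule U(3))
  have x': "x \<in> M \<inter> U" using x U by simp
  note eqx = eq[OF x']
  show psi: "\<psi> x > 0" using F.rad_pos[OF x'] by (simp add: eqx)
  show "a x * a x + b x * b x = 1" using F.ab_unit[OF x'] by (simp add: eqx)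
  show "k 2 x = b x * inverse (\<psi> x)" using psi by (simp add: coslope_def)
  show "k (p+2) x = c x * a x" using F.curv3_components(2)[OF x'] by (simp only: eqx)
  note uw = F.uw_orthonormal[OF x', unfolded eqx]
  show "u x \<bullet> u x = 1" "w x \<bullet> w x = 1" "u x \<bullet> w x = 0" "E x = a x *\<^sub>R u x + b x *\<^sub>R w x" "N x = a x *\<^sub>R w x - b x *\<^sub>R u x"
    using uw by auto
  show "P x z \<bullet> u x = 0" "P x z \<bullet> w x = 0" using F.proj2_uw[OF x', of z] by (simp_all add: eqx)
  show "(y - P x y) \<bullet> P x z = 0" using F.proj2_orthogonal[OF x', of y z] by (simp add: eqx)
  note td = F.tder_leaf_data[OF x', of v, unfolded eqx]
  show "tder M \<psi> x v = a x * (v \<bullet> E x)" if "N x \<bullet> v = 0"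
    using td(1)[OF that] t1[rule_format, OF eq(2)[symmetric], where v = v] by simp
  show "tder M a x v = - (k 1 x * b x) * (v \<bullet> E x)" if "N x \<bullet> v = 0"
    using td(2)[OF that] t1[rule_format, OF eq(3)[symmetric], where v = v] by simp
  show "tder M b x v = k 1 x * a x * (v \<bullet> E x)" if "N x \<bullet> v = 0"
    using td(3)[OF that] t1[rule_format, OF eq(4)[symmetric], where v = v] by simp
  show "tder M c x v = c x * b x * c x * (v \<bullet> E x)" if "N x \<bullet> v = 0"
    using td(4)[OF that] t1[rule_format, OF eq(7)[symmetric], where v = v] by simp
  show "tder M u x v = inverse (\<psi> x) *\<^sub>R P x v" if "N x \<bullet> v = 0"
    using td(5)[OF that] t2[rule_format, OF eq(5)[symmetric], where v = v] by simp
  show "tder M w x v = - c x *\<^sub>R (v - (v \<bullet> E x) *\<^sub>R E x - P x v)" if "N x \<bullet> v = 0"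
    using td(6)[OF that] t2[rule_format, OF eq(6)[symmetric], where v = v] by simp
  show "tder M (pr z) x v = 0" if "N x \<bullet> v = 0"
    using F.tder_pr[OF x' that, of z] t2[rule_format, of "pr z" "F.pr z" v] eq by simp
qed

lemma c_zero_propagates: "x0 \<in> M ==> c x0 = 0 ==> x \<in> M ==> c x = 0"
proof (rule stationary_value[of "\<lambda>x. (c x * b x) *\<^sub>R E x" "\<lambda>x. x" 0 c x0 x])
  show "continuous_on M (\<lambda>x. (c x * b x) *\<^sub>R E x)"
    by (intro continuous_intros E_continuous smooth_along_continuous_on leaf_data_smooth)
  show "tder M c y v = (v \<bullet> (c y * b y) *\<^sub>R E y) *\<^sub>R c y" if "y \<in> M" "N y \<bullet> v = 0" for y v
    using leaf_equations(16)[OF that] by simp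
qed (simp_all add: conn smooth_on_ident leaf_data_smooth)

lemma pr_constant: "x \<in> M ==> y \<in> M ==> pr z x = pr z y"
  by (rule zero_derivative_constant[OF conn(1) leaf_data_smooth(7) leaf_equations(19)])

text \<open>An orthonormal basis adapted to the two parallel subspaces, read off at one point.\<close>

lemma adapted_basis:
  obtains A :: "nat => 'a" and x0 where "x0 \<in> M" "A (p+2) = w x0"
    "!!i j. i \<in> {1..n+1} ==> j \<in> {1..n+1} ==> A i \<bullet> A j = (if i = j then 1 else 0)"
    "!!x j. x \<in> M ==> j \<in> {1..n+1} ==> pr (A j) x = (if j <= p + 1 then A j else 0)"
    "!!x j. x \<in> M ==> j \<in> {p+2..n+1} ==> u x \<bullet> A j = 0"
    "!!x j. x \<in> M ==> j \<in> {1..p+1} ==> w x \<bullet> A j = 0"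
proof -
  obtain x0 where x0: "x0 \<in> M" using conn(2) by blast
  obtain U e where U: "open U" "x0 \<in> U" "H_frame_pos (M \<inter> U) N n e k p q"
      and eq: "!!y. y \<in> M \<inter> U ==> e 1 y = E y"
        "!!y. y \<in> M \<inter> U ==> radius (M \<inter> U) k (e 1) y = \<psi> y"
        "!!y. y \<in> M \<inter> U ==> slope (M \<inter> U) k (e 1) y = a y"
        "!!y. y \<in> M \<inter> U ==> coslope (M \<inter> U) k (e 1) y = b y"
        "!!y. y \<in> M \<inter> U ==> dir2 (M \<inter> U) N k (e 1) y = u y"
        "!!y. y \<in> M \<inter> U ==> dir3 (M \<inter> U) N k (e 1) y = w y"
        "!!y. y \<in> M \<inter> U ==> curv3 (M \<inter> U) k (e 1) p y = c y"
        "!!y z. y \<in> M \<inter> U ==> proj2 (M \<inter> U) N k (e 1) p y z = P y z"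
      and "\<forall>f g v. (\<forall>y\<in>M \<inter> U. f y = g y) --> tder M (f :: 'a => real) x0 v = tder (M \<inter> U) g x0 v"
      and "\<forall>f g v. (\<forall>y\<in>M \<inter> U. f y = g y) --> tder M (f :: 'a => 'a) x0 v = tder (M \<inter> U) g x0 v"
    by (rule frame_pos[OF x0], rule that)
  interpret F: H_frame_pos "M \<inter> U" N n e k p q by (rule U(3))
  have x': "x0 \<in> M \<inter> U" using x0 U by simp
  note uw = F.uw_orthonormal[OF x', unfolded eq[OF x']]
  note prc = F.pr_components[OF x', unfolded eq[OF x']]
  have pq: "p > 1" "n = p + q + 1" using F.pq by auto
  define A where "A j = (if j = 1 then u x0 else if j <= p + 1 then e j x0 else if j = p + 2 then w x0 else e (j - 1) x0)" for j
  have on: "A i \<bullet> A j = (if i = j then 1 else 0)" if "i \<in> {1..n+1}" "j \<in> {1..n+1}" for i j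
  proof -
    have ue: "u x0 \<bullet> e i x0 = 0" "w x0 \<bullet> e i x0 = 0" "e i x0 \<bullet> u x0 = 0" "e i x0 \<bullet> w x0 = 0" if "i \<in> {2..n}" for i
      using uw(5,6)[OF that] by (simp_all add: inner_commute)
    have ee: "e i x0 \<bullet> e j x0 = (if i = j then 1 else 0)" if "i \<in> {2..n}" "j \<in> {2..n}" for i j
      using F.e_orthonormal[OF x', of i j] that by simp
    define f where "f j = (if j <= p + 1 then j else j - 1)" for j
    have Ae: "A j = e (f j) x0" "f j \<in> {2..n}" if "j \<in> {1..n+1}" "j ~= 1" "j ~= p + 2" for j
      using that pq by (auto simp: A_def f_def)
    have f_inj: "f i = f j \<longleftrightarrow> i = j" if "i ~= p + 2" "j ~= p + 2" for i j
      using that by (auto simp: f_def)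
    have A1: "A 1 = u x0" "A (p + 2) = w x0" using pq by (auto simp: A_def)
    consider "i = 1" | "i = p + 2" | "i ~= 1" "i ~= p + 2" by blast
    then show ?thesis
    proof cases
      case 1
      then show ?thesis using Ae[OF that(2)] ue[of "f j"] A1 uw(1-4) pq by (cases "j = 1"; cases "j = p + 2") auto
    next
      case 2
      then show ?thesis using Ae[OF that(2)] ue[of "f j"] A1 uw(1-4) pq by (cases "j = 1"; cases "j = p + 2") auto
    next
      case 3
      then show ?thesis using Ae[OF that(1)] Ae[OF that(2)] ue[of "f i"] ee[of "f i" "f j"] f_inj[of i j] A1 pq
        by (cases "j = 1"; cases "j = p + 2") auto
    qed
  qed
  have pr0: "pr (A j) x0 = (if j <= p + 1 then A j else 0)" if j: "j \<in> {1..n+1}" for j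
  proof (rule F.eqI[OF x'])
    have u: "pr (A j) x0 \<bullet> u x0 = A j \<bullet> u x0" and w: "pr (A j) x0 \<bullet> w x0 = 0" using prc by auto
    have Au: "A j \<bullet> u x0 = (if j = 1 then 1 else 0)" using on[OF j, of 1] pq by (simp add: A_def)
    have Aw: "A j \<bullet> w x0 = (if j = p + 2 then 1 else 0)" using on[OF j, of "p + 2"] pq by (simp add: A_def)
    have ru: "(if j <= p + 1 then A j else 0) \<bullet> u x0 = A j \<bullet> u x0" "(if j <= p + 1 then A j else 0) \<bullet> w x0 = 0"
      using Au Aw j by auto
    show "pr (A j) x0 \<bullet> N x0 = (if j <= p + 1 then A j else 0) \<bullet> N x0"
      unfolding uw(8) inner_diff_right inner_scaleR_right u w ru by simp
    fix i assume i: "i \<in> {1..n}"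
    show "pr (A j) x0 \<bullet> e i x0 = (if j <= p + 1 then A j else 0) \<bullet> e i x0"
    proof (cases "i = 1")
      case True
      show ?thesis unfolding True eq(1)[OF x'] uw(7) inner_add_right inner_scaleR_right u w ru by simp
    next
      case False
      then have i2: "i \<in> {2..n}" using i by auto
      show ?thesis
        unfolding prc(3)[OF i2]
        using on[OF j, of "if i <= p + 1 then i else i + 1"] i2 pq by (auto simp: A_def split: if_splits)
    qed
  qed
  have pr: "pr (A j) x = (if j <= p + 1 then A j else 0)" if "x \<in> M" "j \<in> {1..n+1}" for x j
    using pr_constant[OF that(1) x0] pr0[OF that(2)] by simp
  have pru: "pr z x \<bullet> u x = z \<bullet> u x" "pr z x \<bullet> w x = 0" if "x \<in> M" for z x
    using leaf_equations(5,7)[OF that] leaf_equations(10,11)[OF that, of z] by (simp_all add: inner_add_left)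
  show thesis
  proof (rule that[OF x0 _ on pr])
    show "A (p + 2) = w x0" using pq by (simp add: A_def)
    show "u x \<bullet> A j = 0" if "x \<in> M" "j \<in> {p+2..n+1}" for x j
      using pru(1)[OF that(1), of "A j"] pr[OF that(1), of j] that(2) by (simp add: inner_commute)
    show "w x \<bullet> A j = 0" if "x \<in> M" "j \<in> {1..p+1}" for x j
      using pru(2)[OF that(1), of "A j"] pr[OF that(1), of j] that(2) pq by (simp add: inner_commute)
  qed
qed

end

section \<open>The profile curve\<close>

lemma smooth_on_inverse:
  fixes f :: "'a::real_normed_vector => real"
  shows "open A ==> smooth_on A f ==> (!!x. x \<in> A ==> f x ~= 0) ==> smooth_on A (\<lambda>x. inverse (f x))"
  unfolding smooth_on_def using C_on_inverse[of A f] by simp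

lemmas smooth_on_mult = smooth_on_bilinear[OF bounded_bilinear_mult]

text \<open>
  The phase space consists of the profile \<open>(\<psi>, \<phi>)\<close> and its velocity. For \<open>q = 0\<close> the
  curvature \<open>kap p q\<close> is that of the profile of a cylinder, and \<open>\<phi>\<close> may vanish.
\<close>

definition kap :: "real => real => real \<times> real \<times> real \<times> real => real" where
  "kap p q z = 1/3 * (p * (snd (snd (snd z)) / fst z) - q * (fst (snd (snd z)) / fst (snd z)))"

definition profile_field :: "real => real => real \<times> real \<times> real \<times> real => real \<times> real \<times> real \<times> real" where
  "profile_field p q z = (fst (snd (snd z)), snd (snd (snd z)),
     kap p q z * snd (snd (snd z)), - (kap p q z * fst (snd (snd z))))"

definition phase_space :: "real => (real \<times> real \<times> real \<times> real) set" where
  "phase_space q = {z. fst z ~= 0 \<and> (q ~= 0 --> fst (snd z) ~= 0)}"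

lemma open_phase_space: "open (phase_space q)"
proof (cases "q = 0")
  case True
  then show ?thesis by (auto simp: phase_space_def intro!: open_Collect_neq continuous_intros)
next
  case False
  then have "phase_space q = {z. fst z ~= 0} \<inter> {z. fst (snd z) ~= 0}" by (auto simp: phase_space_def)
  then show ?thesis by (auto intro!: open_Int open_Collect_neq continuous_intros)
qed

lemma profile_field_smooth: "smooth_on (phase_space q) (profile_field p q)"
proof -
  note o = open_phase_space[of q]
  have proj: "smooth_on A fst" "smooth_on A (\<lambda>z. fst (snd z))" "smooth_on A (\<lambda>z. fst (snd (snd z)))"
    "smooth_on A (\<lambda>z. snd (snd (snd z)))" for A :: "(real \<times> real \<times> real \<times> real) set"
    by (intro smooth_on_bounded_linear bounded_linear_fst
        bounded_linear_compose[OF bounded_linear_fst bounded_linear_snd]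
        bounded_linear_compose[OF bounded_linear_fst bounded_linear_compose[OF bounded_linear_snd bounded_linear_snd]]
        bounded_linear_compose[OF bounded_linear_snd bounded_linear_compose[OF bounded_linear_snd bounded_linear_snd]])+
  have neg: "smooth_on (phase_space q) (\<lambda>z. - f z)" if "smooth_on (phase_space q) f" for f :: "_ => real"
    using smooth_on_mult[OF o smooth_on_const[of _ "-1"] that] by simp
  have 1: "smooth_on (phase_space q) (\<lambda>z. p * (snd (snd (snd z)) * inverse (fst z)))"
    by (rule smooth_on_mult[OF o smooth_on_const smooth_on_mult[OF o proj(4) smooth_on_inverse[OF o proj(1)]]])
      (simp add: phase_space_def)
  have 2: "smooth_on (phase_space q) (\<lambda>z. - (q * (fst (snd (snd z)) * inverse (fst (snd z)))))"
  proof (cases "q = 0")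
    case True
    then show ?thesis by (simp add: smooth_on_const)
  next
    case False
    show ?thesis
      by (rule neg[OF smooth_on_mult[OF o smooth_on_const smooth_on_mult[OF o proj(3) smooth_on_inverse[OF o proj(2)]]]])
        (use False in \<open>simp add: phase_space_def\<close>)
  qed
  have "smooth_on (phase_space q) (\<lambda>z. 1/3 * (p * (snd (snd (snd z)) * inverse (fst z)) +
      - (q * (fst (snd (snd z)) * inverse (fst (snd z))))))"
    by (rule smooth_on_mult[OF o smooth_on_const smooth_on_add[OF o 1 2]])
  then have kap: "smooth_on (phase_space q) (kap p q)"
    by (rule smooth_on_cong[OF o]) (simp only: kap_def divide_inverse diff_conv_add_uminus)
  have 3: "smooth_on (phase_space q) (\<lambda>z. kap p q z * snd (snd (snd z)))"
    by (rule smooth_on_mult[OF o kap proj(4)])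
  have 4: "smooth_on (phase_space q) (\<lambda>z. - (kap p q z * fst (snd (snd z))))"
    by (rule neg[OF smooth_on_mult[OF o kap proj(3)]])
  have 5: "smooth_on (phase_space q) (\<lambda>z. (kap p q z * snd (snd (snd z)), - (kap p q z * fst (snd (snd z)))))"
    by (rule smooth_on_Pair[OF o 3 4])
  have 6: "smooth_on (phase_space q) (\<lambda>z. (snd (snd (snd z)), kap p q z * snd (snd (snd z)), - (kap p q z * fst (snd (snd z)))))"
    by (rule smooth_on_Pair[OF o proj(4) 5])
  have 7: "smooth_on (phase_space q) (\<lambda>z. (fst (snd (snd z)), snd (snd (snd z)),
      kap p q z * snd (snd (snd z)), - (kap p q z * fst (snd (snd z)))))"
    by (rule smooth_on_Pair[OF o proj(3) 6])
  show ?thesis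
    by (rule smooth_on_cong[OF o 7]) (simp add: profile_field_def)
qed

lemma profile_of_solution:
  assumes Z: "solves (profile_field p q) (phase_space q) Z I" and s1: "s1 \<in> I"
    and unit: "(fst (snd (snd (Z s1))))\<^sup>2 + (snd (snd (snd (Z s1))))\<^sup>2 = 1"
  defines "\<psi> \<equiv> \<lambda>s. fst (Z s)" and "\<phi> \<equiv> \<lambda>s. fst (snd (Z s))"
  shows "profile_curve I \<psi> \<phi>"
    "!!s. s \<in> I ==> \<psi> s ~= 0 \<and> (q ~= 0 --> \<phi> s ~= 0) \<and> deriv \<psi> s = fst (snd (snd (Z s))) \<and> deriv \<phi> s = snd (snd (snd (Z s))) \<and>
      deriv \<phi> s * deriv (deriv \<psi>) s - deriv (deriv \<phi>) s * deriv \<psi> s =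
        1/3 * (p * (deriv \<phi> s / \<psi> s) - q * (deriv \<psi> s / \<phi> s))"
proof -
  define a where "a s = fst (snd (snd (Z s)))" for s
  define b where "b s = snd (snd (snd (Z s)))" for s
  note I = solvesD(3)[OF Z]
  have dZ: "(Z has_vector_derivative (a s, b s, kap p q (Z s) * b s, - (kap p q (Z s) * a s))) (at s)" if "s \<in> I" for s
    using solvesD(2)[OF Z that] by (simp add: profile_field_def a_def b_def)
  note lin = bounded_linear_fst bounded_linear_compose[OF bounded_linear_fst bounded_linear_snd]
        bounded_linear_compose[OF bounded_linear_fst bounded_linear_compose[OF bounded_linear_snd bounded_linear_snd]]
        bounded_linear_compose[OF bounded_linear_snd bounded_linear_compose[OF bounded_linear_snd bounded_linear_snd]]
  have d: "DERIV \<psi> s :> a s" "DERIV \<phi> s :> b s" "DERIV a s :> kap p q (Z s) * b s" "DERIV b s :> - (kap p q (Z s) * a s)"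
    if "s \<in> I" for s
    using lin[THEN bounded_linear.has_vector_derivative, OF dZ[OF that]]
    by (simp_all add: has_real_derivative_iff_has_vector_derivative \<psi>_def \<phi>_def a_def[abs_def] b_def[abs_def])
  have dpsi: "deriv \<psi> s = a s" "deriv \<phi> s = b s" if "s \<in> I" for s
    using d(1,2)[OF that] by (simp_all add: DERIV_imp_deriv)
  have ddpsi: "deriv (deriv \<psi>) s = kap p q (Z s) * b s" "deriv (deriv \<phi>) s = - (kap p q (Z s) * a s)" if s: "s \<in> I" for s
    by (rule DERIV_imp_deriv, rule has_field_derivative_transform_within_open[OF d(3)[OF s] I s], simp add: dpsi(1))
      (rule DERIV_imp_deriv, rule has_field_derivative_transform_within_open[OF d(4)[OF s] I s], simp add: dpsi(2))
  have "\<exists>C. \<forall>s\<in>I. (a s)\<^sup>2 + (b s)\<^sup>2 = C"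
  proof (rule has_field_derivative_zero_constant)
    show "convex I" using solvesD(4)[OF Z] by (simp add: is_interval_convex_1)
    fix s assume s: "s \<in> I"
    have "DERIV (\<lambda>s. (a s)\<^sup>2 + (b s)\<^sup>2) s :> 2 * a s * (kap p q (Z s) * b s) + 2 * b s * (- (kap p q (Z s) * a s))"
      using d(3,4)[OF s] by (auto intro!: derivative_eq_intros)
    then show "((\<lambda>s. (a s)\<^sup>2 + (b s)\<^sup>2) has_field_derivative 0) (at s within I)"
      by (simp add: algebra_simps has_field_derivative_at_within)
  qed
  then have ab: "(a s)\<^sup>2 + (b s)\<^sup>2 = 1" if "s \<in> I" for s
    using s1 unit that by (metis a_def b_def)
  have Zs: "smooth_on I Z" by (rule solves_smooth[OF open_phase_space profile_field_smooth Z])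
  have "smooth_on I \<psi>" "smooth_on I \<phi>"
    unfolding \<psi>_def \<phi>_def
    by (rule smooth_on_compose[OF I open_UNIV subset_UNIV smooth_on_bounded_linear[OF lin(1)] Zs])
      (rule smooth_on_compose[OF I open_UNIV subset_UNIV smooth_on_bounded_linear[OF lin(2)] Zs])
  then show "profile_curve I \<psi> \<phi>"
    using I solvesD(4)[OF Z] ab dpsi by (simp add: profile_curve_def)
  fix s assume s: "s \<in> I"
  have "b s * (kap p q (Z s) * b s) - - (kap p q (Z s) * a s) * a s = kap p q (Z s) * ((a s)\<^sup>2 + (b s)\<^sup>2)"
    by (simp add: power2_eq_square algebra_simps)
  also have "\<dots> = kap p q (Z s)" by (simp add: ab[OF s])
  finally have "b s * (kap p q (Z s) * b s) - - (kap p q (Z s) * a s) * a s = 1/3 * (p * (b s / \<psi> s) - q * (a s / \<phi> s))"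
    by (simp add: kap_def \<psi>_def \<phi>_def a_def b_def)
  then show "\<psi> s ~= 0 \<and> (q ~= 0 --> \<phi> s ~= 0) \<and> deriv \<psi> s = fst (snd (snd (Z s))) \<and> deriv \<phi> s = snd (snd (snd (Z s))) \<and>
      deriv \<phi> s * deriv (deriv \<psi>) s - deriv (deriv \<phi>) s * deriv \<psi> s =
        1/3 * (p * (deriv \<phi> s / \<psi> s) - q * (deriv \<psi> s / \<phi> s))"
    using solvesD(1)[OF Z s] unfolding dpsi[OF s] ddpsi[OF s]
    by (simp add: phase_space_def \<psi>_def \<phi>_def a_def b_def)
qed

section \<open>Realizing a hypersurface by a parametrization\<close>

context hypersurface
begin

text \<open>
  The parameters for which \<open>Q s\<close> holds at the image point form an open set: by transversality of \<open>R\<close>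
  to the curve \<open>r\<close>, a point near \<open>M\<close> with the right value of \<open>R\<close> already lies on \<open>M\<close>.
\<close>

lemma param_representation:
  fixes b A :: "nat => 'a" and cd :: "real => (nat => real) => nat => real" and Q :: "real => 'a => bool"
    and R :: "'a => real \<times> real" and r :: "real => real \<times> real"
  assumes dim: "DIM('a) = n + 1" and b: "bij_betw b {1..n+1} Basis"
    and A: "!!i j. i \<in> {1..n+1} ==> j \<in> {1..n+1} ==> A i \<bullet> A j = (if i = j then 1 else 0)"
    and I: "open I" and cont: "!!j. j \<in> {1..n+1} ==> continuous_on (I \<times> UNIV) (\<lambda>z. cd (fst z) (snd z) j)"
    and surj: "!!x. x \<in> M ==> \<exists>s\<in>I. \<exists>t\<in>extensional {2..n}. Q s x \<and> (\<forall>j\<in>{1..n+1}. (x - O') \<bullet> A j = cd s t j)"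
    and R: "smooth_on UNIV R" and r: "smooth_on I r"
    and RX: "!!s t y. s \<in> I ==> (!!j. j \<in> {1..n+1} ==> (y - O') \<bullet> A j = cd s t j) ==> R y = r s"
    and RQ: "!!s y. s \<in> I ==> y \<in> M ==> Q s y ==> R y = r s"
    and trans: "!!x s. x \<in> M ==> s \<in> I ==> Q s x ==> \<exists>r'. (r has_vector_derivative r') (at s) \<and>
        (\<forall>c \<sigma>. c *\<^sub>R frechet_derivative R (at x) (N x) = \<sigma> *\<^sub>R r' --> c = 0 \<and> \<sigma> = 0)"
    and near: "!!x s e. x \<in> M ==> s \<in> I ==> Q s x ==> e > 0 ==>
        \<exists>d>0. \<forall>y\<in>M. dist y x < d --> (\<exists>s'\<in>I. \<bar>s' - s\<bar> < e \<and> Q s' y)"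
  shows "\<exists>D. param_domain n I D \<and> congruent_sets M ((\<lambda>(s, t). \<Sum>j\<in>{1..n+1}. cd s t j *\<^sub>R b j) ` D)"
proof -
  have A_exp: "(\<Sum>j\<in>{1..n+1}. (v \<bullet> A j) *\<^sub>R A j) = v" "v \<bullet> v = (\<Sum>j\<in>{1..n+1}. (v \<bullet> A j) * (v \<bullet> A j))" for v
    by (rule orthonormal_expansion[of "{1..n+1}" A], simp, simp add: dim, rule A, assumption, assumption)+
  have bb: "b i \<bullet> b j = (if i = j then 1 else 0)" if "i \<in> {1..n+1}" "j \<in> {1..n+1}" for i j
    using bij_betwE[OF b] inj_on_eq_iff[OF bij_betw_imp_inj_on[OF b] that] that by (simp add: inner_Basis)
  define F where "F x = (\<Sum>j\<in>{1..n+1}. ((x - O') \<bullet> A j) *\<^sub>R b j)" for x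
  define X where "X z = O' + (\<Sum>j\<in>{1..n+1}. cd (fst z) (snd z) j *\<^sub>R A j)" for z
  have XA: "(X z - O') \<bullet> A j = cd (fst z) (snd z) j" if j: "j \<in> {1..n+1}" for z j
  proof -
    have "(X z - O') \<bullet> A j = (\<Sum>i\<in>{1..n+1}. if i = j then cd (fst z) (snd z) j else 0)"
      unfolding X_def add_diff_cancel_left' inner_sum_left by (rule sum.cong) (use A[OF _ j] in auto)
    then show ?thesis using j by simp
  qed
  have XI: "X (s, t) = x" if "!!j. j \<in> {1..n+1} ==> (x - O') \<bullet> A j = cd s t j" for x s t
  proof -
    have "(\<Sum>j\<in>{1..n+1}. cd s t j *\<^sub>R A j) = (\<Sum>j\<in>{1..n+1}. ((x - O') \<bullet> A j) *\<^sub>R A j)"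
      by (rule sum.cong) (use that in auto)
    then show ?thesis by (simp add: X_def A_exp(1))
  qed
  define D where "D = {z. snd z \<in> extensional {2..n} \<and> fst z \<in> I \<and> X z \<in> M \<and> Q (fst z) (X z)}"
  have isom: "dist (F x) (F y) = dist x y" for x y
  proof -
    have e: "F x - F y = (\<Sum>j\<in>{1..n+1}. ((x - y) \<bullet> A j) *\<^sub>R b j)"
      by (simp add: F_def sum_subtractf[symmetric] scaleR_diff_left[symmetric] inner_diff_left)
    have "(F x - F y) \<bullet> b i = (x - y) \<bullet> A i" if i: "i \<in> {1..n+1}" for i
    proof -
      have "(F x - F y) \<bullet> b i = (\<Sum>j\<in>{1..n+1}. if j = i then (x - y) \<bullet> A i else 0)"
        unfolding e inner_sum_left by (rule sum.cong) (use bb[OF _ i] in auto)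
      then show ?thesis using i by simp
    qed
    then have "(F x - F y) \<bullet> (F x - F y) = (x - y) \<bullet> (x - y)"
      unfolding A_exp(2)[of "x - y"] by (subst (2) e) (simp add: inner_sum_right)
    then show ?thesis by (simp add: dist_norm norm_eq_sqrt_inner)
  qed
  have "F ` M = (\<lambda>(s, t). \<Sum>j\<in>{1..n+1}. cd s t j *\<^sub>R b j) ` D"
  proof (intro subset_antisym subsetI)
    fix y assume "y \<in> F ` M"
    then obtain x where x: "x \<in> M" "y = F x" by blast
    obtain s t where st: "s \<in> I" "t \<in> extensional {2..n}" "Q s x" "!!j. j \<in> {1..n+1} ==> (x - O') \<bullet> A j = cd s t j"
      using surj[OF x(1)] by blast
    have "(s, t) \<in> D" using st x(1) XI[OF st(4)] by (simp add: D_def)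
    moreover have "y = (\<Sum>j\<in>{1..n+1}. cd s t j *\<^sub>R b j)"
      unfolding x(2) F_def by (rule sum.cong) (use st(4) in auto)
    ultimately show "y \<in> (\<lambda>(s, t). \<Sum>j\<in>{1..n+1}. cd s t j *\<^sub>R b j) ` D" by force
  next
    fix y assume "y \<in> (\<lambda>(s, t). \<Sum>j\<in>{1..n+1}. cd s t j *\<^sub>R b j) ` D"
    then obtain z where z: "z \<in> D" "y = (\<Sum>j\<in>{1..n+1}. cd (fst z) (snd z) j *\<^sub>R b j)" by auto
    have "F (X z) = y" unfolding F_def z(2) by (rule sum.cong) (use XA in auto)
    then show "y \<in> F ` M" using z(1) by (auto simp: D_def)
  qed
  then have cong: "congruent_sets M ((\<lambda>(s, t). \<Sum>j\<in>{1..n+1}. cd s t j *\<^sub>R b j) ` D)"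
    unfolding congruent_sets_def using isom by blast
  have X_cont: "continuous_on (I \<times> UNIV) X"
    unfolding X_def by (intro continuous_intros cont)
  have "openin (param_topology n) D"
  proof (subst openin_subopen, rule ballI)
    fix z assume z: "z \<in> D"
    define x s where "x = X z" and "s = fst z"
    have xs: "x \<in> M" "s \<in> I" "Q s x" using z by (auto simp: D_def x_def s_def)
    obtain r' where r': "(r has_vector_derivative r') (at s)"
      "!!c \<sigma>. c *\<^sub>R frechet_derivative R (at x) (N x) = \<sigma> *\<^sub>R r' ==> c = 0 \<and> \<sigma> = 0"
      using trans[OF xs] by blast
    obtain d where d: "d > 0" "!!y s'. s' \<in> I ==> dist y x < d ==> \<bar>s' - s\<bar> < d ==> R y = r s' ==> y \<in> M \<and> Q s' y"
      by (rule transversal_points[OF xs(1) R I xs(2) r r'(1) refl r'(2) near[OF xs]])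
        (use RQ in auto)
    define W where "W = (I \<times> UNIV) \<inter> X -` ball x d \<inter> (ball s d \<times> UNIV)"
    have "open W" unfolding W_def
      by (intro open_Int continuous_open_preimage[OF X_cont] open_Times I) auto
    then have "openin (param_topology n) ({z. snd z \<in> extensional {2..n}} \<inter> W)" by (rule openin_param_topology)
    moreover have "z \<in> {z. snd z \<in> extensional {2..n}} \<inter> W"
      using z d(1) by (auto simp: W_def D_def x_def s_def mem_Times_iff)
    moreover have "{z. snd z \<in> extensional {2..n}} \<inter> W \<subseteq> D"
    proof
      fix y assume y: "y \<in> {z. snd z \<in> extensional {2..n}} \<inter> W"
      have "R (X y) = r (fst y)"
        by (rule RX[of "fst y" "X y" "snd y"]) (use y XA in \<open>auto simp: W_def mem_Times_iff\<close>)
      then have "X y \<in> M \<and> Q (fst y) (X y)"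
        by (intro d(2)) (use y in \<open>auto simp: W_def mem_Times_iff dist_commute dist_real_def abs_minus_commute\<close>)
      then show "y \<in> D" using y by (auto simp: D_def W_def mem_Times_iff)
    qed
    ultimately show "\<exists>T. openin (param_topology n) T \<and> z \<in> T \<and> T \<subseteq> D" by blast
  qed
  then have "param_domain n I D" by (auto simp: param_domain_def D_def)
  then show ?thesis using cong by blast
qed

end

lemma sphere_coord_cong:
  "(!!l. l \<in> {1..d} ==> \<theta> l = \<theta>' l) ==> i \<in> {1..d+1} ==> sphere_coord d \<theta> i = sphere_coord d \<theta>' i"
  unfolding sphere_coord_def by (intro arg_cong2[where f = "(*)"] prod.cong) auto

lemma continuous_on_angle: "continuous_on S (\<lambda>z :: real \<times> (nat => real). snd z i)"
  by (rule continuous_on_compose2[OF continuous_on_product_coordinates continuous_on_snd[OF continuous_on_id]]) auto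

lemma continuous_on_sphere_coord:
  "continuous_on S (\<lambda>z :: real \<times> (nat => real). sphere_coord d (\<lambda>l. snd z (f l)) i)"
  unfolding sphere_coord_def
  by (cases "i <= d") (auto intro!: continuous_intros continuous_on_angle)


lemma sum_squares_adapted:
  fixes A :: "nat => 'a::euclidean_space"
  assumes dim: "DIM('a) = n + 1"
    and A: "!!i j. i \<in> {1..n+1} ==> j \<in> {1..n+1} ==> A i \<bullet> A j = (if i = j then 1 else 0)"
    and S: "S \<subseteq> {1..n+1}" and z: "!!j. j \<in> {1..n+1} - S ==> v \<bullet> A j = 0"
  shows "(\<Sum>j\<in>S. (v \<bullet> A j)\<^sup>2) = v \<bullet> v"
proof -
  have "v \<bullet> v = (\<Sum>j\<in>{1..n+1}. (v \<bullet> A j) * (v \<bullet> A j))"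
    by (rule orthonormal_expansion(2)[of "{1..n+1}" A], simp, simp add: dim, rule A, assumption, assumption)
  also have "\<dots> = (\<Sum>j\<in>S. (v \<bullet> A j) * (v \<bullet> A j))"
    by (rule sum.mono_neutral_right) (use S z in auto)
  finally show ?thesis by (simp add: power2_eq_square)
qed

lemma has_derivative_sum_squares:
  fixes A :: "nat => 'a::euclidean_space"
  shows "((\<lambda>y. \<Sum>j\<in>S. ((y - O') \<bullet> A j)\<^sup>2) has_derivative (\<lambda>v. \<Sum>j\<in>S. 2 * ((x - O') \<bullet> A j) * (v \<bullet> A j))) (at x)"
  by (rule has_derivative_sum, rule has_derivative_eq_rhs, (rule derivative_intros)+) (auto simp: fun_eq_iff)

lemma sum_squares_smooth:
  fixes A :: "nat => 'a::euclidean_space"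
  shows "smooth_on UNIV (\<lambda>y. (y - O') \<bullet> A j)" "smooth_on UNIV (\<lambda>y. \<Sum>j\<in>S. ((y - O') \<bullet> A j)\<^sup>2)"
proof -
  show 1: "smooth_on UNIV (\<lambda>y. (y - O') \<bullet> A j)" for j
    using smooth_on_bilinear[OF bounded_bilinear_inner open_UNIV
        smooth_on_add[OF open_UNIV smooth_on_ident smooth_on_const[of _ "- O'"]] smooth_on_const[of _ "A j"]]
    by simp
  show "smooth_on UNIV (\<lambda>y. \<Sum>j\<in>S. ((y - O') \<bullet> A j)\<^sup>2)"
    unfolding power2_eq_square by (rule smooth_on_sum[OF open_UNIV smooth_on_mult[OF open_UNIV 1 1]])
qed

lemma transversal_vectors:
  fixes a b c \<sigma> :: real
  assumes "- (c * b) = \<sigma> * a" "c * a = \<sigma> * b" "a * a + b * b = 1"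
  shows "c = 0 \<and> \<sigma> = 0"
proof -
  have "c * (a * a + b * b) = (c * a) * a - (- (c * b)) * b" by (simp add: algebra_simps)
  also have "\<dots> = 0" unfolding assms(1,2) by (simp add: algebra_simps)
  finally have c: "c = 0" using assms(3) by simp
  have "\<sigma> * (a * a + b * b) = (\<sigma> * a) * a + (\<sigma> * b) * b" by (simp add: algebra_simps)
  also have "\<dots> = 0" unfolding assms(1,2)[symmetric] by (simp add: c)
  finally show ?thesis using assms(3) c by simp
qed

section \<open>H-hypersurfaces are rotational or cylindrical\<close>

context H_global_pos
begin

lemma const_facts: "DIM('a) = n + 1" "p > 1" "q > 1" "n = p + q + 1"
proof -
  obtain x where "x \<in> M" using conn(2) by blast
  from pointwise_facts(1-4)[OF this] show "DIM('a) = n + 1" "p > 1" "q > 1" "n = p + q + 1" by auto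
qed

text \<open>
  The two cases below differ in the coordinate \<open>\<phi>\<close> and in the multiplicity \<open>q'\<close> that enters the
  curvature of the profile: \<open>q' = q\<close> for rotational hypersurfaces, \<open>q' = 0\<close> for cylinders.
\<close>

lemma profile_exists:
  fixes \<phi> :: "'a => real" and q' :: real
  assumes phi: "smooth_along M \<phi>" "!!x v. x \<in> M ==> N x \<bullet> v = 0 ==> tder M \<phi> x v = b x * (v \<bullet> E x)"
    and q': "!!x. x \<in> M ==> q' ~= 0 ==> \<phi> x ~= 0"
    and k1: "!!x. x \<in> M ==> k 1 x = - kap p q' (\<psi> x, \<phi> x, a x, b x)"
  obtains I \<psi>' \<phi>' Q where "profile_curve I \<psi>' \<phi>'"
    "!!s. s \<in> I ==> \<psi>' s ~= 0 \<and> (q' ~= 0 --> \<phi>' s ~= 0) \<and>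
      deriv \<phi>' s * deriv (deriv \<psi>') s - deriv (deriv \<phi>') s * deriv \<psi>' s =
        1/3 * (p * (deriv \<phi>' s / \<psi>' s) - q' * (deriv \<psi>' s / \<phi>' s))"
    "!!x. x \<in> M ==> \<exists>s\<in>I. Q s x"
    "!!x s. s \<in> I ==> x \<in> M ==> Q s x ==> \<psi>' s = \<psi> x \<and> \<phi>' s = \<phi> x \<and> deriv \<psi>' s = a x \<and> deriv \<phi>' s = b x"
    "!!x s e. x \<in> M ==> s \<in> I ==> Q s x ==> e > 0 ==>
        \<exists>d>0. \<forall>y\<in>M. dist y x < d --> (\<exists>s'\<in>I. \<bar>s' - s\<bar> < e \<and> Q s' y)"
proof -
  let ?G = "profile_field p q'" and ?Om = "phase_space q'"
  define Y where "Y x = (\<psi> x, \<phi> x, a x, b x)" for x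
  note sm = leaf_data_smooth(1,2,3)
  have Ys: "smooth_along M Y"
    unfolding Y_def by (rule smooth_along_Pair[OF sm(1) smooth_along_Pair[OF phi(1) smooth_along_Pair[OF sm(2,3)]]])
  have YO: "Y x \<in> ?Om" if "x \<in> M" for x
    using leaf_equations(1)[OF that] q'[OF that] by (simp add: Y_def phase_space_def)
  have DY: "tder M Y x v = (v \<bullet> E x) *\<^sub>R ?G (Y x)" if x: "x \<in> M" and v: "N x \<bullet> v = 0" for x v
  proof -
    have T: "v \<in> tangent_space M x" using v tangent_iff[OF x] by simp
    have "tder M Y x v = (tder M \<psi> x v, tder M \<phi> x v, tder M a x v, tder M b x v)"
      unfolding Y_def
      by (simp only: tder_Pair[OF x T sm(1) smooth_along_Pair[OF phi(1) smooth_along_Pair[OF sm(2,3)]]]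
        tder_Pair[OF x T phi(1) smooth_along_Pair[OF sm(2,3)]] tder_Pair[OF x T sm(2,3)])
    then show ?thesis
      using leaf_equations(13-15)[OF x v] phi(2)[OF x v] k1[OF x] by (simp add: profile_field_def Y_def)
  qed
  note E = E_smooth pointwise_facts(5,6)
  note G = open_phase_space[of q'] profile_field_smooth[of q' p]
  obtain Z I where Z: "solves ?G ?Om Z I" and ZM: "!!x. x \<in> M ==> \<exists>s\<in>I. Z s = Y x"
    by (rule single_integral_curve[OF E G Ys YO DY conn], assumption+, rule that)
  obtain x1 where x1: "x1 \<in> M" using conn(2) by blast
  obtain s1 where s1: "s1 \<in> I" "Z s1 = Y x1" using ZM[OF x1] by blast
  have unit: "(fst (snd (snd (Z s1))))\<^sup>2 + (snd (snd (snd (Z s1))))\<^sup>2 = 1"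
    using leaf_equations(2)[OF x1] by (simp add: s1(2) Y_def power2_eq_square)
  note prof = profile_of_solution[OF Z s1(1) unit]
  show thesis
  proof (rule that[OF prof(1), of "\<lambda>s x. Z s = Y x"])
    show "\<exists>s\<in>I. Z s = Y x" if "x \<in> M" for x by (rule ZM[OF that])
    show "fst (Z s) = \<psi> x \<and> fst (snd (Z s)) = \<phi> x \<and> deriv (\<lambda>s. fst (Z s)) s = a x \<and> deriv (\<lambda>s. fst (snd (Z s))) s = b x"
      if "s \<in> I" "x \<in> M" "Z s = Y x" for x s
      using prof(2)[OF that(1)] that(3) by (simp add: Y_def)
    show "\<exists>d>0. \<forall>y\<in>M. dist y x < d --> (\<exists>s'\<in>I. \<bar>s' - s\<bar> < e \<and> Z s' = Y y)"
      if xs: "x \<in> M" "s \<in> I" "Z s = Y x" "e > 0" for x s e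
    proof -
      obtain d where "d > 0" "!!y. y \<in> M ==> dist y x < d ==> \<exists>s'\<in>I. \<bar>s' - s\<bar> < e \<and> Z s' = Y y"
        by (rule near_integral_curve[OF E G Ys YO DY xs(1) Z xs(2,3,4)], assumption+, rule that)
      then show ?thesis by blast
    qed
  qed (use prof(2) in blast)
qed

end

context H_global_pos
begin

text \<open>Coordinates of unit vectors with respect to the adapted basis.\<close>

lemma direction_angles:
  fixes A :: "nat => 'a"
  assumes A: "!!i j. i \<in> {1..n+1} ==> j \<in> {1..n+1} ==> A i \<bullet> A j = (if i = j then 1 else 0)"
    and uA: "!!j. j \<in> {p+2..n+1} ==> v \<bullet> A j = 0" and v: "v \<bullet> v = 1"
  obtains \<theta> where "!!j. j \<in> {1..p+1} ==> v \<bullet> A j = sphere_coord p \<theta> j"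
proof -
  have "(\<Sum>j\<in>{1..p+1}. (v \<bullet> A j)\<^sup>2) = v \<bullet> v"
    by (rule sum_squares_adapted[OF const_facts(1) A]) (use const_facts uA in auto)
  then show thesis using sphere_coord_surj[of p "\<lambda>j. v \<bullet> A j"] const_facts(2) v that by auto
qed

lemma codirection_angles:
  fixes A :: "nat => 'a"
  assumes A: "!!i j. i \<in> {1..n+1} ==> j \<in> {1..n+1} ==> A i \<bullet> A j = (if i = j then 1 else 0)"
    and wA: "!!j. j \<in> {1..p+1} ==> v \<bullet> A j = 0" and v: "v \<bullet> v = 1"
  obtains \<theta> where "!!j. j \<in> {p+2..n+1} ==> v \<bullet> A j = sphere_coord q \<theta> (j - (p + 1))"
proof -
  have "(\<Sum>j\<in>{p+2..n+1}. (v \<bullet> A j)\<^sup>2) = v \<bullet> v"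
    by (rule sum_squares_adapted[OF const_facts(1) A]) (use const_facts wA in auto)
  moreover have "(\<Sum>j\<in>{1 + (p+1)..q + 1 + (p+1)}. (v \<bullet> A j)\<^sup>2) = (\<Sum>i\<in>{1..q+1}. (v \<bullet> A (i + (p+1)))\<^sup>2)"
    by (rule sum.shift_bounds_cl_nat_ivl)
  moreover have "{1 + (p+1)..q + 1 + (p+1)} = {p+2..n+1}" using const_facts by auto
  ultimately have "(\<Sum>i\<in>{1..q+1}. (v \<bullet> A (i + (p+1)))\<^sup>2) = 1" using v by simp
  then obtain \<theta> where th: "\<forall>i\<in>{1..q+1}. v \<bullet> A (i + (p+1)) = sphere_coord q \<theta> i"
    using sphere_coord_surj[of q "\<lambda>i. v \<bullet> A (i + (p+1))"] const_facts(3) by auto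
  show thesis
  proof (rule that[of \<theta>])
    fix j assume j: "j \<in> {p+2..n+1}"
    have "j - (p + 1) \<in> {1..q+1}" "j - (p + 1) + (p + 1) = j" using j const_facts by auto
    then show "v \<bullet> A j = sphere_coord q \<theta> (j - (p + 1))" using th by metis
  qed
qed

lemma sphere_coord_squares:
  "(\<Sum>j\<in>{1..p+1}. (r * sphere_coord p \<theta> j)\<^sup>2) = r\<^sup>2"
  "(\<Sum>j\<in>{p+2..n+1}. (r * sphere_coord q \<theta> (j - (p + 1)))\<^sup>2) = r\<^sup>2"
proof -
  show "(\<Sum>j\<in>{1..p+1}. (r * sphere_coord p \<theta> j)\<^sup>2) = r\<^sup>2"
    unfolding power_mult_distrib sum_distrib_left[symmetric] sphere_coord_norm by simp
  have eq: "{1 + (p+1)..q + 1 + (p+1)} = {p+2..n+1}" using const_facts by auto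
  have "(\<Sum>j\<in>{1 + (p+1)..q + 1 + (p+1)}. (r * sphere_coord q \<theta> (j - (p + 1)))\<^sup>2)
      = (\<Sum>i\<in>{1..q+1}. (r * sphere_coord q \<theta> (i + (p+1) - (p + 1)))\<^sup>2)"
    by (rule sum.shift_bounds_cl_nat_ivl)
  also have "\<dots> = r\<^sup>2"
    unfolding power_mult_distrib sum_distrib_left[symmetric] add_diff_cancel_right' sphere_coord_norm by simp
  finally show "(\<Sum>j\<in>{p+2..n+1}. (r * sphere_coord q \<theta> (j - (p + 1)))\<^sup>2) = r\<^sup>2"
    unfolding eq .
qed

lemma inner_sums:
  fixes A :: "nat => 'a"
  assumes A: "!!i j. i \<in> {1..n+1} ==> j \<in> {1..n+1} ==> A i \<bullet> A j = (if i = j then 1 else 0)"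
    and x: "x \<in> M"
    and uA: "!!j. j \<in> {p+2..n+1} ==> u x \<bullet> A j = 0" and wA: "!!j. j \<in> {1..p+1} ==> w x \<bullet> A j = 0"
  shows "(\<Sum>j\<in>{1..p+1}. 2 * (r * (u x \<bullet> A j)) * (N x \<bullet> A j)) = - (2 * r * b x)"
    "(\<Sum>j\<in>{p+2..n+1}. 2 * (r * (w x \<bullet> A j)) * (N x \<bullet> A j)) = 2 * r * a x"
proof -
  have N: "N x \<bullet> A j = a x * (w x \<bullet> A j) - b x * (u x \<bullet> A j)" for j
    by (subst leaf_equations(9)[OF x]) (simp add: inner_diff_left)
  have "(\<Sum>j\<in>{1..p+1}. 2 * (r * (u x \<bullet> A j)) * (N x \<bullet> A j)) = (\<Sum>j\<in>{1..p+1}. - (2 * r * b x) * (u x \<bullet> A j)\<^sup>2)"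
    by (rule sum.cong) (use wA in \<open>auto simp: N power2_eq_square\<close>)
  also have "\<dots> = - (2 * r * b x) * (u x \<bullet> u x)"
    unfolding sum_distrib_left[symmetric]
    by (subst sum_squares_adapted[OF const_facts(1) A]) (use const_facts uA in auto)
  finally show "(\<Sum>j\<in>{1..p+1}. 2 * (r * (u x \<bullet> A j)) * (N x \<bullet> A j)) = - (2 * r * b x)"
    by (simp add: leaf_equations(5)[OF x])
  have "(\<Sum>j\<in>{p+2..n+1}. 2 * (r * (w x \<bullet> A j)) * (N x \<bullet> A j)) = (\<Sum>j\<in>{p+2..n+1}. (2 * r * a x) * (w x \<bullet> A j)\<^sup>2)"
    by (rule sum.cong) (use uA in \<open>auto simp: N power2_eq_square\<close>)
  also have "\<dots> = (2 * r * a x) * (w x \<bullet> w x)"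
    unfolding sum_distrib_left[symmetric]
    by (subst sum_squares_adapted[OF const_facts(1) A]) (use const_facts wA in auto)
  finally show "(\<Sum>j\<in>{p+2..n+1}. 2 * (r * (w x \<bullet> A j)) * (N x \<bullet> A j)) = 2 * r * a x"
    by (simp add: leaf_equations(6)[OF x])
qed

lemma tder_position:
  assumes x: "x \<in> M" and v: "N x \<bullet> v = 0"
  shows "tder M (\<lambda>x. x - \<psi> x *\<^sub>R u x) x v = v - P x v - (a x * (v \<bullet> E x)) *\<^sub>R u x"
proof -
  have T: "v \<in> tangent_space M x" using v tangent_iff[OF x] by simp
  note s = leaf_data_smooth(1,4)
  have "tder M (\<lambda>x. x - \<psi> x *\<^sub>R u x) x v = v - (\<psi> x *\<^sub>R tder M u x v + tder M \<psi> x v *\<^sub>R u x)"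
    by (simp only: tder_diff[OF x T smooth_along_ident smooth_along_scaleR[OF s]] tder_scaleR[OF x T s] tder_ident[OF x T])
  then show ?thesis using leaf_equations(1)[OF x] leaf_equations(13,17)[OF x v] by (simp add: algebra_simps)
qed

text \<open>
  With \<open>\<phi> = - 1 / c\<close> the derivative of \<open>x - \<psi> u - \<phi> w\<close> vanishes. So \<open>M\<close> lies on spheres about one
  centre in each of two orthogonal subspaces, with radii \<open>\<psi>\<close> and \<open>\<phi>\<close>.
\<close>

lemma rotational_case:
  fixes bs :: "nat => 'a"
  assumes bs: "bij_betw bs {1..n+1} Basis" and c: "!!x. x \<in> M ==> c x ~= 0"
  shows "rotational_type bs n p M"
proof -
  define \<phi> where "\<phi> x = - inverse (c x)" for x
  have phi_s: "smooth_along M \<phi>"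
    unfolding \<phi>_def by (rule smooth_along_uminus[OF smooth_along_inverse[OF leaf_data_smooth(6) c]])
  have phi_nz: "\<phi> x ~= 0" if "x \<in> M" for x using c[OF that] by (simp add: \<phi>_def)
  have phi_d: "tder M \<phi> x v = b x * (v \<bullet> E x)" if x: "x \<in> M" and v: "N x \<bullet> v = 0" for x v
  proof -
    have T: "v \<in> tangent_space M x" using v tangent_iff[OF x] by simp
    have "tder M \<phi> x v = - tder M (\<lambda>y. inverse (c y)) x v"
      unfolding \<phi>_def[abs_def] by (rule tder_uminus[OF x T smooth_along_inverse[OF leaf_data_smooth(6) c]])
    also have "tder M (\<lambda>y. inverse (c y)) x v = - (tder M c x v / (c x)\<^sup>2)"
      by (rule tder_inverse[OF x T leaf_data_smooth(6) c[OF x]])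
    finally have "tder M \<phi> x v = tder M c x v / (c x)\<^sup>2" by simp
    then show ?thesis using leaf_equations(16)[OF x v] c[OF x] by (simp add: power2_eq_square)
  qed
  have k1: "k 1 x = - kap p q (\<psi> x, \<phi> x, a x, b x)" if x: "x \<in> M" for x
  proof -
    have 1: "b x / \<psi> x = k 2 x" unfolding leaf_equations(3)[OF x] by (rule divide_inverse)
    have 2: "a x / \<phi> x = - k (p+2) x"
      unfolding \<phi>_def leaf_equations(4)[OF x] using c[OF x] by (simp add: field_simps)
    have "kap p q (\<psi> x, \<phi> x, a x, b x) = 1/3 * (p * (b x / \<psi> x) - q * (a x / \<phi> x))" by (simp add: kap_def)
    then show ?thesis unfolding 1 2 using pointwise_facts(10)[OF x] by simp
  qed
  have q0: "real q ~= 0" using const_facts(3) by simp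
  obtain I \<psi>' \<phi>' Q where prof: "profile_curve I \<psi>' \<phi>'"
    "!!s. s \<in> I ==> \<psi>' s ~= 0 \<and> (real q ~= 0 --> \<phi>' s ~= 0) \<and>
      deriv \<phi>' s * deriv (deriv \<psi>') s - deriv (deriv \<phi>') s * deriv \<psi>' s =
        1/3 * (p * (deriv \<phi>' s / \<psi>' s) - q * (deriv \<psi>' s / \<phi>' s))"
    and Q: "!!x. x \<in> M ==> \<exists>s\<in>I. Q s x"
    "!!x s. s \<in> I ==> x \<in> M ==> Q s x ==> \<psi>' s = \<psi> x \<and> \<phi>' s = \<phi> x \<and> deriv \<psi>' s = a x \<and> deriv \<phi>' s = b x"
    and near: "!!x s e. x \<in> M ==> s \<in> I ==> Q s x ==> e > 0 ==>
        \<exists>d>0. \<forall>y\<in>M. dist y x < d --> (\<exists>s'\<in>I. \<bar>s' - s\<bar> < e \<and> Q s' y)"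
    by (rule profile_exists[OF phi_s phi_d phi_nz k1], assumption+, rule that)
  obtain A x0 where x0: "x0 \<in> M" and "A (p+2) = w x0"
    and A: "!!i j. i \<in> {1..n+1} ==> j \<in> {1..n+1} ==> A i \<bullet> A j = (if i = j then 1 else 0)"
    and "!!x j. x \<in> M ==> j \<in> {1..n+1} ==> pr (A j) x = (if j <= p + 1 then A j else 0)"
    and uA: "!!x j. x \<in> M ==> j \<in> {p+2..n+1} ==> u x \<bullet> A j = 0"
    and wA: "!!x j. x \<in> M ==> j \<in> {1..p+1} ==> w x \<bullet> A j = 0"
    by (rule adapted_basis, rule that)
  define F where "F x = x - \<psi> x *\<^sub>R u x - \<phi> x *\<^sub>R w x" for x
  note s1 = smooth_along_diff[OF smooth_along_ident smooth_along_scaleR[OF leaf_data_smooth(1,4)]]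
  note s2 = smooth_along_scaleR[OF phi_s leaf_data_smooth(5)]
  have dF: "tder M F x v = 0" if x: "x \<in> M" and v: "N x \<bullet> v = 0" for x v
  proof -
    have T: "v \<in> tangent_space M x" using v tangent_iff[OF x] by simp
    have "tder M F x v = tder M (\<lambda>x. x - \<psi> x *\<^sub>R u x) x v - (\<phi> x *\<^sub>R tder M w x v + tder M \<phi> x v *\<^sub>R w x)"
      unfolding F_def[abs_def] by (simp only: tder_diff[OF x T s1 s2] tder_scaleR[OF x T phi_s leaf_data_smooth(5)])
    also have "\<phi> x *\<^sub>R tder M w x v = v - (v \<bullet> E x) *\<^sub>R E x - P x v"
      using leaf_equations(18)[OF x v] c[OF x] by (simp add: \<phi>_def)
    also have "(v \<bullet> E x) *\<^sub>R E x = (v \<bullet> E x) *\<^sub>R (a x *\<^sub>R u x + b x *\<^sub>R w x)"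
      by (simp only: leaf_equations(8)[OF x, symmetric])
    finally show ?thesis unfolding tder_position[OF x v] phi_d[OF x v] by (simp add: algebra_simps)
  qed
  have Fs: "smooth_along M F" unfolding F_def by (rule smooth_along_diff[OF s1 s2])
  define O' where "O' = F x0"
  have pos: "x - O' = \<psi> x *\<^sub>R u x + \<phi> x *\<^sub>R w x" if "x \<in> M" for x
    using zero_derivative_constant[OF conn(1) Fs dF that x0] by (simp add: O'_def F_def algebra_simps)
  have co: "(x - O') \<bullet> A j = (if j <= p + 1 then \<psi> x * (u x \<bullet> A j) else \<phi> x * (w x \<bullet> A j))"
    if "x \<in> M" "j \<in> {1..n+1}" for x j
    using uA[OF that(1), of j] wA[OF that(1), of j] that(2) by (simp add: pos[OF that(1)] inner_add_left)
  define R where "R y = ((\<Sum>j\<in>{1..p+1}. ((y - O') \<bullet> A j)\<^sup>2), (\<Sum>j\<in>{p+2..n+1}. ((y - O') \<bullet> A j)\<^sup>2))" for y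
  define r where "r s = ((\<psi>' s)\<^sup>2, (\<phi>' s)\<^sup>2)" for s
  define cd where "cd s t j = (if j <= p + 1 then \<psi>' s * sphere_coord p (\<lambda>l. t (l + 1)) j
      else \<phi>' s * sphere_coord (n - p - 1) (\<lambda>l. t (l + p + 1)) (j - (p + 1)))" for s t j
  have nq: "n - p - 1 = q" "n - (p + 1) = q" using const_facts by simp_all
  have I: "open I" "smooth_on I \<psi>'" "smooth_on I \<phi>'" using prof(1) by (auto simp: profile_curve_def)
  have pd: "DERIV \<psi>' s :> deriv \<psi>' s" "DERIV \<phi>' s :> deriv \<phi>' s" if "s \<in> I" for s
    using smooth_on_has_derivative[OF I(2) that] smooth_on_has_derivative[OF I(3) that]
    by (auto simp: DERIV_deriv_iff_real_differentiable differentiable_def)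
  have RM: "R x = r s" if "s \<in> I" "x \<in> M" "Q s x" for x s
  proof -
    have "(\<Sum>j\<in>{1..p+1}. ((x - O') \<bullet> A j)\<^sup>2) = (\<Sum>j\<in>{1..p+1}. (\<psi> x)\<^sup>2 * (u x \<bullet> A j)\<^sup>2)"
      by (rule sum.cong) (use co[OF that(2)] const_facts in \<open>auto simp: power_mult_distrib\<close>)
    also have "\<dots> = (\<psi> x)\<^sup>2 * (u x \<bullet> u x)"
      unfolding sum_distrib_left[symmetric]
      by (subst sum_squares_adapted[OF const_facts(1) A]) (use const_facts uA that in auto)
    moreover have "(\<Sum>j\<in>{p+2..n+1}. ((x - O') \<bullet> A j)\<^sup>2) = (\<Sum>j\<in>{p+2..n+1}. (\<phi> x)\<^sup>2 * (w x \<bullet> A j)\<^sup>2)"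
      by (rule sum.cong) (use co[OF that(2)] const_facts in \<open>auto simp: power_mult_distrib\<close>)
    moreover have "(\<Sum>j\<in>{p+2..n+1}. (\<phi> x)\<^sup>2 * (w x \<bullet> A j)\<^sup>2) = (\<phi> x)\<^sup>2 * (w x \<bullet> w x)"
      unfolding sum_distrib_left[symmetric]
      by (subst sum_squares_adapted[OF const_facts(1) A]) (use const_facts wA that in auto)
    ultimately show ?thesis using Q(2)[OF that] leaf_equations(5,6)[OF that(2)] by (simp add: R_def r_def)
  qed
  have "\<exists>D. param_domain n I D \<and> congruent_sets M ((\<lambda>(s, t). \<Sum>j\<in>{1..n+1}. cd s t j *\<^sub>R bs j) ` D)"
  proof (rule param_representation[OF const_facts(1) bs A I(1), of cd Q O' R r])
    show "continuous_on (I \<times> UNIV) (\<lambda>z. cd (fst z) (snd z) j)" for j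
      unfolding cd_def
      by (cases "j <= p + 1") (auto intro!: continuous_intros continuous_on_sphere_coord
          continuous_on_compose2[OF smooth_on_continuous[OF I(2)]] continuous_on_compose2[OF smooth_on_continuous[OF I(3)]])
    show "\<exists>s\<in>I. \<exists>t\<in>extensional {2..n}. Q s x \<and> (\<forall>j\<in>{1..n+1}. (x - O') \<bullet> A j = cd s t j)" if x: "x \<in> M" for x
    proof -
      obtain s where s: "s \<in> I" "Q s x" using Q(1)[OF x] by blast
      obtain \<theta> where th: "!!j. j \<in> {1..p+1} ==> u x \<bullet> A j = sphere_coord p \<theta> j"
        by (rule direction_angles[OF A uA[OF x] leaf_equations(5)[OF x]]) (assumption+, rule that)
      obtain \<theta>' where th': "!!j. j \<in> {p+2..n+1} ==> w x \<bullet> A j = sphere_coord q \<theta>' (j - (p + 1))"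
        by (rule codirection_angles[OF A wA[OF x] leaf_equations(6)[OF x]]) (assumption+, rule that)
      define t where "t i = (if i \<in> {2..p+1} then \<theta> (i - 1) else if i \<in> {p+2..n} then \<theta>' (i - p - 1) else undefined)" for i
      have "t \<in> extensional {2..n}" using const_facts by (auto simp: t_def extensional_def)
      moreover have "(x - O') \<bullet> A j = cd s t j" if j: "j \<in> {1..n+1}" for j
      proof (cases "j <= p + 1")
        case True
        have "sphere_coord p (\<lambda>l. t (l + 1)) j = sphere_coord p \<theta> j"
          by (rule sphere_coord_cong) (use True j in \<open>auto simp: t_def\<close>)
        then show ?thesis using co[OF x j] True th[of j] j Q(2)[OF s(1) x s(2)] by (simp add: cd_def)
      next
        case False
        have "sphere_coord q (\<lambda>l. t (l + p + 1)) (j - (p + 1)) = sphere_coord q \<theta>' (j - (p + 1))"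
          by (rule sphere_coord_cong) (use False j const_facts in \<open>auto simp: t_def\<close>)
        then show ?thesis using co[OF x j] False th'[of j] j Q(2)[OF s(1) x s(2)] by (simp add: cd_def nq)
      qed
      ultimately show ?thesis using s by blast
    qed
    show "smooth_on UNIV R" unfolding R_def by (rule smooth_on_Pair[OF open_UNIV sum_squares_smooth(2) sum_squares_smooth(2)])
    show "smooth_on I r" unfolding r_def power2_eq_square
      by (rule smooth_on_Pair[OF I(1) smooth_on_mult[OF I(1) I(2) I(2)] smooth_on_mult[OF I(1) I(3) I(3)]])
    show "R y = r s" if "s \<in> I" "!!j. j \<in> {1..n+1} ==> (y - O') \<bullet> A j = cd s t j" for s t y
    proof -
      have "(\<Sum>j\<in>{1..p+1}. ((y - O') \<bullet> A j)\<^sup>2) = (\<Sum>j\<in>{1..p+1}. (\<psi>' s * sphere_coord p (\<lambda>l. t (l + 1)) j)\<^sup>2)"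
        by (rule sum.cong) (use that(2) const_facts in \<open>auto simp: cd_def\<close>)
      moreover have "(\<Sum>j\<in>{p+2..n+1}. ((y - O') \<bullet> A j)\<^sup>2)
          = (\<Sum>j\<in>{p+2..n+1}. (\<phi>' s * sphere_coord q (\<lambda>l. t (l + p + 1)) (j - (p + 1)))\<^sup>2)"
        by (rule sum.cong) (use that(2) in \<open>auto simp: cd_def nq\<close>)
      ultimately show ?thesis by (simp only: R_def r_def sphere_coord_squares)
    qed
    show "R y = r s" if "s \<in> I" "y \<in> M" "Q s y" for s y by (rule RM[OF that])
    show "\<exists>r'. (r has_vector_derivative r') (at s) \<and>
        (\<forall>c \<sigma>. c *\<^sub>R frechet_derivative R (at x) (N x) = \<sigma> *\<^sub>R r' --> c = 0 \<and> \<sigma> = 0)"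
      if x: "x \<in> M" and s: "s \<in> I" "Q s x" for x s
    proof -
      note Qs = Q(2)[OF s(1) x s(2)]
      have "(R has_derivative (\<lambda>v. (\<Sum>j\<in>{1..p+1}. 2 * ((x - O') \<bullet> A j) * (v \<bullet> A j),
          \<Sum>j\<in>{p+2..n+1}. 2 * ((x - O') \<bullet> A j) * (v \<bullet> A j)))) (at x)"
        unfolding R_def by (rule has_derivative_Pair[OF has_derivative_sum_squares has_derivative_sum_squares])
      then have "frechet_derivative R (at x) (N x) = (\<Sum>j\<in>{1..p+1}. 2 * ((x - O') \<bullet> A j) * (N x \<bullet> A j),
          \<Sum>j\<in>{p+2..n+1}. 2 * ((x - O') \<bullet> A j) * (N x \<bullet> A j))"
        by (simp only: frechet_derivative_eqI)
      also have "(\<Sum>j\<in>{1..p+1}. 2 * ((x - O') \<bullet> A j) * (N x \<bullet> A j)) = (\<Sum>j\<in>{1..p+1}. 2 * (\<psi> x * (u x \<bullet> A j)) * (N x \<bullet> A j))"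
        by (rule sum.cong) (use co[OF x] const_facts in auto)
      also have "(\<Sum>j\<in>{p+2..n+1}. 2 * ((x - O') \<bullet> A j) * (N x \<bullet> A j)) = (\<Sum>j\<in>{p+2..n+1}. 2 * (\<phi> x * (w x \<bullet> A j)) * (N x \<bullet> A j))"
        by (rule sum.cong) (use co[OF x] const_facts in auto)
      finally have R': "frechet_derivative R (at x) (N x) = (- (2 * \<psi> x * b x), 2 * \<phi> x * a x)"
        by (simp only: inner_sums[OF A x uA[OF x] wA[OF x]])
      have "((\<lambda>s. (\<psi>' s)\<^sup>2) has_vector_derivative 2 * \<psi> x * a x) (at s)" "((\<lambda>s. (\<phi>' s)\<^sup>2) has_vector_derivative 2 * \<phi> x * b x) (at s)"
        unfolding has_real_derivative_iff_has_vector_derivative[symmetric]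
        using pd[OF s(1)] Qs by (auto intro!: derivative_eq_intros)
      then have "(r has_vector_derivative (2 * \<psi> x * a x, 2 * \<phi> x * b x)) (at s)"
        unfolding r_def by (rule has_vector_derivative_Pair)
      moreover have "c = 0 \<and> \<sigma> = 0"
        if "c *\<^sub>R (- (2 * \<psi> x * b x), 2 * \<phi> x * a x) = \<sigma> *\<^sub>R (2 * \<psi> x * a x, 2 * \<phi> x * b x)" for c \<sigma> :: real
      proof (rule transversal_vectors[OF _ _ leaf_equations(2)[OF x]])
        have 1: "\<psi> x * (- (c * b x)) = \<psi> x * (\<sigma> * a x)" "\<phi> x * (c * a x) = \<phi> x * (\<sigma> * b x)"
          using that by (simp_all add: algebra_simps)
        show "- (c * b x) = \<sigma> * a x" using 1(1) leaf_equations(1)[OF x] by (simp only: mult_left_cancel[OF less_imp_neq[THEN not_sym]])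
        show "c * a x = \<sigma> * b x" by (rule mult_left_cancel[OF phi_nz[OF x], THEN iffD1, OF 1(2)])
      qed
      ultimately show ?thesis unfolding R' by blast
    qed
    show "\<exists>d>0. \<forall>y\<in>M. dist y x < d --> (\<exists>s'\<in>I. \<bar>s' - s\<bar> < e \<and> Q s' y)"
      if "x \<in> M" "s \<in> I" "Q s x" "e > 0" for x s e by (rule near[OF that])
  qed
  moreover have "rotational_param bs n p \<psi>' \<phi>' = (\<lambda>(s, t). \<Sum>j\<in>{1..n+1}. cd s t j *\<^sub>R bs j)"
    by (simp add: rotational_param_def cd_def)
  moreover have "\<forall>s\<in>I. \<psi>' s ~= 0 \<and> \<phi>' s ~= 0 \<and>
      deriv \<phi>' s * deriv (deriv \<psi>') s - deriv (deriv \<phi>') s * deriv \<psi>' s =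
      1 / 3 * (real p * (deriv \<phi>' s / \<psi>' s) - real (n - p - 1) * (deriv \<psi>' s / \<phi>' s))"
    unfolding nq using prof(2) q0 by blast
  ultimately show ?thesis
    unfolding rotational_type_def using prof(1) by (intro exI[of _ I] exI[of _ \<psi>'] exI[of _ \<phi>']) simp
qed


text \<open>
  Now \<open>w\<close> is constant and its height function plays the role of \<open>\<phi>\<close>; the second family of leaves
  lies in fixed parallel subspaces, where the coordinates of \<open>x\<close> are the remaining parameters.
\<close>

lemma cylinder_case:
  fixes bs :: "nat => 'a"
  assumes bs: "bij_betw bs {1..n+1} Basis" and c: "!!x. x \<in> M ==> c x = 0"
  shows "cylinder_type bs n p M"
proof -
  obtain A x0 where x0: "x0 \<in> M" and Aw: "A (p+2) = w x0"
    and A: "!!i j. i \<in> {1..n+1} ==> j \<in> {1..n+1} ==> A i \<bullet> A j = (if i = j then 1 else 0)"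
    and prA: "!!x j. x \<in> M ==> j \<in> {1..n+1} ==> pr (A j) x = (if j <= p + 1 then A j else 0)"
    and uA: "!!x j. x \<in> M ==> j \<in> {p+2..n+1} ==> u x \<bullet> A j = 0"
    and wA: "!!x j. x \<in> M ==> j \<in> {1..p+1} ==> w x \<bullet> A j = 0"
    by (rule adapted_basis, rule that)
  have w_const: "w x = A (p+2)" if "x \<in> M" for x
    unfolding Aw
    by (rule zero_derivative_constant[OF conn(1) leaf_data_smooth(5) _ that x0])
      (use leaf_equations(18) c in simp)
  define \<phi> where "\<phi> x = x \<bullet> A (p+2)" for x
  have phi_s: "smooth_along M \<phi>"
    unfolding \<phi>_def[abs_def] by (rule smooth_along_inner[OF smooth_along_ident smooth_along_const])
  have phi_d: "tder M \<phi> x v = b x * (v \<bullet> E x)" if x: "x \<in> M" and v: "N x \<bullet> v = 0" for x v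
  proof -
    have T: "v \<in> tangent_space M x" using v tangent_iff[OF x] by simp
    have "tder M \<phi> x v = v \<bullet> A (p+2)"
      unfolding \<phi>_def[abs_def]
      using tder_inner[OF x T smooth_along_ident smooth_along_const[of M "A (p+2)"]]
        tder_ident[OF x T] tder_const[OF x T, of "A (p+2)"] by simp
    also have "\<dots> = v \<bullet> (b x *\<^sub>R E x + a x *\<^sub>R N x)" by (simp only: w_const[OF x, symmetric] dir3_def)
    finally show ?thesis using v by (simp add: inner_add_right inner_commute)
  qed
  have k1: "k 1 x = - kap p 0 (\<psi> x, \<phi> x, a x, b x)" if x: "x \<in> M" for x
  proof -
    have 1: "b x / \<psi> x = k 2 x" unfolding leaf_equations(3)[OF x] by (rule divide_inverse)
    have "kap p 0 (\<psi> x, \<phi> x, a x, b x) = 1/3 * (p * (b x / \<psi> x))" by (simp add: kap_def)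
    then show ?thesis unfolding 1 using pointwise_facts(10)[OF x] leaf_equations(4)[OF x] c[OF x] by simp
  qed
  have no: "(0::real) ~= 0 ==> \<phi> x ~= 0" for x by simp
  obtain I \<psi>' \<phi>' Q where prof: "profile_curve I \<psi>' \<phi>'"
    "!!s. s \<in> I ==> \<psi>' s ~= 0 \<and> ((0::real) ~= 0 --> \<phi>' s ~= 0) \<and>
      deriv \<phi>' s * deriv (deriv \<psi>') s - deriv (deriv \<phi>') s * deriv \<psi>' s =
        1/3 * (p * (deriv \<phi>' s / \<psi>' s) - 0 * (deriv \<psi>' s / \<phi>' s))"
    and Q: "!!x. x \<in> M ==> \<exists>s\<in>I. Q s x"
    "!!x s. s \<in> I ==> x \<in> M ==> Q s x ==> \<psi>' s = \<psi> x \<and> \<phi>' s = \<phi> x \<and> deriv \<psi>' s = a x \<and> deriv \<phi>' s = b x"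
    and near: "!!x s e. x \<in> M ==> s \<in> I ==> Q s x ==> e > 0 ==>
        \<exists>d>0. \<forall>y\<in>M. dist y x < d --> (\<exists>s'\<in>I. \<bar>s' - s\<bar> < e \<and> Q s' y)"
    by (rule profile_exists[OF phi_s phi_d no k1], assumption+, rule that)
  have pos: "(x - \<psi> x *\<^sub>R u x) \<bullet> A j = (x0 - \<psi> x0 *\<^sub>R u x0) \<bullet> A j" if j: "j \<in> {1..p+1}" and x: "x \<in> M" for x j
  proof (rule zero_derivative_constant[of "\<lambda>x. (x - \<psi> x *\<^sub>R u x) \<bullet> A j", OF conn(1) _ _ x x0])
    note s = smooth_along_diff[OF smooth_along_ident smooth_along_scaleR[OF leaf_data_smooth(1,4)]]
    show "smooth_along M (\<lambda>x. (x - \<psi> x *\<^sub>R u x) \<bullet> A j)" by (rule smooth_along_inner[OF s smooth_along_const])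
    fix x v assume x: "x \<in> M" and v: "N x \<bullet> v = 0"
    have T: "v \<in> tangent_space M x" using v tangent_iff[OF x] by simp
    let ?y = "v - P x v - (a x * (v \<bullet> E x)) *\<^sub>R u x"
    have "tder M (\<lambda>x. (x - \<psi> x *\<^sub>R u x) \<bullet> A j) x v = ?y \<bullet> A j"
      using tder_inner[OF x T s smooth_along_const[of M "A j"]] tder_const[OF x T, of "A j"]
        tder_position[OF x v] by simp
    also have "\<dots> = ?y \<bullet> pr (A j) x" using prA[OF x, of j] j const_facts by simp
    also have "\<dots> = (v - P x v) \<bullet> P x (A j) - (a x * (v \<bullet> E x)) * (P x (A j) \<bullet> u x)
        + (A j \<bullet> u x) * (v \<bullet> u x - P x v \<bullet> u x - a x * (v \<bullet> E x) * (u x \<bullet> u x))"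
      by (simp add: inner_add_right inner_diff_left inner_commute[of "u x" "P x (A j)"] algebra_simps)
    also have "v \<bullet> u x = a x * (v \<bullet> E x)" using v by (simp add: dir2_def inner_diff_right inner_commute)
    finally show "tder M (\<lambda>x. (x - \<psi> x *\<^sub>R u x) \<bullet> A j) x v = 0"
      using leaf_equations(12)[OF x, of v "A j"] leaf_equations(10)[OF x] leaf_equations(5)[OF x] by simp
  qed
  define O' where "O' = (\<Sum>j\<in>{1..p+1}. ((x0 - \<psi> x0 *\<^sub>R u x0) \<bullet> A j) *\<^sub>R A j)"
  have OA: "O' \<bullet> A j = (if j <= p + 1 then (x0 - \<psi> x0 *\<^sub>R u x0) \<bullet> A j else 0)" if j: "j \<in> {1..n+1}" for j
  proof -
    have "O' \<bullet> A j = (\<Sum>i\<in>{1..p+1}. if i = j then (x0 - \<psi> x0 *\<^sub>R u x0) \<bullet> A j else 0)"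
      unfolding O'_def inner_sum_left by (rule sum.cong) (use A[OF _ j] const_facts in auto)
    then show ?thesis using j by simp
  qed
  have co: "(x - O') \<bullet> A j = (if j <= p + 1 then \<psi> x * (u x \<bullet> A j) else x \<bullet> A j)"
    if "x \<in> M" "j \<in> {1..n+1}" for x j
    using pos[of j x] OA[OF that(2)] that by (auto simp: inner_diff_left algebra_simps)
  define R where "R y = ((\<Sum>j\<in>{1..p+1}. ((y - O') \<bullet> A j)\<^sup>2), (y - O') \<bullet> A (p+2))" for y
  define r where "r s = ((\<psi>' s)\<^sup>2, \<phi>' s)" for s
  define cd where "cd s t j = (if j <= p + 1 then \<psi>' s * sphere_coord p (\<lambda>l. t (l + 1)) j
      else if j = p + 2 then \<phi>' s else t (j - 1))" for s and t :: "nat => real" and j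
  have I: "open I" "smooth_on I \<psi>'" "smooth_on I \<phi>'" using prof(1) by (auto simp: profile_curve_def)
  have pd: "DERIV \<psi>' s :> deriv \<psi>' s" "DERIV \<phi>' s :> deriv \<phi>' s" if "s \<in> I" for s
    using smooth_on_has_derivative[OF I(2) that] smooth_on_has_derivative[OF I(3) that]
    by (auto simp: DERIV_deriv_iff_real_differentiable differentiable_def)
  have p2: "p + 2 \<in> {1..n+1}" "\<not> p + 2 <= p + 1" using const_facts by auto
  have RM: "R x = r s" if "s \<in> I" "x \<in> M" "Q s x" for x s
  proof -
    have "(\<Sum>j\<in>{1..p+1}. ((x - O') \<bullet> A j)\<^sup>2) = (\<Sum>j\<in>{1..p+1}. (\<psi> x)\<^sup>2 * (u x \<bullet> A j)\<^sup>2)"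
      by (rule sum.cong) (use co[OF that(2)] const_facts in \<open>auto simp: power_mult_distrib\<close>)
    also have "\<dots> = (\<psi> x)\<^sup>2 * (u x \<bullet> u x)"
      unfolding sum_distrib_left[symmetric]
      by (subst sum_squares_adapted[OF const_facts(1) A]) (use const_facts uA that in auto)
    finally have 1: "(\<Sum>j\<in>{1..p+1}. ((x - O') \<bullet> A j)\<^sup>2) = (\<psi> x)\<^sup>2" by (simp add: leaf_equations(5)[OF that(2)])
    have 2: "(x - O') \<bullet> A (p+2) = \<phi> x" unfolding co[OF that(2) p2(1)] using p2 by (simp add: \<phi>_def)
    show ?thesis unfolding R_def r_def 1 2 using Q(2)[OF that] by simp
  qed
  have "\<exists>D. param_domain n I D \<and> congruent_sets M ((\<lambda>(s, t). \<Sum>j\<in>{1..n+1}. cd s t j *\<^sub>R bs j) ` D)"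
  proof (rule param_representation[OF const_facts(1) bs A I(1), of cd Q O' R r])
    show "continuous_on (I \<times> UNIV) (\<lambda>z. cd (fst z) (snd z) j)" for j
    proof -
      have 1: "continuous_on (I \<times> UNIV) (\<lambda>z. \<psi>' (fst z) * sphere_coord p (\<lambda>l. snd z (l + 1)) j)"
        by (auto intro!: continuous_intros continuous_on_sphere_coord
            continuous_on_compose2[OF smooth_on_continuous[OF I(2)]])
      have 2: "continuous_on (I \<times> UNIV) (\<lambda>z :: real \<times> (nat => real). \<phi>' (fst z))"
        by (auto intro!: continuous_intros continuous_on_compose2[OF smooth_on_continuous[OF I(3)]])
      show ?thesis
        unfolding cd_def using 1 2 continuous_on_angle[of "I \<times> UNIV" "j - 1"]
        by (cases "j <= p + 1"; cases "j = p + 2") simp_all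
    qed
    show "\<exists>s\<in>I. \<exists>t\<in>extensional {2..n}. Q s x \<and> (\<forall>j\<in>{1..n+1}. (x - O') \<bullet> A j = cd s t j)" if x: "x \<in> M" for x
    proof -
      obtain s where s: "s \<in> I" "Q s x" using Q(1)[OF x] by blast
      obtain \<theta> where th: "!!j. j \<in> {1..p+1} ==> u x \<bullet> A j = sphere_coord p \<theta> j"
        by (rule direction_angles[OF A uA[OF x] leaf_equations(5)[OF x]]) (assumption+, rule that)
      define t where "t i = (if i \<in> {2..p+1} then \<theta> (i - 1) else if i \<in> {p+2..n} then (x - O') \<bullet> A (i + 1) else undefined)" for i
      have "t \<in> extensional {2..n}" using const_facts by (auto simp: t_def extensional_def)
      moreover have "(x - O') \<bullet> A j = cd s t j" if j: "j \<in> {1..n+1}" for j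
      proof (cases "j <= p + 1")
        case True
        have "sphere_coord p (\<lambda>l. t (l + 1)) j = sphere_coord p \<theta> j"
          by (rule sphere_coord_cong) (use True j in \<open>auto simp: t_def\<close>)
        then show ?thesis using co[OF x j] True th[of j] j Q(2)[OF s(1) x s(2)] by (simp add: cd_def)
      next
        case False
        show ?thesis
        proof (cases "j = p + 2")
          case True
          have "(x - O') \<bullet> A (p+2) = \<phi> x" unfolding co[OF x p2(1)] using p2 by (simp add: \<phi>_def)
          then show ?thesis using True p2 Q(2)[OF s(1) x s(2)] by (simp add: cd_def)
        next
          case F2: False
          then have "j - 1 \<in> {p+2..n}" "\<not> j - 1 <= p + 1" "j - 1 + 1 = j" using False j by auto
          then have "t (j - 1) = (x - O') \<bullet> A j" unfolding t_def by simp
          then show ?thesis using False F2 by (simp add: cd_def)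
        qed
      qed
      ultimately show ?thesis using s by blast
    qed
    show "smooth_on UNIV R" unfolding R_def by (rule smooth_on_Pair[OF open_UNIV sum_squares_smooth(2) sum_squares_smooth(1)])
    show "smooth_on I r" unfolding r_def power2_eq_square
      by (rule smooth_on_Pair[OF I(1) smooth_on_mult[OF I(1) I(2) I(2)] I(3)])
    show "R y = r s" if "s \<in> I" "!!j. j \<in> {1..n+1} ==> (y - O') \<bullet> A j = cd s t j" for s t y
    proof -
      have 1: "(\<Sum>j\<in>{1..p+1}. ((y - O') \<bullet> A j)\<^sup>2) = (\<Sum>j\<in>{1..p+1}. (\<psi>' s * sphere_coord p (\<lambda>l. t (l + 1)) j)\<^sup>2)"
        by (rule sum.cong) (use that(2) const_facts in \<open>auto simp: cd_def\<close>)
      have 2: "(y - O') \<bullet> A (p+2) = \<phi>' s" unfolding that(2)[OF p2(1)] using p2 by (simp add: cd_def)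
      show ?thesis unfolding R_def r_def 1 2 sphere_coord_squares ..
    qed
    show "R y = r s" if "s \<in> I" "y \<in> M" "Q s y" for s y by (rule RM[OF that])
    show "\<exists>r'. (r has_vector_derivative r') (at s) \<and>
        (\<forall>c \<sigma>. c *\<^sub>R frechet_derivative R (at x) (N x) = \<sigma> *\<^sub>R r' --> c = 0 \<and> \<sigma> = 0)"
      if x: "x \<in> M" and s: "s \<in> I" "Q s x" for x s
    proof -
      note Qs = Q(2)[OF s(1) x s(2)]
      have "((\<lambda>y. (y - O') \<bullet> A (p+2)) has_derivative (\<lambda>v. v \<bullet> A (p+2))) (at x)"
        by (auto intro!: derivative_eq_intros)
      then have "(R has_derivative (\<lambda>v. (\<Sum>j\<in>{1..p+1}. 2 * ((x - O') \<bullet> A j) * (v \<bullet> A j), v \<bullet> A (p+2)))) (at x)"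
        unfolding R_def by (rule has_derivative_Pair[OF has_derivative_sum_squares])
      then have "frechet_derivative R (at x) (N x) = (\<Sum>j\<in>{1..p+1}. 2 * ((x - O') \<bullet> A j) * (N x \<bullet> A j), N x \<bullet> A (p+2))"
        by (simp only: frechet_derivative_eqI)
      also have "(\<Sum>j\<in>{1..p+1}. 2 * ((x - O') \<bullet> A j) * (N x \<bullet> A j)) = (\<Sum>j\<in>{1..p+1}. 2 * (\<psi> x * (u x \<bullet> A j)) * (N x \<bullet> A j))"
        by (rule sum.cong) (use co[OF x] const_facts in auto)
      also have "N x \<bullet> A (p+2) = a x"
      proof -
        have "N x \<bullet> A (p+2) = (a x *\<^sub>R w x - b x *\<^sub>R u x) \<bullet> w x"
          by (simp only: leaf_equations(9)[OF x, symmetric] w_const[OF x, symmetric])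
        then show ?thesis using leaf_equations(6,7)[OF x] by (simp add: inner_diff_left)
      qed
      finally have R': "frechet_derivative R (at x) (N x) = (- (2 * \<psi> x * b x), a x)"
        by (simp only: inner_sums[OF A x uA[OF x] wA[OF x]])
      have "((\<lambda>s. (\<psi>' s)\<^sup>2) has_vector_derivative 2 * \<psi> x * a x) (at s)" "(\<phi>' has_vector_derivative b x) (at s)"
        unfolding has_real_derivative_iff_has_vector_derivative[symmetric]
        using pd[OF s(1)] Qs by (auto intro!: derivative_eq_intros)
      then have "(r has_vector_derivative (2 * \<psi> x * a x, b x)) (at s)"
        unfolding r_def by (rule has_vector_derivative_Pair)
      moreover have "c = 0 \<and> \<sigma> = 0"
        if "c *\<^sub>R (- (2 * \<psi> x * b x), a x) = \<sigma> *\<^sub>R (2 * \<psi> x * a x, b x)" for c \<sigma> :: real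
      proof (rule transversal_vectors[OF _ _ leaf_equations(2)[OF x]])
        have "c * (- (2 * \<psi> x * b x)) = \<sigma> * (2 * \<psi> x * a x)"
          using that by (simp only: scaleR_Pair prod.inject real_scaleR_def)
        moreover have "c * (- (X * b x)) = X * (- (c * b x))" for X by (simp add: mult.left_commute)
        ultimately have "(2 * \<psi> x) * (- (c * b x)) = (2 * \<psi> x) * (\<sigma> * a x)"
          by (metis mult.left_commute)
        moreover have "2 * \<psi> x ~= 0" using leaf_equations(1)[OF x] by simp
        ultimately show "- (c * b x) = \<sigma> * a x" by (metis mult_left_cancel)
        show "c * a x = \<sigma> * b x" using that by (simp only: scaleR_Pair prod.inject real_scaleR_def)
      qed
      ultimately show ?thesis unfolding R' by blast
    qed
    show "\<exists>d>0. \<forall>y\<in>M. dist y x < d --> (\<exists>s'\<in>I. \<bar>s' - s\<bar> < e \<and> Q s' y)"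
      if "x \<in> M" "s \<in> I" "Q s x" "e > 0" for x s e by (rule near[OF that])
  qed
  moreover have "cylinder_param bs n p \<psi>' \<phi>' = (\<lambda>(s, t). \<Sum>j\<in>{1..n+1}. cd s t j *\<^sub>R bs j)"
    by (simp add: cylinder_param_def cd_def)
  moreover have "\<forall>s\<in>I. \<psi>' s ~= 0 \<and> deriv \<phi>' s * deriv (deriv \<psi>') s - deriv (deriv \<phi>') s * deriv \<psi>' s =
      real p / 3 * (deriv \<phi>' s / \<psi>' s)"
    using prof(2) by simp
  ultimately show ?thesis
    unfolding cylinder_type_def using prof(1) by (intro exI[of _ I] exI[of _ \<psi>'] exI[of _ \<phi>']) simp
qed

end

section \<open>Rotational hypersurfaces and cylinders are H-hypersurfaces\<close>

text \<open>
  An orthonormal frame of the tangent space of the unit sphere, in the coordinates of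
  \<open>sphere_coord\<close>: the normalized coordinate fields, extended smoothly over the poles.
\<close>

fun sphere_frame :: "nat => (nat => real) => nat => nat => real" where
  "sphere_frame 0 \<theta> l i = 0"
| "sphere_frame (Suc d) \<theta> l i =
    (if l = 1 then (if i = 1 then - sin (\<theta> 1) else cos (\<theta> 1) * sphere_coord d (\<lambda>l. \<theta> (Suc l)) (i - 1))
     else if i = 1 then 0 else sphere_frame d (\<lambda>l. \<theta> (Suc l)) (l - 1) (i - 1))"

lemma sphere_frame_orthonormal:
  "l \<in> {1..d} ==> m \<in> {1..d} ==> (\<Sum>i\<in>{1..d+1}. sphere_frame d \<theta> l i * sphere_frame d \<theta> m i) = (if l = m then 1 else 0)"
  "l \<in> {1..d} ==> (\<Sum>i\<in>{1..d+1}. sphere_frame d \<theta> l i * sphere_coord d \<theta> i) = 0"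
proof (induction d arbitrary: \<theta> l m)
  case (Suc d)
  let ?T = "\<lambda>\<theta> :: nat => real. \<lambda>l. \<theta> (Suc l)"
  have split: "(\<Sum>i\<in>{1..Suc d+1}. f i) = f 1 + (\<Sum>i\<in>{1..d+1}. f (Suc i))" for f :: "nat => real"
    using sum_shift_1[of f "d+1"] by simp
  have norm: "(\<Sum>i\<in>{1..d+1}. sphere_coord d (?T \<theta>) i * sphere_coord d (?T \<theta>) i) = 1" for \<theta>
    using sphere_coord_norm[of d "?T \<theta>"] by (simp only: power2_eq_square)
  have one: "sphere_coord (Suc d) \<theta> 1 = cos (\<theta> 1)" for \<theta> by (simp add: sphere_coord_1)
  have sc: "(\<Sum>i\<in>{1..d+1}. g i * sphere_coord (Suc d) \<theta> (Suc i)) = sin (\<theta> 1) * (\<Sum>i\<in>{1..d+1}. g i * sphere_coord d (?T \<theta>) i)"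
    for g \<theta> :: "nat => real"
    unfolding sum_distrib_left by (rule sum.cong) (use sphere_coord_Suc[of _ d \<theta>] in auto)
  have c1: "l = 1 \<or> (l ~= 1 \<and> l - 1 \<in> {1..d})" if "l \<in> {1..Suc d}" for l using that by auto
  {
    case 1
    consider "l = 1" "m = 1" | "l = 1" "m ~= 1" "m - 1 \<in> {1..d}" | "l ~= 1" "m = 1" "l - 1 \<in> {1..d}"
      | "l ~= 1" "m ~= 1" "l - 1 \<in> {1..d}" "m - 1 \<in> {1..d}" using c1[OF 1(1)] c1[OF 1(2)] by blast
    then show ?case
    proof cases
      case 1
      have "(\<Sum>i\<in>{1..d+1}. (cos (\<theta> 1) * sphere_coord d (?T \<theta>) i) * (cos (\<theta> 1) * sphere_coord d (?T \<theta>) i)) =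
          (cos (\<theta> 1) * cos (\<theta> 1)) * (\<Sum>i\<in>{1..d+1}. sphere_coord d (?T \<theta>) i * sphere_coord d (?T \<theta>) i)"
        unfolding sum_distrib_left by (rule sum.cong) (auto simp: algebra_simps)
      then have "(\<Sum>i\<in>{1..d+1}. (cos (\<theta> 1) * sphere_coord d (?T \<theta>) i) * (cos (\<theta> 1) * sphere_coord d (?T \<theta>) i)) =
          cos (\<theta> 1) * cos (\<theta> 1)" unfolding norm by simp
      note eq = this
      have "(\<Sum>i\<in>{1..Suc d+1}. sphere_frame (Suc d) \<theta> 1 i * sphere_frame (Suc d) \<theta> 1 i) = sin (\<theta> 1) * sin (\<theta> 1) +
          (\<Sum>i\<in>{1..d+1}. (cos (\<theta> 1) * sphere_coord d (?T \<theta>) i) * (cos (\<theta> 1) * sphere_coord d (?T \<theta>) i))"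
        unfolding split by (rule arg_cong2[where f = "(+)"], simp, rule sum.cong[OF refl], auto)
      also have "\<dots> = 1" using sin_cos_squared_add[of "\<theta> 1"] unfolding eq by (simp only: power2_eq_square)
      finally show ?thesis unfolding 1 by (simp only: refl if_True)
    next
      case 2
      have "(\<Sum>i\<in>{1..d+1}. (cos (\<theta> 1) * sphere_coord d (?T \<theta>) i) * sphere_frame d (?T \<theta>) (m - 1) i) =
          cos (\<theta> 1) * (\<Sum>i\<in>{1..d+1}. sphere_frame d (?T \<theta>) (m - 1) i * sphere_coord d (?T \<theta>) i)"
        unfolding sum_distrib_left by (rule sum.cong) (auto simp: algebra_simps)
      then have "(\<Sum>i\<in>{1..d+1}. (cos (\<theta> 1) * sphere_coord d (?T \<theta>) i) * sphere_frame d (?T \<theta>) (m - 1) i) = 0"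
        unfolding Suc.IH(2)[OF 2(3)] by simp
      then show ?thesis using 2 unfolding split by simp
    next
      case 3
      have "(\<Sum>i\<in>{1..d+1}. sphere_frame d (?T \<theta>) (l - 1) i * (cos (\<theta> 1) * sphere_coord d (?T \<theta>) i)) =
          cos (\<theta> 1) * (\<Sum>i\<in>{1..d+1}. sphere_frame d (?T \<theta>) (l - 1) i * sphere_coord d (?T \<theta>) i)"
        unfolding sum_distrib_left by (rule sum.cong) (auto simp: algebra_simps)
      then have "(\<Sum>i\<in>{1..d+1}. sphere_frame d (?T \<theta>) (l - 1) i * (cos (\<theta> 1) * sphere_coord d (?T \<theta>) i)) = 0"
        unfolding Suc.IH(2)[OF 3(3)] by simp
      then show ?thesis using 3 unfolding split by simp
    next
      case 4
      then show ?thesis using Suc.IH(1)[OF 4(3,4), of "?T \<theta>"] unfolding split by (auto simp: le_Suc_eq)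
    qed
  next
    case 2
    consider "l = 1" | "l ~= 1" "l - 1 \<in> {1..d}" using c1[OF 2] by blast
    then show ?case
    proof cases
      case 1
      have "(\<Sum>i\<in>{1..d+1}. (cos (\<theta> 1) * sphere_coord d (?T \<theta>) i) * sphere_coord d (?T \<theta>) i) =
          cos (\<theta> 1) * (\<Sum>i\<in>{1..d+1}. sphere_coord d (?T \<theta>) i * sphere_coord d (?T \<theta>) i)"
        unfolding sum_distrib_left by (rule sum.cong) (auto simp: algebra_simps)
      then have "(\<Sum>i\<in>{1..d+1}. (cos (\<theta> 1) * sphere_coord d (?T \<theta>) i) * sphere_coord d (?T \<theta>) i) = cos (\<theta> 1)"
        unfolding norm by simp
      then show ?thesis using 1 unfolding split one sc by simp
    next
      case 2
      then show ?thesis using Suc.IH(2)[OF 2(2), of "?T \<theta>"] unfolding split one sc by simp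
    qed
  }
qed simp_all

lemma sphere_coord_derivative:
  assumes "l \<in> {1..d}" "i \<in> {1..d+1}"
  shows "((\<lambda>\<tau>. sphere_coord d (\<theta>(l := \<tau>)) i) has_real_derivative
    (\<Prod>m\<in>{1..<l}. sin (\<theta> m)) * sphere_frame d \<theta> l i) (at (\<theta> l))"
  using assms
proof (induction d arbitrary: \<theta> l i)
  case (Suc d)
  let ?t = "\<lambda>l. \<theta> (Suc l)"
  show ?case
  proof (cases "i = 1")
    case True
    then show ?thesis
      by (cases "l = 1") (auto simp: sphere_coord_1 intro!: derivative_eq_intros)
  next
    case False
    then obtain j where j: "i = Suc j" "j \<in> {1..d+1}" using Suc.prems by (cases i) auto
    have eq: "sphere_coord (Suc d) (\<theta>(l := \<tau>)) i = sin ((\<theta>(l := \<tau>)) 1) * sphere_coord d (\<lambda>m. (\<theta>(l := \<tau>)) (Suc m)) j" for \<tau>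
      using sphere_coord_Suc[of j d "\<theta>(l := \<tau>)"] j by simp
    show ?thesis
    proof (cases "l = 1")
      case True

      have "sphere_coord d (\<lambda>m. (\<theta>(1 := \<tau>)) (Suc m)) j = sphere_coord d ?t j" for \<tau>
        by (rule sphere_coord_cong) (use j in auto)
      then show ?thesis unfolding eq using True j by (auto intro!: derivative_eq_intros)
    next
      case F: False
      then obtain l' where l': "l = Suc l'" "l' \<in> {1..d}" using Suc.prems by (cases l) auto
      have upd: "(\<lambda>m. (\<theta>(l := \<tau>)) (Suc m)) = ?t(l' := \<tau>)" for \<tau> using l' by auto
      have "{1..<Suc l'} = insert 1 {Suc 1..<Suc l'}" using l' by auto
      then have "(\<Prod>m\<in>{1..<l}. sin (\<theta> m)) = sin (\<theta> 1) * (\<Prod>m\<in>{Suc 1..<Suc l'}. sin (\<theta> m))"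
        unfolding l'(1) by simp
      also have "(\<Prod>m\<in>{Suc 1..<Suc l'}. sin (\<theta> m)) = (\<Prod>m\<in>{1..<l'}. sin (?t m))"
        by (rule prod.shift_bounds_Suc_ivl)
      finally have pr: "(\<Prod>m\<in>{1..<l}. sin (\<theta> m)) = sin (\<theta> 1) * (\<Prod>m\<in>{1..<l'}. sin (?t m))" .
      have "((\<lambda>\<tau>. sin (\<theta> 1) * sphere_coord d (?t(l' := \<tau>)) j) has_real_derivative
          sin (\<theta> 1) * ((\<Prod>m\<in>{1..<l'}. sin (?t m)) * sphere_frame d ?t l' j)) (at (?t l'))"
        by (rule DERIV_cmult[OF Suc.IH[OF l'(2) j(2)]])
      then show ?thesis unfolding eq upd pr using F l' j by (simp add: mult.assoc)
    qed
  qed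
qed simp

context hypersurface
begin

text \<open>
  The common part of both families. The hypersurface is swept out by \<open>X\<close>; the vectors
  \<open>w2\<close>, \<open>w3\<close> span the plane of the profile and \<open>f i\<close> are the remaining principal directions.
\<close>

context
  fixes n :: nat and s1 :: "'a => real" and Rg :: "(real \<times> (nat => real)) set"
    and X w2 w3 :: "real => (nat => real) => 'a" and f :: "nat => real => (nat => real) => 'a"
    and dp df ddp ddf :: "real => real" and m \<alpha> \<beta> g :: "nat => real => (nat => real) => real"
  assumes dim: "DIM('a) = n + 1" and n: "n >= 1"
    and s1: "!!x. x \<in> M ==> s1 x = mean_curvature M N x" "smooth_along M s1"
    and move_s: "!!s t. (s, t) \<in> Rg ==> \<exists>d>0. \<forall>\<tau>. \<bar>\<tau> - s\<bar> < d --> (\<tau>, t) \<in> Rg"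
    and move_t: "!!s t i. (s, t) \<in> Rg ==> i \<in> {2..n} ==> \<exists>d>0. \<forall>\<tau>. \<bar>\<tau> - t i\<bar> < d --> (s, t(i := \<tau>)) \<in> Rg"
    and XM: "!!s t. (s, t) \<in> Rg ==> X s t \<in> M"
    and on: "!!s t. (s, t) \<in> Rg ==> w2 s t \<bullet> w2 s t = 1 \<and> w3 s t \<bullet> w3 s t = 1 \<and> w2 s t \<bullet> w3 s t = 0"
      "!!s t i. (s, t) \<in> Rg ==> i \<in> {2..n} ==> w2 s t \<bullet> f i s t = 0 \<and> w3 s t \<bullet> f i s t = 0"
      "!!s t i j. (s, t) \<in> Rg ==> i \<in> {2..n} ==> j \<in> {2..n} ==> f i s t \<bullet> f j s t = (if i = j then 1 else 0)"
    and Xs: "!!s t. (s, t) \<in> Rg ==> ((\<lambda>\<tau>. X \<tau> t) has_vector_derivative dp s *\<^sub>R w2 s t + df s *\<^sub>R w3 s t) (at s)"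
      "!!s t. (s, t) \<in> Rg ==> ((\<lambda>\<tau>. w2 \<tau> t) has_vector_derivative 0) (at s)"
      "!!s t. (s, t) \<in> Rg ==> ((\<lambda>\<tau>. w3 \<tau> t) has_vector_derivative 0) (at s)"
    and Xt: "!!s t i. (s, t) \<in> Rg ==> i \<in> {2..n} ==> ((\<lambda>\<tau>. X s (t(i := \<tau>))) has_vector_derivative m i s t *\<^sub>R f i s t) (at (t i))"
      "!!s t i. (s, t) \<in> Rg ==> i \<in> {2..n} ==> ((\<lambda>\<tau>. w2 s (t(i := \<tau>))) has_vector_derivative \<alpha> i s t *\<^sub>R f i s t) (at (t i))"
      "!!s t i. (s, t) \<in> Rg ==> i \<in> {2..n} ==> ((\<lambda>\<tau>. w3 s (t(i := \<tau>))) has_vector_derivative \<beta> i s t *\<^sub>R f i s t) (at (t i))"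
    and m: "!!s t i. (s, t) \<in> Rg ==> i \<in> {2..n} ==> m i s t ~= 0 \<and> df s * \<alpha> i s t - dp s * \<beta> i s t = m i s t * g i s t"
    and prof: "!!s t. (s, t) \<in> Rg ==> dp s * dp s + df s * df s = 1 \<and> DERIV dp s :> ddp s \<and> DERIV df s :> ddf s \<and>
        dp s * ddp s + df s * ddf s = 0 \<and> 3 * (df s * ddp s - ddf s * dp s) = (\<Sum>i\<in>{2..n}. g i s t)"
begin

definition "nv s t = df s *\<^sub>R w2 s t - dp s *\<^sub>R w3 s t"
definition "E0 s t = dp s *\<^sub>R w2 s t + df s *\<^sub>R w3 s t"
definition "sgn_nv s t = N (X s t) \<bullet> nv s t"
definition "kp s = df s * ddp s - ddf s * dp s"

lemma f_tangent: assumes z: "(s, t) \<in> Rg" and i: "i \<in> {2..n}" shows "N (X s t) \<bullet> f i s t = 0"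
proof -
  obtain d where d: "d > 0" "!!\<tau>. \<bar>\<tau> - t i\<bar> < d ==> (s, t(i := \<tau>)) \<in> Rg" using move_t[OF z i] by blast
  have "m i s t *\<^sub>R f i s t \<in> tangent_space M (X s (t(i := t i)))"
    by (rule velocity_tangent[OF Xt(1)[OF z i], of "ball (t i) d"])
      (use d XM in \<open>auto simp: dist_real_def abs_minus_commute\<close>)
  then show ?thesis using tangent_iff[OF XM[OF z]] m[OF z i] by simp
qed

lemma E0_tangent: assumes z: "(s, t) \<in> Rg" shows "N (X s t) \<bullet> E0 s t = 0"
proof -
  obtain d where d: "d > 0" "!!\<tau>. \<bar>\<tau> - s\<bar> < d ==> (\<tau>, t) \<in> Rg" using move_s[OF z] by blast
  have "E0 s t \<in> tangent_space M (X s t)"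
    unfolding E0_def by (rule velocity_tangent[OF Xs(1)[OF z], of "ball s d"])
      (use d XM in \<open>auto simp: dist_real_def abs_minus_commute\<close>)
  then show ?thesis using tangent_iff[OF XM[OF z]] by simp
qed

text \<open>The normal is orthogonal to all \<open>f i\<close> and to the profile, so only its sign is free.\<close>

lemma normal_eq:
  assumes z: "(s, t) \<in> Rg"
  shows "N (X s t) = sgn_nv s t *\<^sub>R nv s t" "sgn_nv s t = 1 \<or> sgn_nv s t = -1"
proof -
  note o = on(1)[OF z] and p = prof[OF z]
  define a where "a i = (if i = 0 then nv s t else if i = 1 then E0 s t else f i s t)" for i
  have nn: "nv s t \<bullet> nv s t = 1" "E0 s t \<bullet> E0 s t = 1" "nv s t \<bullet> E0 s t = 0"
    using o p by (simp_all add: nv_def E0_def inner_diff_left inner_diff_right inner_add_left inner_add_right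
        inner_commute[of "w3 s t" "w2 s t"] algebra_simps)
  have nf: "nv s t \<bullet> f i s t = 0" "E0 s t \<bullet> f i s t = 0" if "i \<in> {2..n}" for i
    using on(2)[OF z that] by (simp_all add: nv_def E0_def inner_diff_left inner_add_left)
  have a: "a i \<bullet> a j = (if i = j then 1 else 0)" if "i \<in> {0..n}" "j \<in> {0..n}" for i j
  proof -
    have c: "i = 0 \<or> i = 1 \<or> i \<in> {2..n}" "j = 0 \<or> j = 1 \<or> j \<in> {2..n}" using that by auto
    show ?thesis using c nn nf[of i] nf[of j] on(3)[OF z, of i j]
      by (auto simp: a_def inner_commute)
  qed
  have "N (X s t) \<bullet> a i = 0" if "i \<in> {0..n} - {0}" for i
    using that f_tangent[OF z, of i] E0_tangent[OF z] by (auto simp: a_def)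
  then have "(\<Sum>i\<in>{0..n}. (N (X s t) \<bullet> a i) *\<^sub>R a i) = (\<Sum>i\<in>{0}. (N (X s t) \<bullet> a i) *\<^sub>R a i)"
    by (intro sum.mono_neutral_right) auto
  then show e: "N (X s t) = sgn_nv s t *\<^sub>R nv s t"
    using orthonormal_expansion(1)[of "{0..n}" a "N (X s t)"] a dim by (simp add: a_def sgn_nv_def)
  have "sgn_nv s t * sgn_nv s t = 1"
    using N_unit[OF XM[OF z]] nn(1) by (subst (asm) (1 2) e) simp
  then show "sgn_nv s t = 1 \<or> sgn_nv s t = -1" by (simp add: square_eq_1_iff)
qed

text \<open>
  Along a curve in \<open>M\<close> the sign is locally constant by continuity, so \<open>N\<close> may be differentiated
  through the explicit formula.
\<close>

lemma curve_sign:
  assumes c: "(c has_vector_derivative v) (at \<tau>0)" and cM: "!!\<tau>. \<bar>\<tau> - \<tau>0\<bar> < d ==> (S \<tau>, T \<tau>) \<in> Rg \<and> c \<tau> = X (S \<tau>) (T \<tau>)"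
    and d: "d > 0" and nvd: "((\<lambda>\<tau>. nv (S \<tau>) (T \<tau>)) has_vector_derivative nv') (at \<tau>0)"
  shows "\<exists>e>0. e <= d \<and> (\<forall>\<tau>. \<bar>\<tau> - \<tau>0\<bar> < e --> sgn_nv (S \<tau>) (T \<tau>) = sgn_nv (S \<tau>0) (T \<tau>0))"
    and "tder M N (c \<tau>0) v = sgn_nv (S \<tau>0) (T \<tau>0) *\<^sub>R nv'"
proof -
  let ?B = "ball \<tau>0 d"
  have inB: "\<tau> \<in> ?B \<longleftrightarrow> \<bar>\<tau> - \<tau>0\<bar> < d" for \<tau> by (auto simp: dist_real_def)
  have Nc: "((\<lambda>\<tau>. N (c \<tau>)) has_vector_derivative tder M N (c \<tau>0) v) (at \<tau>0)"
    by (rule has_derivative_along_curve[OF c, of ?B]) (use d cM XM N_smooth inB in auto)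
  define h where "h \<tau> = N (c \<tau>) \<bullet> nv (S \<tau>) (T \<tau>)" for \<tau>
  have hs: "h \<tau> = sgn_nv (S \<tau>) (T \<tau>)" if "\<bar>\<tau> - \<tau>0\<bar> < d" for \<tau> using cM[OF that] by (simp add: h_def sgn_nv_def)
  have "isCont h \<tau>0" unfolding h_def
    using has_vector_derivative_continuous[OF Nc] has_vector_derivative_continuous[OF nvd] by (intro continuous_intros)
  then obtain e' where e': "e' > 0" "!!\<tau>. \<bar>\<tau> - \<tau>0\<bar> < e' ==> \<bar>h \<tau> - h \<tau>0\<bar> < 1"
    unfolding continuous_at_eps_delta dist_real_def by (metis zero_less_one)
  define e where "e = min d e'"
  have same: "sgn_nv (S \<tau>) (T \<tau>) = sgn_nv (S \<tau>0) (T \<tau>0)" if t: "\<bar>\<tau> - \<tau>0\<bar> < e" for \<tau>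
  proof -
    have "\<bar>h \<tau> - h \<tau>0\<bar> < 1" using e'(2) t by (simp add: e_def)
    moreover have "h \<tau> = 1 \<or> h \<tau> = -1" using normal_eq(2)[of "S \<tau>" "T \<tau>"] hs[of \<tau>] cM[of \<tau>] t by (simp add: e_def)
    moreover have "h \<tau>0 = 1 \<or> h \<tau>0 = -1" using normal_eq(2)[of "S \<tau>0" "T \<tau>0"] hs[of \<tau>0] cM[of \<tau>0] d by simp
    ultimately have "h \<tau> = h \<tau>0" by auto
    then show ?thesis using hs[of \<tau>] hs[of \<tau>0] t d by (simp add: e_def)
  qed
  have epos: "e > 0" "e <= d" using d e'(1) by (auto simp: e_def)
  have "((\<lambda>\<tau>. sgn_nv (S \<tau>0) (T \<tau>0) *\<^sub>R nv (S \<tau>) (T \<tau>)) has_vector_derivative sgn_nv (S \<tau>0) (T \<tau>0) *\<^sub>R nv') (at \<tau>0)"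
    by (rule bounded_linear.has_vector_derivative[OF bounded_linear_scaleR_right nvd])
  then have "((\<lambda>\<tau>. N (c \<tau>)) has_vector_derivative sgn_nv (S \<tau>0) (T \<tau>0) *\<^sub>R nv') (at \<tau>0)"
  proof (rule has_vector_derivative_transform_within_open[of _ _ _ "ball \<tau>0 e"])
    fix \<tau> assume "\<tau> \<in> ball \<tau>0 e"
    then have t: "\<bar>\<tau> - \<tau>0\<bar> < e" by (simp add: dist_real_def abs_minus_commute)
    have "(S \<tau>, T \<tau>) \<in> Rg \<and> c \<tau> = X (S \<tau>) (T \<tau>)" using cM[of \<tau>] t epos by simp
    then show "sgn_nv (S \<tau>0) (T \<tau>0) *\<^sub>R nv (S \<tau>) (T \<tau>) = N (c \<tau>)"
      using normal_eq(1)[of "S \<tau>" "T \<tau>"] same[OF t] by metis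
  qed (use epos in auto)
  then show "tder M N (c \<tau>0) v = sgn_nv (S \<tau>0) (T \<tau>0) *\<^sub>R nv'" by (rule vector_derivative_unique_at[OF Nc])
  show "\<exists>e>0. e <= d \<and> (\<forall>\<tau>. \<bar>\<tau> - \<tau>0\<bar> < e --> sgn_nv (S \<tau>) (T \<tau>) = sgn_nv (S \<tau>0) (T \<tau>0))"
    by (rule exI[of _ e], intro conjI allI impI, rule epos(1), rule epos(2), rule same)
qed

lemma principal_directions:
  assumes z: "(s, t) \<in> Rg"
  shows "shape_operator M N (X s t) (E0 s t) = (sgn_nv s t * kp s) *\<^sub>R E0 s t"
    and "!!i. i \<in> {2..n} ==> shape_operator M N (X s t) (f i s t) = - (sgn_nv s t * g i s t) *\<^sub>R f i s t"
    and "!!i. i \<in> {2..n} ==> \<exists>e>0. \<forall>\<tau>. \<bar>\<tau> - t i\<bar> < e --> (s, t(i := \<tau>)) \<in> Rg \<and> sgn_nv s (t(i := \<tau>)) = sgn_nv s t"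
proof -
  have S: "shape_operator M N x v = - tder M N x v" for x v by (simp add: shape_operator_def tder_def)
  note p = prof[OF z]
  show "shape_operator M N (X s t) (E0 s t) = (sgn_nv s t * kp s) *\<^sub>R E0 s t"
  proof -
    obtain d where d: "d > 0" "!!\<tau>. \<bar>\<tau> - s\<bar> < d ==> (\<tau>, t) \<in> Rg" using move_s[OF z] by blast
    have "((\<lambda>\<tau>. df \<tau> *\<^sub>R w2 \<tau> t - dp \<tau> *\<^sub>R w3 \<tau> t) has_vector_derivative
        (df s *\<^sub>R 0 + ddf s *\<^sub>R w2 s t) - (dp s *\<^sub>R 0 + ddp s *\<^sub>R w3 s t)) (at s)"
      by (intro has_vector_derivative_diff has_vector_derivative_scaleR Xs(2,3)[OF z]) (use p in auto)
    then have nvd: "((\<lambda>\<tau>. nv \<tau> t) has_vector_derivative ddf s *\<^sub>R w2 s t - ddp s *\<^sub>R w3 s t) (at s)"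
      by (simp add: nv_def)
    have 1: "ddp s = kp s * df s"
    proof -
      have "kp s * df s = ddp s * (df s * df s) - (df s * ddf s) * dp s" by (simp add: kp_def algebra_simps)
      also have "df s * ddf s = - (dp s * ddp s)" using p by linarith
      also have "ddp s * (df s * df s) - - (dp s * ddp s) * dp s = ddp s * (dp s * dp s + df s * df s)" by (simp add: algebra_simps)
      finally show ?thesis using p by simp
    qed
    have 2: "ddf s = - (kp s * dp s)"
    proof -
      have "kp s * dp s = (dp s * ddp s) * df s - ddf s * (dp s * dp s)" by (simp add: kp_def algebra_simps)
      also have "dp s * ddp s = - (df s * ddf s)" using p by linarith
      also have "- (df s * ddf s) * df s - ddf s * (dp s * dp s) = - ddf s * (dp s * dp s + df s * df s)" by (simp add: algebra_simps)
      finally show ?thesis using p by simp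
    qed
    have "tder M N (X s t) (E0 s t) = sgn_nv s t *\<^sub>R (ddf s *\<^sub>R w2 s t - ddp s *\<^sub>R w3 s t)"
      by (rule curve_sign(2)[where S = "\<lambda>\<tau>. \<tau>" and T = "\<lambda>\<tau>. t" and c = "\<lambda>\<tau>. X \<tau> t", OF Xs(1)[OF z, folded E0_def] _ d(1) nvd])
        (use d in simp)
    also have "ddf s *\<^sub>R w2 s t - ddp s *\<^sub>R w3 s t = - kp s *\<^sub>R E0 s t"
      unfolding 1 2 E0_def by (simp add: algebra_simps)
    finally show ?thesis by (simp add: S)
  qed
  fix i assume i: "i \<in> {2..n}"
  obtain d where d: "d > 0" "!!\<tau>. \<bar>\<tau> - t i\<bar> < d ==> (s, t(i := \<tau>)) \<in> Rg" using move_t[OF z i] by blast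
  have "((\<lambda>\<tau>. df s *\<^sub>R w2 s (t(i := \<tau>)) - dp s *\<^sub>R w3 s (t(i := \<tau>))) has_vector_derivative
      df s *\<^sub>R (\<alpha> i s t *\<^sub>R f i s t) - dp s *\<^sub>R (\<beta> i s t *\<^sub>R f i s t)) (at (t i))"
    by (intro has_vector_derivative_diff bounded_linear.has_vector_derivative[OF bounded_linear_scaleR_right] Xt(2,3)[OF z i])
  moreover have "df s *\<^sub>R (\<alpha> i s t *\<^sub>R f i s t) - dp s *\<^sub>R (\<beta> i s t *\<^sub>R f i s t) = (m i s t * g i s t) *\<^sub>R f i s t"
    using m[OF z i] by (simp add: scaleR_left_diff_distrib[symmetric])
  ultimately have nvd: "((\<lambda>\<tau>. nv s (t(i := \<tau>))) has_vector_derivative (m i s t * g i s t) *\<^sub>R f i s t) (at (t i))"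
    by (simp add: nv_def)
  have on_curve: "(s, t(i := \<tau>)) \<in> Rg \<and> X s (t(i := \<tau>)) = X s (t(i := \<tau>))" if "\<bar>\<tau> - t i\<bar> < d" for \<tau>
    using d(2)[OF that] by simp
  note sign = curve_sign[where S = "\<lambda>\<tau>. s" and T = "\<lambda>\<tau>. t(i := \<tau>)" and c = "\<lambda>\<tau>. X s (t(i := \<tau>))",
      OF Xt(1)[OF z i] on_curve d(1) nvd, simplified fun_upd_triv]
  obtain e where e: "e > 0" "e <= d" "\<forall>\<tau>. \<bar>\<tau> - t i\<bar> < e --> sgn_nv s (t(i := \<tau>)) = sgn_nv s t"
    using sign(1) by blast
  have "m i s t *\<^sub>R tder M N (X s t) (f i s t) = m i s t *\<^sub>R ((sgn_nv s t * g i s t) *\<^sub>R f i s t)"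
    using sign(2) linear_scale[OF tder_linear[OF N_smooth XM[OF z]]] by (simp add: algebra_simps)
  then have "tder M N (X s t) (f i s t) = (sgn_nv s t * g i s t) *\<^sub>R f i s t"
    using m[OF z i] by (metis scaleR_cancel_left)
  then show "shape_operator M N (X s t) (f i s t) = - (sgn_nv s t * g i s t) *\<^sub>R f i s t" by (simp add: S)
  show "\<exists>e>0. \<forall>\<tau>. \<bar>\<tau> - t i\<bar> < e --> (s, t(i := \<tau>)) \<in> Rg \<and> sgn_nv s (t(i := \<tau>)) = sgn_nv s t"
    using e(1-3) d(2) by (intro exI[of _ e]) auto
qed

lemma mean_curvature_param:
  assumes z: "(s, t) \<in> Rg"
  shows "mean_curvature M N (X s t) = - 2 * (sgn_nv s t * kp s)"
proof -
  note o = on(1)[OF z] and p = prof[OF z]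
  define e where "e i = (if i = 1 then E0 s t else f i s t)" for i
  define k where "k i = (if i = 1 then sgn_nv s t * kp s else - (sgn_nv s t * g i s t))" for i
  have E1: "E0 s t \<bullet> E0 s t = 1"
    using o p by (simp add: E0_def inner_add_left inner_add_right inner_commute[of "w3 s t" "w2 s t"])
  have Ef: "E0 s t \<bullet> f i s t = 0" if "i \<in> {2..n}" for i
    using on(2)[OF z that] by (simp add: E0_def inner_add_left)
  have c: "i = 1 \<or> i \<in> {2..n}" if "i \<in> {1..n}" for i using that by auto
  have "mean_curvature M N (X s t) = (\<Sum>i\<in>{1..n}. k i)"
  proof (rule mean_curvature_eq[OF dim XM[OF z], of e k])
    show "N (X s t) \<bullet> e i = 0" if "i \<in> {1..n}" for i
      using c[OF that] E0_tangent[OF z] f_tangent[OF z, of i] by (auto simp: e_def)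
    show "e i \<bullet> e j = (if i = j then 1 else 0)" if "i \<in> {1..n}" "j \<in> {1..n}" for i j
      using c[OF that(1)] c[OF that(2)] E1 Ef[of i] Ef[of j] on(3)[OF z, of i j] by (auto simp: e_def inner_commute)
    show "shape_operator M N (X s t) (e i) = k i *\<^sub>R e i" if "i \<in> {1..n}" for i
      using c[OF that] principal_directions(1)[OF z] principal_directions(2)[OF z, of i] by (auto simp: e_def k_def)
  qed
  also have "{1..n} = insert 1 {2..n}" using n by auto
  also have "(\<Sum>i\<in>insert 1 {2..n}. k i) = k 1 + (\<Sum>i\<in>{2..n}. k i)" by (rule sum.insert) auto
  also have "(\<Sum>i\<in>{2..n}. k i) = (\<Sum>i\<in>{2..n}. - (sgn_nv s t * g i s t))" by (rule sum.cong) (auto simp: k_def)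
  also have "\<dots> = - (sgn_nv s t * (3 * kp s))"
    using p by (simp add: sum_negf sum_distrib_left[symmetric] kp_def)
  finally show ?thesis by (simp add: k_def)
qed

lemma H_equation_param:
  assumes z: "(s, t) \<in> Rg"
  shows "shape_operator M N (X s t) (grad M s1 (X s t)) = - (s1 (X s t) / 2) *\<^sub>R grad M s1 (X s t)"
proof -
  let ?x = "X s t"
  let ?G = "grad M s1 ?x"
  have x: "?x \<in> M" by (rule XM[OF z])
  note o = on(1)[OF z] and p = prof[OF z]
  have lin: "linear (tder M N ?x)" "linear (tder M s1 ?x)" by (rule tder_linear[OF N_smooth x], rule tder_linear[OF s1(2) x])
  have Gf: "?G \<bullet> f i s t = 0" if i: "i \<in> {2..n}" for i
  proof -
    obtain e where e: "e > 0" "!!\<tau>. \<bar>\<tau> - t i\<bar> < e ==> (s, t(i := \<tau>)) \<in> Rg \<and> sgn_nv s (t(i := \<tau>)) = sgn_nv s t"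
      using principal_directions(3)[OF z i] by blast
    have 1: "((\<lambda>\<tau>. s1 (X s (t(i := \<tau>)))) has_vector_derivative tder M s1 (X s (t(i := t i))) (m i s t *\<^sub>R f i s t)) (at (t i))"
      by (rule has_derivative_along_curve[OF Xt(1)[OF z i], of "ball (t i) e"])
        (use e XM s1(2) in \<open>auto simp: dist_real_def abs_minus_commute\<close>)
    have "((\<lambda>\<tau>. s1 (X s (t(i := \<tau>)))) has_vector_derivative 0) (at (t i))"
    proof (rule has_vector_derivative_transform_within_open[of "\<lambda>\<tau>. - 2 * (sgn_nv s t * kp s)" _ _ "ball (t i) e"])
      fix \<tau> assume "\<tau> \<in> ball (t i) e"
      then have "(s, t(i := \<tau>)) \<in> Rg" "sgn_nv s (t(i := \<tau>)) = sgn_nv s t" using e(2)[of \<tau>] by (auto simp: dist_real_def abs_minus_commute)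
      then show "- 2 * (sgn_nv s t * kp s) = s1 (X s (t(i := \<tau>)))"
        using mean_curvature_param s1(1) XM by simp
    qed (use e in auto)
    then have "tder M s1 ?x (m i s t *\<^sub>R f i s t) = 0" using vector_derivative_unique_at[OF 1] by simp
    then have "tder M s1 ?x (f i s t) = 0" using m[OF z i] by (simp add: linear_scale[OF lin(2)])
    then show ?thesis using grad_exists(2)[OF s1(2) x, of "f i s t"] f_tangent[OF z i] tangent_iff[OF x] by simp
  qed
  define e where "e i = (if i = 1 then E0 s t else f i s t)" for i
  have E1: "E0 s t \<bullet> E0 s t = 1"
    using o p by (simp add: E0_def inner_add_left inner_add_right inner_commute[of "w3 s t" "w2 s t"])
  have Ef: "E0 s t \<bullet> f i s t = 0" if "i \<in> {2..n}" for i
    using on(2)[OF z that] by (simp add: E0_def inner_add_left)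
  have c: "i = 1 \<or> i \<in> {2..n}" if "i \<in> {1..n}" for i using that by auto
  have "?G = (?G \<bullet> E0 s t) *\<^sub>R E0 s t"
  proof (rule frame_eqI[OF dim x, of e])
    show "N ?x \<bullet> e i = 0" if "i \<in> {1..n}" for i
      using c[OF that] E0_tangent[OF z] f_tangent[OF z, of i] by (auto simp: e_def)
    show "e i \<bullet> e j = (if i = j then 1 else 0)" if "i \<in> {1..n}" "j \<in> {1..n}" for i j
      using c[OF that(1)] c[OF that(2)] E1 Ef[of i] Ef[of j] on(3)[OF z, of i j] by (auto simp: e_def inner_commute)
    show "?G \<bullet> N ?x = ((?G \<bullet> E0 s t) *\<^sub>R E0 s t) \<bullet> N ?x"
      using grad_exists(1)[OF s1(2) x] tangent_iff[OF x] E0_tangent[OF z] by (simp add: inner_commute)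
    show "?G \<bullet> e i = ((?G \<bullet> E0 s t) *\<^sub>R E0 s t) \<bullet> e i" if "i \<in> {1..n}" for i
      using c[OF that] Gf[of i] E1 Ef[of i] by (auto simp: e_def)
  qed
  then obtain r where r: "?G = r *\<^sub>R E0 s t" by blast
  have "shape_operator M N ?x (r *\<^sub>R E0 s t) = r *\<^sub>R shape_operator M N ?x (E0 s t)"
    using linear_scale[OF lin(1)] by (simp add: shape_operator_def tder_def[symmetric])
  also have "\<dots> = (sgn_nv s t * kp s) *\<^sub>R (r *\<^sub>R E0 s t)" unfolding principal_directions(1)[OF z] by simp
  also have "sgn_nv s t * kp s = - (s1 ?x / 2)" using mean_curvature_param[OF z] s1(1)[OF x] by simp
  finally show ?thesis unfolding r .
qed

end

end

text \<open>
  The unit vectors of the spheres in both families, and the tangent vectors to these spheres, have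
  coordinates in consecutive vectors of an orthonormal basis.
\<close>

definition blk :: "(nat => 'a::euclidean_space) => nat => nat => (nat => real) => 'a" where
  "blk A d r c = (\<Sum>j\<in>{1..d+1}. c j *\<^sub>R A (j + r))"

lemma blk_inner:
  assumes A: "!!i j. i \<in> {1..n+1} ==> j \<in> {1..n+1} ==> A i \<bullet> A j = (if i = j then 1 else 0)"
    and r: "d + r <= n"
  shows "blk A d r c \<bullet> blk A d r c' = (\<Sum>j\<in>{1..d+1}. c j * c' j)"
    and "j \<in> {1..n+1} ==> j \<notin> {1+r..d+1+r} ==> blk A d r c \<bullet> A j = 0"
    and "d' + r' <= n ==> d + r < r' ==> blk A d r c \<bullet> blk A d' r' c' = 0"
proof -
  have 1: "blk A d r c \<bullet> A (j + r) = c j" if j: "j \<in> {1..d+1}" for j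
  proof -
    have "blk A d r c \<bullet> A (j+r) = (\<Sum>i\<in>{1..d+1}. if i = j then c i else 0)"
      unfolding blk_def inner_sum_left
    proof (rule sum.cong[OF refl])
      fix i assume i: "i \<in> {1..d+1}"
      have "A (i + r) \<bullet> A (j + r) = (if i + r = j + r then 1 else 0)" by (rule A) (use i j r in auto)
      then show "(c i *\<^sub>R A (i + r)) \<bullet> A (j + r) = (if i = j then c i else 0)" by simp
    qed
    then show ?thesis using j by simp
  qed
  have 2: "blk A d r c \<bullet> A j = 0" if j: "j \<in> {1..n+1}" "j \<notin> {1+r..d+1+r}" for j
    unfolding blk_def inner_sum_left
  proof (rule sum.neutral, rule ballI)
    fix i assume i: "i \<in> {1..d+1}"
    have "A (i + r) \<bullet> A j = (if i + r = j then 1 else 0)" by (rule A) (use i j r in auto)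
    then show "(c i *\<^sub>R A (i + r)) \<bullet> A j = 0" using i j by auto
  qed
  then show "j \<in> {1..n+1} ==> j \<notin> {1+r..d+1+r} ==> blk A d r c \<bullet> A j = 0" .
  have "blk A d r c \<bullet> blk A d r c' = (\<Sum>j\<in>{1..d+1}. c' j * (blk A d r c \<bullet> A (j + r)))"
    unfolding blk_def[of A d r c'] inner_sum_right by simp
  also have "\<dots> = (\<Sum>j\<in>{1..d+1}. c j * c' j)" by (rule sum.cong) (simp_all add: 1)
  finally show "blk A d r c \<bullet> blk A d r c' = (\<Sum>j\<in>{1..d+1}. c j * c' j)" .
  assume r': "d' + r' <= n" "d + r < r'"
  show "blk A d r c \<bullet> blk A d' r' c' = 0"
    unfolding blk_def[of A d' r' c'] inner_sum_right
  proof (rule sum.neutral, rule ballI)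
    fix i assume "i \<in> {1..d'+1}"
    then have "blk A d r c \<bullet> A (i + r') = 0" by (intro 2) (use r' in auto)
    then show "blk A d r c \<bullet> (c' i *\<^sub>R A (i + r')) = 0" by simp
  qed
qed

lemma scaleR_const_derivative:
  "(h has_real_derivative h') (at s) ==> ((\<lambda>\<tau>. h \<tau> *\<^sub>R V) has_vector_derivative h' *\<^sub>R V) (at s)"
  unfolding has_real_derivative_iff_has_vector_derivative
  by (rule bounded_linear.has_vector_derivative[OF bounded_linear_scaleR_left])

lemma blk_sphere_derivative:
  assumes i: "i \<in> {1+u..d+u}"
  shows "((\<lambda>\<tau>. blk A d r (sphere_coord d (\<lambda>m. (t(i := \<tau>)) (m + u)))) has_vector_derivative
    (\<Prod>m\<in>{1..<i-u}. sin (t (m+u))) *\<^sub>R blk A d r (sphere_frame d (\<lambda>m. t (m+u)) (i-u))) (at (t i))"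
proof -
  define \<theta> where "\<theta> = (\<lambda>m. t (m+u))"
  have l: "i - u \<in> {1..d}" and iu: "i - u + u = i" using i by auto
  have upd: "(\<lambda>m. (t(i := \<tau>)) (m+u)) = \<theta>(i-u := \<tau>)" for \<tau>
  proof
    fix m show "(t(i := \<tau>)) (m+u) = (\<theta>(i-u := \<tau>)) m" using iu by (cases "m = i - u") (auto simp: \<theta>_def)
  qed
  have "((\<lambda>\<tau>. blk A d r (sphere_coord d (\<theta>(i-u := \<tau>)))) has_vector_derivative
      (\<Prod>m\<in>{1..<i-u}. sin (\<theta> m)) *\<^sub>R blk A d r (sphere_frame d \<theta> (i-u))) (at (\<theta> (i-u)))"
    unfolding blk_def scaleR_sum_right
  proof (rule has_vector_derivative_sum)
    fix j assume j: "j \<in> {1..d+1}"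
    show "((\<lambda>\<tau>. sphere_coord d (\<theta>(i-u := \<tau>)) j *\<^sub>R A (j + r)) has_vector_derivative
        (\<Prod>m\<in>{1..<i-u}. sin (\<theta> m)) *\<^sub>R sphere_frame d \<theta> (i-u) j *\<^sub>R A (j + r)) (at (\<theta> (i-u)))"
      using scaleR_const_derivative[OF sphere_coord_derivative[OF l j], where V = "A (j + r)"] by simp
  qed
  then show ?thesis unfolding upd by (simp only: \<theta>_def iu)
qed

lemma blk_sphere_const:
  assumes i: "i \<notin> {1+u..d+u}"
  shows "blk A d r (sphere_coord d (\<lambda>m. (t(i := \<tau>)) (m + u))) = blk A d r (sphere_coord d (\<lambda>m. t (m + u)))"
  unfolding blk_def
proof (rule sum.cong[OF refl])
  fix j assume j: "j \<in> {1..d+1}"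
  have "sphere_coord d (\<lambda>m. (t(i := \<tau>)) (m + u)) j = sphere_coord d (\<lambda>m. t (m + u)) j"
    by (rule sphere_coord_cong) (use j i in auto)
  then show "sphere_coord d (\<lambda>m. (t(i := \<tau>)) (m + u)) j *\<^sub>R A (j + r) = sphere_coord d (\<lambda>m. t (m + u)) j *\<^sub>R A (j + r)"
    by (simp only:)
qed

lemma blk_sphere_continuous:
  assumes "!!i. continuous_on UNIV (\<lambda>\<tau>::real. T \<tau> i)"
  shows "continuous_on UNIV (\<lambda>\<tau>. blk A d r (sphere_coord d (\<lambda>m. T \<tau> (m + u))))"
proof -
  have "continuous_on UNIV (\<lambda>\<tau>. sphere_coord d (\<lambda>m. T \<tau> (m + u)) j)" for j
    unfolding sphere_coord_def by (cases "j <= d") (auto intro!: continuous_intros assms)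
  then show ?thesis unfolding blk_def by (intro continuous_intros)
qed

lemma smooth_on_deriv:
  fixes f :: "real => real"
  assumes I: "open I" and f: "smooth_on I f"
  shows "smooth_on I (deriv f)" "s \<in> I ==> (f has_real_derivative deriv f s) (at s)"
proof -
  have d: "(f has_real_derivative frechet_derivative f (at s) 1) (at s)" if s: "s \<in> I" for s
  proof (rule has_derivative_imp_has_field_derivative[OF smooth_on_has_derivative[OF f s]])
    fix x :: real
    show "x * frechet_derivative f (at s) 1 = frechet_derivative f (at s) x"
      using linear_scale[OF has_derivative_linear[OF smooth_on_has_derivative[OF f s]], of x 1] by simp
  qed
  have e: "frechet_derivative f (at s) 1 = deriv f s" if "s \<in> I" for s
    by (rule DERIV_imp_deriv[OF d[OF that], symmetric])
  show "smooth_on I (deriv f)" by (rule smooth_on_cong[OF I smooth_on_derivative[OF f, of 1] e])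
  show "(f has_real_derivative deriv f s) (at s)" if "s \<in> I" using d[OF that] unfolding e[OF that] .
qed

lemma profile_facts:
  assumes prof: "profile_curve I \<psi> \<phi>" and s: "s \<in> I"
  shows "(\<psi> has_real_derivative deriv \<psi> s) (at s)" "(\<phi> has_real_derivative deriv \<phi> s) (at s)"
    and "(deriv \<psi> has_real_derivative deriv (deriv \<psi>) s) (at s)" "(deriv \<phi> has_real_derivative deriv (deriv \<phi>) s) (at s)"
    and "deriv \<psi> s * deriv \<psi> s + deriv \<phi> s * deriv \<phi> s = 1"
    and "deriv \<psi> s * deriv (deriv \<psi>) s + deriv \<phi> s * deriv (deriv \<phi>) s = 0"
proof -
  have I: "open I" "smooth_on I \<psi>" "smooth_on I \<phi>" using prof by (auto simp: profile_curve_def)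
  note d1 = smooth_on_deriv[OF I(1,2)] and d2 = smooth_on_deriv[OF I(1,3)]
  show "(\<psi> has_real_derivative deriv \<psi> s) (at s)" "(\<phi> has_real_derivative deriv \<phi> s) (at s)"
    by (rule d1(2)[OF s], rule d2(2)[OF s])
  show dd: "(deriv \<psi> has_real_derivative deriv (deriv \<psi>) s) (at s)" "(deriv \<phi> has_real_derivative deriv (deriv \<phi>) s) (at s)"
    by (rule smooth_on_deriv(2)[OF I(1) d1(1) s], rule smooth_on_deriv(2)[OF I(1) d2(1) s])
  have one: "deriv \<psi> s * deriv \<psi> s + deriv \<phi> s * deriv \<phi> s = 1" if "s \<in> I" for s
    using prof that by (simp add: profile_curve_def power2_eq_square)
  then show "deriv \<psi> s * deriv \<psi> s + deriv \<phi> s * deriv \<phi> s = 1" using s by simp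
  have "((\<lambda>s. deriv \<psi> s * deriv \<psi> s + deriv \<phi> s * deriv \<phi> s) has_real_derivative
      (deriv (deriv \<psi>) s * deriv \<psi> s + deriv (deriv \<psi>) s * deriv \<psi> s) +
      (deriv (deriv \<phi>) s * deriv \<phi> s + deriv (deriv \<phi>) s * deriv \<phi> s)) (at s)"
    by (intro DERIV_add DERIV_mult dd)
  moreover have "((\<lambda>s. deriv \<psi> s * deriv \<psi> s + deriv \<phi> s * deriv \<phi> s) has_real_derivative 0) (at s)"
    by (rule has_field_derivative_transform_within_open[OF DERIV_const[of 1] I(1) s]) (simp add: one)
  ultimately have "(deriv (deriv \<psi>) s * deriv \<psi> s + deriv (deriv \<psi>) s * deriv \<psi> s) +
      (deriv (deriv \<phi>) s * deriv \<phi> s + deriv (deriv \<phi>) s * deriv \<phi> s) = 0" by (rule DERIV_unique)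
  then show "deriv \<psi> s * deriv (deriv \<psi>) s + deriv \<phi> s * deriv (deriv \<phi>) s = 0"
    unfolding mult.commute[of "deriv (deriv \<psi>) s"] mult.commute[of "deriv (deriv \<phi>) s"] by linarith
qed

lemma openin_param_curve:
  assumes D: "openin (param_topology n) D" and g: "continuous_on UNIV (\<lambda>\<tau>. fst (\<gamma> \<tau>))" "!!i. i \<in> {2..n} ==> continuous_on UNIV (\<lambda>\<tau>. snd (\<gamma> \<tau>) i)"
    and e: "!!\<tau>. snd (\<gamma> \<tau>) \<in> extensional {2..n}" and D0: "\<gamma> \<tau>0 \<in> D"
  shows "\<exists>d>0. \<forall>\<tau>::real. \<bar>\<tau> - \<tau>0\<bar> < d --> \<gamma> \<tau> \<in> D"
proof -
  have "continuous_map euclideanreal (param_topology n) \<gamma>"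
    unfolding continuous_map_pairwise continuous_map_componentwise using g e by (auto simp: o_def)
  then have "openin euclideanreal {\<tau> \<in> topspace euclideanreal. \<gamma> \<tau> \<in> D}" by (rule openin_continuous_map_preimage[OF _ D])
  then have "open {\<tau>. \<gamma> \<tau> \<in> D}" by simp
  then obtain d where "d > 0" "ball \<tau>0 d \<subseteq> {\<tau>. \<gamma> \<tau> \<in> D}" using D0 unfolding open_contains_ball by blast
  then show ?thesis by (intro exI[of _ d]) (auto simp: dist_real_def abs_minus_commute subset_iff)
qed

text \<open>
  A distance preserving map is an orthogonal transformation followed by a translation; its inverse
  carries the parametrization to one of \<open>M\<close> in another orthonormal basis.
\<close>

lemma congruent_param:
  fixes b :: "nat => 'a::euclidean_space"
  assumes b: "bij_betw b {1..n+1} Basis" and c: "congruent_sets M ((\<lambda>(s, t). \<Sum>j\<in>{1..n+1}. cd s t j *\<^sub>R b j) ` D)"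
  obtains O' A where "!!i j. i \<in> {1..n+1} ==> j \<in> {1..n+1} ==> A i \<bullet> A j = (if i = j then 1 else 0)"
    "M = (\<lambda>(s, t). O' + (\<Sum>j\<in>{1..n+1}. cd s t j *\<^sub>R A j)) ` D"
proof -
  let ?P = "\<lambda>(s, t). \<Sum>j\<in>{1..n+1}. cd s t j *\<^sub>R b j"
  obtain f where f: "\<forall>x y. dist (f x) (f y) = dist x y" "f ` M = ?P ` D" using c unfolding congruent_sets_def by blast
  define L where "L x = f x - f 0" for x
  have L: "orthogonal_transformation L"
    unfolding orthogonal_transformation_isometry L_def using f(1) by (simp add: dist_norm)
  define J where "J = inv L"
  have J: "orthogonal_transformation J" unfolding J_def by (rule orthogonal_transformation_inv[OF L])
  have JL: "J (L x) = x" for x unfolding J_def by (rule inv_f_f[OF orthogonal_transformation_inj[OF L]])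
  have lin: "linear J" by (rule orthogonal_transformation_linear[OF J])
  have J_inner: "J x \<bullet> J y = x \<bullet> y" for x y using J by (simp add: orthogonal_transformation_def)
  show thesis
  proof (rule that[of "\<lambda>j. J (b j)" "- J (f 0)"])
    fix i j assume ij: "i \<in> {1..n+1}" "j \<in> {1..n+1}"
    have "b i \<in> Basis" "b j \<in> Basis" using bij_betwE[OF b] ij by auto
    moreover have "b i = b j \<longleftrightarrow> i = j" by (rule inj_on_eq_iff[OF bij_betw_imp_inj_on[OF b] ij])
    ultimately show "J (b i) \<bullet> J (b j) = (if i = j then 1 else 0)" by (simp add: J_inner inner_Basis)
  next
    have "M = (\<lambda>x. J (f x - f 0)) ` M" using JL by (simp add: L_def)
    also have "\<dots> = (\<lambda>y. J (y - f 0)) ` (f ` M)" by (simp add: image_image)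
    also have "\<dots> = (\<lambda>z. J (?P z - f 0)) ` D" unfolding f(2) image_image ..
    also have "\<dots> = (\<lambda>(s, t). - J (f 0) + (\<Sum>j\<in>{1..n+1}. cd s t j *\<^sub>R J (b j))) ` D"
      by (rule image_cong[OF refl]) (auto simp: linear_diff[OF lin] linear_sum[OF lin] linear_scale[OF lin])
    finally show "M = (\<lambda>(s, t). - J (f 0) + (\<Sum>j\<in>{1..n+1}. cd s t j *\<^sub>R J (b j))) ` D" .
  qed
qed

lemma sum_two_blocks:
  "(\<Sum>i\<in>{2..p+q+1}. if i <= p + 1 then x else y) = real p * x + real q * y"
proof -
  have "{2..p+q+1} = {2..p+1} \<union> {p+2..p+q+1}" by auto
  then have "(\<Sum>i\<in>{2..p+q+1}. if i <= p + 1 then x else y) =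
      (\<Sum>i\<in>{2..p+1}. if i <= p + 1 then x else y) + (\<Sum>i\<in>{p+2..p+q+1}. if i <= p + 1 then x else y)"
    by (simp only:) (rule sum.union_disjoint, auto)
  also have "(\<Sum>i\<in>{2..p+1}. if i <= p + 1 then x else y) = (\<Sum>i\<in>{2..p+1}. x)" by (rule sum.cong) auto
  also have "(\<Sum>i\<in>{p+2..p+q+1}. if i <= p + 1 then x else y) = (\<Sum>i\<in>{p+2..p+q+1}. y)" by (rule sum.cong) auto
  finally show ?thesis by simp
qed

lemma sum_split_block:
  fixes h :: "nat => 'b::comm_monoid_add"
  shows "(\<Sum>j\<in>{1..p+q+2}. h j) = (\<Sum>j\<in>{1..p+1}. h j) + (\<Sum>j\<in>{1..q+1}. h (j + (p+1)))"
proof -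
  have "{1..p+q+2} = {1..p+1} \<union> {1+(p+1)..(q+1)+(p+1)}" by auto
  then have "(\<Sum>j\<in>{1..p+q+2}. h j) = (\<Sum>j\<in>{1..p+1}. h j) + (\<Sum>j\<in>{1+(p+1)..(q+1)+(p+1)}. h j)"
    by (simp only:) (rule sum.union_disjoint, auto)
  then show ?thesis unfolding sum.shift_bounds_cl_nat_ivl .
qed

locale curved_hypersurface = hypersurface M N for M :: "'a::euclidean_space set" and N +
  fixes n :: nat
  assumes dim: "DIM('a) = n + 1" and n1: "n >= 1"
    and s1_smooth: "smooth_along M (mean_curvature M N)"
    and G_smooth: "smooth_along M (grad M (mean_curvature M N))"
    and G_nz: "!!x. x \<in> M ==> grad M (mean_curvature M N) x ~= 0"
    and nonempty: "M ~= {}"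
begin

abbreviation "G \<equiv> grad M (mean_curvature M N)"

lemma G_tangent: "x \<in> M ==> N x \<bullet> G x = 0"
  using grad_exists(1)[OF s1_smooth] tangent_iff by simp

lemma G_inner: "x \<in> M ==> N x \<bullet> v = 0 ==> G x \<bullet> v = tder M (mean_curvature M N) x v"
  using grad_exists(2)[OF s1_smooth] tangent_iff by simp

text \<open>Both sides of the equation are continuous, so it need only be checked on a dense subset.\<close>

lemma H_hypersurface_dense:
  assumes eq: "!!x. x \<in> R ==> x \<in> M \<and> shape_operator M N x (G x) = - (mean_curvature M N x / 2) *\<^sub>R G x"
    and dense: "M \<subseteq> closure R"
  shows "H_hypersurface M N"
proof -
  define h where "h x = - tder M N x (G x) + (mean_curvature M N x / 2) *\<^sub>R G x" for x
  have S: "shape_operator M N x v = - tder M N x v" for x v by (simp add: shape_operator_def tder_def)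
  have "continuous_on M (\<lambda>x. tder M N x (G x))"
    by (rule smooth_along_continuous_on[OF smooth_along_tder[OF N_smooth G_smooth G_tangent]])
  then have hc: "continuous_on M h" unfolding h_def
    by (intro continuous_intros smooth_along_continuous_on[OF s1_smooth] smooth_along_continuous_on[OF G_smooth]) auto
  have h0: "h x = 0" if "x \<in> R" for x using eq[OF that] by (simp add: h_def S)
  have "h x = 0" if x: "x \<in> M" for x
  proof (rule ccontr)
    assume nz: "h x ~= 0"
    obtain V where V: "open V" "V \<inter> M = h -` (- {0}) \<inter> M"
      using hc[unfolded continuous_on_open_invariant] open_Compl[OF closed_singleton[of 0]] by blast
    have "x \<in> V" using V(2) x nz by auto
    then have "V \<inter> R ~= {}" using open_Int_closure_eq_empty[OF V(1), of R] dense x by blast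
    then obtain y where "y \<in> R" "y \<in> V" by blast
    then show False using V(2) h0[of y] eq[of y] by auto
  qed
  then have "shape_operator M N x (G x) = - (mean_curvature M N x / 2) *\<^sub>R G x" if "x \<in> M" for x
    using that by (simp add: h_def S add_eq_0_iff)
  moreover have "\<not> mean_curvature M N constant_on M"
  proof
    assume "mean_curvature M N constant_on M"
    then obtain c where c: "!!x. x \<in> M ==> mean_curvature M N x = c" unfolding constant_on_def by blast
    obtain x where x: "x \<in> M" using nonempty by blast
    have "tder M (mean_curvature M N) x = tder M (\<lambda>y. c) x" by (rule tder_cong[OF x c])
    then have "tder M (mean_curvature M N) x (G x) = 0"
      using tder_const[OF x grad_exists(1)[OF s1_smooth x]] by simp
    then have "G x \<bullet> G x = 0" using G_inner[OF x G_tangent[OF x]] by simp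
    then show False using G_nz[OF x] by simp
  qed
  ultimately show ?thesis unfolding H_hypersurface_def Let_def by blast
qed

text \<open>
  All factors \<open>sin (t l)\<close> are nonzero at the regular points. Adding a small positive number to all
  angles at once moves any point of the domain to a regular one.
\<close>

lemma H_hypersurface_param:
  assumes D: "openin (param_topology n) D" and MX: "M = (\<lambda>(s, t). X s t) ` D"
    and cont: "!!s t. (s, t) \<in> D ==> continuous_on UNIV (\<lambda>\<tau>::real. X s (\<lambda>i. if i \<in> {2..n} then t i + \<tau> else t i))"
    and on: "!!s t. (s, t) \<in> D ==> w2 s t \<bullet> w2 s t = 1 \<and> w3 s t \<bullet> w3 s t = 1 \<and> w2 s t \<bullet> w3 s t = 0"
      "!!s t i. (s, t) \<in> D ==> i \<in> {2..n} ==> w2 s t \<bullet> f i s t = 0 \<and> w3 s t \<bullet> f i s t = 0"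
      "!!s t i j. (s, t) \<in> D ==> i \<in> {2..n} ==> j \<in> {2..n} ==> f i s t \<bullet> f j s t = (if i = j then 1 else 0)"
    and Xs: "!!s t. (s, t) \<in> D ==> ((\<lambda>\<tau>. X \<tau> t) has_vector_derivative dp s *\<^sub>R w2 s t + df s *\<^sub>R w3 s t) (at s)"
      "!!s t. (s, t) \<in> D ==> ((\<lambda>\<tau>. w2 \<tau> t) has_vector_derivative 0) (at s)"
      "!!s t. (s, t) \<in> D ==> ((\<lambda>\<tau>. w3 \<tau> t) has_vector_derivative 0) (at s)"
    and Xt: "!!s t i. (s, t) \<in> D ==> i \<in> {2..n} ==> ((\<lambda>\<tau>. X s (t(i := \<tau>))) has_vector_derivative m i s t *\<^sub>R f i s t) (at (t i))"
      "!!s t i. (s, t) \<in> D ==> i \<in> {2..n} ==> ((\<lambda>\<tau>. w2 s (t(i := \<tau>))) has_vector_derivative \<alpha> i s t *\<^sub>R f i s t) (at (t i))"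
      "!!s t i. (s, t) \<in> D ==> i \<in> {2..n} ==> ((\<lambda>\<tau>. w3 s (t(i := \<tau>))) has_vector_derivative \<beta> i s t *\<^sub>R f i s t) (at (t i))"
    and m: "!!s t i. (s, t) \<in> D ==> i \<in> {2..n} ==> \<forall>l\<in>{2..n}. sin (t l) ~= 0 ==> m i s t ~= 0"
      "!!s t i. (s, t) \<in> D ==> i \<in> {2..n} ==> df s * \<alpha> i s t - dp s * \<beta> i s t = m i s t * g i s t"
    and prof: "!!s t. (s, t) \<in> D ==> dp s * dp s + df s * df s = 1 \<and> DERIV dp s :> ddp s \<and> DERIV df s :> ddf s \<and>
        dp s * ddp s + df s * ddf s = 0 \<and> 3 * (df s * ddp s - ddf s * dp s) = (\<Sum>i\<in>{2..n}. g i s t)"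
  shows "H_hypersurface M N"
proof -
  define Rg where "Rg = {z \<in> D. \<forall>l\<in>{2..n}. sin (snd z l) ~= 0}"
  have Rg: "(s, t) \<in> Rg \<longleftrightarrow> (s, t) \<in> D \<and> (\<forall>l\<in>{2..n}. sin (t l) ~= 0)" for s t by (simp add: Rg_def)
  have RgD: "(s, t) \<in> D" if "(s, t) \<in> Rg" for s t using that by (simp add: Rg)
  have ext: "t \<in> extensional {2..n}" if "(s, t) \<in> D" for s t
    using subsetD[OF openin_subset[OF D] that] by (simp add: PiE_def)
  have sin_nz: "\<exists>d>0. \<forall>\<tau>. \<bar>\<tau> - a\<bar> < d --> sin \<tau> ~= 0" if a: "sin a ~= 0" for a :: real
  proof -
    have "open {\<tau>::real. sin \<tau> ~= 0}" by (intro open_Collect_neq continuous_intros)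
    then obtain d where d: "d > 0" "ball a d \<subseteq> {\<tau>. sin \<tau> ~= 0}" using a unfolding open_contains_ball by blast
    then show ?thesis by (intro exI[of _ d]) (auto simp: dist_real_def abs_minus_commute subset_iff)
  qed
  have move_s: "\<exists>d>0. \<forall>\<tau>. \<bar>\<tau> - s\<bar> < d --> (\<tau>, t) \<in> Rg" if z: "(s, t) \<in> Rg" for s t
  proof -
    have "\<exists>d>0. \<forall>\<tau>. \<bar>\<tau> - s\<bar> < d --> (\<tau>, t) \<in> D"
      by (rule openin_param_curve[OF D, of "\<lambda>\<tau>. (\<tau>, t)"]) (use RgD[OF z] ext[OF RgD[OF z]] in auto)
    then show ?thesis using z by (simp add: Rg)
  qed
  have move_t: "\<exists>d>0. \<forall>\<tau>. \<bar>\<tau> - t i\<bar> < d --> (s, t(i := \<tau>)) \<in> Rg" if z: "(s, t) \<in> Rg" and i: "i \<in> {2..n}" for s t i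
  proof -
    have 1: "continuous_on UNIV (\<lambda>\<tau>. (t(i := \<tau>)) j)" for j by (cases "j = i") auto
    have "\<exists>d>0. \<forall>\<tau>. \<bar>\<tau> - t i\<bar> < d --> (s, t(i := \<tau>)) \<in> D"
    proof (rule openin_param_curve[OF D, of "\<lambda>\<tau>. (s, t(i := \<tau>))"])
      show "continuous_on UNIV (\<lambda>\<tau>. snd (s, t(i := \<tau>)) j)" for j using 1 by simp
      show "snd (s, t(i := \<tau>)) \<in> extensional {2..n}" for \<tau> using ext[OF RgD[OF z]] i by (auto simp: extensional_def)
    qed (use RgD[OF z] in auto)
    then obtain d where d: "d > 0" "!!\<tau>. \<bar>\<tau> - t i\<bar> < d ==> (s, t(i := \<tau>)) \<in> D" by blast
    obtain d' where d': "d' > 0" "!!\<tau>. \<bar>\<tau> - t i\<bar> < d' ==> sin \<tau> ~= 0" using sin_nz[of "t i"] z i by (auto simp: Rg)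
    show ?thesis
      by (rule exI[of _ "min d d'"]) (use d d' z in \<open>auto simp: Rg\<close>)
  qed
  have XM: "X s t \<in> M" if "(s, t) \<in> D" for s t using that unfolding MX by (rule image_eqI[rotated]) simp
  have mm: "m i s t ~= 0 \<and> df s * \<alpha> i s t - dp s * \<beta> i s t = m i s t * g i s t" if "(s, t) \<in> Rg" "i \<in> {2..n}" for s t i
    using m[OF RgD[OF that(1)] that(2)] that(1) by (simp add: Rg)
  have eq: "shape_operator M N (X s t) (G (X s t)) = - (mean_curvature M N (X s t) / 2) *\<^sub>R G (X s t)"
    if "(s, t) \<in> Rg" for s t
    by (rule H_equation_param[where n = n and ?s1.0 = "mean_curvature M N" and Rg = Rg and X = X and ?w2.0 = w2
          and ?w3.0 = w3 and f = f and dp = dp and df = df and ddp = ddp and ddf = ddf and m = m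
          and \<alpha> = \<alpha> and \<beta> = \<beta> and g = g, OF dim n1 refl s1_smooth])
      (rule that move_s move_t XM[OF RgD] on(1)[OF RgD] on(2)[OF RgD] on(3)[OF RgD] Xs(1)[OF RgD] Xs(2)[OF RgD] Xs(3)[OF RgD]
        Xt(1)[OF RgD] Xt(2)[OF RgD] Xt(3)[OF RgD] mm prof[OF RgD]; assumption)+
  have dense: "X s t \<in> closure ((\<lambda>(s, t). X s t) ` Rg)" if z: "(s, t) \<in> D" for s t
  proof -
    define T where "T \<tau> = (\<lambda>i. if i \<in> {2..n} then t i + \<tau> else t i)" for \<tau> :: real
    have T0: "T 0 = t" by (auto simp: T_def)
    have Tc: "continuous_on UNIV (\<lambda>\<tau>. T \<tau> j)" for j
      unfolding T_def by (cases "j \<in> {2..n}") (auto intro!: continuous_intros)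
    have "\<exists>d>0. \<forall>\<tau>. \<bar>\<tau> - 0\<bar> < d --> (s, T \<tau>) \<in> D"
    proof (rule openin_param_curve[OF D, of "\<lambda>\<tau>. (s, T \<tau>)"])
      show "continuous_on UNIV (\<lambda>\<tau>. snd (s, T \<tau>) j)" for j using Tc by simp
      show "snd (s, T \<tau>) \<in> extensional {2..n}" for \<tau> using ext[OF z] by (auto simp: extensional_def T_def)
    qed (use z T0 in auto)
    then have ev1: "eventually (\<lambda>\<tau>. (s, T \<tau>) \<in> D) (at_right 0)" unfolding eventually_at dist_real_def by auto
    have "eventually (\<lambda>\<tau>. sin (t l + \<tau>) ~= 0) (at_right 0)" for l
    proof (cases "sin (t l) = 0")
      case True
      then have "cos (t l) ~= 0" using sin_cos_squared_add[of "t l"] by auto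
      then have "sin (t l + \<tau>) ~= 0" if "0 < \<tau>" "\<tau> < pi" for \<tau>
        using True sin_gt_zero[OF that] by (simp add: sin_add)
      then show ?thesis unfolding eventually_at dist_real_def by (intro exI[of _ pi]) auto
    next
      case False
      obtain d where d: "d > 0" "!!\<tau>. \<bar>\<tau> - t l\<bar> < d ==> sin \<tau> ~= 0" using sin_nz[OF False] by blast
      have "sin (t l + \<tau>) ~= 0" if "\<bar>\<tau>\<bar> < d" for \<tau> using d(2)[of "t l + \<tau>"] that by simp
      then show ?thesis unfolding eventually_at dist_real_def using d(1) by (intro exI[of _ d]) auto
    qed
    then have "\<forall>l\<in>{2..n}. eventually (\<lambda>\<tau>. sin (t l + \<tau>) ~= 0) (at_right 0)" by blast
    then have "eventually (\<lambda>\<tau>. \<forall>l\<in>{2..n}. sin (t l + \<tau>) ~= 0) (at_right 0)" by (rule eventually_ball_finite[rotated]) simp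
    with ev1 have "eventually (\<lambda>\<tau>. X s (T \<tau>) \<in> closure ((\<lambda>(s, t). X s t) ` Rg)) (at_right 0)"
    proof eventually_elim
      fix \<tau> assume "(s, T \<tau>) \<in> D" "\<forall>l\<in>{2..n}. sin (t l + \<tau>) ~= 0"
      then have "(s, T \<tau>) \<in> Rg" by (simp add: Rg T_def)
      then have "X s (T \<tau>) \<in> (\<lambda>(s, t). X s t) ` Rg" by (rule image_eqI[rotated]) simp
      then show "X s (T \<tau>) \<in> closure ((\<lambda>(s, t). X s t) ` Rg)" by (rule subsetD[OF closure_subset])
    qed
    moreover have "((\<lambda>\<tau>. X s (T \<tau>)) \<longlongrightarrow> X s (T 0)) (at_right 0)"
      using cont[OF z] unfolding T_def[symmetric] continuous_on_def by (auto intro: tendsto_within_subset)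
    ultimately show ?thesis
      unfolding T0 by (intro Lim_in_closed_set[OF closed_closure, where F = "at_right (0::real)"]) auto
  qed
  show ?thesis
  proof (rule H_hypersurface_dense[of "(\<lambda>(s, t). X s t) ` Rg"])
    show "M \<subseteq> closure ((\<lambda>(s, t). X s t) ` Rg)"
    proof
      fix x assume "x \<in> M"
      then obtain s t where st: "(s, t) \<in> D" "x = X s t" unfolding MX by (elim imageE) (auto split: prod.splits)
      show "x \<in> closure ((\<lambda>(s, t). X s t) ` Rg)" unfolding st(2) by (rule dense[OF st(1)])
    qed
    show "x \<in> M \<and> shape_operator M N x (G x) = - (mean_curvature M N x / 2) *\<^sub>R G x" if "x \<in> (\<lambda>(s, t). X s t) ` Rg" for x
    proof -
      obtain s t where st: "(s, t) \<in> Rg" "x = X s t" using \<open>x \<in> _\<close> by (elim imageE) (auto split: prod.splits)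
      show ?thesis unfolding st(2) using XM[OF RgD[OF st(1)]] eq[OF st(1)] by blast
    qed
  qed
qed

lemma prod_sin_nz:
  assumes "\<forall>l\<in>{2..n}. sin (t l :: real) ~= 0" "u >= 1" "i <= n"
  shows "(\<Prod>m\<in>{1..<i-u}. sin (t (m + u))) ~= 0"
proof -
  have "sin (t (m + u)) ~= 0" if "m \<in> {1..<i-u}" for m
  proof (rule assms(1)[THEN bspec])
    show "m + u \<in> {2..n}" using that assms(2,3) unfolding atLeastAtMost_iff atLeastLessThan_iff by arith
  qed
  then show ?thesis by (simp add: prod_zero_iff)
qed

lemma rotational_H:
  assumes nn: "n = p + q + 1" and b: "bij_betw b {1..n+1} Basis" and rt: "rotational_type b n p M"
  shows "H_hypersurface M N"
proof -
  obtain I \<psi> \<phi> D where prof: "profile_curve I \<psi> \<phi>"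
    and eqn: "\<forall>s\<in>I. \<psi> s ~= 0 \<and> \<phi> s ~= 0 \<and> deriv \<phi> s * deriv (deriv \<psi>) s - deriv (deriv \<phi>) s * deriv \<psi> s =
             1 / 3 * (real p * (deriv \<phi> s / \<psi> s) - real (n - p - 1) * (deriv \<psi> s / \<phi> s))"
    and dom: "param_domain n I D" and cong: "congruent_sets M (rotational_param b n p \<psi> \<phi> ` D)"
    using rt unfolding rotational_type_def by blast
  have nq: "n - p - 1 = q" "n - (p + 1) = q" "n - Suc p = q" "n + 1 = p + q + 2" using nn by auto
  define cd where "cd s t j = (if j <= p + 1 then \<psi> s * sphere_coord p (\<lambda>l. t (l + 1)) j
      else \<phi> s * sphere_coord q (\<lambda>l. t (l + (p + 1))) (j - (p + 1)))" for s t j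
  have P: "rotational_param b n p \<psi> \<phi> = (\<lambda>(s, t). \<Sum>j\<in>{1..n+1}. cd s t j *\<^sub>R b j)"
    unfolding rotational_param_def cd_def nq(1) by (simp only: add.assoc)
  obtain O' A where A: "!!i j. i \<in> {1..n+1} ==> j \<in> {1..n+1} ==> A i \<bullet> A j = (if i = j then 1 else 0)"
    and MA: "M = (\<lambda>(s, t). O' + (\<Sum>j\<in>{1..n+1}. cd s t j *\<^sub>R A j)) ` D"
    by (rule congruent_param[OF b cong[unfolded P]], rule that)
  define w2 where "w2 s t = blk A p 0 (sphere_coord p (\<lambda>m. t (m + 1)))" for s :: real and t
  define w3 where "w3 s t = blk A q (p+1) (sphere_coord q (\<lambda>m. t (m + (p+1))))" for s :: real and t
  define f where "f i s t = (if i <= p + 1 then blk A p 0 (sphere_frame p (\<lambda>m. t (m + 1)) (i - 1))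
      else blk A q (p+1) (sphere_frame q (\<lambda>m. t (m + (p+1))) (i - (p+1))))" for i and s :: real and t
  define X where "X s t = O' + \<psi> s *\<^sub>R w2 s t + \<phi> s *\<^sub>R w3 s t" for s t
  define \<alpha> where "\<alpha> i s t = (if i <= p + 1 then (\<Prod>m\<in>{1..<i-1}. sin (t (m+1))) else 0)" for i and s :: real and t :: "nat => real"
  define \<beta> where "\<beta> i s t = (if i <= p + 1 then 0 else (\<Prod>m\<in>{1..<i-(p+1)}. sin (t (m+(p+1)))))" for i and s :: real and t :: "nat => real"
  define m where "m i s t = \<psi> s * \<alpha> i s t + \<phi> s * \<beta> i s t" for i s t
  define g where "g i s t = (if i <= p + 1 then deriv \<phi> s / \<psi> s else - (deriv \<psi> s / \<phi> s))" for i :: nat and s and t :: "nat => real"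
  have D: "openin (param_topology n) D" and sI: "!!s t. (s, t) \<in> D ==> s \<in> I" using dom by (auto simp: param_domain_def)
  have r: "p + 0 <= n" "q + (p+1) <= n" "p + 0 < p + 1" using nn by auto
  have ip: "blk A p 0 c \<bullet> blk A p 0 c' = (\<Sum>j\<in>{1..p+1}. c j * c' j)" for c c'
    by (rule blk_inner(1)[OF _ r(1)]) (rule A; assumption)
  have iq: "blk A q (p+1) c \<bullet> blk A q (p+1) c' = (\<Sum>j\<in>{1..q+1}. c j * c' j)" for c c'
    by (rule blk_inner(1)[OF _ r(2)]) (rule A; assumption)
  have ipq: "blk A p 0 c \<bullet> blk A q (p+1) c' = 0" for c c'
    by (rule blk_inner(3)[OF _ r(1) r(2) r(3)]) (rule A; assumption)
  have iqp: "blk A q (p+1) c \<bullet> blk A p 0 c' = 0" for c c' by (subst inner_commute) (rule ipq)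
  have blocks: "i <= p + 1 \<and> i - 1 \<in> {1..p} \<and> i \<in> {1+1..p+1} \<and> i \<notin> {1+(p+1)..q+(p+1)} \<or>
      \<not> i <= p + 1 \<and> i - (p+1) \<in> {1..q} \<and> i \<in> {1+(p+1)..q+(p+1)} \<and> i \<notin> {1+1..p+1}" if "i \<in> {2..n}" for i
    using that nn by auto
  have norm: "(\<Sum>j\<in>{1..d+1}. sphere_coord d \<theta> j * sphere_coord d \<theta> j) = 1" for d \<theta>
    using sphere_coord_norm[of d \<theta>] by (simp only: power2_eq_square)
  have orth: "(\<Sum>j\<in>{1..d+1}. sphere_coord d \<theta> j * sphere_frame d \<theta> l j) = 0" if "l \<in> {1..d}" for d \<theta> l
    using sphere_frame_orthonormal(2)[OF that, of \<theta>] by (simp only: mult.commute)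
  have dw2: "((\<lambda>\<tau>. w2 s (t(i := \<tau>))) has_vector_derivative \<alpha> i s t *\<^sub>R f i s t) (at (t i))" if "i \<in> {2..n}" for s t i
    using blocks[OF that]
  proof (elim disjE conjE)
    assume i: "i <= p + 1" "i \<in> {1+1..p+1}"
    show ?thesis using blk_sphere_derivative[OF i(2), of A 0 t] i(1) by (simp only: w2_def \<alpha>_def f_def if_True)
  next
    assume i: "\<not> i <= p + 1" "i \<notin> {1+1..p+1}"
    show ?thesis unfolding w2_def blk_sphere_const[OF i(2)] using i(1) by (simp add: \<alpha>_def)
  qed
  have dw3: "((\<lambda>\<tau>. w3 s (t(i := \<tau>))) has_vector_derivative \<beta> i s t *\<^sub>R f i s t) (at (t i))" if "i \<in> {2..n}" for s t i
    using blocks[OF that]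
  proof (elim disjE conjE)
    assume i: "\<not> i <= p + 1" "i \<in> {1+(p+1)..q+(p+1)}"
    show ?thesis using blk_sphere_derivative[OF i(2), of A "p+1" t] i(1) by (simp only: w3_def \<beta>_def f_def if_False)
  next
    assume i: "i <= p + 1" "i \<notin> {1+(p+1)..q+(p+1)}"
    show ?thesis unfolding w3_def blk_sphere_const[OF i(2)] using i(1) by (simp add: \<beta>_def)
  qed
  show ?thesis
  proof (rule H_hypersurface_param[OF D, of X w2 w3 f "deriv \<psi>" "deriv \<phi>" m \<alpha> \<beta> g "deriv (deriv \<psi>)" "deriv (deriv \<phi>)"])
    have "O' + (\<Sum>j\<in>{1..n+1}. cd s t j *\<^sub>R A j) = X s t" for s t
    proof -
      have "(\<Sum>j\<in>{1..p+1}. cd s t j *\<^sub>R A j) = \<psi> s *\<^sub>R w2 s t"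
        unfolding w2_def blk_def scaleR_sum_right by (rule sum.cong) (auto simp: cd_def)
      moreover have "(\<Sum>j\<in>{1..q+1}. cd s t (j + (p+1)) *\<^sub>R A (j + (p+1))) = \<phi> s *\<^sub>R w3 s t"
        unfolding w3_def blk_def scaleR_sum_right by (rule sum.cong) (auto simp: cd_def)
      ultimately show ?thesis unfolding nq(4) sum_split_block X_def by (simp only: add.assoc)
    qed
    then show "M = (\<lambda>(s, t). X s t) ` D" by (subst MA) (simp only:)
    show "continuous_on UNIV (\<lambda>\<tau>. X s (\<lambda>i. if i \<in> {2..n} then t i + \<tau> else t i))" for s t
    proof -
      have "continuous_on UNIV (\<lambda>\<tau>. if i \<in> {2..n} then t i + \<tau> else t i)" for i
        by (cases "i \<in> {2..n}") (auto intro!: continuous_intros)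
      then show ?thesis unfolding X_def w2_def w3_def by (intro continuous_intros blk_sphere_continuous)
    qed
    show "w2 s t \<bullet> w2 s t = 1 \<and> w3 s t \<bullet> w3 s t = 1 \<and> w2 s t \<bullet> w3 s t = 0" for s t
      unfolding w2_def w3_def ip iq ipq norm by simp
    show "w2 s t \<bullet> f i s t = 0 \<and> w3 s t \<bullet> f i s t = 0" if "i \<in> {2..n}" for s t i
      using blocks[OF that]
    proof (elim disjE conjE)
      assume i: "i <= p + 1" "i - 1 \<in> {1..p}"
      show ?thesis using i(1) unfolding w2_def w3_def f_def by (simp add: ip iqp orth[OF i(2)])
    next
      assume i: "\<not> i <= p + 1" "i - (p+1) \<in> {1..q}"
      have "w2 s t \<bullet> f i s t = 0" unfolding w2_def f_def if_not_P[OF i(1)] by (rule ipq)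
      moreover have "w3 s t \<bullet> f i s t = 0" unfolding w3_def f_def if_not_P[OF i(1)] iq by (rule orth[OF i(2)])
      ultimately show ?thesis ..
    qed
    show "f i s t \<bullet> f j s t = (if i = j then 1 else 0)" if "i \<in> {2..n}" "j \<in> {2..n}" for s t i j
    proof -
      have e: "i <= p + 1 ==> j <= p + 1 ==> i - 1 = j - 1 \<longleftrightarrow> i = j"
        "\<not> i <= p + 1 ==> \<not> j <= p + 1 ==> i - (p+1) = j - (p+1) \<longleftrightarrow> i = j" using that by auto
      have x: "i <= p + 1 ==> \<not> j <= p + 1 ==> i ~= j" "\<not> i <= p + 1 ==> j <= p + 1 ==> i ~= j" by auto
      show ?thesis using blocks[OF that(1)] blocks[OF that(2)] unfolding f_def
        by (elim disjE conjE) (simp_all only: if_True if_False ip iq ipq iqp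
            sphere_frame_orthonormal(1) e x simp_thms)
    qed
    show "((\<lambda>\<tau>. X \<tau> t) has_vector_derivative deriv \<psi> s *\<^sub>R w2 s t + deriv \<phi> s *\<^sub>R w3 s t) (at s)" if "(s, t) \<in> D" for s t
    proof -
      note pf = profile_facts[OF prof sI[OF that]]
      have X: "(\<lambda>\<tau>. X \<tau> t) = (\<lambda>\<tau>. O' + \<psi> \<tau> *\<^sub>R w2 s t + \<phi> \<tau> *\<^sub>R w3 s t)"
        by (simp only: X_def w2_def w3_def)
      show ?thesis unfolding X
        using has_vector_derivative_add[OF has_vector_derivative_add[OF has_vector_derivative_const[of O']
            scaleR_const_derivative[OF pf(1), of "w2 s t"]] scaleR_const_derivative[OF pf(2), of "w3 s t"]] by simp
    qed
    show "((\<lambda>\<tau>. w2 \<tau> t) has_vector_derivative 0) (at s)" "((\<lambda>\<tau>. w3 \<tau> t) has_vector_derivative 0) (at s)" for s t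
      unfolding w2_def w3_def by simp_all
    show "((\<lambda>\<tau>. w2 s (t(i := \<tau>))) has_vector_derivative \<alpha> i s t *\<^sub>R f i s t) (at (t i))" if "i \<in> {2..n}" for s t i
      by (rule dw2[OF that])
    show "((\<lambda>\<tau>. w3 s (t(i := \<tau>))) has_vector_derivative \<beta> i s t *\<^sub>R f i s t) (at (t i))" if "i \<in> {2..n}" for s t i
      by (rule dw3[OF that])
    show "((\<lambda>\<tau>. X s (t(i := \<tau>))) has_vector_derivative m i s t *\<^sub>R f i s t) (at (t i))" if "i \<in> {2..n}" for s t i
    proof -
      have "((\<lambda>\<tau>. X s (t(i := \<tau>))) has_vector_derivative 0 + \<psi> s *\<^sub>R (\<alpha> i s t *\<^sub>R f i s t) + \<phi> s *\<^sub>R (\<beta> i s t *\<^sub>R f i s t)) (at (t i))"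
        unfolding X_def
        by (intro has_vector_derivative_add has_vector_derivative_const
            bounded_linear.has_vector_derivative[OF bounded_linear_scaleR_right] dw2[OF that] dw3[OF that])
      then show ?thesis by (simp add: m_def scaleR_add_left)
    qed
    show "m i s t ~= 0" if "(s, t) \<in> D" "i \<in> {2..n}" "\<forall>l\<in>{2..n}. sin (t l) ~= 0" for s t i
      using prod_sin_nz[OF that(3), of 1 i] prod_sin_nz[OF that(3), of "p+1" i] that(2) eqn[THEN bspec, OF sI[OF that(1)]]
      by (simp add: m_def \<alpha>_def \<beta>_def)
    show "deriv \<phi> s * \<alpha> i s t - deriv \<psi> s * \<beta> i s t = m i s t * g i s t" if "(s, t) \<in> D" "i \<in> {2..n}" for s t i
      using eqn[THEN bspec, OF sI[OF that(1)]] by (simp add: m_def \<alpha>_def \<beta>_def g_def)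
    show "deriv \<psi> s * deriv \<psi> s + deriv \<phi> s * deriv \<phi> s = 1 \<and> (deriv \<psi> has_real_derivative deriv (deriv \<psi>) s) (at s) \<and>
        (deriv \<phi> has_real_derivative deriv (deriv \<phi>) s) (at s) \<and>
        deriv \<psi> s * deriv (deriv \<psi>) s + deriv \<phi> s * deriv (deriv \<phi>) s = 0 \<and>
        3 * (deriv \<phi> s * deriv (deriv \<psi>) s - deriv (deriv \<phi>) s * deriv \<psi> s) = (\<Sum>i\<in>{2..n}. g i s t)" if "(s, t) \<in> D" for s t
    proof -
      have "(\<Sum>i\<in>{2..n}. g i s t) = real p * (deriv \<phi> s / \<psi> s) - real q * (deriv \<psi> s / \<phi> s)"
        unfolding g_def nn sum_two_blocks by simp
      moreover have "3 * (deriv \<phi> s * deriv (deriv \<psi>) s - deriv (deriv \<phi>) s * deriv \<psi> s) =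
          real p * (deriv \<phi> s / \<psi> s) - real q * (deriv \<psi> s / \<phi> s)"
      proof -
        have "3 * (1 / 3 * z) = z" for z :: real by simp
        then show ?thesis
          using eqn[THEN bspec, OF sI[OF that], THEN conjunct2, THEN conjunct2] unfolding nq(1) by (simp only:)
      qed
      ultimately show ?thesis using profile_facts[OF prof sI[OF that]] by presburger
    qed
  qed
qed

lemma cylinder_H:
  assumes nn: "n = p + q + 1" and b: "bij_betw b {1..n+1} Basis" and rt: "cylinder_type b n p M"
  shows "H_hypersurface M N"
proof -
  obtain I \<psi> \<phi> D where prof: "profile_curve I \<psi> \<phi>"
    and eqn: "\<forall>s\<in>I. \<psi> s ~= 0 \<and> deriv \<phi> s * deriv (deriv \<psi>) s - deriv (deriv \<phi>) s * deriv \<psi> s =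
             real p / 3 * (deriv \<phi> s / \<psi> s)"
    and dom: "param_domain n I D" and cong: "congruent_sets M (cylinder_param b n p \<psi> \<phi> ` D)"
    using rt unfolding cylinder_type_def by blast
  have nq: "n + 1 = p + q + 2" using nn by auto
  define cd where "cd s t j = (if j <= p + 1 then \<psi> s * sphere_coord p (\<lambda>l. t (l + 1)) j
      else if j = p + 2 then \<phi> s else t (j - 1))" for s t j
  have P: "cylinder_param b n p \<psi> \<phi> = (\<lambda>(s, t). \<Sum>j\<in>{1..n+1}. cd s t j *\<^sub>R b j)"
    unfolding cylinder_param_def cd_def ..
  obtain O' A where A: "!!i j. i \<in> {1..n+1} ==> j \<in> {1..n+1} ==> A i \<bullet> A j = (if i = j then 1 else 0)"
    and MA: "M = (\<lambda>(s, t). O' + (\<Sum>j\<in>{1..n+1}. cd s t j *\<^sub>R A j)) ` D"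
    by (rule congruent_param[OF b cong[unfolded P]], rule that)
  define w2 where "w2 s t = blk A p 0 (sphere_coord p (\<lambda>m. t (m + 1)))" for s :: real and t
  define w3 where "w3 s t = A (p+2)" for s :: real and t :: "nat => real"
  define f where "f i s t = (if i <= p + 1 then blk A p 0 (sphere_frame p (\<lambda>m. t (m + 1)) (i - 1)) else A (i + 1))" for i and s :: real and t
  define F where "F t = (\<Sum>i\<in>{p+2..n}. t i *\<^sub>R A (i + 1))" for t
  define X where "X s t = O' + \<psi> s *\<^sub>R w2 s t + \<phi> s *\<^sub>R w3 s t + F t" for s t
  define \<alpha> where "\<alpha> i s t = (if i <= p + 1 then (\<Prod>m\<in>{1..<i-1}. sin (t (m+1))) else 0)" for i and s :: real and t :: "nat => real"
  define m where "m i s t = \<psi> s * \<alpha> i s t + (if i <= p + 1 then 0 else 1)" for i s t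
  define g where "g i s t = (if i <= p + 1 then deriv \<phi> s / \<psi> s else 0)" for i :: nat and s and t :: "nat => real"
  have D: "openin (param_topology n) D" and sI: "!!s t. (s, t) \<in> D ==> s \<in> I" using dom by (auto simp: param_domain_def)
  have r: "p + 0 <= n" using nn by auto
  have ip: "blk A p 0 c \<bullet> blk A p 0 c' = (\<Sum>j\<in>{1..p+1}. c j * c' j)" for c c'
    by (rule blk_inner(1)[OF _ r(1)]) (rule A; assumption)
  have iA: "blk A p 0 c \<bullet> A j = 0" "A j \<bullet> blk A p 0 c = 0" if "j \<in> {p+2..n+1}" for j c
    using blk_inner(2)[OF A r, of j c] that by (auto simp: inner_commute)
  have blocks: "i <= p + 1 \<and> i - 1 \<in> {1..p} \<and> i \<in> {1+1..p+1} \<or>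
      \<not> i <= p + 1 \<and> i + 1 \<in> {p+2..n+1} \<and> i \<in> {p+2..n} \<and> i \<notin> {1+1..p+1}" if "i \<in> {2..n}" for i
    using that nn by auto
  have norm: "(\<Sum>j\<in>{1..d+1}. sphere_coord d \<theta> j * sphere_coord d \<theta> j) = 1" for d \<theta>
    using sphere_coord_norm[of d \<theta>] by (simp only: power2_eq_square)
  have orth: "(\<Sum>j\<in>{1..d+1}. sphere_coord d \<theta> j * sphere_frame d \<theta> l j) = 0" if "l \<in> {1..d}" for d \<theta> l
    using sphere_frame_orthonormal(2)[OF that, of \<theta>] by (simp only: mult.commute)
  have dw2: "((\<lambda>\<tau>. w2 s (t(i := \<tau>))) has_vector_derivative \<alpha> i s t *\<^sub>R f i s t) (at (t i))" if "i \<in> {2..n}" for s t i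
    using blocks[OF that]
  proof (elim disjE conjE)
    assume i: "i <= p + 1" "i \<in> {1+1..p+1}"
    show ?thesis using blk_sphere_derivative[OF i(2), of A 0 t] i(1) by (simp only: w2_def \<alpha>_def f_def if_True)
  next
    assume i: "\<not> i <= p + 1" "i \<notin> {1+1..p+1}"
    show ?thesis unfolding w2_def blk_sphere_const[OF i(2)] using i(1) by (simp add: \<alpha>_def)
  qed
  have dF: "((\<lambda>\<tau>. F (t(i := \<tau>))) has_vector_derivative (if i <= p + 1 then 0 else 1) *\<^sub>R f i s t) (at (t i))" if "i \<in> {2..n}" for s t i
    using blocks[OF that]
  proof (elim disjE conjE)
    assume i: "i <= p + 1"
    have "F (t(i := \<tau>)) = F t" for \<tau> unfolding F_def by (rule sum.cong) (use i in auto)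
    then show ?thesis using i by simp
  next
    assume i: "\<not> i <= p + 1" "i \<in> {p+2..n}"
    have "((\<lambda>\<tau>. F (t(i := \<tau>))) has_vector_derivative (\<Sum>j\<in>{p+2..n}. (if j = i then 1 else 0) *\<^sub>R A (j + 1))) (at (t i))"
      unfolding F_def
    proof (rule has_vector_derivative_sum)
      fix j show "((\<lambda>\<tau>. (t(i := \<tau>)) j *\<^sub>R A (j + 1)) has_vector_derivative (if j = i then 1 else 0) *\<^sub>R A (j + 1)) (at (t i))"
        by (rule scaleR_const_derivative) (cases "j = i"; auto)
    qed
    moreover have "(\<Sum>j\<in>{p+2..n}. (if j = i then 1 else 0) *\<^sub>R A (j + 1)) = (\<Sum>j\<in>{p+2..n}. if j = i then A (j + 1) else 0)"
      by (rule sum.cong) auto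
    moreover have "\<dots> = A (i + 1)" using i(2) by simp
    ultimately show ?thesis using i(1) by (simp add: f_def)
  qed
  show ?thesis
  proof (rule H_hypersurface_param[OF D, of X w2 w3 f "deriv \<psi>" "deriv \<phi>" m \<alpha> "\<lambda>i s t. 0" g "deriv (deriv \<psi>)" "deriv (deriv \<phi>)"])
    have "O' + (\<Sum>j\<in>{1..n+1}. cd s t j *\<^sub>R A j) = X s t" for s t
    proof -
      have 1: "(\<Sum>j\<in>{1..p+1}. cd s t j *\<^sub>R A j) = \<psi> s *\<^sub>R w2 s t"
        unfolding w2_def blk_def scaleR_sum_right by (rule sum.cong) (auto simp: cd_def)
      have "{1..q+1} = insert 1 {2..q+1}" by auto
      then have "(\<Sum>j\<in>{1..q+1}. cd s t (j + (p+1)) *\<^sub>R A (j + (p+1))) =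
          cd s t (1 + (p+1)) *\<^sub>R A (1 + (p+1)) + (\<Sum>j\<in>{2..q+1}. cd s t (j + (p+1)) *\<^sub>R A (j + (p+1)))" by simp
      also have "cd s t (1 + (p+1)) *\<^sub>R A (1 + (p+1)) = \<phi> s *\<^sub>R w3 s t"
      proof -
        have "1 + (p+1) = p + 2" by simp
        then show ?thesis by (simp only:) (simp add: cd_def w3_def)
      qed
      also have "(\<Sum>j\<in>{2..q+1}. cd s t (j + (p+1)) *\<^sub>R A (j + (p+1))) = (\<Sum>j\<in>{2..q+1}. t (j + p) *\<^sub>R A (j + p + 1))"
        by (rule sum.cong) (auto simp: cd_def add.assoc)
      also have "\<dots> = F t"
        unfolding F_def nn using sum.shift_bounds_cl_nat_ivl[of "\<lambda>i. t i *\<^sub>R A (i + 1)" 2 p "q+1"]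
        by (simp add: add.commute add.left_commute)
      finally show ?thesis unfolding nq sum_split_block X_def 1 by (simp only: add.assoc)
    qed
    then show "M = (\<lambda>(s, t). X s t) ` D" by (subst MA) (simp only:)
    show "continuous_on UNIV (\<lambda>\<tau>. X s (\<lambda>i. if i \<in> {2..n} then t i + \<tau> else t i))" for s t
    proof -
      have c: "continuous_on UNIV (\<lambda>\<tau>. if i \<in> {2..n} then t i + \<tau> else t i)" for i
        by (cases "i \<in> {2..n}") (auto intro!: continuous_intros)
      show ?thesis unfolding X_def w2_def w3_def F_def by (intro continuous_on_add continuous_on_scaleR continuous_on_sum continuous_on_const blk_sphere_continuous c)
    qed
    show "w2 s t \<bullet> w2 s t = 1 \<and> w3 s t \<bullet> w3 s t = 1 \<and> w2 s t \<bullet> w3 s t = 0" for s t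
      using A[of "p+2" "p+2"] iA(1)[of "p+2"] nn unfolding w2_def w3_def ip norm by simp
    show "w2 s t \<bullet> f i s t = 0 \<and> w3 s t \<bullet> f i s t = 0" if "i \<in> {2..n}" for s t i
      using blocks[OF that]
    proof (elim disjE conjE)
      assume i: "i <= p + 1" "i - 1 \<in> {1..p}"
      show ?thesis using i(1) iA(2)[of "p+2"] nn unfolding w2_def w3_def f_def by (simp add: ip orth[OF i(2)])
    next
      assume i: "\<not> i <= p + 1" "i + 1 \<in> {p+2..n+1}"
      show ?thesis using i(1) iA(1)[OF i(2)] A[of "p+2" "i+1"] i(2) nn unfolding w2_def w3_def f_def by auto
    qed
    show "f i s t \<bullet> f j s t = (if i = j then 1 else 0)" if "i \<in> {2..n}" "j \<in> {2..n}" for s t i j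
    proof -
      have e: "i <= p + 1 ==> j <= p + 1 ==> i - 1 = j - 1 \<longleftrightarrow> i = j" using that by auto
      have x: "i <= p + 1 ==> \<not> j <= p + 1 ==> i ~= j" "\<not> i <= p + 1 ==> j <= p + 1 ==> i ~= j" by auto
      have a: "A (i + 1) \<bullet> A (j + 1) = (if i = j then 1 else 0)" using A[of "i+1" "j+1"] that by simp
      show ?thesis using blocks[OF that(1)] blocks[OF that(2)] unfolding f_def
        by (elim disjE conjE) (simp_all only: if_True if_False ip iA sphere_frame_orthonormal(1) e x a simp_thms)
    qed
    show "((\<lambda>\<tau>. X \<tau> t) has_vector_derivative deriv \<psi> s *\<^sub>R w2 s t + deriv \<phi> s *\<^sub>R w3 s t) (at s)" if "(s, t) \<in> D" for s t
    proof -
      note pf = profile_facts[OF prof sI[OF that]]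
      have X: "(\<lambda>\<tau>. X \<tau> t) = (\<lambda>\<tau>. O' + \<psi> \<tau> *\<^sub>R w2 s t + \<phi> \<tau> *\<^sub>R w3 s t + F t)"
        by (simp only: X_def w2_def w3_def)
      show ?thesis unfolding X
        using has_vector_derivative_add[OF has_vector_derivative_add[OF has_vector_derivative_add[OF has_vector_derivative_const[of O']
            scaleR_const_derivative[OF pf(1), of "w2 s t"]] scaleR_const_derivative[OF pf(2), of "w3 s t"]] has_vector_derivative_const[of "F t"]] by simp
    qed
    show "((\<lambda>\<tau>. w2 \<tau> t) has_vector_derivative 0) (at s)" "((\<lambda>\<tau>. w3 \<tau> t) has_vector_derivative 0) (at s)" for s t
      unfolding w2_def w3_def by simp_all
    show "((\<lambda>\<tau>. w2 s (t(i := \<tau>))) has_vector_derivative \<alpha> i s t *\<^sub>R f i s t) (at (t i))" if "i \<in> {2..n}" for s t i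
      by (rule dw2[OF that])
    show "((\<lambda>\<tau>. w3 s (t(i := \<tau>))) has_vector_derivative 0 *\<^sub>R f i s t) (at (t i))" for s t i
      unfolding w3_def by simp
    show "((\<lambda>\<tau>. X s (t(i := \<tau>))) has_vector_derivative m i s t *\<^sub>R f i s t) (at (t i))" if "i \<in> {2..n}" for s t i
    proof -
      have "((\<lambda>\<tau>. X s (t(i := \<tau>))) has_vector_derivative 0 + \<psi> s *\<^sub>R (\<alpha> i s t *\<^sub>R f i s t) + 0 + (if i <= p + 1 then 0 else 1) *\<^sub>R f i s t) (at (t i))"
        unfolding X_def w3_def
        by (intro has_vector_derivative_add has_vector_derivative_const
            bounded_linear.has_vector_derivative[OF bounded_linear_scaleR_right] dw2[OF that] dF[OF that])
      then show ?thesis by (simp add: m_def scaleR_add_left)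
    qed
    show "m i s t ~= 0" if "(s, t) \<in> D" "i \<in> {2..n}" "\<forall>l\<in>{2..n}. sin (t l) ~= 0" for s t i
      using prod_sin_nz[OF that(3), of 1 i] that(2) eqn[THEN bspec, OF sI[OF that(1)]]
      by (simp add: m_def \<alpha>_def)
    show "deriv \<phi> s * \<alpha> i s t - deriv \<psi> s * 0 = m i s t * g i s t" if "(s, t) \<in> D" "i \<in> {2..n}" for s t i
      using eqn[THEN bspec, OF sI[OF that(1)]] by (simp add: m_def \<alpha>_def g_def)
    show "deriv \<psi> s * deriv \<psi> s + deriv \<phi> s * deriv \<phi> s = 1 \<and> (deriv \<psi> has_real_derivative deriv (deriv \<psi>) s) (at s) \<and>
        (deriv \<phi> has_real_derivative deriv (deriv \<phi>) s) (at s) \<and>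
        deriv \<psi> s * deriv (deriv \<psi>) s + deriv \<phi> s * deriv (deriv \<phi>) s = 0 \<and>
        3 * (deriv \<phi> s * deriv (deriv \<psi>) s - deriv (deriv \<phi>) s * deriv \<psi> s) = (\<Sum>i\<in>{2..n}. g i s t)" if "(s, t) \<in> D" for s t
    proof -
      have "(\<Sum>i\<in>{2..n}. g i s t) = real p * (deriv \<phi> s / \<psi> s)"
        unfolding g_def nn sum_two_blocks by simp
      moreover have "3 * (deriv \<phi> s * deriv (deriv \<psi>) s - deriv (deriv \<phi>) s * deriv \<psi> s) = real p * (deriv \<phi> s / \<psi> s)"
        using eqn[THEN bspec, OF sI[OF that]] by simp
      ultimately show ?thesis using profile_facts[OF prof sI[OF that]] by presburger
    qed
  qed
qed

end

section \<open>From the H-equation to the structure equations\<close>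

text \<open>
  The renumbering of the frame by which a result on one multiple curvature applies to the other.
\<close>

definition swap_blocks :: "nat => nat => nat => nat" where
  "swap_blocks p q i = (if i = 1 then 1 else if i <= q + 1 then i + p else i - q)"

lemma swap_blocks:
  "swap_blocks p q 1 = 1" "q >= 1 ==> swap_blocks p q 2 = p + 2" "swap_blocks p q (q+2) = 2"
  "i \<in> {1..p+q+1} ==> swap_blocks p q i \<in> {1..p+q+1}"
  "i \<in> {2..p+q+1} ==> swap_blocks p q i \<in> {2..p+q+1}"
  "i \<in> {2..q+1} ==> swap_blocks p q i \<in> {p+2..p+q+1}"
  "i \<in> {q+2..p+q+1} ==> swap_blocks p q i \<in> {2..p+1}"
  "i \<in> {1..p+q+1} ==> j \<in> {1..p+q+1} ==> swap_blocks p q i = swap_blocks p q j \<longleftrightarrow> i = j"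
  by (auto simp: swap_blocks_def)

lemma (in H_frame) swap: "H_frame M N n (\<lambda>i. e (swap_blocks p q i)) (\<lambda>i. k (swap_blocks p q i)) q p"
proof (intro H_frame.intro H_frame_axioms.intro principal_frame.intro principal_frame_axioms.intro)
  note n = pq(3)
  have q1: "q >= 1" using pq by simp
  note \<sigma>2 = swap_blocks(2)[OF q1, of p]
  show "hypersurface M N" by (rule hypersurface_axioms)
  show "DIM('a) = n + 1" by (rule dim)
  show "q > 1" "p > 1" "n = q + p + 1" using pq by auto
  show "smooth_along M (e (swap_blocks p q i))" if "i \<in> {1..n}" for i
    by (rule e_smooth) (use swap_blocks(4)[of i p q] that n in simp)
  show "N x \<bullet> e (swap_blocks p q i) x = 0" if "x \<in> M" "i \<in> {1..n}" for x i
    by (rule e_tangent[OF that(1)]) (use swap_blocks(4)[of i p q] that n in simp)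
  show "e (swap_blocks p q i) x \<bullet> e (swap_blocks p q j) x = (if i = j then 1 else 0)" if "x \<in> M" "i \<in> {1..n}" "j \<in> {1..n}" for x i j
    using e_orthonormal[OF that(1), of "swap_blocks p q i" "swap_blocks p q j"] swap_blocks(4)[of i p q]
      swap_blocks(4)[of j p q] swap_blocks(8)[of i p q j] that n by simp
  show "shape_operator M N x (e (swap_blocks p q i) x) = k (swap_blocks p q i) x *\<^sub>R e (swap_blocks p q i) x"
    if "x \<in> M" "i \<in> {1..n}" for x i
    by (rule e_principal[OF that(1)]) (use swap_blocks(4)[of i p q] that n in simp)
  show "k (swap_blocks p q i) x = k (swap_blocks p q 2) x" if "x \<in> M" "i \<in> {2..q+1}" for x i
    using mult3[OF that(1), of "swap_blocks p q i"] swap_blocks(6)[OF that(2), of p] n \<sigma>2 by simp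
  show "k (swap_blocks p q i) x = k (swap_blocks p q (q+2)) x" if "x \<in> M" "i \<in> {q+2..n}" for x i
    using mult2[OF that(1), of "swap_blocks p q i"] swap_blocks(7)[of i q p] that(2) n swap_blocks(3)[of p q] by simp
  show "k (swap_blocks p q 1) x ~= k (swap_blocks p q 2) x \<and> k (swap_blocks p q 1) x ~= k (swap_blocks p q (q+2)) x \<and>
      k (swap_blocks p q 2) x ~= k (swap_blocks p q (q+2)) x" if "x \<in> M" for x
    using distinct[OF that] unfolding swap_blocks(1,3) \<sigma>2 by metis
  show "tder M (k (swap_blocks p q 1)) x (e (swap_blocks p q i) x) = 0" if "x \<in> M" "i \<in> {2..n}" for x i
    unfolding swap_blocks(1) by (rule D_k1[OF that(1)]) (use swap_blocks(5)[of i p q] that(2) n in simp)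
  show "tder M (k (swap_blocks p q 1)) x (e (swap_blocks p q 1) x) ~= 0" if "x \<in> M" for x
    unfolding swap_blocks(1) by (rule D1_k1[OF that])
  show "3 * k (swap_blocks p q 1) x + real q * k (swap_blocks p q 2) x + real p * k (swap_blocks p q (q+2)) x = 0" if "x \<in> M" for x
    using k_sum[OF that] unfolding swap_blocks(1,3) \<sigma>2 by linarith
qed

lemma (in H_global) swap: "H_global M N n (\<lambda>i. k (swap_blocks p q i)) q p E"
proof (intro H_global.intro H_global_axioms.intro)
  show "\<exists>U e. open U \<and> x \<in> U \<and> H_frame (M \<inter> U) N n e (\<lambda>i. k (swap_blocks p q i)) q p \<and> (\<forall>y\<in>M \<inter> U. e 1 y = E y)"
    if x: "x \<in> M" for x
  proof -
    obtain U e where U: "open U" "x \<in> U" "H_frame (M \<inter> U) N n e k p q" "!!y. y \<in> M ==> y \<in> U ==> e 1 y = E y"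
      by (rule frameE[OF x], rule that)
    show ?thesis
      by (rule exI[of _ U], rule exI[of _ "\<lambda>i. e (swap_blocks p q i)"])
        (use U H_frame.swap[OF U(3)] in \<open>auto simp: swap_blocks(1)\<close>)
  qed
qed (rule hypersurface_axioms conn)+

text \<open>
  If one of the two multiple principal curvatures is flat along the leaf direction somewhere, it is
  so everywhere, and the hypersurface is a cylinder with that curvature as the zero one.
\<close>

lemma (in H_global) classification:
  assumes b: "bij_betw b {1..n+1} Basis"
  shows "rotational_type b n p M \<or> cylinder_type b n p M \<or> cylinder_type b n q M"
proof -
  obtain x0 where x0: "x0 \<in> M" using conn(2) by blast
  have q1: "q >= 1" using pointwise_facts(3)[OF x0] by simp
  note \<sigma> = swap_blocks(1)[of p q] swap_blocks(2)[OF q1, of p] swap_blocks(3)[of p q]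
  show ?thesis
  proof (cases "\<exists>x\<in>M. leaf_curv M k E 2 x = 0 \<and> k 2 x = 0")
    case True
    then obtain x1 where x1: "x1 \<in> M" "leaf_curv M k E 2 x1 = 0" "k 2 x1 = 0" by blast
    have flat: "leaf_curv M k E 2 x = 0 \<and> k 2 x = 0" if "x \<in> M" for x by (rule leaf_flat_propagates[OF x1 that])
    let ?k = "\<lambda>i. k (swap_blocks p q i)"
    have "?k 2 x ~= 0" if x: "x \<in> M" for x
      using flat[OF x] pointwise_facts(9)[OF x] unfolding \<sigma> by metis
    then have S: "H_global_pos M N n ?k q p E"
      by (intro H_global_pos.intro H_global_pos_axioms.intro swap) blast
    have "curv3 M ?k E q x = 0" if x: "x \<in> M" for x
    proof -
      have "leaf_curv M ?k E (q+2) x = leaf_curv M k E 2 x" unfolding leaf_curv_def \<sigma> ..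
      then show ?thesis unfolding curv3_def \<sigma> using flat[OF x] by simp
    qed
    then have "cylinder_type b n q M" by (rule H_global_pos.cylinder_case[OF S b])
    then show ?thesis by blast
  next
    case False
    then have S: "H_global_pos M N n k p q E"
      by (intro H_global_pos.intro H_global_pos_axioms.intro H_global_axioms) blast
    show ?thesis
    proof (cases "\<exists>x\<in>M. curv3 M k E p x = 0")
      case True
      then obtain x1 where x1: "x1 \<in> M" "curv3 M k E p x1 = 0" by blast
      have "cylinder_type b n p M"
        by (rule H_global_pos.cylinder_case[OF S b H_global_pos.c_zero_propagates[OF S x1]])
      then show ?thesis by blast
    next
      case F: False
      have "rotational_type b n p M" by (rule H_global_pos.rotational_case[OF S b]) (use F in blast)
      then show ?thesis by blast
    qed
  qed
qed

locale diag_hypersurface = hypersurface M N for M :: "'a::euclidean_space set" and N +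
  fixes n :: nat and k :: "nat => 'a => real" and p q :: nat
  assumes dim: "DIM('a) = n + 1" and pq: "p > 1" "q > 1" "n = p + q + 1"
    and conn: "connected M" "M ~= {}"
    and shape: "shape_diag M N n k"
    and mult2: "!!x i. x \<in> M ==> i \<in> {2..p+1} ==> k i x = k 2 x"
    and mult3: "!!x i. x \<in> M ==> i \<in> {p+2..n} ==> k i x = k (p+2) x"
    and distinct: "!!x. x \<in> M ==> k 1 x ~= k 2 x \<and> k 1 x ~= k (p+2) x \<and> k 2 x ~= k (p+2) x"
    and grad_nz: "!!x. x \<in> M ==> grad M (mean_curvature M N) x ~= 0"
begin

abbreviation "s1 \<equiv> mean_curvature M N"

lemma idx: "1 \<in> {1..n}" "2 \<in> {1..n}" "p + 2 \<in> {1..n}" "i \<in> {2..n} ==> i \<in> {1..n}"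
  "i \<in> {1..n} ==> i = 1 \<or> i \<in> {2..n}"
  using pq by auto

lemma shape_Int_open: "open U ==> y \<in> U ==> shape_operator (M \<inter> U) N y v = shape_operator M N y v"
  by (simp add: shape_operator_def tder_def[symmetric] tder_Int_open)

lemma local_frame:
  assumes x: "x \<in> M"
  obtains U e where "open U" "x \<in> U" "principal_frame (M \<inter> U) N n e k"
proof -
  obtain U e where UU: "open U \<and> x \<in> U \<and> (\<forall>i\<in>{1..n}. smooth_along (M \<inter> U) (e i)) \<and>
        (\<forall>y\<in>M \<inter> U.
           (\<forall>i\<in>{1..n}. e i y \<in> tangent_space M y \<and> shape_operator M N y (e i y) = k i y *\<^sub>R e i y) \<and>
           (\<forall>i\<in>{1..n}. \<forall>j\<in>{1..n}. e i y \<bullet> e j y = (if i = j then 1 else 0)))"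
    using shape[unfolded shape_diag_def, THEN bspec, OF x] by (elim exE) (rule that)
  have U: "open U" "x \<in> U" "!!i. i \<in> {1..n} ==> smooth_along (M \<inter> U) (e i)" using UU by blast+
  have e: "!!y i. y \<in> M \<inter> U ==> i \<in> {1..n} ==> e i y \<in> tangent_space M y \<and> shape_operator M N y (e i y) = k i y *\<^sub>R e i y"
      "!!y i j. y \<in> M \<inter> U ==> i \<in> {1..n} ==> j \<in> {1..n} ==> e i y \<bullet> e j y = (if i = j then 1 else 0)"
    using UU by blast+
  have "principal_frame (M \<inter> U) N n e k"
  proof (intro principal_frame.intro principal_frame_axioms.intro)
    show "hypersurface (M \<inter> U) N" by (rule hypersurface_Int_open[OF U(1)])
    show "DIM('a) = n + 1" by (rule dim)
    show "N y \<bullet> e i y = 0" if "y \<in> M \<inter> U" "i \<in> {1..n}" for y i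
      using e(1)[OF that] tangent_iff[of y] that(1) by simp
    show "shape_operator (M \<inter> U) N y (e i y) = k i y *\<^sub>R e i y" if "y \<in> M \<inter> U" "i \<in> {1..n}" for y i
      using e(1)[OF that] shape_Int_open[OF U(1), of y] that(1) by simp
  qed (rule U(3) e(2); assumption)+
  then show thesis using that U by blast
qed

lemma k_class: "x \<in> M ==> i \<in> {2..n} ==> k i x = (if i <= p + 1 then k 2 x else k (p+2) x)"
  using mult2[of x i] mult3[of x i] by auto

lemma s1_eq: assumes x: "x \<in> M" shows "s1 x = k 1 x + (real p * k 2 x + real q * k (p+2) x)"
proof -
  obtain U e where U: "open U" "x \<in> U" "principal_frame (M \<inter> U) N n e k" by (rule local_frame[OF x], rule that)
  interpret F: principal_frame "M \<inter> U" N n e k by (rule U(3))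
  have xU: "x \<in> M \<inter> U" using x U by simp
  have "s1 x = (\<Sum>i\<in>{1..n}. k i x)"
    by (rule mean_curvature_eq[OF dim x F.e_tangent[OF xU] F.e_orthonormal[OF xU]])
      (use F.e_principal[OF xU] shape_Int_open[OF U(1,2)] in auto)
  also have "{1..n} = insert 1 {2..n}" using pq by auto
  also have "(\<Sum>i\<in>insert 1 {2..n}. k i x) = k 1 x + (\<Sum>i\<in>{2..n}. k i x)" by (rule sum.insert) auto
  also have "(\<Sum>i\<in>{2..n}. k i x) = (\<Sum>i\<in>{2..n}. if i <= p + 1 then k 2 x else k (p+2) x)"
    by (rule sum.cong[OF refl k_class[OF x]])
  finally show ?thesis unfolding pq(3) sum_two_blocks .
qed

lemma k_smooth: assumes i: "i \<in> {1..n}" shows "smooth_along M (k i)"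
proof (rule smooth_along_local)
  fix x assume x: "x \<in> M"
  obtain U e where U: "open U" "x \<in> U" "principal_frame (M \<inter> U) N n e k" by (rule local_frame[OF x], rule that)
  then show "\<exists>U. open U \<and> x \<in> U \<and> smooth_along (M \<inter> U) (k i)" using principal_frame.k_smooth[OF U(3) i] by blast
qed

lemma s1_smooth: "smooth_along M s1"
proof (rule smooth_along_cong)
  show "smooth_along M (\<lambda>x. k 1 x + (real p * k 2 x + real q * k (p+2) x))"
    by (intro smooth_along_add smooth_along_mult smooth_along_const k_smooth idx)
qed (simp add: s1_eq)

abbreviation "G \<equiv> grad M s1"

lemma G_tangent: "x \<in> M ==> N x \<bullet> G x = 0"
  using grad_exists(1)[OF s1_smooth] tangent_iff by simp

lemma G_inner: "x \<in> M ==> N x \<bullet> v = 0 ==> G x \<bullet> v = tder M s1 x v"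
  using grad_exists(2)[OF s1_smooth] tangent_iff by simp

lemma G_smooth: "smooth_along M G"
proof (rule smooth_along_local)
  fix x assume x: "x \<in> M"
  obtain U e where U: "open U" "x \<in> U" "principal_frame (M \<inter> U) N n e k" by (rule local_frame[OF x], rule that)
  interpret F: principal_frame "M \<inter> U" N n e k by (rule U(3))
  have s: "smooth_along (M \<inter> U) s1" by (rule smooth_along_subset[OF s1_smooth]) simp
  have "smooth_along (M \<inter> U) G"
  proof (rule smooth_along_cong)
    show "smooth_along (M \<inter> U) (\<lambda>y. \<Sum>i\<in>{1..n}. tder (M \<inter> U) s1 y (e i y) *\<^sub>R e i y)"
      by (intro smooth_along_sum smooth_along_scaleR F.D_smooth s F.e_smooth)
    fix y assume y: "y \<in> M \<inter> U"
    have "(\<Sum>i\<in>{1..n}. tder (M \<inter> U) s1 y (e i y) *\<^sub>R e i y) = (\<Sum>i\<in>{1..n}. (G y \<bullet> e i y) *\<^sub>R e i y)"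
    proof (rule sum.cong[OF refl])
      fix i assume i: "i \<in> {1..n}"
      have "G y \<bullet> e i y = tder M s1 y (e i y)" by (rule G_inner) (use y F.e_tangent[OF y i] in auto)
      also have "\<dots> = tder (M \<inter> U) s1 y (e i y)" using tder_Int_open[OF U(1), of y M s1] y by simp
      finally show "tder (M \<inter> U) s1 y (e i y) *\<^sub>R e i y = (G y \<bullet> e i y) *\<^sub>R e i y" by simp
    qed
    also have "\<dots> = G y" using F.expand(1)[OF y, of "G y"] G_tangent[of y] y by (simp add: inner_commute[of "G y" "N y"])
    finally show "(\<Sum>i\<in>{1..n}. tder (M \<inter> U) s1 y (e i y) *\<^sub>R e i y) = G y" .
  qed
  then show "\<exists>U. open U \<and> x \<in> U \<and> smooth_along (M \<inter> U) G" using U by blast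
qed

lemma curved: "curved_hypersurface M N n"
proof (intro curved_hypersurface.intro curved_hypersurface_axioms.intro hypersurface_axioms dim s1_smooth G_smooth grad_nz conn)
  show "n >= 1" using pq by simp
qed

context
  assumes H: "H_hypersurface M N"
begin

lemma H_eq: "x \<in> M ==> shape_operator M N x (G x) = - (s1 x / 2) *\<^sub>R G x"
  using H unfolding H_hypersurface_def Let_def by blast

lemma eigen_component:
  assumes x: "x \<in> M" and U: "open U" "x \<in> U" "principal_frame (M \<inter> U) N n e k" and i: "i \<in> {1..n}"
  shows "(k i x + s1 x / 2) * (G x \<bullet> e i x) = 0"
proof -
  interpret F: principal_frame "M \<inter> U" N n e k by (rule U(3))
  have xU: "x \<in> M \<inter> U" using x U by simp
  have "tder (M \<inter> U) N x (G x) = (\<Sum>l\<in>{1..n}. (G x \<bullet> e l x) *\<^sub>R tder (M \<inter> U) N x (e l x))"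
    by (rule F.D_expand[OF F.N_smooth xU G_tangent[OF x]])
  also have "\<dots> = (\<Sum>l\<in>{1..n}. - ((G x \<bullet> e l x) * k l x) *\<^sub>R e l x)"
    by (rule sum.cong[OF refl]) (simp add: F.D_N[OF xU])
  finally have "tder (M \<inter> U) N x (G x) \<bullet> e i x = (\<Sum>l\<in>{1..n}. (- ((G x \<bullet> e l x) * k l x) *\<^sub>R e l x) \<bullet> e i x)"
    by (simp only: inner_sum_left)
  also have "\<dots> = (\<Sum>l\<in>{1..n}. if l = i then - ((G x \<bullet> e i x) * k i x) else 0)"
    by (rule sum.cong[OF refl]) (simp add: F.e_orthonormal[OF xU _ i] del: atLeastAtMost_iff)
  finally have "tder (M \<inter> U) N x (G x) \<bullet> e i x = (\<Sum>l\<in>{1..n}. if l = i then - ((G x \<bullet> e i x) * k i x) else 0)" .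
  then have 1: "tder (M \<inter> U) N x (G x) \<bullet> e i x = - ((G x \<bullet> e i x) * k i x)" using i by simp
  have "tder (M \<inter> U) N x (G x) = (s1 x / 2) *\<^sub>R G x"
    using H_eq[OF x] tder_Int_open[OF U(1,2), of M N] by (simp add: shape_operator_def tder_def[symmetric])
  then have "(s1 x / 2) * (G x \<bullet> e i x) = - ((G x \<bullet> e i x) * k i x)" using 1 by simp
  then show ?thesis by (simp add: algebra_simps)
qed

text \<open>
  The gradient is an eigenvector for \<open>- s1 / 2\<close>. If that eigenvalue were one of the multiple
  principal curvatures at a point, then also nearby; but by the Codazzi equation a multiple
  principal curvature is constant along its own leaves, so the gradient would vanish.
\<close>

lemma k1_eq: assumes x: "x \<in> M" shows "k 1 x = - (s1 x / 2)"
proof (rule ccontr)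
  assume k1: "k 1 x ~= - (s1 x / 2)"
  obtain U e where U: "open U" "x \<in> U" "principal_frame (M \<inter> U) N n e k" by (rule local_frame[OF x], rule that)
  interpret F: principal_frame "M \<inter> U" N n e k by (rule U(3))
  have xU: "x \<in> M \<inter> U" using x U by simp
  have ex: "\<exists>i\<in>{1..n}. G y \<bullet> e i y ~= 0" if y: "y \<in> M \<inter> U" for y
  proof (rule ccontr)
    assume "\<not> (\<exists>i\<in>{1..n}. G y \<bullet> e i y ~= 0)"
    then have z: "G y \<bullet> e i y = 0" if "i \<in> {1..n}" for i using that by blast
    have "G y = 0" by (rule F.eqI[OF y]) (use z G_tangent[of y] y in \<open>simp_all add: inner_commute\<close>)
    then show False using grad_nz y by blast
  qed
  have comp: "k i y = - (s1 y / 2)" if "y \<in> M \<inter> U" "i \<in> {1..n}" "G y \<bullet> e i y ~= 0" for y i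
    using eigen_component[of y U e i] that U by simp
  obtain i0 where i0: "i0 \<in> {1..n}" "G x \<bullet> e i0 x ~= 0" using ex[OF xU] by blast
  have ki0: "k i0 x = - (s1 x / 2)" by (rule comp[OF xU i0])
  then have i02: "i0 \<in> {2..n}" using k1 idx(5)[OF i0(1)] by auto
  obtain j j' where j: "j \<in> {2, p+2}" "j' \<in> {2, p+2}" "j ~= j'" "k j x = - (s1 x / 2)"
  proof (cases "i0 <= p + 1")
    case True
    then show ?thesis using that[of 2 "p+2"] ki0 k_class[OF x i02] pq by simp
  next
    case False
    then show ?thesis using that[of "p+2" 2] ki0 k_class[OF x i02] pq by simp
  qed
  have jn: "j \<in> {1..n}" "j' \<in> {1..n}" using j idx by auto
  define h where "h y = (k 1 y + s1 y / 2) * (k j' y + s1 y / 2)" for y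
  have hx: "h x ~= 0"
  proof -
    have "k j' x ~= k j x" using j distinct[OF x] by auto
    then show ?thesis using k1 j(4) by (auto simp: h_def)
  qed
  have "continuous_on M h" unfolding h_def
    by (intro continuous_intros smooth_along_continuous_on[OF s1_smooth] smooth_along_continuous_on[OF k_smooth] jn idx(1)) auto
  then obtain V where V: "open V" "V \<inter> M = h -` (- {0}) \<inter> M"
    unfolding continuous_on_open_invariant using open_Compl[OF closed_singleton[of "0::real"]] by blast
  have xV: "x \<in> V" using V(2) x hx by auto
  have cls: "k i y = k j y" if y: "y \<in> M" "y \<in> U" "y \<in> V" and i: "i \<in> {1..n}" "G y \<bullet> e i y ~= 0" for y i
  proof -
    have hy: "h y ~= 0" using V(2) y by auto
    have ki: "k i y = - (s1 y / 2)" by (rule comp) (use y i in auto)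
    then have "i ~= 1" using hy by (auto simp: h_def)
    then have i2: "i \<in> {2..n}" using idx(5)[OF i(1)] by simp
    have "k i y ~= k j' y" using hy ki by (auto simp: h_def)
    then show ?thesis using k_class[OF y(1) i2] j(1-3) by (auto split: if_splits)
  qed
  have near: "s1 y = - 2 * k j y" if y: "y \<in> M \<inter> (U \<inter> V)" for y
  proof -
    obtain i where i: "i \<in> {1..n}" "G y \<bullet> e i y ~= 0" using ex[of y] y by blast
    have "k i y = - (s1 y / 2)" by (rule comp[OF _ i]) (use y in auto)
    then show ?thesis using cls[OF _ _ _ i] y by simp
  qed
  have W: "open (U \<inter> V)" "x \<in> U \<inter> V" using U V xV by auto
  have jT: "tder M s1 x v = - 2 * tder M (k j) x v" if v: "v \<in> tangent_space M x" for v
  proof -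
    have "tder (M \<inter> (U \<inter> V)) s1 x = tder (M \<inter> (U \<inter> V)) (\<lambda>y. - 2 * k j y) x"
      by (rule tder_cong[OF _ near]) (use x W in auto)
    then have "tder M s1 x v = tder M (\<lambda>y. - 2 * k j y) x v"
      unfolding tder_Int_open[OF W] by simp
    then show ?thesis by (simp only: tder_cmult[OF x v k_smooth[OF jn(1)]])
  qed
  have "G x \<bullet> e i0 x = 0"
  proof -
    have kij: "k i0 x = k j x" using ki0 j(4) by simp
    have same: "j = 2 \<longleftrightarrow> i0 <= p + 1"
      using kij k_class[OF x i02] j(1) distinct[OF x] by (auto split: if_splits)
    obtain l where l: "l \<in> {2..n}" "l ~= i0" "l <= p + 1 \<longleftrightarrow> i0 <= p + 1"
    proof (cases "i0 <= p + 1")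
      case True
      show ?thesis by (rule that[of "if i0 = 2 then 3 else 2"]) (use True pq in auto)
    next
      case False
      show ?thesis by (rule that[of "if i0 = p + 2 then p + 3 else p + 2"]) (use False pq in auto)
    qed
    have kl: "k l y = k j y" if "y \<in> M" for y
      using k_class[OF that l(1)] l(3) same j(1) pq(1) by auto
    have "tder (M \<inter> U) (k l) x (e i0 x) = 0"
      using F.codazzi[OF xU i0(1) idx(4)[OF l(1)] idx(4)[OF l(1)]] l(2) kl[OF x] kij by simp
    moreover have "tder (M \<inter> U) (k l) x = tder M (k j) x"
      unfolding tder_Int_open[OF U(1,2)] by (rule tder_cong[OF x kl])
    ultimately have "tder M (k j) x (e i0 x) = 0" by simp
    moreover have T: "N x \<bullet> e i0 x = 0" by (rule F.e_tangent[OF xU i0(1)])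
    ultimately show ?thesis using jT[of "e i0 x"] G_inner[OF x T] tangent_iff[OF x] by simp
  qed
  then show False using i0(2) by simp
qed

lemma global: "H_global M N n k p q (\<lambda>x. inverse (sqrt (G x \<bullet> G x)) *\<^sub>R G x)"
proof (intro H_global.intro H_global_axioms.intro hypersurface_axioms conn)
  fix x0 assume x0: "x0 \<in> M"
  define E where "E x = inverse (sqrt (G x \<bullet> G x)) *\<^sub>R G x" for x
  have GG: "G x \<bullet> G x > 0" if "x \<in> M" for x using grad_nz[OF that] by simp
  have E_smooth: "smooth_along M E" unfolding E_def
  proof (intro smooth_along_scaleR smooth_along_inverse smooth_along_sqrt smooth_along_inner G_smooth)
    show "G x \<bullet> G x > 0" if "x \<in> M" for x by (rule GG[OF that])
    show "sqrt (G x \<bullet> G x) ~= 0" if "x \<in> M" for x using GG[OF that] by simp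
  qed
  have E_unit: "E x \<bullet> E x = 1" if "x \<in> M" for x
  proof -
    have "inverse (sqrt (G x \<bullet> G x)) * inverse (sqrt (G x \<bullet> G x)) = inverse (G x \<bullet> G x)"
      using GG[OF that] by (simp add: inverse_mult_distrib[symmetric])
    then show ?thesis using GG[OF that] by (simp add: E_def mult.assoc[symmetric])
  qed
  obtain U e where U: "open U" "x0 \<in> U" "principal_frame (M \<inter> U) N n e k" by (rule local_frame[OF x0], rule that)
  interpret F: principal_frame "M \<inter> U" N n e k by (rule U(3))
  have Ge: "G x \<bullet> e i x = 0" if x: "x \<in> M \<inter> U" and i: "i \<in> {2..n}" for x i
  proof -
    have "k i x ~= k 1 x" using k_class[of x i] distinct[of x] x i by auto
    then have "k i x + s1 x / 2 ~= 0" using k1_eq[of x] x by simp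
    then show ?thesis using eigen_component[of x U e i] x U idx(4)[OF i] by simp
  qed
  define e' where "e' i = (if i = 1 then E else e i)" for i
  have dk1: "tder (M \<inter> U) (k 1) x v = - (1/2) * (G x \<bullet> v)" if x: "x \<in> M \<inter> U" and v: "N x \<bullet> v = 0" for x v
  proof -
    have xM: "x \<in> M" and xU: "x \<in> U" using x by auto
    have T: "v \<in> tangent_space M x" using v tangent_iff[OF xM] by simp
    have "tder M (k 1) x = tder M (\<lambda>y. - (1/2) * s1 y) x" by (rule tder_cong[OF xM]) (simp add: k1_eq)
    then show ?thesis
      using tder_cmult[OF xM T s1_smooth, of "- (1/2)"] G_inner[OF xM v] tder_Int_open[OF U(1) xU, of M "k 1"] by simp
  qed
  have "H_frame (M \<inter> U) N n e' k p q"
  proof (intro H_frame.intro H_frame_axioms.intro principal_frame.intro principal_frame_axioms.intro)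
    show "hypersurface (M \<inter> U) N" by (rule hypersurface_Int_open[OF U(1)])
    show "DIM('a) = n + 1" by (rule dim)
    show "p > 1" "q > 1" "n = p + q + 1" by (rule pq)+
    show "smooth_along (M \<inter> U) (e' i)" if "i \<in> {1..n}" for i
      using smooth_along_subset[OF E_smooth, of "M \<inter> U"] F.e_smooth[OF that] by (auto simp: e'_def)
    show "N x \<bullet> e' i x = 0" if "x \<in> M \<inter> U" "i \<in> {1..n}" for x i
      using F.e_tangent[OF that] G_tangent[of x] that by (auto simp: e'_def E_def)
    show "e' i x \<bullet> e' j x = (if i = j then 1 else 0)" if "x \<in> M \<inter> U" "i \<in> {1..n}" "j \<in> {1..n}" for x i j
      using F.e_orthonormal[OF that] E_unit[of x] Ge[OF that(1), of i] Ge[OF that(1), of j] that(1) idx(5)[OF that(2)] idx(5)[OF that(3)]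
      by (auto simp: e'_def E_def inner_commute)
    show "shape_operator (M \<inter> U) N x (e' i x) = k i x *\<^sub>R e' i x" if "x \<in> M \<inter> U" "i \<in> {1..n}" for x i
    proof (cases "i = 1")
      case True
      have xM: "x \<in> M" and xU: "x \<in> U" using that by auto
      have lin: "linear (tder M N x)" by (rule tder_linear[OF N_smooth xM])
      have "shape_operator M N x (c *\<^sub>R G x) = c *\<^sub>R shape_operator M N x (G x)" for c
        using linear_scale[OF lin] by (simp add: shape_operator_def tder_def[symmetric])
      then show ?thesis using True H_eq[OF xM] k1_eq[OF xM] shape_Int_open[OF U(1) xU] by (simp add: e'_def E_def)
    next
      case False
      then show ?thesis using F.e_principal[OF that] by (simp add: e'_def)
    qed
    show "k i x = k 2 x" if "x \<in> M \<inter> U" "i \<in> {2..p+1}" for x i using mult2 that by blast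
    show "k i x = k (p+2) x" if "x \<in> M \<inter> U" "i \<in> {p+2..n}" for x i using mult3 that by blast
    show "k 1 x ~= k 2 x \<and> k 1 x ~= k (p+2) x \<and> k 2 x ~= k (p+2) x" if "x \<in> M \<inter> U" for x using distinct that by blast
    show "tder (M \<inter> U) (k 1) x (e' i x) = 0" if "x \<in> M \<inter> U" "i \<in> {2..n}" for x i
      using dk1[OF that(1) F.e_tangent[OF that(1) idx(4)[OF that(2)]]] Ge[OF that] that(2) by (auto simp: e'_def)
    show "tder (M \<inter> U) (k 1) x (e' 1 x) ~= 0" if "x \<in> M \<inter> U" for x
      using dk1[OF that, of "E x"] G_tangent[of x] GG[of x] that by (auto simp: e'_def E_def)
    show "3 * k 1 x + real p * k 2 x + real q * k (p+2) x = 0" if "x \<in> M \<inter> U" for x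
      using s1_eq[of x] k1_eq[of x] that by simp
  qed
  then show "\<exists>U e. open U \<and> x0 \<in> U \<and> H_frame (M \<inter> U) N n e k p q \<and> (\<forall>y\<in>M \<inter> U. e 1 y = inverse (sqrt (G y \<bullet> G y)) *\<^sub>R G y)"
    using U by (intro exI[of _ U] exI[of _ e']) (auto simp: e'_def E_def)
qed

end

end

theorem theorem4p2:
  fixes M :: "'a::euclidean_space set" and N :: "'a \<Rightarrow> 'a"
    and k :: "nat \<Rightarrow> 'a \<Rightarrow> real" and n p q :: nat and b :: "nat \<Rightarrow> 'a"
  assumes dim: "DIM('a) = n + 1"
    and coords: "bij_betw b {1..n+1} Basis"
    and pq: "p > 1" "q > 1" "q = n - p - 1"
    and hyp: "oriented_hypersurface M N" "connected M" "M \<noteq> {}"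
    and shape: "shape_diag M N n k"
    and mult: "\<forall>x\<in>M. (\<forall>i\<in>{2..p+1}. k i x = k 2 x) \<and> (\<forall>i\<in>{p+2..n}. k i x = k (p+2) x)"
    and distinct: "\<forall>x\<in>M. k 1 x \<noteq> k 2 x \<and> k 1 x \<noteq> k (p+2) x \<and> k 2 x \<noteq> k (p+2) x"
    and grad_nz: "\<forall>x\<in>M. grad M (mean_curvature M N) x \<noteq> 0"
  shows "H_hypersurface M N \<longleftrightarrow>
           rotational_type b n p M \<or>
           cylinder_type b n p M \<or>
           cylinder_type b n q M"
proof
  have n: "n = p + q + 1" "n = q + p + 1" using pq by auto
  have "diag_hypersurface M N n k p q"
    by (intro diag_hypersurface.intro hypersurface.intro diag_hypersurface_axioms.intro dim pq(1,2) n(1) hyp shape)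
      (use mult distinct grad_nz in blast)+
  then interpret diag_hypersurface M N n k p q .
  show "rotational_type b n p M \<or> cylinder_type b n p M \<or> cylinder_type b n q M" if "H_hypersurface M N"
    by (rule H_global.classification[OF global[OF that] coords])
  show "H_hypersurface M N" if "rotational_type b n p M \<or> cylinder_type b n p M \<or> cylinder_type b n q M"
    using that curved_hypersurface.rotational_H[OF curved n(1) coords] curved_hypersurface.cylinder_H[OF curved n(1) coords]
      curved_hypersurface.cylinder_H[OF curved n(2) coords] by blast
qed


end
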